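(* Let $p\in\Gamma_{cl}^{0}(\mathbb{R}^{n},\mathcal{B}(\mathbb{C}^{q}))$ be such that $op(p)op(p)=op(p)$. Then $\mathrm{Res}(p)=0$.
   Context: $\Gamma_{cl}^{m}(\mathbb{R}^{n},\mathcal{B}(\mathbb{C}^q))$, $m\in\mathbb{Z}$: smooth $q\times q$-matrix-valued $a$ on $\mathbb{R}^{2n}$ with $\Vert\partial_x^\beta\partial_\xi^\alpha a\Vert\le C_{\alpha\beta}[(x,\xi)]^{m-|\alpha|-|\beta|}$ ($[y]$ a fixed smooth positive function equal to $|y|$ for $|y|\ge 1$), admitting homogeneous terms $a_{(m-j)}$ (smooth on $\mathbb{R}^{2n}\setminus\{0\}$, positively homogeneous of degree $m-j$) with $a-\sum_{j<N}\chi a_{(m-j)}$ of order $m-N$ for every $N$ and every zero excision function $\chi$. $op(a)u(x)=(2\pi)^{-n}\int e^{ix\cdot\xi}a(x,\xi)\hat u(\xi)d\xi$. Wodzicki trace: $\mathrm{Res}(a)=(2\pi)^{-n}\int_{S^{2n-1}}\mathrm{Tr}\,a_{(-2n)}(x,\xi)\,d\theta$, where $a_{(-2n)}$ is the degree $-2n$ term of the expansion, $\mathrm{Tr}$ the matrix trace and $d\theta$ the surface measure on the unit sphere $S^{2n-1}\subset\mathbb{R}^{2n}$; $\mathrm{Res}$ is a trace on $\bigcup_{m\in\mathbb{Z}}\Gamma^m_{cl}$ modulo $\Gamma^{-\infty}$. *)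

theory Defs
  imports "HOL-Analysis.Analysis"
begin

text \<open>Iterated partial derivatives along a list of directions (for smooth functions the
  order is irrelevant; a list of basis vectors of length k encodes a multi-index of size k).\<close>
fun pdiff :: "'a::real_normed_vector list \<Rightarrow> ('a \<Rightarrow> 'b::real_normed_vector) \<Rightarrow> 'a \<Rightarrow> 'b" where
  "pdiff [] f = f"
| "pdiff (v # vs) f = (\<lambda>z. frechet_derivative (pdiff vs f) (at z) v)"

definition smooth_on :: "'a::euclidean_space set \<Rightarrow> ('a \<Rightarrow> 'b::real_normed_vector) \<Rightarrow> bool" where
  "smooth_on S f \<longleftrightarrow> (\<forall>ds. set ds \<subseteq> Basis \<longrightarrow> (\<forall>z\<in>S. pdiff ds f differentiable (at z)))"

text \<open>The weight [y]: smooth version equals norm y for norm y >= 1; the resulting symbol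
  classes do not depend on the choice, we use max 1 (norm y).\<close>
definition bracket :: "'a::real_normed_vector \<Rightarrow> real" where
  "bracket y = max 1 (norm y)"

type_synonym ('n,'q) symbol = "((real^'n) \<times> (real^'n)) \<Rightarrow> complex^'q^'q"

definition Gamma :: "int \<Rightarrow> ('n::finite,'q::finite) symbol \<Rightarrow> bool" where
  "Gamma m a \<longleftrightarrow> smooth_on UNIV a \<and>
     (\<forall>ds. set ds \<subseteq> Basis \<longrightarrow>
        (\<exists>C. \<forall>z. norm (pdiff ds a z) \<le> C * bracket z powr (real_of_int m - real (length ds))))"

definition pos_homogeneous :: "int \<Rightarrow> ('a::real_normed_vector \<Rightarrow> 'b::real_normed_vector) \<Rightarrow> bool" where
  "pos_homogeneous d f \<longleftrightarrow> (\<forall>t>0. \<forall>z. z \<noteq> 0 \<longrightarrow> f (t *\<^sub>R z) = (t powr real_of_int d) *\<^sub>R f z)"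

definition excision :: "('a::euclidean_space \<Rightarrow> real) \<Rightarrow> bool" where
  "excision c \<longleftrightarrow> smooth_on UNIV c \<and> (\<exists>r>0. \<forall>z. norm z < r \<longrightarrow> c z = 0)
      \<and> (\<exists>R. \<forall>z. norm z \<ge> R \<longrightarrow> c z = 1)"

definition classical_terms :: "int \<Rightarrow> ('n::finite,'q::finite) symbol \<Rightarrow> (nat \<Rightarrow> ('n,'q) symbol) \<Rightarrow> bool" where
  "classical_terms m a h \<longleftrightarrow>
     (\<forall>j. smooth_on (UNIV - {0}) (h j) \<and> pos_homogeneous (m - int j) (h j)) \<and>
     (\<forall>N c. excision c \<longrightarrow> Gamma (m - int N) (\<lambda>z. a z - (\<Sum>j<N. c z *\<^sub>R h j z)))"

definition Gamma_cl :: "int \<Rightarrow> ('n::finite,'q::finite) symbol \<Rightarrow> bool" where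
  "Gamma_cl m a \<longleftrightarrow> Gamma m a \<and> (\<exists>h. classical_terms m a h)"

text \<open>Integral over the unit sphere S^(d-1) in a euclidean space of dimension d with respect
  to surface measure, via polar coordinates:
  integral over S of g dtheta = d * integral over unit ball of g(z/|z|) dz.\<close>
definition sphere_integral :: "('a::euclidean_space \<Rightarrow> complex) \<Rightarrow> complex" where
  "sphere_integral g = of_nat DIM('a) * integral (ball 0 1) (\<lambda>z. g (z /\<^sub>R norm z))"

text \<open>Wodzicki residue of a classical symbol of order m (degree -2n term of the expansion).\<close>
definition Res :: "int \<Rightarrow> ('n::finite,'q::finite) symbol \<Rightarrow> complex" where
  "Res m a = (let h = (SOME h. classical_terms m a h); k = m + 2 * int CARD('n) in
     if k < 0 then 0
     else of_real ((2 * pi) powr (- real CARD('n))) * sphere_integral (\<lambda>z. trace (h (nat k) z)))"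

definition schwartz :: "(real^'n::finite \<Rightarrow> complex^'q::finite) \<Rightarrow> bool" where
  "schwartz u \<longleftrightarrow> smooth_on UNIV u \<and>
     (\<forall>ds k. set ds \<subseteq> Basis \<longrightarrow> (\<exists>C. \<forall>x. norm x ^ k * norm (pdiff ds u x) \<le> C))"

definition fourier :: "(real^'n::finite \<Rightarrow> complex^'q::finite) \<Rightarrow> real^'n \<Rightarrow> complex^'q" where
  "fourier u \<xi> = integral UNIV (\<lambda>x. (\<chi> i. cis (- (x \<bullet> \<xi>)) * u x $ i))"

definition op :: "('n::finite,'q::finite) symbol \<Rightarrow> (real^'n \<Rightarrow> complex^'q) \<Rightarrow> real^'n \<Rightarrow> complex^'q" where
  "op a u x = ((2 * pi) powr (- real CARD('n))) *\<^sub>R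
      integral UNIV (\<lambda>\<xi>. (\<chi> i. cis (x \<bullet> \<xi>) * (a (x, \<xi>) *v fourier u \<xi>) $ i))"

end

theory Submission
  imports Defs "HOL-Probability.Probability" "HOL-Combinatorics.Permutations"
begin

text \<open>Testing the operator identity on phase space translates of a function that is equal to
  \<open>1\<close> near the origin shows that \<open>p\<close> agrees with the Leibniz expansion of \<open>p # p\<close> up to any order.
  Comparing coefficients along rays, the formal series \<open>P\<close> of homogeneous terms of \<open>p\<close> is
  idempotent for the formal Leibniz product, and it remains to see that the residue of a formal
  idempotent vanishes. The residue is the integral of the degree \<open>-2n\<close> matrix trace against a radial
  weight; it kills derivatives of terms of degree \<open>1 - 2n\<close>, hence commutators. The compressions
  \<open>Z\<^sub>i = P z\<^sub>i P\<close> of the coordinate functions satisfy \<open>[Z\<^sub>i, Z\<^sub>j] = [z\<^sub>i, z\<^sub>j] P + F\<^sub>i\<^sub>j\<close>, where the leading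
  term of \<open>F\<^sub>i\<^sub>j\<close> is the curvature of the principal symbol \<open>p\<^sub>0\<close>. Cyclicity of the trace on alternating
  products of the \<open>Z\<^sub>i\<close> reduces the residue of \<open>P\<close>, up to a nonzero constant, to the trace of the top
  exterior power of the curvature, which is \<open>0\<close> because \<open>p\<^sub>0\<close> is constant along rays.\<close>

section \<open>Smooth functions and directional derivatives\<close>

text \<open>The proof is a count of orders. A commutator with a coordinate has order 2 less than the
  product, so the curvature part of \<open>[Z_i, Z_j]\<close> has order -2, and a product of
  \<open>n\<close> such parts has order exactly \<open>-2n\<close>. In the degree that the residue
  reads, only its principal part is visible: all lower terms of \<open>p\<close> have dropped out on
  this side. On the other side the scalar parts multiply to a constant times \<open>P\<close>, and
  the same degree reads the lower term of \<open>P\<close> that is wanted. The functional is cyclic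
  only in this one degree, and \<open>2n\<close> factors of order 1 are what makes both sides land
  in it. Alternation replaces commutativity: inside an alternating sum a product
  \<open>Z_i Z_j\<close> is half a commutator. The constant is an alternating sum over the
  symplectic form; it is nonzero because its terms are nonnegative and one of them is 1.

  On the analytic side, conjugation by a phase space translation moves every point to the origin.
  Estimates there with constants that do not depend on the translation parameter \<open>t\<close>
  become statements about decay in \<open>t\<close>, and Fourier inversion is only used at the
  origin.\<close>

definition dd :: "'a \<Rightarrow> ('a::real_normed_vector \<Rightarrow> 'b::real_normed_vector) \<Rightarrow> 'a \<Rightarrow> 'b" where
  "dd v f = (\<lambda>z. frechet_derivative f (at z) v)"

text \<open>\<open>pdiff\<close> takes the head of the list as the outermost derivative. Peeling the
  last entry applies it to \<open>f\<close> first, so that inductions can pass from \<open>f\<close>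
  to \<open>dd v f\<close> and keep the shape of the statement.\<close>

lemma pdiff_snoc: "pdiff (ds @ [v]) f = pdiff ds (dd v f)"
  by (induction ds) (auto simp: dd_def)

lemma pdiff_Cons_dd: "pdiff (v # ds) f = dd v (pdiff ds f)"
  by (simp add: dd_def)

lemma dd_eqI: "(f has_derivative f') (at z) \<Longrightarrow> dd v f z = f' v"
  unfolding dd_def by (metis frechet_derivative_at)

lemma has_derivative_dd: "f differentiable at z \<Longrightarrow> (f has_derivative (\<lambda>v. dd v f z)) (at z)"
  unfolding dd_def by (simp add: frechet_derivative_works)

lemma dd_scale_dir: "f differentiable at z \<Longrightarrow> dd (c *\<^sub>R v) f z = c *\<^sub>R dd v f z"
  unfolding dd_def by (rule linear_scale[OF linear_frechet_derivative])

lemma dd_add_dir: "f differentiable at z \<Longrightarrow> dd (v + w) f z = dd v f z + dd w f z"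
  unfolding dd_def by (rule linear_add[OF linear_frechet_derivative])

lemma dd_expand:
  fixes f :: "'a::euclidean_space \<Rightarrow> 'b::real_normed_vector"
  assumes "f differentiable at z"
  shows "dd v f z = (\<Sum>b\<in>Basis. (v \<bullet> b) *\<^sub>R dd b f z)"
proof -
  have "linear (\<lambda>v. dd v f z)"
    using has_derivative_dd[OF assms] has_derivative_linear by blast
  then have "dd (\<Sum>b\<in>Basis. (v \<bullet> b) *\<^sub>R b) f z = (\<Sum>b\<in>Basis. (v \<bullet> b) *\<^sub>R dd b f z)"
    using linear_sum[of "\<lambda>v. dd v f z" "\<lambda>b. (v \<bullet> b) *\<^sub>R b" Basis] linear_scale[of "\<lambda>v. dd v f z"] by simp
  then show ?thesis by (simp add: euclidean_representation)
qed

text \<open>\<open>frechet_derivative\<close> is a choice among the possible derivatives, and near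
  \<open>z\<close> both functions have the same ones. The equality therefore also holds at points
  where no derivative exists.\<close>

lemma dd_cong_open:
  assumes "open S" "z \<in> S" "\<forall>y\<in>S. f y = g y"
  shows "dd v f z = dd v g z"
proof -
  have "(f has_derivative D) (at z) \<longleftrightarrow> (g has_derivative D) (at z)" for D
    using has_derivative_transform_within_open[of f D z UNIV S g]
      has_derivative_transform_within_open[of g D z UNIV S f] assms by auto
  then show ?thesis unfolding dd_def frechet_derivative_def by simp
qed

lemma differentiable_cong_open:
  assumes "open S" "z \<in> S" "\<forall>y\<in>S. f y = g y" "f differentiable at z"
  shows "g differentiable at z"
  using assms(4) has_derivative_transform_within_open[of f _ z UNIV S g] assms(1-3)
  unfolding differentiable_def by blast

text \<open>\<open>smooth_on\<close> quantifies over lists of directions, which gives no induction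
  for products and compositions. Counting the order from the innermost derivative does;
  \<open>smooth_on_csm\<close> recovers smoothness as the conjunction over all orders.\<close>

primrec csm :: "nat \<Rightarrow> 'a::euclidean_space set \<Rightarrow> ('a \<Rightarrow> 'b::real_normed_vector) \<Rightarrow> bool" where
  "csm 0 S f \<longleftrightarrow> (\<forall>z\<in>S. f differentiable at z)"
| "csm (Suc k) S f \<longleftrightarrow> (\<forall>z\<in>S. f differentiable at z) \<and> (\<forall>v\<in>Basis. csm k S (dd v f))"

lemma csm_iff:
  "csm k S f \<longleftrightarrow> (\<forall>ds. set ds \<subseteq> Basis \<longrightarrow> length ds \<le> k \<longrightarrow> (\<forall>z\<in>S. pdiff ds f differentiable at z))"
proof (induction k arbitrary: f)
  case 0
  then show ?case by auto
next
  case (Suc k)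
  show ?case
  proof
    assume L: "csm (Suc k) S f"
    show "\<forall>ds. set ds \<subseteq> Basis \<longrightarrow> length ds \<le> Suc k \<longrightarrow> (\<forall>z\<in>S. pdiff ds f differentiable at z)"
    proof (intro allI impI)
      fix ds :: "'a list" assume ds: "set ds \<subseteq> Basis" "length ds \<le> Suc k"
      show "\<forall>z\<in>S. pdiff ds f differentiable at z"
      proof (cases ds rule: rev_cases)
        case Nil
        then show ?thesis using L by simp
      next
        case (snoc es v)
        then show ?thesis using ds L Suc.IH[of "dd v f"] by (auto simp: pdiff_snoc)
      qed
    qed
  next
    assume R: "\<forall>ds. set ds \<subseteq> Basis \<longrightarrow> length ds \<le> Suc k \<longrightarrow> (\<forall>z\<in>S. pdiff ds f differentiable at z)"
    have "csm k S (dd v f)" if "v \<in> Basis" for v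
      unfolding Suc.IH
    proof (intro allI impI)
      fix ds :: "'a list" assume "set ds \<subseteq> Basis" "length ds \<le> k"
      then show "\<forall>z\<in>S. pdiff ds (dd v f) differentiable at z"
        using R[rule_format, of "ds @ [v]"] that by (auto simp: pdiff_snoc)
    qed
    moreover have "\<forall>z\<in>S. f differentiable at z" using R[rule_format, of "[]"] by auto
    ultimately show "csm (Suc k) S f" by simp
  qed
qed

lemma smooth_on_csm: "smooth_on S f \<longleftrightarrow> (\<forall>k. csm k S f)"
  unfolding smooth_on_def csm_iff by (meson le_refl)

lemma csm_diff: "csm k S f \<Longrightarrow> z \<in> S \<Longrightarrow> f differentiable at z"
  by (cases k) auto

lemma csm_le: "csm k S f \<Longrightarrow> l \<le> k \<Longrightarrow> csm l S f"
  unfolding csm_iff by (meson le_trans)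

lemma csm_cong:
  assumes "open S" "\<forall>y\<in>S. f y = g y" "csm k S f"
  shows "csm k S g"
  using assms(2,3)
proof (induction k arbitrary: f g)
  case 0
  then show ?case using differentiable_cong_open[OF assms(1)] unfolding csm.simps by blast
next
  case (Suc k)
  have "csm k S (dd v g)" if "v \<in> Basis" for v
  proof (rule Suc.IH[of "dd v f"])
    show "\<forall>y\<in>S. dd v f y = dd v g y"
      using dd_cong_open[OF assms(1) _ Suc.prems(1)] by blast
    show "csm k S (dd v f)" using Suc.prems(2) that unfolding csm.simps by blast
  qed
  moreover have "\<forall>z\<in>S. g differentiable at z"
    using Suc.prems differentiable_cong_open[OF assms(1)] unfolding csm.simps by blast
  ultimately show ?case unfolding csm.simps by blast
qed

lemma smooth_on_cong:
  assumes "open S" "\<forall>y\<in>S. f y = g y" "smooth_on S f"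
  shows "smooth_on S g"
  using csm_cong[OF assms(1,2)] assms(3) unfolding smooth_on_csm by blast

lemma pdiff_cong_open:
  assumes "open S" "\<forall>y\<in>S. f y = g y" "z \<in> S"
  shows "pdiff ds f z = pdiff ds g z"
proof -
  have "\<forall>z\<in>S. pdiff ds f z = pdiff ds g z"
  proof (induction ds)
    case (Cons v ds)
    then show ?case unfolding pdiff_Cons_dd using dd_cong_open[OF assms(1)] by blast
  qed (use assms in simp)
  then show ?thesis using assms by blast
qed

lemma smooth_on_subset: "smooth_on S f \<Longrightarrow> T \<subseteq> S \<Longrightarrow> smooth_on T f"
  unfolding smooth_on_def by blast

lemma smooth_on_diff: "smooth_on S f \<Longrightarrow> z \<in> S \<Longrightarrow> f differentiable at z"
  using csm_diff[of 0 S f z] by (simp add: smooth_on_csm del: csm.simps)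

lemma smooth_on_dd: "smooth_on S f \<Longrightarrow> v \<in> Basis \<Longrightarrow> smooth_on S (dd v f)"
  unfolding smooth_on_csm using csm.simps(2)[of _ S f] by (simp del: csm.simps)

lemma smooth_on_pdiff: "smooth_on S f \<Longrightarrow> set ds \<subseteq> Basis \<Longrightarrow> smooth_on S (pdiff ds f)"
  by (induction ds) (simp_all add: pdiff_Cons_dd smooth_on_dd del: pdiff.simps(2))

lemma smooth_on_continuous: "smooth_on S f \<Longrightarrow> continuous_on S f"
  by (meson continuous_at_imp_continuous_on differentiable_imp_continuous_within smooth_on_diff)

lemma csm_const [simp]: "csm k S (\<lambda>z. c)"
proof (induction k arbitrary: c)
  case (Suc k)
  have "dd v (\<lambda>z. c) = (\<lambda>z. 0)" for v :: 'a by (auto simp: dd_def)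
  then show ?case using Suc by simp
qed auto

lemma dd_const [simp]: "dd v (\<lambda>z. c) = (\<lambda>z. 0)"
  by (auto simp: dd_def)

lemma dd_linear: "bounded_linear f \<Longrightarrow> dd v f = (\<lambda>z. f v)"
  by (rule ext) (rule dd_eqI[OF bounded_linear_imp_has_derivative])

lemma csm_linear: "bounded_linear f \<Longrightarrow> csm k S f"
  by (cases k) (auto simp: dd_linear bounded_linear_imp_differentiable)

lemma smooth_on_const [simp]: "smooth_on S (\<lambda>z. c)"
  by (simp add: smooth_on_csm)

lemma smooth_on_linear: "bounded_linear f \<Longrightarrow> smooth_on S f"
  by (simp add: smooth_on_csm csm_linear)

lemma dd_add:
  assumes "f differentiable at z" "g differentiable at z"
  shows "dd v (\<lambda>z. f z + g z) z = dd v f z + dd v g z"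
  by (rule dd_eqI) (intro has_derivative_add has_derivative_dd assms)

lemma dd_sum:
  assumes "\<And>i. i \<in> I \<Longrightarrow> f i differentiable at z"
  shows "dd v (\<lambda>z. \<Sum>i\<in>I. f i z) z = (\<Sum>i\<in>I. dd v (f i) z)"
  by (rule dd_eqI) (intro has_derivative_sum has_derivative_dd assms)

lemma dd_bounded_linear:
  assumes "bounded_linear h" "f differentiable at z"
  shows "dd v (\<lambda>z. h (f z)) z = h (dd v f z)"
  by (rule dd_eqI[OF bounded_linear.has_derivative[OF assms(1) has_derivative_dd[OF assms(2)]]])

lemma dd_bilinear:
  assumes "bounded_bilinear h" "f differentiable at z" "g differentiable at z"
  shows "dd v (\<lambda>z. h (f z) (g z)) z = h (dd v f z) (g z) + h (f z) (dd v g z)"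
  by (subst dd_eqI[OF bounded_bilinear.FDERIV[OF assms(1) has_derivative_dd[OF assms(2)] has_derivative_dd[OF assms(3)]]])
     (rule add.commute)

lemma differentiable_bilinear:
  assumes "bounded_bilinear h" "f differentiable at z" "g differentiable at z"
  shows "(\<lambda>z. h (f z) (g z)) differentiable at z"
  unfolding differentiable_def
  by (rule exI, rule bounded_bilinear.FDERIV[OF assms(1) has_derivative_dd[OF assms(2)] has_derivative_dd[OF assms(3)]])

lemma differentiable_bounded_linear:
  assumes "bounded_linear h" "f differentiable at z"
  shows "(\<lambda>z. h (f z)) differentiable at z"
  unfolding differentiable_def
  by (rule exI, rule bounded_linear.has_derivative[OF assms(1) has_derivative_dd[OF assms(2)]])

lemma csm_add:
  assumes "open S" "csm k S f" "csm k S g"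
  shows "csm k S (\<lambda>z. f z + g z)"
  using assms(2,3)
proof (induction k arbitrary: f g)
  case (Suc k)
  have "csm k S (dd v (\<lambda>z. f z + g z))" if "v \<in> Basis" for v
  proof (rule csm_cong[OF assms(1), where f="\<lambda>z. dd v f z + dd v g z"])
    show "csm k S (\<lambda>z. dd v f z + dd v g z)"
      by (rule Suc.IH) (use Suc.prems that in auto)
    show "\<forall>y\<in>S. dd v f y + dd v g y = dd v (\<lambda>z. f z + g z) y"
      by (rule ballI, rule dd_add[symmetric]) (use Suc.prems that in auto)
  qed
  then show ?case using Suc.prems by auto
qed auto

lemma csm_SucI:
  "(\<And>z. z \<in> S \<Longrightarrow> f differentiable at z) \<Longrightarrow> (\<And>v. v \<in> Basis \<Longrightarrow> csm k S (dd v f)) \<Longrightarrow> csm (Suc k) S f"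
  by simp

lemma csm_SucD: "csm (Suc k) S f \<Longrightarrow> v \<in> Basis \<Longrightarrow> csm k S (dd v f)"
  by simp

lemma csm_bounded_linear:
  assumes "open S" "bounded_linear h" "csm k S f"
  shows "csm k S (\<lambda>z. h (f z))"
  using assms(3)
proof (induction k arbitrary: f)
  case 0
  show ?case unfolding csm.simps
    by (rule ballI, rule differentiable_bounded_linear[OF assms(2)], rule csm_diff[OF 0])
next
  case (Suc k)
  show ?case
  proof (rule csm_SucI)
    fix v :: 'a assume v: "v \<in> Basis"
    show "csm k S (dd v (\<lambda>z. h (f z)))"
    proof (rule csm_cong[OF assms(1)])
      show "csm k S (\<lambda>z. h (dd v f z))"
        by (rule Suc.IH[OF csm_SucD[OF Suc.prems v]])
      show "\<forall>y\<in>S. h (dd v f y) = dd v (\<lambda>z. h (f z)) y"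
        by (rule ballI, rule dd_bounded_linear[OF assms(2), symmetric], rule csm_diff[OF Suc.prems])
    qed
  next
    fix z assume "z \<in> S"
    then show "(\<lambda>z. h (f z)) differentiable at z"
      by (rule differentiable_bounded_linear[OF assms(2) csm_diff[OF Suc.prems]])
  qed
qed

lemma csm_bilinear:
  assumes "open S" "bounded_bilinear h" "csm k S f" "csm k S g"
  shows "csm k S (\<lambda>z. h (f z) (g z))"
  using assms(3,4)
proof (induction k arbitrary: f g)
  case 0
  show ?case unfolding csm.simps
    by (rule ballI, rule differentiable_bilinear[OF assms(2) csm_diff[OF 0(1)] csm_diff[OF 0(2)]])
next
  case (Suc k)
  have fk: "csm k S f" by (rule csm_le[OF Suc.prems(1)]) simp
  have gk: "csm k S g" by (rule csm_le[OF Suc.prems(2)]) simp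
  show ?case
  proof (rule csm_SucI)
    fix v :: 'a assume v: "v \<in> Basis"
    show "csm k S (dd v (\<lambda>z. h (f z) (g z)))"
    proof (rule csm_cong[OF assms(1)])
      show "csm k S (\<lambda>z. h (dd v f z) (g z) + h (f z) (dd v g z))"
        by (rule csm_add[OF assms(1) Suc.IH[OF csm_SucD[OF Suc.prems(1) v] gk]
              Suc.IH[OF fk csm_SucD[OF Suc.prems(2) v]]])
      show "\<forall>y\<in>S. h (dd v f y) (g y) + h (f y) (dd v g y) = dd v (\<lambda>z. h (f z) (g z)) y"
        by (rule ballI, rule dd_bilinear[OF assms(2) csm_diff[OF Suc.prems(1)] csm_diff[OF Suc.prems(2)], symmetric])
    qed
  next
    fix z assume "z \<in> S"
    then show "(\<lambda>z. h (f z) (g z)) differentiable at z"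
      by (intro differentiable_bilinear[OF assms(2)] csm_diff[OF Suc.prems(1)] csm_diff[OF Suc.prems(2)])
  qed
qed

lemma csm_sum:
  assumes "open S" "\<And>i. i \<in> I \<Longrightarrow> csm k S (f i)"
  shows "csm k S (\<lambda>z. \<Sum>i\<in>I. f i z)"
  using assms(2) by (induction I rule: infinite_finite_induct) (auto intro!: csm_add[OF assms(1)])

lemma dd_compose:
  fixes f :: "'b::euclidean_space \<Rightarrow> 'c::real_normed_vector" and g :: "'a::real_normed_vector \<Rightarrow> 'b"
  assumes "g differentiable at z" "f differentiable at (g z)"
  shows "dd v (\<lambda>z. f (g z)) z = (\<Sum>b\<in>Basis. (dd v g z \<bullet> b) *\<^sub>R dd b f (g z))"
proof -
  have "dd v (\<lambda>z. f (g z)) z = dd (dd v g z) f (g z)"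
    by (rule dd_eqI[OF has_derivative_compose[OF has_derivative_dd[OF assms(1)] has_derivative_dd[OF assms(2)]]])
  also have "\<dots> = (\<Sum>b\<in>Basis. (dd v g z \<bullet> b) *\<^sub>R dd b f (g z))"
    by (rule dd_expand[OF assms(2)])
  finally show ?thesis .
qed

text \<open>The chain rule is used in coordinates: a derivative of the composition is a sum of
  products of a partial derivative of \<open>g\<close> with a partial derivative of \<open>f\<close>
  at \<open>g\<close>. To the latter the induction hypothesis applies, with \<open>g\<close> itself
  taken at the lower order.\<close>

lemma csm_compose:
  fixes f :: "'b::euclidean_space \<Rightarrow> 'c::real_normed_vector" and g :: "'a::euclidean_space \<Rightarrow> 'b"
  assumes "open S" "csm k T f" "csm k S g" "g ` S \<subseteq> T"
  shows "csm k S (\<lambda>z. f (g z))"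
  using assms(2,3)
proof (induction k arbitrary: f)
  case 0
  show ?case unfolding csm.simps
  proof
    fix z assume z: "z \<in> S"
    then have "g z \<in> T" using assms(4) by blast
    show "(\<lambda>z. f (g z)) differentiable at z"
      by (rule differentiable_compose[of f g, OF csm_diff[OF 0(1) \<open>g z \<in> T\<close>] csm_diff[OF 0(2) z]])
  qed
next
  case (Suc k)
  have gk: "csm k S g" by (rule csm_le[OF Suc.prems(2)]) simp
  have D: "f differentiable at (g z)" "g differentiable at z" if "z \<in> S" for z
  proof -
    have "g z \<in> T" using assms(4) that by blast
    then show "f differentiable at (g z)" by (rule csm_diff[OF Suc.prems(1)])
    show "g differentiable at z" by (rule csm_diff[OF Suc.prems(2) that])
  qed
  show ?case
  proof (rule csm_SucI)
    fix v :: 'a assume v: "v \<in> Basis"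
    show "csm k S (dd v (\<lambda>z. f (g z)))"
    proof (rule csm_cong[OF assms(1)])
      show "\<forall>y\<in>S. (\<Sum>b\<in>Basis. (dd v g y \<bullet> b) *\<^sub>R dd b f (g y)) = dd v (\<lambda>z. f (g z)) y"
        by (rule ballI, rule dd_compose[symmetric]) (rule D, assumption)+
      show "csm k S (\<lambda>z. \<Sum>b\<in>Basis. (dd v g z \<bullet> b) *\<^sub>R dd b f (g z))"
      proof (rule csm_sum[OF assms(1)], rule csm_bilinear[OF assms(1) bounded_bilinear_scaleR])
        fix b :: 'b assume b: "b \<in> Basis"
        show "csm k S (\<lambda>z. dd v g z \<bullet> b)"
          by (rule csm_bounded_linear[OF assms(1) bounded_linear_inner_left csm_SucD[OF Suc.prems(2) v]])
        show "csm k S (\<lambda>z. dd b f (g z))"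
          by (rule Suc.IH[OF csm_SucD[OF Suc.prems(1) b] gk])
      qed
    qed
  next
    fix z assume "z \<in> S"
    then show "(\<lambda>z. f (g z)) differentiable at z"
      by (intro differentiable_compose[of f g] D)
  qed
qed

lemma smooth_on_add: "open S \<Longrightarrow> smooth_on S f \<Longrightarrow> smooth_on S g \<Longrightarrow> smooth_on S (\<lambda>z. f z + g z)"
  by (simp add: smooth_on_csm csm_add)

lemma smooth_on_bounded_linear:
  "open S \<Longrightarrow> bounded_linear h \<Longrightarrow> smooth_on S f \<Longrightarrow> smooth_on S (\<lambda>z. h (f z))"
  by (simp add: smooth_on_csm csm_bounded_linear)

lemma smooth_on_bilinear:
  "open S \<Longrightarrow> bounded_bilinear h \<Longrightarrow> smooth_on S f \<Longrightarrow> smooth_on S g \<Longrightarrow> smooth_on S (\<lambda>z. h (f z) (g z))"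
  by (simp add: smooth_on_csm csm_bilinear)

lemma smooth_on_sum:
  "open S \<Longrightarrow> (\<And>i. i \<in> I \<Longrightarrow> smooth_on S (f i)) \<Longrightarrow> smooth_on S (\<lambda>z. \<Sum>i\<in>I. f i z)"
  by (simp add: smooth_on_csm csm_sum)

lemma smooth_on_compose:
  "open S \<Longrightarrow> smooth_on T f \<Longrightarrow> smooth_on S g \<Longrightarrow> g ` S \<subseteq> T \<Longrightarrow> smooth_on S (\<lambda>z. f (g z))"
  unfolding smooth_on_csm by (intro allI csm_compose[of S _ T f g]) simp_all

text \<open>The mean value estimate along \<open>u\<close> expresses the second difference by
  increments of \<open>dd u f\<close>, and differentiability of \<open>dd u f\<close> at the single
  point \<open>z\<close> controls these up to \<open>e * s\<close>.\<close>

lemma second_difference_aux: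
  fixes f :: "'a::real_normed_vector \<Rightarrow> 'b::real_normed_vector"
  assumes "open S" "z \<in> S" and f: "\<And>y. y \<in> S \<Longrightarrow> f differentiable at y"
    and fu: "dd u f differentiable at z" and e: "e > 0"
  shows "\<exists>d>0. \<forall>s. 0 < s \<and> s < d \<longrightarrow>
    norm (f (z + s *\<^sub>R u + s *\<^sub>R v) - f (z + s *\<^sub>R u) - f (z + s *\<^sub>R v) + f z - s\<^sup>2 *\<^sub>R dd v (dd u f) z) \<le> e * s\<^sup>2"
proof -
  define K where "K = norm u + norm v + 1"
  have K: "K > 0" unfolding K_def by (simp add: add_nonneg_pos)
  let ?L = "\<lambda>h. dd h (dd u f) z"
  have hd: "(dd u f has_derivative ?L) (at z)" by (rule has_derivative_dd[OF fu])
  then have lin: "linear ?L" by (rule has_derivative_linear)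
  from hd[unfolded has_derivative_at_alt] e K
  obtain d1 where d1: "d1 > 0" "\<And>y. norm (y - z) < d1 \<Longrightarrow>
     norm (dd u f y - dd u f z - ?L (y - z)) \<le> e / (2*K) * norm (y - z)"
    by (metis divide_pos_pos mult_pos_pos zero_less_numeral)
  from assms(1,2) obtain d2 where d2: "d2 > 0" "ball z d2 \<subseteq> S" by (meson openE)
  define d where "d = min d1 d2 / K"
  have d: "d > 0" using d1 d2 K by (simp add: d_def)
  show ?thesis
  proof (intro exI conjI allI impI, rule d)
    fix s assume s: "0 < s \<and> s < d"
    have near: "norm (a *\<^sub>R u + b *\<^sub>R v) \<le> s * K \<and> norm (a *\<^sub>R u + b *\<^sub>R v) < min d1 d2"
      if "a \<in> {0..s}" "b \<in> {0..s}" for a b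
    proof -
      have "norm (a *\<^sub>R u + b *\<^sub>R v) \<le> a * norm u + b * norm v"
        using norm_triangle_ineq[of "a *\<^sub>R u" "b *\<^sub>R v"] that by simp
      also have "\<dots> \<le> s * norm u + s * norm v"
        using that by (intro add_mono mult_right_mono) auto
      also have "\<dots> \<le> s * K" using s by (simp add: K_def algebra_simps)
      finally have 1: "norm (a *\<^sub>R u + b *\<^sub>R v) \<le> s * K" .
      moreover have "s * K < min d1 d2" using s K by (simp add: d_def pos_less_divide_eq)
      ultimately show ?thesis by linarith
    qed
    have inS: "z + a *\<^sub>R u + b *\<^sub>R v \<in> S" if "a \<in> {0..s}" "b \<in> {0..s}" for a b
    proof -
      have "z + a *\<^sub>R u + b *\<^sub>R v \<in> ball z d2"
        using near[OF that] by (simp add: dist_norm norm_minus_commute add.assoc norm_minus_cancel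
            flip: norm_minus_cancel[of "a *\<^sub>R u + b *\<^sub>R v"])
      then show ?thesis using d2 by auto
    qed
    \<comment> \<open>The increment in direction \<open>v\<close>, as a function of the position
      along \<open>u\<close>, with its expected main part subtracted. Its derivative
      \<open>\<psi>'\<close> is small, and \<open>\<psi> s - \<psi> 0\<close> is the quantity to be
      estimated.\<close>
    define \<psi> where "\<psi> \<tau> = f (z + \<tau> *\<^sub>R u + s *\<^sub>R v) - f (z + \<tau> *\<^sub>R u) - (\<tau> * s) *\<^sub>R ?L v" for \<tau>
    define \<psi>' where "\<psi>' \<tau> = dd u f (z + \<tau> *\<^sub>R u + s *\<^sub>R v) - dd u f (z + \<tau> *\<^sub>R u) - s *\<^sub>R ?L v" for \<tau>
    have der: "((\<lambda>\<tau>. f (z + \<tau> *\<^sub>R u + b *\<^sub>R v)) has_derivative (\<lambda>h. h *\<^sub>R dd u f (z + \<tau> *\<^sub>R u + b *\<^sub>R v))) (at \<tau> within T)"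
      if "\<tau> \<in> {0..s}" "b \<in> {0..s}" for \<tau> b T
    proof -
      have D: "(f has_derivative (\<lambda>h. dd h f (z + \<tau> *\<^sub>R u + b *\<^sub>R v))) (at (z + \<tau> *\<^sub>R u + b *\<^sub>R v))"
        by (rule has_derivative_dd) (rule f[OF inS[OF that]])
      have "((\<lambda>\<tau>. z + \<tau> *\<^sub>R u + b *\<^sub>R v) has_derivative (\<lambda>h. h *\<^sub>R u)) (at \<tau> within T)"
        by (auto intro!: derivative_eq_intros)
      from has_derivative_compose[OF this D]
      have "((\<lambda>\<tau>. f (z + \<tau> *\<^sub>R u + b *\<^sub>R v)) has_derivative (\<lambda>h. dd (h *\<^sub>R u) f (z + \<tau> *\<^sub>R u + b *\<^sub>R v))) (at \<tau> within T)" .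
      then show ?thesis by (simp add: dd_scale_dir f[OF inS[OF that]])
    qed
    have D\<psi>: "(\<psi> has_derivative (\<lambda>h. h *\<^sub>R \<psi>' \<tau>)) (at \<tau> within {0..s})" if "\<tau> \<in> {0..s}" for \<tau>
    proof -
      have "(\<psi> has_derivative (\<lambda>h. h *\<^sub>R dd u f (z + \<tau> *\<^sub>R u + s *\<^sub>R v) - h *\<^sub>R dd u f (z + \<tau> *\<^sub>R u) - (h * s) *\<^sub>R ?L v)) (at \<tau> within {0..s})"
        unfolding \<psi>_def
        by (intro has_derivative_diff der that has_derivative_scaleR_left derivative_eq_intros)
           (use s that der[of \<tau> 0 "{0..s}"] in \<open>auto intro!: derivative_eq_intros\<close>)
      then show ?thesis by (simp add: \<psi>'_def algebra_simps)
    qed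
    have b\<psi>: "norm (\<psi>' \<tau>) \<le> e * s" if "\<tau> \<in> {0..s}" for \<tau>
    proof -
      define r where "r y = dd u f y - dd u f z - ?L (y - z)" for y
      have r: "norm (r (z + \<tau> *\<^sub>R u + b *\<^sub>R v)) \<le> e / 2 * s" if b: "b \<in> {0..s}" for b
      proof -
        let ?h = "\<tau> *\<^sub>R u + b *\<^sub>R v"
        have "norm (r (z + ?h)) \<le> e / (2*K) * norm ?h"
          unfolding r_def using d1(2)[of "z + ?h"] near[OF \<open>\<tau> \<in> {0..s}\<close> b] by simp
        also have "\<dots> \<le> e / (2*K) * (s * K)"
          using near[OF \<open>\<tau> \<in> {0..s}\<close> b] e K by (intro mult_left_mono) auto
        also have "\<dots> = e / 2 * s" using K by simp
        finally show ?thesis by (simp add: add.assoc)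
      qed
      have "\<psi>' \<tau> = r (z + \<tau> *\<^sub>R u + s *\<^sub>R v) - r (z + \<tau> *\<^sub>R u + 0 *\<^sub>R v)"
        unfolding \<psi>'_def r_def by (simp add: dd_add_dir dd_scale_dir fu add.assoc)
      then show ?thesis using r[of s] r[of 0] s norm_triangle_ineq4[of "r (z + \<tau> *\<^sub>R u + s *\<^sub>R v)" "r (z + \<tau> *\<^sub>R u + 0 *\<^sub>R v)"]
        by simp
    qed
    have "norm (\<psi> s - \<psi> 0) \<le> (e * s) * norm (s - 0)"
    proof (rule differentiable_bound[where S="{0..s}" and f'="\<lambda>\<tau> h. h *\<^sub>R \<psi>' \<tau>"])
      show "onorm (\<lambda>h. h *\<^sub>R \<psi>' x) \<le> e * s" if "x \<in> {0..s}" for x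
      proof (rule onorm_le)
        fix h :: real
        show "norm (h *\<^sub>R \<psi>' x) \<le> e * s * norm h"
          using mult_left_mono[OF b\<psi>[OF that], of "\<bar>h\<bar>"] by (simp add: mult.commute)
      qed
    qed (use D\<psi> s in auto)
    then show "norm (f (z + s *\<^sub>R u + s *\<^sub>R v) - f (z + s *\<^sub>R u) - f (z + s *\<^sub>R v) + f z - s\<^sup>2 *\<^sub>R ?L v) \<le> e * s\<^sup>2"
      using s by (simp add: \<psi>_def power2_eq_square algebra_simps)
  qed
qed

text \<open>The second difference is symmetric in \<open>u\<close> and \<open>v\<close>, so both
  mixed derivatives approximate it up to \<open>e * s\<^sup>2\<close>. With \<open>e\<close> a third
  of their distance this is a contradiction.\<close>

lemma dd_commute:
  fixes f :: "'a::real_normed_vector \<Rightarrow> 'b::real_normed_vector"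
  assumes "open S" "z \<in> S" and f: "\<And>y. y \<in> S \<Longrightarrow> f differentiable at y"
    and fu: "dd u f differentiable at z" and fv: "dd v f differentiable at z"
  shows "dd u (dd v f) z = dd v (dd u f) z"
proof (rule ccontr)
  assume neq: "\<not> ?thesis"
  define e where "e = norm (dd u (dd v f) z - dd v (dd u f) z) / 3"
  have e: "e > 0" using neq by (simp add: e_def)
  obtain d1 where d1: "d1 > 0" "\<And>s. 0 < s \<and> s < d1 \<Longrightarrow>
    norm (f (z + s *\<^sub>R u + s *\<^sub>R v) - f (z + s *\<^sub>R u) - f (z + s *\<^sub>R v) + f z - s\<^sup>2 *\<^sub>R dd v (dd u f) z) \<le> e * s\<^sup>2"
    using second_difference_aux[OF assms(1,2) f fu e] by blast
  obtain d2 where d2: "d2 > 0" "\<And>s. 0 < s \<and> s < d2 \<Longrightarrow>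
    norm (f (z + s *\<^sub>R v + s *\<^sub>R u) - f (z + s *\<^sub>R v) - f (z + s *\<^sub>R u) + f z - s\<^sup>2 *\<^sub>R dd u (dd v f) z) \<le> e * s\<^sup>2"
    using second_difference_aux[OF assms(1,2) f fv e] by blast
  define s where "s = min d1 d2 / 2"
  have s: "0 < s \<and> s < d1" "0 < s \<and> s < d2" using d1 d2 by (auto simp: s_def)
  let ?D = "f (z + s *\<^sub>R u + s *\<^sub>R v) - f (z + s *\<^sub>R u) - f (z + s *\<^sub>R v) + f z"
  have 1: "norm (?D - s\<^sup>2 *\<^sub>R dd v (dd u f) z) \<le> e * s\<^sup>2" by (rule d1(2)[OF s(1)])
  have eq: "?D = f (z + s *\<^sub>R v + s *\<^sub>R u) - f (z + s *\<^sub>R v) - f (z + s *\<^sub>R u) + f z"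
    by (simp add: add.commute add.left_commute diff_right_commute)
  have 2: "norm (?D - s\<^sup>2 *\<^sub>R dd u (dd v f) z) \<le> e * s\<^sup>2"
    unfolding eq by (rule d2(2)[OF s(2)])
  have "norm (s\<^sup>2 *\<^sub>R (dd u (dd v f) z - dd v (dd u f) z)) \<le> e * s\<^sup>2 + e * s\<^sup>2"
    using norm_triangle_ineq4[of "?D - s\<^sup>2 *\<^sub>R dd v (dd u f) z" "?D - s\<^sup>2 *\<^sub>R dd u (dd v f) z"] 1 2
    by (simp add: algebra_simps)
  then have "s\<^sup>2 * (3 * e) \<le> s\<^sup>2 * (2 * e)" by (simp add: e_def)
  moreover have "s\<^sup>2 * e > 0" using s e by simp
  ultimately show False by linarith
qed

section \<open>Uniform families of symbols and Schwartz functions\<close>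

text \<open>The index \<open>t\<close> will be the centre of a phase space translation. The constant
  is chosen before \<open>t\<close>, so all later estimates at the origin are uniform over
  translations.\<close>

primrec bdn :: "nat \<Rightarrow> ('t \<Rightarrow> 'a \<Rightarrow> real) \<Rightarrow> ('t \<Rightarrow> 'a::euclidean_space \<Rightarrow> complex) \<Rightarrow> bool" where
  "bdn 0 W a \<longleftrightarrow> (\<exists>C. \<forall>t z. norm (a t z) \<le> C * W t z)"
| "bdn (Suc n) W a \<longleftrightarrow> (\<exists>C. \<forall>t z. norm (a t z) \<le> C * W t z) \<and> (\<forall>v\<in>Basis. bdn n W (\<lambda>t. dd v (a t)))"

definition bsym :: "('t \<Rightarrow> 'a \<Rightarrow> real) \<Rightarrow> ('t \<Rightarrow> 'a::euclidean_space \<Rightarrow> complex) \<Rightarrow> bool" where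
  "bsym W a \<longleftrightarrow> (\<forall>t. smooth_on UNIV (a t)) \<and> (\<forall>n. bdn n W a)"

lemma bdn_bound: "bdn n W a \<Longrightarrow> \<exists>C. \<forall>t z. norm (a t z) \<le> C * W t z"
  by (cases n) auto

lemma bdn_pdiff: "bdn n W a \<longleftrightarrow>
   (\<forall>ds. set ds \<subseteq> Basis \<longrightarrow> length ds \<le> n \<longrightarrow> (\<exists>C. \<forall>t z. norm (pdiff ds (a t) z) \<le> C * W t z))"
proof (induction n arbitrary: a)
  case (Suc n)
  show ?case
  proof
    assume L: "bdn (Suc n) W a"
    show "\<forall>ds. set ds \<subseteq> Basis \<longrightarrow> length ds \<le> Suc n \<longrightarrow> (\<exists>C. \<forall>t z. norm (pdiff ds (a t) z) \<le> C * W t z)"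
    proof (intro allI impI)
      fix ds :: "'b list" assume ds: "set ds \<subseteq> Basis" "length ds \<le> Suc n"
      show "\<exists>C. \<forall>t z. norm (pdiff ds (a t) z) \<le> C * W t z"
      proof (cases ds rule: rev_cases)
        case Nil
        then show ?thesis using L by simp
      next
        case (snoc es v)
        then have "bdn n W (\<lambda>t. dd v (a t))" using L ds by simp
        then show ?thesis unfolding snoc pdiff_snoc using Suc.IH[of "\<lambda>t. dd v (a t)"] ds snoc by simp
      qed
    qed
  next
    assume R: "\<forall>ds. set ds \<subseteq> Basis \<longrightarrow> length ds \<le> Suc n \<longrightarrow> (\<exists>C. \<forall>t z. norm (pdiff ds (a t) z) \<le> C * W t z)"
    have "bdn n W (\<lambda>t. dd v (a t))" if v: "v \<in> Basis" for v
      unfolding Suc.IH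
    proof (intro allI impI)
      fix ds :: "'b list" assume "set ds \<subseteq> Basis" "length ds \<le> n"
      then show "\<exists>C. \<forall>t z. norm (pdiff ds (dd v (a t)) z) \<le> C * W t z"
        using R[rule_format, of "ds @ [v]"] v by (simp add: pdiff_snoc)
    qed
    then show "bdn (Suc n) W a" using R[rule_format, of "[]"] by simp
  qed
qed simp

lemma bsym_pdiff_iff: "bsym W a \<longleftrightarrow> (\<forall>t. smooth_on UNIV (a t)) \<and>
   (\<forall>ds. set ds \<subseteq> Basis \<longrightarrow> (\<exists>C. \<forall>t z. norm (pdiff ds (a t) z) \<le> C * W t z))"
  unfolding bsym_def bdn_pdiff by (meson le_refl)

lemma bsym_smooth: "bsym W a \<Longrightarrow> smooth_on UNIV (a t)"
  by (simp add: bsym_def)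

lemma bsym_diff: "bsym W a \<Longrightarrow> a t differentiable at z"
  by (rule smooth_on_diff[OF bsym_smooth]) auto

lemma bsym_bound: "bsym W a \<Longrightarrow> \<exists>C. \<forall>t z. norm (a t z) \<le> C * W t z"
  unfolding bsym_def using bdn_bound by blast

lemma bsym_dd: "bsym W a \<Longrightarrow> v \<in> Basis \<Longrightarrow> bsym W (\<lambda>t. dd v (a t))"
  unfolding bsym_def by (metis bdn.simps(2) smooth_on_dd)

lemma bsym_pdiff: "bsym W a \<Longrightarrow> set ds \<subseteq> Basis \<Longrightarrow> bsym W (\<lambda>t. pdiff ds (a t))"
proof (induction ds)
  case (Cons v ds)
  then show ?case using bsym_dd[of W "\<lambda>t. pdiff ds (a t)" v] by (simp add: dd_def)
qed simp

lemma bdn_add: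
  fixes a b :: "'t \<Rightarrow> 'a::euclidean_space \<Rightarrow> complex"
  assumes "bdn n W a" "bdn n W b" "\<And>t. smooth_on UNIV (a t)" "\<And>t. smooth_on UNIV (b t)"
  shows "bdn n W (\<lambda>t z. a t z + b t z)"
  using assms
proof (induction n arbitrary: a b)
  have bd: "\<exists>C. \<forall>t z. norm (a t z + b t z) \<le> C * W t z"
    if "\<exists>C. \<forall>t z. norm (a t z) \<le> C * W t z" "\<exists>C. \<forall>t z. norm (b t z) \<le> C * W t z" for a b :: "'t \<Rightarrow> 'a \<Rightarrow> complex"
  proof -
    from that obtain A B where "\<And>t z. norm (a t z) \<le> A * W t z" "\<And>t z. norm (b t z) \<le> B * W t z" by blast
    then have "norm (a t z + b t z) \<le> (A + B) * W t z" for t z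
      using norm_triangle_ineq[of "a t z" "b t z"] by (smt (verit) distrib_right)
    then show ?thesis by blast
  qed
  { case 0
    then show ?case using bd by simp }
  { case (Suc n)
    have "bdn n W (\<lambda>t. dd v (\<lambda>z. a t z + b t z))" if v: "v \<in> Basis" for v
    proof -
      have "dd v (\<lambda>z. a t z + b t z) = (\<lambda>z. dd v (a t) z + dd v (b t) z)" for t
        by (rule ext, rule dd_add; rule smooth_on_diff[OF Suc.prems(3)] smooth_on_diff[OF Suc.prems(4)]; simp)
      then show ?thesis using Suc.IH[of "\<lambda>t. dd v (a t)" "\<lambda>t. dd v (b t)"] Suc.prems v
        by (simp add: smooth_on_dd)
    qed
    moreover have "\<exists>C. \<forall>t z. norm (a t z + b t z) \<le> C * W t z"
      by (rule bd) (rule bdn_bound[OF Suc.prems(1)], rule bdn_bound[OF Suc.prems(2)])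
    ultimately show ?case by simp }
qed

lemma bdn_mult:
  fixes a b :: "'t \<Rightarrow> 'a::euclidean_space \<Rightarrow> complex"
  assumes "bdn n W a" "bdn n V b" "\<And>t. smooth_on UNIV (a t)" "\<And>t. smooth_on UNIV (b t)"
    and W: "\<And>t z. 0 \<le> W t z" and V: "\<And>t z. 0 \<le> V t z"
  shows "bdn n (\<lambda>t z. W t z * V t z) (\<lambda>t z. a t z * b t z)"
  using assms(1-4)
proof (induction n arbitrary: a b)
  have bd: "\<exists>C. \<forall>t z. norm (a t z * b t z) \<le> C * (W t z * V t z)"
    if "\<exists>C. \<forall>t z. norm (a t z) \<le> C * W t z" "\<exists>C. \<forall>t z. norm (b t z) \<le> C * V t z" for a b :: "'t \<Rightarrow> 'a \<Rightarrow> complex"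
  proof -
    from that obtain A B where A: "\<And>t z. norm (a t z) \<le> A * W t z" and B: "\<And>t z. norm (b t z) \<le> B * V t z" by blast
    have "norm (a t z * b t z) \<le> (A * W t z) * (B * V t z)" for t z
    proof -
      have "0 \<le> A * W t z" using A[of t z] norm_ge_zero[of "a t z"] by linarith
      then show ?thesis unfolding norm_mult by (intro mult_mono A B norm_ge_zero)
    qed
    then have "norm (a t z * b t z) \<le> (A * B) * (W t z * V t z)" for t z by (simp add: mult_ac)
    then show ?thesis by blast
  qed
  { case 0
    then show ?case using bd by simp }
  { case (Suc n)
    have less: "bdn n W a" "bdn n V b" using Suc.prems(1,2) unfolding bdn_pdiff by auto
    have "bdn n (\<lambda>t z. W t z * V t z) (\<lambda>t. dd v (\<lambda>z. a t z * b t z))" if v: "v \<in> Basis" for v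
    proof -
      have "dd v (\<lambda>z. a t z * b t z) = (\<lambda>z. dd v (a t) z * b t z + a t z * dd v (b t) z)" for t
        by (rule ext, rule dd_bilinear[OF bounded_bilinear_mult];
            rule smooth_on_diff[OF Suc.prems(3)] smooth_on_diff[OF Suc.prems(4)]; simp)
      moreover have "bdn n (\<lambda>t z. W t z * V t z) (\<lambda>t z. dd v (a t) z * b t z + a t z * dd v (b t) z)"
      proof (rule bdn_add)
        show "bdn n (\<lambda>t z. W t z * V t z) (\<lambda>t z. dd v (a t) z * b t z)"
          by (rule Suc.IH) (use Suc.prems less v in \<open>simp_all add: smooth_on_dd\<close>)
        show "bdn n (\<lambda>t z. W t z * V t z) (\<lambda>t z. a t z * dd v (b t) z)"
          by (rule Suc.IH) (use Suc.prems less v in \<open>simp_all add: smooth_on_dd\<close>)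
      qed (use Suc.prems v in \<open>simp_all add: smooth_on_dd smooth_on_bilinear[OF open_UNIV bounded_bilinear_mult]\<close>)
      ultimately show ?thesis by simp
    qed
    moreover have "\<exists>C. \<forall>t z. norm (a t z * b t z) \<le> C * (W t z * V t z)"
      by (rule bd) (rule bdn_bound[OF Suc.prems(1)], rule bdn_bound[OF Suc.prems(2)])
    ultimately show ?case by simp }
qed

lemma bsym_add: "bsym W a \<Longrightarrow> bsym W b \<Longrightarrow> bsym W (\<lambda>t z. a t z + b t z)"
  unfolding bsym_def by (simp add: bdn_add smooth_on_add)

lemma bsym_mult:
  assumes "bsym W a" "bsym V b" "\<And>t z. 0 \<le> W t z" "\<And>t z. 0 \<le> V t z"
  shows "bsym (\<lambda>t z. W t z * V t z) (\<lambda>t z. a t z * b t z)"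
  using assms unfolding bsym_def
  by (simp add: bdn_mult smooth_on_bilinear[OF open_UNIV bounded_bilinear_mult])

lemma bsym_const: "bsym (\<lambda>(t::'t) (z::'a::euclidean_space). 1) (\<lambda>t z. c)"
proof -
  have "bdn n (\<lambda>(t::'t) (z::'a). 1) (\<lambda>t z. c)" for n and c :: complex
    by (induction n arbitrary: c) auto
  then show ?thesis unfolding bsym_def by simp
qed

lemma bsym_cmult:
  assumes "bsym W a" "\<And>t z. 0 \<le> W t z"
  shows "bsym W (\<lambda>t z. c * a t z)"
  using bsym_mult[OF bsym_const[of c] assms(1)] assms(2) by simp

section \<open>Rapidly decreasing families and amplitudes\<close>

definition wt :: "nat \<Rightarrow> 'a::real_normed_vector \<Rightarrow> real" where
  "wt k y = 1 / (1 + norm y) ^ k"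

lemma wt_pos [simp]: "0 < wt k y" and wt_nonneg [simp]: "0 \<le> wt k y"
  by (simp_all add: wt_def add_pos_nonneg)

lemma wt_0 [simp]: "wt 0 y = 1"
  by (simp add: wt_def)

lemma le_wt_iff: "x \<le> C * wt k y \<longleftrightarrow> x * (1 + norm y) ^ k \<le> C"
  by (simp add: wt_def pos_le_divide_eq add_pos_nonneg)

definition sch :: "('t \<Rightarrow> 'a::euclidean_space \<Rightarrow> complex) \<Rightarrow> bool" where
  "sch u \<longleftrightarrow> (\<forall>k. bsym (\<lambda>t y. wt k y) u)"

text \<open>Rapid decay is required in the second variable, which is integrated out, and only
  boundedness in the first. This makes all oscillatory integrals below absolutely
  convergent.\<close>

definition amp :: "('t \<Rightarrow> 'a::euclidean_space \<times> 'b::euclidean_space \<Rightarrow> complex) \<Rightarrow> bool" where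
  "amp a \<longleftrightarrow> (\<forall>k. bsym (\<lambda>t z. wt k (snd z)) a)"

lemma sch_dd: "sch u \<Longrightarrow> v \<in> Basis \<Longrightarrow> sch (\<lambda>t. dd v (u t))"
  by (simp add: sch_def bsym_dd)

lemma sch_pdiff: "sch u \<Longrightarrow> set ds \<subseteq> Basis \<Longrightarrow> sch (\<lambda>t. pdiff ds (u t))"
  by (simp add: sch_def bsym_pdiff)

lemma sch_cmult: "sch u \<Longrightarrow> sch (\<lambda>t y. c * u t y)"
  by (simp add: sch_def bsym_cmult)

lemma sch_smooth: "sch u \<Longrightarrow> smooth_on UNIV (u t)"
  by (auto simp: sch_def intro: bsym_smooth)

lemma sch_bound: "sch u \<Longrightarrow> \<exists>C. \<forall>t y. norm (u t y) \<le> C * wt k y"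
  unfolding sch_def by (rule bsym_bound) simp

lemma amp_dd: "amp a \<Longrightarrow> v \<in> Basis \<Longrightarrow> amp (\<lambda>t. dd v (a t))"
  by (simp add: amp_def bsym_dd)

lemma amp_add: "amp a \<Longrightarrow> amp b \<Longrightarrow> amp (\<lambda>t z. a t z + b t z)"
  by (simp add: amp_def bsym_add)

lemma amp_cmult: "amp a \<Longrightarrow> amp (\<lambda>t z. c * a t z)"
  by (simp add: amp_def bsym_cmult)

lemma amp_smooth: "amp a \<Longrightarrow> smooth_on UNIV (a t)"
  by (auto simp: amp_def intro: bsym_smooth)

lemma amp_bound: "amp a \<Longrightarrow> \<exists>C. \<forall>t z. norm (a t z) \<le> C * wt k (snd z)"
  unfolding amp_def by (rule bsym_bound) simp

lemma amp_bsym_mult: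
  assumes "bsym (\<lambda>t z. (1 + norm (snd z)) ^ m) a" "amp b"
  shows "amp (\<lambda>t z. a t z * b t z)"
  unfolding amp_def
proof
  fix k
  have "bsym (\<lambda>t z. (1 + norm (snd z)) ^ m * wt (m + k) (snd z)) (\<lambda>t z. a t z * b t z)"
    by (rule bsym_mult) (use assms in \<open>auto simp: amp_def\<close>)
  moreover have "(1 + norm y) ^ m * wt (m + k) y = wt k y" for y :: 'c
    by (simp add: wt_def power_add add_nonneg_eq_0_iff)
  ultimately show "bsym (\<lambda>t z. wt k (snd z)) (\<lambda>t z. a t z * b t z)" by simp
qed

lemma bsym_linear:
  fixes L :: "'a::euclidean_space \<Rightarrow> complex"
  assumes "bounded_linear L" and b: "\<And>z. norm (L z) \<le> K * W z" and W: "\<And>z. 1 \<le> W z"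
  shows "bsym (\<lambda>t::'t. W) (\<lambda>t. L)"
proof -
  have c: "bdn n (\<lambda>t::'t. W) (\<lambda>t z. c)" for n and c :: complex
  proof (induction n arbitrary: c)
    have *: "norm c \<le> norm c * W z" for c :: complex and z
      using mult_left_mono[OF W[of z], of "norm c"] by simp
    { case 0 then show ?case using * by auto }
    { case (Suc n) then show ?case using * by auto }
  qed
  have "bdn n (\<lambda>t::'t. W) (\<lambda>t. L)" for n
    using b c by (cases n) (auto simp: dd_linear[OF assms(1)])
  then show ?thesis unfolding bsym_def using smooth_on_linear[OF assms(1)] by blast
qed

lemma pdiff_translate:
  assumes "smooth_on UNIV f" "set ds \<subseteq> Basis"
  shows "pdiff ds (\<lambda>z. f (t + z)) = (\<lambda>z. pdiff ds f (t + z))"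
  using assms(2)
proof (induction ds)
  case (Cons v ds)
  have "dd v (\<lambda>z. pdiff ds f (t + z)) z = dd v (pdiff ds f) (t + z)" for z
  proof (rule dd_eqI)
    have "pdiff ds f differentiable at (t + z)"
      by (rule smooth_on_diff[OF smooth_on_pdiff[OF assms(1)]]) (use Cons in auto)
    then have D: "(pdiff ds f has_derivative (\<lambda>v. dd v (pdiff ds f) (t + z))) (at (t + z))"
      by (rule has_derivative_dd)
    have "((\<lambda>z. t + z) has_derivative (\<lambda>h. h)) (at z)"
      by (auto intro!: derivative_eq_intros)
    from has_derivative_compose[of "\<lambda>z. t + z" "\<lambda>h. h" z UNIV, OF this D]
    show "((\<lambda>z. pdiff ds f (t + z)) has_derivative (\<lambda>v. dd v (pdiff ds f) (t + z))) (at z)" .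
  qed
  then show ?case using Cons by (simp add: pdiff_Cons_dd del: pdiff.simps(2))
qed simp

lemma smooth_on_translate: "smooth_on UNIV f \<Longrightarrow> smooth_on UNIV (\<lambda>z. f (t + z))"
  by (rule smooth_on_compose[OF open_UNIV, of UNIV f]) (auto intro!: smooth_on_add smooth_on_linear[OF bounded_linear_ident])

lemma pdiff_zero [simp]: "pdiff ds (\<lambda>z. 0) = (\<lambda>z. 0)"
  by (induction ds) (auto simp: pdiff_Cons_dd simp del: pdiff.simps(2))

lemma dd_snd:
  fixes f :: "'b::real_normed_vector \<Rightarrow> 'c::real_normed_vector"
  assumes "f differentiable at (snd z)"
  shows "dd (v, w) (\<lambda>z. f (snd z)) z = dd w f (snd z)"
  using dd_eqI[OF has_derivative_compose[OF bounded_linear_imp_has_derivative[OF bounded_linear_snd] has_derivative_dd[OF assms]], of "(v, w)"]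
  by simp

lemma bsym_snd:
  fixes u :: "'t \<Rightarrow> 'b::euclidean_space \<Rightarrow> complex"
  assumes "bsym W u" "\<And>t y. 0 \<le> W t y"
  shows "bsym (\<lambda>t (z::'a::euclidean_space \<times> 'b). W t (snd z)) (\<lambda>t z. u t (snd z))"
proof -
  have sm: "smooth_on UNIV (\<lambda>z::'a \<times> 'b. u t (snd z))" if "bsym W u" for t u
    by (rule smooth_on_compose[OF open_UNIV bsym_smooth[OF that]]) (auto intro: smooth_on_linear[OF bounded_linear_snd])
  have bd: "\<exists>C. \<forall>t (z::'a \<times> 'b). norm (u t (snd z)) \<le> C * W t (snd z)" if "bsym W u" for u
    using bsym_bound[OF that] by metis
  have z: "bdn n (\<lambda>t (z::'a \<times> 'b). W t (snd z)) (\<lambda>t z. 0)" for n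
    by (induction n) (auto intro!: exI[of _ 0])
  have "bdn n (\<lambda>t (z::'a \<times> 'b). W t (snd z)) (\<lambda>t z. u t (snd z))" if "bsym W u" for n u
    using that
  proof (induction n arbitrary: u)
    case 0
    then show ?case using bd by simp
  next
    case (Suc n)
    have "bdn n (\<lambda>t (z::'a \<times> 'b). W t (snd z)) (\<lambda>t. dd v (\<lambda>z. u t (snd z)))" if v: "v \<in> Basis" for v
    proof -
      obtain p q where pq: "v = (p, q)" by force
      have *: "dd v (\<lambda>z. u t (snd z)) = (\<lambda>z. dd q (u t) (snd z))" for t
        unfolding pq by (rule ext, rule dd_snd, rule bsym_diff[OF Suc.prems])
      have "q = 0 \<or> q \<in> Basis" using v unfolding pq Basis_prod_def by auto
      then show ?thesis
      proof
        assume "q = 0"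
        have "dd 0 (u t) y = 0" for t y
          using dd_scale_dir[OF bsym_diff[OF Suc.prems], of 0 0 t y] by simp
        then show ?thesis unfolding * \<open>q = 0\<close> using z by simp
      next
        assume "q \<in> Basis"
        then show ?thesis unfolding * by (intro Suc.IH[OF bsym_dd[OF Suc.prems]])
      qed
    qed
    then show ?case using bd[OF Suc.prems] by simp
  qed
  then show ?thesis using sm assms(1) unfolding bsym_def by blast
qed

lemma sch_amp: "sch u \<Longrightarrow> amp (\<lambda>t z. u t (snd z))"
  unfolding sch_def amp_def by (auto intro!: bsym_snd)

section \<open>Integrability of polynomial weights and differentiation under the integral\<close>

lemma lborel_prod_coordinates:
  fixes g :: "'a::euclidean_space \<Rightarrow> real \<Rightarrow> 'c::{real_normed_field,banach,second_countable_topology}"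
  assumes g: "\<And>b. b \<in> Basis \<Longrightarrow> integrable lborel (g b)"
  shows "integrable lborel (\<lambda>x. \<Prod>b\<in>Basis. g b (x \<bullet> b))"
    and "(LINT x|lborel. (\<Prod>b\<in>Basis. g b (x \<bullet> b))) = (\<Prod>b\<in>Basis. LINT r|lborel. g b r)"
proof -
  interpret product_sigma_finite "\<lambda>_::'a. lborel :: real measure"
    by standard
  let ?T = "\<lambda>f::'a \<Rightarrow> real. \<Sum>b\<in>Basis. f b *\<^sub>R b"
  have T: "?T \<in> measurable (\<Pi>\<^sub>M b\<in>Basis. lborel) borel" by measurable
  have gm: "g b \<in> borel_measurable borel" if "b \<in> Basis" for b
    using borel_measurable_integrable[OF g[OF that]] by simp
  have m: "(\<lambda>x. \<Prod>b\<in>Basis. g b (x \<bullet> b)) \<in> borel_measurable borel"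
    by (intro borel_measurable_prod measurable_compose[OF _ gm]) auto
  have e: "(\<Prod>b\<in>Basis. g b (?T f \<bullet> b)) = (\<Prod>b\<in>Basis. g b (f b))" for f
    by (rule prod.cong) auto
  show "integrable lborel (\<lambda>x. \<Prod>b\<in>Basis. g b (x \<bullet> b))"
    unfolding lborel_eq[where 'a='a] integrable_distr_eq[OF T m] e
    by (rule product_integrable_prod[OF finite_Basis g])
  show "(LINT x|lborel. (\<Prod>b\<in>Basis. g b (x \<bullet> b))) = (\<Prod>b\<in>Basis. LINT r|lborel. g b r)"
    unfolding lborel_eq[where 'a='a] integral_distr[OF T m] e
    by (rule product_integral_prod[OF finite_Basis g])
qed

text \<open>Two powers of \<open>1 + norm x\<close> are spent on each coordinate: they dominate
  \<open>1 + (x \<bullet> b)\<^sup>2\<close>, and the product of the functions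
  \<open>1 / (1 + (x \<bullet> b)\<^sup>2)\<close> is integrable.\<close>

lemma integrable_wt:
  assumes "2 * DIM('a) \<le> k"
  shows "integrable lborel (wt k :: 'a::euclidean_space \<Rightarrow> real)"
proof -
  have "integrable lborel (\<lambda>x::real. inverse (1 + x\<^sup>2))"
    using integrable_inverse_1_plus_square by (simp add: set_integrable_def)
  then have i: "integrable lborel (\<lambda>x::'a. \<Prod>b\<in>Basis. inverse (1 + (x \<bullet> b)\<^sup>2))"
    by (rule lborel_prod_coordinates(1)[where g="\<lambda>b r. inverse (1 + r\<^sup>2)"])
  show ?thesis
  proof (rule Bochner_Integration.integrable_bound[OF i])
    show "(wt k :: 'a \<Rightarrow> real) \<in> borel_measurable lborel"
      unfolding wt_def by measurable
    have "wt k x \<le> (\<Prod>b\<in>Basis. inverse (1 + (x \<bullet> b)\<^sup>2))" for x :: 'a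
    proof -
      have "(\<Prod>b\<in>Basis. 1 + (x \<bullet> b)\<^sup>2) \<le> (\<Prod>b\<in>(Basis::'a set). (1 + norm x)\<^sup>2)"
      proof (rule prod_mono)
        fix b :: 'a assume b: "b \<in> Basis"
        have "(x \<bullet> b)\<^sup>2 \<le> (norm x)\<^sup>2"
          using Basis_le_norm[OF b, of x] by (simp add: abs_le_square_iff[symmetric])
        then show "0 \<le> 1 + (x \<bullet> b)\<^sup>2 \<and> 1 + (x \<bullet> b)\<^sup>2 \<le> (1 + norm x)\<^sup>2"
          by (simp add: power2_sum add_increasing2)
      qed
      also have "\<dots> = (1 + norm x) ^ (2 * DIM('a))" by (simp add: power_mult)
      also have "\<dots> \<le> (1 + norm x) ^ k" by (rule power_increasing[OF assms]) simp
      finally have le: "(\<Prod>b\<in>Basis. 1 + (x \<bullet> b)\<^sup>2) \<le> (1 + norm x) ^ k" .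
      have "0 < (\<Prod>b\<in>(Basis::'a set). 1 + (x \<bullet> b)\<^sup>2)"
        by (intro prod_pos) (auto intro: add_pos_nonneg)
      from le_imp_inverse_le[OF le this] show ?thesis
        by (simp add: wt_def inverse_eq_divide prod_dividef)
    qed
    then show "AE x in lborel. norm (wt k x :: real) \<le> norm (\<Prod>b\<in>Basis. inverse (1 + ((x::'a) \<bullet> b)\<^sup>2))"
      by (auto intro!: AE_I2 order_trans[OF _ abs_ge_self])
  qed
qed

lemma integrable_wt_bound:
  fixes f :: "'a::euclidean_space \<Rightarrow> complex"
  assumes "continuous_on UNIV f" "\<And>x. norm (f x) \<le> C * wt k x" "2 * DIM('a) \<le> k"
  shows "integrable lborel f"
proof (rule Bochner_Integration.integrable_bound)
  show "integrable lborel (\<lambda>x::'a. C * wt k x)" using integrable_wt[OF assms(3)] by simp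
  show "f \<in> borel_measurable lborel" using borel_measurable_continuous_onI[OF assms(1)] by simp
  show "AE x in lborel. norm (f x) \<le> norm (C * wt k x)"
    using assms(2) by (auto intro!: AE_I2 order_trans[OF _ abs_ge_self])
qed

lemma dd_norm_le:
  fixes f :: "'a::euclidean_space \<Rightarrow> 'b::real_normed_vector" and B :: real
  assumes "f differentiable at x" "\<And>w. w \<in> Basis \<Longrightarrow> norm (dd w f x) \<le> B"
  shows "norm (dd h f x) \<le> DIM('a) * B * norm h"
proof -
  have "norm (dd h f x) \<le> (\<Sum>b\<in>Basis. norm ((h \<bullet> b) *\<^sub>R dd b f x))"
    unfolding dd_expand[OF assms(1), of h] by (rule norm_sum)
  also have "\<dots> \<le> (\<Sum>b\<in>(Basis::'a set). norm h * B)"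
    by (rule sum_mono) (auto intro!: mult_mono assms Basis_le_norm)
  finally show ?thesis by (simp add: mult_ac)
qed

lemma second_order_bound:
  fixes f :: "'a::euclidean_space \<Rightarrow> 'b::real_normed_vector"
  assumes f: "csm 1 (ball y0 r) f"
    and B: "\<And>y v w. y \<in> ball y0 r \<Longrightarrow> v \<in> Basis \<Longrightarrow> w \<in> Basis \<Longrightarrow> norm (dd w (dd v f) y) \<le> B"
    and y: "y \<in> ball y0 r"
  shows "norm (f y - f y0 - (\<Sum>v\<in>Basis. ((y - y0) \<bullet> v) *\<^sub>R dd v f y0)) \<le> (real DIM('a))\<^sup>2 * B * (norm (y - y0))\<^sup>2"
proof -
  let ?d = "real DIM('a)"
  have r: "r > 0" using y by (metis ball_eq_empty emptyE not_le)
  have B0: "B \<ge> 0" using B[of y0] r nonempty_Basis by (meson centre_in_ball ex_in_conv norm_ge_zero order_trans)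
  have D: "f differentiable at x" if "x \<in> ball y0 r" for x by (rule csm_diff[OF f that])
  have DD: "dd v f differentiable at x" if "x \<in> ball y0 r" "v \<in> Basis" for x v
    using f that by simp
  let ?S = "cball y0 (norm (y - y0))"
  have S: "?S \<subseteq> ball y0 r" using y by (auto simp: dist_norm norm_minus_commute)
  have lip: "norm (dd v f x - dd v f y0) \<le> ?d * B * norm (y - y0)" if x: "x \<in> ?S" and v: "v \<in> Basis" for x v
  proof -
    have "norm (dd v f x - dd v f y0) \<le> (?d * B) * norm (x - y0)"
    proof (rule differentiable_bound[of ?S])
      show "(dd v f has_derivative (\<lambda>h. dd h (dd v f) z)) (at z within ?S)" if "z \<in> ?S" for z
        using has_derivative_dd[OF DD[OF _ v]] S that has_derivative_at_withinI by blast
      show "onorm (\<lambda>h. dd h (dd v f) z) \<le> ?d * B" if "z \<in> ?S" for z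
        by (rule onorm_le, rule dd_norm_le[OF DD[OF _ v] B[OF _ v]]) (use S that in auto)
    qed (use x in auto)
    also have "\<dots> \<le> (?d * B) * norm (y - y0)"
      using x B0 by (intro mult_left_mono) (auto simp: dist_norm norm_minus_commute)
    finally show ?thesis .
  qed
  have "norm (f y - f y0 - dd (y - y0) f y0) \<le> norm (y - y0) * (?d * (?d * B * norm (y - y0)))"
  proof (rule differentiable_bound_linearization[where S="?S" and f'="\<lambda>x h. dd h f x"])
    show "y0 + t *\<^sub>R (y - y0) \<in> ?S" if "t \<in> {0..1}" for t
      using that by (auto simp: dist_norm intro: mult_left_le_one_le)
    show "(f has_derivative (\<lambda>h. dd h f x)) (at x within ?S)" if "x \<in> ?S" for x
      using has_derivative_dd[OF D] S that has_derivative_at_withinI by blast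
    show "onorm ((\<lambda>h. dd h f x) - (\<lambda>h. dd h f y0)) \<le> ?d * (?d * B * norm (y - y0))" if x: "x \<in> ?S" for x
    proof (rule onorm_le)
      fix h
      have Dx: "f differentiable at x" and D0: "f differentiable at y0" using D S x r by auto
      have "norm (dd h f x - dd h f y0) = norm (\<Sum>b\<in>Basis. (h \<bullet> b) *\<^sub>R (dd b f x - dd b f y0))"
        unfolding dd_expand[OF Dx, of h] dd_expand[OF D0, of h] by (simp add: sum_subtractf scaleR_diff_right)
      also have "\<dots> \<le> (\<Sum>b\<in>Basis. norm ((h \<bullet> b) *\<^sub>R (dd b f x - dd b f y0)))" by (rule norm_sum)
      also have "\<dots> \<le> (\<Sum>b\<in>(Basis::'a set). norm h * (?d * B * norm (y - y0)))"
        by (rule sum_mono) (auto intro!: mult_mono lip x Basis_le_norm)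
      finally show "norm (((\<lambda>h. dd h f x) - (\<lambda>h. dd h f y0)) h) \<le> ?d * (?d * B * norm (y - y0)) * norm h"
        by (simp add: mult_ac)
    qed
  qed auto
  also have "dd (y - y0) f y0 = (\<Sum>v\<in>Basis. ((y - y0) \<bullet> v) *\<^sub>R dd v f y0)"
    by (rule dd_expand[OF D]) (use r in simp)
  finally show ?thesis by (simp add: power2_eq_square mult_ac)
qed

text \<open>An integrable bound on the second derivatives makes the integrated first order Taylor
  remainder at most a constant times \<open>norm (y - y0)\<close> squared, which gives the
  derivative by a direct estimate.\<close>

lemma has_derivative_under_integral:
  fixes A :: "'a::euclidean_space \<Rightarrow> 'b::euclidean_space \<Rightarrow> complex"
  assumes r: "r > 0" and A: "\<And>\<eta>. csm 1 (ball y0 r) (\<lambda>y. A y \<eta>)"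
    and iA: "\<And>y. y \<in> ball y0 r \<Longrightarrow> integrable lborel (A y)"
    and iD: "\<And>v. v \<in> Basis \<Longrightarrow> integrable lborel (\<lambda>\<eta>. dd v (\<lambda>y. A y \<eta>) y0)"
    and iB: "integrable lborel B"
    and B: "\<And>y v w \<eta>. y \<in> ball y0 r \<Longrightarrow> v \<in> Basis \<Longrightarrow> w \<in> Basis \<Longrightarrow> norm (dd w (dd v (\<lambda>y. A y \<eta>)) y) \<le> B \<eta>"
  shows "((\<lambda>y. LINT \<eta>|lborel. A y \<eta>) has_derivative
     (\<lambda>h. \<Sum>v\<in>Basis. (h \<bullet> v) *\<^sub>R (LINT \<eta>|lborel. dd v (\<lambda>y. A y \<eta>) y0))) (at y0)"
proof (rule has_derivativeI_sandwich[OF r])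
  let ?K = "(real DIM('a))\<^sup>2 * (LINT \<eta>|lborel. B \<eta>)"
  show "bounded_linear (\<lambda>h. \<Sum>v\<in>Basis. (h \<bullet> v) *\<^sub>R (LINT \<eta>|lborel. dd v (\<lambda>y. A y \<eta>) y0))"
    by (intro bounded_linear_sum bounded_linear_compose[OF bounded_linear_scaleR_left bounded_linear_inner_left])
  show "((\<lambda>y. ?K * norm (y - y0)) \<longlongrightarrow> 0) (at y0)"
    by (rule tendsto_eq_intros | simp)+
  fix y assume y: "y \<noteq> y0" "dist y y0 < r"
  then have yb: "y \<in> ball y0 r" by (simp add: dist_commute)
  have y0b: "y0 \<in> ball y0 r" using r by simp
  let ?R = "\<lambda>\<eta>. A y \<eta> - A y0 \<eta> - (\<Sum>v\<in>Basis. ((y - y0) \<bullet> v) *\<^sub>R dd v (\<lambda>y. A y \<eta>) y0)"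
  have e1: "(LINT \<eta>|lborel. A y \<eta>) - (LINT \<eta>|lborel. A y0 \<eta>) -
      (\<Sum>v\<in>Basis. ((y - y0) \<bullet> v) *\<^sub>R (LINT \<eta>|lborel. dd v (\<lambda>y. A y \<eta>) y0)) = (LINT \<eta>|lborel. ?R \<eta>)"
    using iA[OF yb] iA[OF y0b] iD by (simp add: Bochner_Integration.integral_diff Bochner_Integration.integral_sum)
  have e2: "norm (LINT \<eta>|lborel. ?R \<eta>) \<le> (LINT \<eta>|lborel. (real DIM('a))\<^sup>2 * B \<eta> * (norm (y - y0))\<^sup>2)"
  proof (rule order_trans[OF integral_norm_bound], rule integral_mono)
    show "integrable lborel (\<lambda>\<eta>. norm (?R \<eta>))" using iA[OF yb] iA[OF y0b] iD by simp
    show "integrable lborel (\<lambda>\<eta>. (real DIM('a))\<^sup>2 * B \<eta> * (norm (y - y0))\<^sup>2)" using iB by simp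
    show "norm (?R \<eta>) \<le> (real DIM('a))\<^sup>2 * B \<eta> * (norm (y - y0))\<^sup>2" for \<eta>
      by (rule second_order_bound[OF A B yb]) auto
  qed
  have e3: "(LINT \<eta>|lborel. (real DIM('a))\<^sup>2 * B \<eta> * (norm (y - y0))\<^sup>2) = ?K * norm (y - y0) * norm (y - y0)"
    by (simp add: power2_eq_square mult_ac)
  have n: "norm (y - y0) > 0" using y by simp
  show "norm ((LINT \<eta>|lborel. A y \<eta>) - (LINT \<eta>|lborel. A y0 \<eta>) -
      (\<Sum>v\<in>Basis. ((y - y0) \<bullet> v) *\<^sub>R (LINT \<eta>|lborel. dd v (\<lambda>y. A y \<eta>) y0))) / norm (y - y0) \<le> ?K * norm (y - y0)"
    unfolding pos_divide_le_eq[OF n] e1 using e2 unfolding e3 .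
qed

lemma lborel_integral_translate:
  fixes f :: "'a::euclidean_space \<Rightarrow> 'b::{banach,second_countable_topology}"
  assumes "f \<in> borel_measurable borel"
  shows "(LINT x|lborel. f (c + x)) = (LINT x|lborel. f x)"
proof -
  have "(LINT x|lborel. f x) = (LINT x|distr lborel borel ((+) c). f x)" by (simp add: lborel_distr_plus)
  also have "\<dots> = (LINT x|lborel. f (c + x))" by (rule integral_distr) (use assms in auto)
  finally show ?thesis by simp
qed

text \<open>One integrable function then dominates all translates by vectors of length at most 1, as
  differentiation with respect to a translation parameter requires.\<close>

lemma wt_shift: "norm h \<le> 1 \<Longrightarrow> wt k (x + h) \<le> 2 ^ k * wt k x"
proof -
  assume h: "norm h \<le> 1"
  have "1 + norm x \<le> 2 * (1 + norm (x + h))"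
    using norm_triangle_ineq4[of "x + h" h] h norm_ge_zero[of "x + h"] unfolding add_diff_cancel_right' by argo
  then have "(1 + norm x) ^ k \<le> (2 * (1 + norm (x + h))) ^ k" by (intro power_mono) auto
  then have "(1 + norm x) ^ k \<le> 2 ^ k * (1 + norm (x + h)) ^ k" by (simp only: power_mult_distrib)
  moreover have "0 < (1 + norm x) ^ k" "0 < (1 + norm (x + h)) ^ k" by (simp_all add: add_pos_nonneg)
  ultimately show ?thesis unfolding wt_def
    by (metis (no_types, lifting) divide_le_eq mult.commute mult.right_neutral pos_le_divide_eq times_divide_eq_right)
qed

text \<open>The integral of \<open>f (\<eta> + s *\<^sub>R v)\<close> over \<open>\<eta>\<close>
  does not depend on \<open>s\<close>, by translation invariance. Its derivative at
  \<open>s = 0\<close>, taken under the integral, is the left hand side.\<close>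

lemma integral_dd_eq_0:
  fixes f :: "'a::euclidean_space \<Rightarrow> complex"
  assumes f: "csm 2 UNIV f" and v: "v \<in> Basis" and k: "2 * DIM('a) \<le> k"
    and b: "\<And>x. norm (f x) \<le> C * wt k x" "\<And>x. norm (dd v f x) \<le> C * wt k x"
      "\<And>x. norm (dd v (dd v f) x) \<le> C * wt k x"
  shows "(LINT x|lborel. dd v f x) = 0"
proof -
  have D: "f differentiable at x" "dd v f differentiable at x" "dd v (dd v f) differentiable at x" for x
    using f v by (auto simp: numeral_2_eq_2)
  have C: "C \<ge> 0" using order_trans[OF norm_ge_zero b(1)[of 0]] by (simp add: wt_def)
  have lineD: "((\<lambda>s. g (x + s *\<^sub>R v)) has_derivative (\<lambda>h. h *\<^sub>R dd v g (x + s *\<^sub>R v))) (at s)"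
    if "g differentiable at (x + s *\<^sub>R v)" for g :: "'a \<Rightarrow> complex" and x s
  proof -
    have "((\<lambda>s. x + s *\<^sub>R v) has_derivative (\<lambda>h. h *\<^sub>R v)) (at s)"
      by (auto intro!: derivative_eq_intros)
    from has_derivative_compose[OF this has_derivative_dd[OF that]] show ?thesis
      by (simp add: dd_scale_dir[OF that])
  qed
  have line: "dd 1 (\<lambda>s. g (x + s *\<^sub>R v)) s = dd v g (x + s *\<^sub>R v)"
    if "g differentiable at (x + s *\<^sub>R v)" for g :: "'a \<Rightarrow> complex" and x s
    using dd_eqI[OF lineD[OF that], of 1] by simp
  have lineDf: "(\<lambda>s. g (x + s *\<^sub>R v)) differentiable at s"
    if "g differentiable at (x + s *\<^sub>R v)" for g :: "'a \<Rightarrow> complex" and x s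
    using lineD[OF that] unfolding differentiable_def by blast
  have contf: "continuous_on UNIV g" if "\<And>x. g differentiable at x" for g :: "'a \<Rightarrow> complex"
    using that by (meson continuous_at_imp_continuous_on differentiable_imp_continuous_within)
  have l1: "dd 1 (\<lambda>s. f (\<eta> + s *\<^sub>R v)) = (\<lambda>s. dd v f (\<eta> + s *\<^sub>R v))" for \<eta>
    by (rule ext, rule line[OF D(1)])
  have "((\<lambda>s::real. LINT \<eta>|lborel. f (\<eta> + s *\<^sub>R v)) has_derivative
     (\<lambda>h. \<Sum>w\<in>Basis. (h \<bullet> w) *\<^sub>R (LINT \<eta>|lborel. dd w (\<lambda>s. f (\<eta> + s *\<^sub>R v)) 0))) (at 0)"
  proof (rule has_derivative_under_integral[of 1 _ _ "\<lambda>\<eta>. C * 2 ^ k * wt k \<eta>"])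
    show "csm 1 (ball 0 1) (\<lambda>s. f (\<eta> + s *\<^sub>R v))" for \<eta>
      by (simp add: l1 lineDf D)
    fix s :: real assume "s \<in> ball 0 1"
    then have s: "norm (s *\<^sub>R v) \<le> 1" using v by simp
    have le: "C * wt k (\<eta> + s *\<^sub>R v) \<le> C * 2 ^ k * wt k \<eta>" for \<eta>
      using mult_left_mono[OF wt_shift[OF s, of k \<eta>] C] by (simp add: mult_ac)
    have "continuous_on UNIV (\<lambda>\<eta>. f (\<eta> + s *\<^sub>R v))"
      by (rule continuous_on_compose2[OF contf[OF D(1)]]) (auto intro!: continuous_intros)
    then show "integrable lborel (\<lambda>\<eta>. f (\<eta> + s *\<^sub>R v))"
      by (rule integrable_wt_bound[OF _ order_trans[OF b(1) le] k])
    show "norm (dd w (dd u (\<lambda>s. f (\<eta> + s *\<^sub>R v))) s) \<le> C * 2 ^ k * wt k \<eta>" if "u \<in> Basis" "w \<in> Basis" for u w \<eta>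
      using that order_trans[OF b(3) le, of \<eta>] by (simp add: l1 line[OF D(2)])
  next
    show "integrable lborel (\<lambda>\<eta>. dd w (\<lambda>s. f (\<eta> + s *\<^sub>R v)) 0)" if "w \<in> Basis" for w :: real
      using that integrable_wt_bound[OF contf[OF D(2)] b(2) k] by (simp add: l1)
    show "integrable lborel (\<lambda>\<eta>::'a. C * 2 ^ k * wt k \<eta>)" using integrable_wt[OF k] by simp
  qed simp
  moreover have "(\<lambda>s::real. LINT \<eta>|lborel. f (\<eta> + s *\<^sub>R v)) = (\<lambda>s. LINT \<eta>|lborel. f \<eta>)"
  proof
    fix s
    have "(LINT \<eta>|lborel. f (s *\<^sub>R v + \<eta>)) = (LINT \<eta>|lborel. f \<eta>)"
      by (rule lborel_integral_translate[OF borel_measurable_continuous_onI[OF contf[OF D(1)]]])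
    then show "(LINT \<eta>|lborel. f (\<eta> + s *\<^sub>R v)) = (LINT \<eta>|lborel. f \<eta>)" by (simp add: add.commute)
  qed
  ultimately have "((\<lambda>s::real. LINT \<eta>|lborel. f \<eta>) has_derivative
     (\<lambda>h. h *\<^sub>R (LINT \<eta>|lborel. dd v f \<eta>))) (at 0)" by (simp add: l1)
  from has_derivative_unique[OF this has_derivative_const] show ?thesis
    by (metis scaleR_one)
qed

section \<open>Oscillatory integrals and the Fourier transform\<close>

text \<open>The parameter covers both uses: \<open>\<sigma> = -1\<close> gives the Fourier transform
  and \<open>\<sigma> = 1\<close> the quantization of a symbol.\<close>

definition osc :: "real \<Rightarrow> ('a::euclidean_space \<times> 'a \<Rightarrow> complex) \<Rightarrow> 'a \<Rightarrow> complex" where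
  "osc \<sigma> a y = (LINT \<eta>|lborel. cis (\<sigma> * (y \<bullet> \<eta>)) * a (y, \<eta>))"

text \<open>The amplitude of the \<open>v\<close>-derivative of \<open>osc \<sigma> a\<close>; the
  first summand comes from the phase.\<close>

definition ampd :: "real \<Rightarrow> 'a::euclidean_space \<Rightarrow> ('a \<times> 'a \<Rightarrow> complex) \<Rightarrow> 'a \<times> 'a \<Rightarrow> complex" where
  "ampd \<sigma> v a = (\<lambda>z. \<i> * of_real (\<sigma> * (snd z \<bullet> v)) * a z + dd (v, 0) a z)"

lemma Basis_prodI: "v \<in> Basis \<Longrightarrow> (v, 0) \<in> Basis" "v \<in> Basis \<Longrightarrow> (0, v) \<in> Basis"
  by (auto simp: Basis_prod_def)

lemma amp_ampd:
  assumes "amp a" "v \<in> Basis"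
  shows "amp (\<lambda>t. ampd \<sigma> v (a t))"
  unfolding ampd_def
proof (rule amp_add[OF amp_bsym_mult[where m=1] amp_dd[OF assms(1) Basis_prodI(1)[OF assms(2)]]])
  let ?L = "\<lambda>z::'b \<times> 'b. \<i> * complex_of_real (\<sigma> * (snd z \<bullet> v))"
  show "bsym (\<lambda>t z. (1 + norm (snd z)) ^ 1) (\<lambda>t z. ?L z)"
  proof (rule bsym_linear)
    show "bounded_linear ?L"
      by (intro bounded_linear_const_mult bounded_linear_compose[OF bounded_linear_of_real]
          bounded_linear_compose[OF bounded_linear_inner_left] bounded_linear_snd)
    show "norm (?L z) \<le> \<bar>\<sigma>\<bar> * (1 + norm (snd z)) ^ 1" for z
    proof -
      have "\<bar>snd z \<bullet> v\<bar> \<le> 1 + norm (snd z)" using Basis_le_norm[OF assms(2), of "snd z"] by simp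
      then show ?thesis by (simp add: norm_mult abs_mult mult_left_mono)
    qed
  qed auto
qed (rule assms(1))

lemma slice_fst:
  assumes "a differentiable at (y, \<eta>)"
  shows "(\<lambda>y. a (y, \<eta>)) differentiable at y" "dd v (\<lambda>y. a (y, \<eta>)) y = dd (v, 0) a (y, \<eta>)"
proof -
  have "((\<lambda>y. (y, \<eta>)) has_derivative (\<lambda>h. (h, 0))) (at y)" by (auto intro!: derivative_eq_intros)
  from has_derivative_compose[OF this has_derivative_dd[OF assms]]
  have D: "((\<lambda>y. a (y, \<eta>)) has_derivative (\<lambda>h. dd (h, 0) a (y, \<eta>))) (at y)" .
  then show "(\<lambda>y. a (y, \<eta>)) differentiable at y" unfolding differentiable_def by blast
  show "dd v (\<lambda>y. a (y, \<eta>)) y = dd (v, 0) a (y, \<eta>)" by (rule dd_eqI[OF D])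
qed

lemma slice_snd:
  assumes "a differentiable at (y, \<eta>)"
  shows "(\<lambda>\<eta>. a (y, \<eta>)) differentiable at \<eta>" "dd v (\<lambda>\<eta>. a (y, \<eta>)) \<eta> = dd (0, v) a (y, \<eta>)"
proof -
  have "((\<lambda>\<eta>. (y, \<eta>)) has_derivative (\<lambda>h. (0, h))) (at \<eta>)" by (auto intro!: derivative_eq_intros)
  from has_derivative_compose[OF this has_derivative_dd[OF assms]]
  have D: "((\<lambda>\<eta>. a (y, \<eta>)) has_derivative (\<lambda>h. dd (0, h) a (y, \<eta>))) (at \<eta>)" .
  then show "(\<lambda>\<eta>. a (y, \<eta>)) differentiable at \<eta>" unfolding differentiable_def by blast
  show "dd v (\<lambda>\<eta>. a (y, \<eta>)) \<eta> = dd (0, v) a (y, \<eta>)" by (rule dd_eqI[OF D])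
qed

lemma cis_linear:
  fixes \<eta> :: "'a::euclidean_space"
  shows "(\<lambda>y. cis (\<sigma> * (y \<bullet> \<eta>))) differentiable at y"
    "dd v (\<lambda>y. cis (\<sigma> * (y \<bullet> \<eta>))) y = \<i> * of_real (\<sigma> * (v \<bullet> \<eta>)) * cis (\<sigma> * (y \<bullet> \<eta>))"
proof -
  have D: "((\<lambda>y. cis (\<sigma> * (y \<bullet> \<eta>))) has_derivative (\<lambda>v. (\<sigma> * (v \<bullet> \<eta>)) *\<^sub>R (\<i> * cis (\<sigma> * (y \<bullet> \<eta>))))) (at y)"
    by (auto intro!: derivative_eq_intros)
  then show "(\<lambda>y. cis (\<sigma> * (y \<bullet> \<eta>))) differentiable at y" unfolding differentiable_def by blast
  show "dd v (\<lambda>y. cis (\<sigma> * (y \<bullet> \<eta>))) y = \<i> * of_real (\<sigma> * (v \<bullet> \<eta>)) * cis (\<sigma> * (y \<bullet> \<eta>))"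
    using dd_eqI[OF D, of v] by (simp add: scaleR_conv_of_real mult_ac)
qed

lemma osc_slice_fst:
  fixes a :: "'a::euclidean_space \<times> 'a \<Rightarrow> complex"
  assumes "a differentiable at (y, \<eta>)"
  shows "(\<lambda>y. cis (\<sigma> * (y \<bullet> \<eta>)) * a (y, \<eta>)) differentiable at y"
    "dd v (\<lambda>y. cis (\<sigma> * (y \<bullet> \<eta>)) * a (y, \<eta>)) y = cis (\<sigma> * (y \<bullet> \<eta>)) * ampd \<sigma> v a (y, \<eta>)"
proof -
  note c = cis_linear(1)[of \<sigma> \<eta> y] and s = slice_fst(1)[OF assms]
  show "(\<lambda>y. cis (\<sigma> * (y \<bullet> \<eta>)) * a (y, \<eta>)) differentiable at y"
    by (rule differentiable_bilinear[OF bounded_bilinear_mult c s])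
  show "dd v (\<lambda>y. cis (\<sigma> * (y \<bullet> \<eta>)) * a (y, \<eta>)) y = cis (\<sigma> * (y \<bullet> \<eta>)) * ampd \<sigma> v a (y, \<eta>)"
    unfolding dd_bilinear[OF bounded_bilinear_mult c s] slice_fst(2)[OF assms] cis_linear(2) ampd_def
    by (simp add: algebra_simps inner_commute[of v])
qed

lemma osc_slice_snd:
  fixes a :: "'a::euclidean_space \<times> 'a \<Rightarrow> complex"
  assumes "a differentiable at (y, \<eta>)"
  shows "(\<lambda>\<eta>. cis (\<sigma> * (y \<bullet> \<eta>)) * a (y, \<eta>)) differentiable at \<eta>"
    "dd v (\<lambda>\<eta>. cis (\<sigma> * (y \<bullet> \<eta>)) * a (y, \<eta>)) \<eta> =
       cis (\<sigma> * (y \<bullet> \<eta>)) * (\<i> * of_real (\<sigma> * (y \<bullet> v)) * a (y, \<eta>) + dd (0, v) a (y, \<eta>))"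
proof -
  note c = cis_linear(1)[of \<sigma> y \<eta>, unfolded inner_commute[of _ y]] and s = slice_snd(1)[OF assms]
  show "(\<lambda>\<eta>. cis (\<sigma> * (y \<bullet> \<eta>)) * a (y, \<eta>)) differentiable at \<eta>"
    by (rule differentiable_bilinear[OF bounded_bilinear_mult c s])
  show "dd v (\<lambda>\<eta>. cis (\<sigma> * (y \<bullet> \<eta>)) * a (y, \<eta>)) \<eta> =
       cis (\<sigma> * (y \<bullet> \<eta>)) * (\<i> * of_real (\<sigma> * (y \<bullet> v)) * a (y, \<eta>) + dd (0, v) a (y, \<eta>))"
    unfolding dd_bilinear[OF bounded_bilinear_mult c s] slice_snd(2)[OF assms]
      cis_linear(2)[of v \<sigma> y \<eta>, unfolded inner_commute[of _ y]]
    by (simp add: algebra_simps)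
qed

lemma amp_diff: "amp a \<Longrightarrow> a t differentiable at z"
  by (rule smooth_on_diff[OF amp_smooth]) auto

lemma osc_integrand_continuous:
  assumes "amp a"
  shows "continuous_on UNIV (\<lambda>\<eta>. cis (\<sigma> * (y \<bullet> \<eta>)) * a t (y, \<eta>))"
  using osc_slice_snd(1)[OF amp_diff[OF assms]]
  by (meson continuous_at_imp_continuous_on differentiable_imp_continuous_within)

lemma osc_integrable:
  fixes a :: "'t \<Rightarrow> 'a::euclidean_space \<times> 'a \<Rightarrow> complex"
  assumes "amp a"
  shows "integrable lborel (\<lambda>\<eta>. cis (\<sigma> * (y \<bullet> \<eta>)) * a t (y, \<eta>))"
proof -
  obtain C where C: "\<And>t z. norm (a t z) \<le> C * wt (2 * DIM('a)) (snd z)"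
    using amp_bound[OF assms] by blast
  show ?thesis
    by (rule integrable_wt_bound[OF osc_integrand_continuous[OF assms], of _ _ _ C "2 * DIM('a)"])
       (use C[of t "(y, _)"] in \<open>simp_all add: norm_mult\<close>)
qed

lemma osc_bounded:
  fixes a :: "'t \<Rightarrow> 'a::euclidean_space \<times> 'a \<Rightarrow> complex"
  assumes "amp a"
  shows "\<exists>C. \<forall>t y. norm (osc \<sigma> (a t) y) \<le> C"
proof -
  obtain C where C: "\<And>t z. norm (a t z) \<le> C * wt (2 * DIM('a)) (snd z)"
    using amp_bound[OF assms] by blast
  have "norm (osc \<sigma> (a t) y) \<le> (LINT \<eta>|lborel. C * wt (2 * DIM('a)) (\<eta>::'a))" for t y
    unfolding osc_def
  proof (rule order_trans[OF integral_norm_bound], rule integral_mono)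
    show "integrable lborel (\<lambda>\<eta>. norm (cis (\<sigma> * (y \<bullet> \<eta>)) * a t (y, \<eta>)))"
      by (rule integrable_norm[OF osc_integrable[OF assms]])
    show "integrable lborel (\<lambda>\<eta>::'a. C * wt (2 * DIM('a)) \<eta>)" using integrable_wt[where 'a='a, of "2 * DIM('a)"] by simp
    show "norm (cis (\<sigma> * (y \<bullet> \<eta>)) * a t (y, \<eta>)) \<le> C * wt (2 * DIM('a)) \<eta>" for \<eta>
      using C[of t "(y, \<eta>)"] by (simp add: norm_mult)
  qed
  then show ?thesis by blast
qed

lemma osc_deriv:
  fixes a :: "'t \<Rightarrow> 'a::euclidean_space \<times> 'a \<Rightarrow> complex"
  assumes a: "amp a"
  shows "osc \<sigma> (a t) differentiable at y"
    and "v \<in> Basis \<Longrightarrow> dd v (osc \<sigma> (a t)) y = osc \<sigma> (ampd \<sigma> v (a t)) y"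
proof -
  let ?A = "\<lambda>y \<eta>. cis (\<sigma> * (y \<bullet> \<eta>)) * a t (y, \<eta>)"
  let ?k = "2 * DIM('a)"
  have "\<exists>C. \<forall>z. norm (ampd \<sigma> (snd vw) (ampd \<sigma> (fst vw) (a t)) z) \<le> C * wt ?k (snd z)"
    if "vw \<in> Basis \<times> Basis" for vw
  proof -
    have "fst vw \<in> Basis" "snd vw \<in> Basis" using that by auto
    from amp_bound[OF amp_ampd[OF amp_ampd[OF a this(1)] this(2)]] show ?thesis by blast
  qed
  then obtain C where C: "\<And>v w z. v \<in> Basis \<Longrightarrow> w \<in> Basis \<Longrightarrow>
      norm (ampd \<sigma> w (ampd \<sigma> v (a t)) z) \<le> C (v, w) * wt ?k (snd z)"
    by (metis (no_types, lifting) SigmaI fst_conv snd_conv)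
  define S where "S = (\<Sum>vw\<in>Basis \<times> Basis. \<bar>C vw\<bar>)"
  have d1: "dd v (\<lambda>y. ?A y \<eta>) = (\<lambda>y. cis (\<sigma> * (y \<bullet> \<eta>)) * ampd \<sigma> v (a t) (y, \<eta>))" for v \<eta>
    by (rule ext, rule osc_slice_fst(2)[OF amp_diff[OF a]])
  have d2: "dd w (dd v (\<lambda>y. ?A y \<eta>)) y = cis (\<sigma> * (y \<bullet> \<eta>)) * ampd \<sigma> w (ampd \<sigma> v (a t)) (y, \<eta>)"
    if "v \<in> Basis" for v w \<eta> y
    unfolding d1 by (rule osc_slice_fst(2)[OF amp_diff[OF amp_ampd[OF a that]]])
  have D: "((\<lambda>y. LINT \<eta>|lborel. ?A y \<eta>) has_derivative
     (\<lambda>h. \<Sum>v\<in>Basis. (h \<bullet> v) *\<^sub>R (LINT \<eta>|lborel. dd v (\<lambda>y. ?A y \<eta>) y))) (at y)"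
  proof (rule has_derivative_under_integral[of 1 _ _ "\<lambda>\<eta>::'a. S * wt ?k \<eta>"])
    show "csm 1 (ball y 1) (\<lambda>y. ?A y \<eta>)" for \<eta>
      using osc_slice_fst(1)[OF amp_diff[OF a]] osc_slice_fst(1)[OF amp_diff[OF amp_ampd[OF a]]]
      by (simp add: d1)
    show "integrable lborel (\<lambda>\<eta>. ?A x \<eta>)" for x by (rule osc_integrable[OF a])
    show "integrable lborel (\<lambda>\<eta>. dd v (\<lambda>y. ?A y \<eta>) y)" if "v \<in> Basis" for v
      unfolding d1 by (rule osc_integrable[OF amp_ampd[OF a that]])
    show "integrable lborel (\<lambda>\<eta>::'a. S * wt ?k \<eta>)" using integrable_wt[where 'a='a, of "2 * DIM('a)"] by simp
    fix x v w \<eta> :: 'a assume vw: "v \<in> Basis" "w \<in> Basis"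
    have "\<bar>C (v, w)\<bar> \<le> S" unfolding S_def by (rule member_le_sum) (use vw in auto)
    then have "C (v, w) * wt ?k \<eta> \<le> S * wt ?k \<eta>" by (intro mult_right_mono) auto
    then show "norm (dd w (dd v (\<lambda>y. ?A y \<eta>)) x) \<le> S * wt ?k \<eta>"
      unfolding d2[OF vw(1)] using order_trans[OF C[OF vw, of "(x, \<eta>)"], of "S * wt ?k \<eta>"] by (simp add: norm_mult)
  qed simp
  have e: "osc \<sigma> (a t) = (\<lambda>y. LINT \<eta>|lborel. ?A y \<eta>)" by (simp add: fun_eq_iff osc_def)
  show "osc \<sigma> (a t) differentiable at y" unfolding e differentiable_def using D by blast
  show "dd v (osc \<sigma> (a t)) y = osc \<sigma> (ampd \<sigma> v (a t)) y" if v: "v \<in> Basis"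
    unfolding e using dd_eqI[OF D, of v] v
    by (simp add: d1 osc_def inner_Basis if_distrib[of "\<lambda>x. x *\<^sub>R _"] cong: if_cong)
qed

lemma osc_pdiff:
  assumes "amp a" "set ds \<subseteq> Basis"
  shows "\<exists>b. amp b \<and> (\<forall>t. pdiff ds (osc \<sigma> (a t)) = osc \<sigma> (b t))"
  using assms(2)
proof (induction ds)
  case Nil
  then show ?case using assms(1) by auto
next
  case (Cons v ds)
  then obtain b where b: "amp b" "\<And>t. pdiff ds (osc \<sigma> (a t)) = osc \<sigma> (b t)" by auto
  have "pdiff (v # ds) (osc \<sigma> (a t)) = osc \<sigma> (ampd \<sigma> v (b t))" for t
    unfolding pdiff_Cons_dd b(2) by (rule ext, rule osc_deriv(2)[OF b(1)]) (use Cons in auto)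
  moreover have "amp (\<lambda>t. ampd \<sigma> v (b t))" using amp_ampd[OF b(1)] Cons by auto
  ultimately show ?case by blast
qed

lemma csm_cis: "csm k UNIV (\<lambda>x. c * cis x)"
proof (induction k arbitrary: c)
  have D: "((\<lambda>x. c * cis x) has_derivative (\<lambda>h. h *\<^sub>R (c * \<i> * cis x))) (at x)" for c x
    by (auto intro!: derivative_eq_intros simp: scaleR_conv_of_real algebra_simps)
  then have d: "(\<lambda>x. c * cis x) differentiable at x" for c x unfolding differentiable_def by blast
  { case 0 show ?case using d by simp }
  { case (Suc k)
    have "dd v (\<lambda>x. c * cis x) = (\<lambda>x. (of_real v * c * \<i>) * cis x)" for v
      using dd_eqI[OF D, of v c] by (auto simp: scaleR_conv_of_real algebra_simps)
    then show ?case using d Suc by simp }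
qed

lemma smooth_cis_linear: "bounded_linear L \<Longrightarrow> smooth_on UNIV (\<lambda>x. cis (L x))"
  using smooth_on_compose[OF open_UNIV, of UNIV "\<lambda>x. 1 * cis x" L] smooth_on_linear[of L] csm_cis[of _ 1]
  by (simp add: smooth_on_csm)

text \<open>The integral of an \<open>\<eta>\<close>-derivative of the integrand vanishes. Since
  \<open>\<sigma>\<close> squares to 1, dividing by the factor \<open>\<i> * \<sigma>\<close> that
  the phase produces is multiplying by \<open>- \<i> * \<sigma>\<close>.\<close>

lemma osc_by_parts:
  fixes a :: "'t \<Rightarrow> 'a::euclidean_space \<times> 'a \<Rightarrow> complex"
  assumes a: "amp a" and w: "w \<in> Basis" and \<sigma>: "\<sigma> * \<sigma> = 1"
  shows "of_real (y \<bullet> w) * osc \<sigma> (a t) y = \<i> * of_real \<sigma> * osc \<sigma> (dd (0, w) (a t)) y"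
proof -
  define c where "c = \<i> * complex_of_real (\<sigma> * (y \<bullet> w))"
  \<comment> \<open>The amplitude of the \<open>w\<close>-derivative of the integrand at the fixed
    point \<open>y\<close>. It is iterated once because \<open>integral_dd_eq_0\<close> also asks
    for a bound on the second derivative.\<close>
  define T where "T b = (\<lambda>t z. c * b t z + dd (0, w) (b t) z)" for b :: "'t \<Rightarrow> 'a \<times> 'a \<Rightarrow> complex"
  have T: "amp (T b)" if "amp b" for b
    unfolding T_def by (intro amp_add amp_cmult amp_dd that Basis_prodI w)
  let ?f = "\<lambda>b \<eta>. cis (\<sigma> * (y \<bullet> \<eta>)) * b t (y, \<eta>)"
  have d: "dd w (?f b) = ?f (T b)" if "amp b" for b
    by (rule ext) (simp add: osc_slice_snd(2)[OF amp_diff[OF that]] T_def c_def)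
  have "smooth_on UNIV (?f a)"
  proof (rule smooth_on_bilinear[OF open_UNIV bounded_bilinear_mult])
    show "smooth_on UNIV (\<lambda>\<eta>. cis (\<sigma> * (y \<bullet> \<eta>)))"
      by (intro smooth_cis_linear bounded_linear_const_mult bounded_linear_inner_right)
    have "smooth_on UNIV (\<lambda>\<eta>. (y, 0) + (0, \<eta>))"
      by (rule smooth_on_add[OF open_UNIV smooth_on_const smooth_on_linear])
        (intro bounded_linear_Pair bounded_linear_zero bounded_linear_ident)
    then show "smooth_on UNIV (\<lambda>\<eta>. a t (y, \<eta>))"
      using smooth_on_compose[OF open_UNIV amp_smooth[OF a], of "\<lambda>\<eta>. (y, \<eta>)" t] by simp
  qed
  then have sm: "csm 2 UNIV (?f a)" by (simp add: smooth_on_csm)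
  let ?k = "2 * DIM('a)"
  obtain C0 where C0: "\<And>t z. norm (a t z) \<le> C0 * wt ?k (snd z)" using amp_bound[OF a] by blast
  obtain C1 where C1: "\<And>t z. norm (T a t z) \<le> C1 * wt ?k (snd z)" using amp_bound[OF T[OF a]] by blast
  obtain C2 where C2: "\<And>t z. norm (T (T a) t z) \<le> C2 * wt ?k (snd z)" using amp_bound[OF T[OF T[OF a]]] by blast
  define C where "C = \<bar>C0\<bar> + \<bar>C1\<bar> + \<bar>C2\<bar>"
  have le: "C0 * wt ?k \<eta> \<le> C * wt ?k \<eta>" "C1 * wt ?k \<eta> \<le> C * wt ?k \<eta>" "C2 * wt ?k \<eta> \<le> C * wt ?k \<eta>" for \<eta> :: 'a
    unfolding C_def by (intro mult_right_mono; simp)+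
  have "(LINT \<eta>|lborel. dd w (?f a) \<eta>) = 0"
  proof (rule integral_dd_eq_0[OF sm w, of ?k C])
    show "norm (?f a \<eta>) \<le> C * wt ?k \<eta>" for \<eta> using order_trans[OF C0[of t "(y, \<eta>)"]] le(1)[of \<eta>] by (simp add: norm_mult)
    show "norm (dd w (?f a) \<eta>) \<le> C * wt ?k \<eta>" for \<eta>
      unfolding d[OF a] using order_trans[OF C1[of t "(y, \<eta>)"]] le(2)[of \<eta>] by (simp add: norm_mult)
    show "norm (dd w (dd w (?f a)) \<eta>) \<le> C * wt ?k \<eta>" for \<eta>
      unfolding d[OF a] d[OF T[OF a]] using order_trans[OF C2[of t "(y, \<eta>)"]] le(3)[of \<eta>] by (simp add: norm_mult)
  qed simp
  moreover have "(LINT \<eta>|lborel. ?f (T a) \<eta>) = c * osc \<sigma> (a t) y + osc \<sigma> (dd (0, w) (a t)) y"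
  proof -
    have "?f (T a) \<eta> = c * (cis (\<sigma> * (y \<bullet> \<eta>)) * a t (y, \<eta>)) + cis (\<sigma> * (y \<bullet> \<eta>)) * dd (0, w) (a t) (y, \<eta>)" for \<eta>
      by (simp add: T_def algebra_simps)
    then show ?thesis unfolding osc_def
      using osc_integrable[OF a, of \<sigma> y t] osc_integrable[OF amp_dd[OF a Basis_prodI(2)[OF w]], of \<sigma> y t]
      by simp
  qed
  ultimately have "c * osc \<sigma> (a t) y = - osc \<sigma> (dd (0, w) (a t)) y"
    unfolding d[OF a] by (simp add: eq_neg_iff_add_eq_0)
  then have "(- \<i> * of_real \<sigma>) * (c * osc \<sigma> (a t) y) = \<i> * of_real \<sigma> * osc \<sigma> (dd (0, w) (a t)) y" by simp
  moreover have "(- \<i> * of_real \<sigma>) * c = of_real (y \<bullet> w)"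
  proof -
    have "(- \<i> * of_real \<sigma>) * c = of_real (\<sigma> * \<sigma>) * of_real (y \<bullet> w)"
      unfolding c_def by (simp add: complex_eq_iff)
    then show ?thesis by (simp add: \<sigma>)
  qed
  ultimately show ?thesis by (metis mult.assoc)
qed

text \<open>Since \<open>norm y\<close> is at most the sum of the
  \<open>\<bar>y \<bullet> w\<bar>\<close>, each power of \<open>1 + norm y\<close> costs one
  integration by parts, and that leads to another amplitude of the same class.\<close>

lemma osc_decay:
  fixes a :: "'t \<Rightarrow> 'a::euclidean_space \<times> 'a \<Rightarrow> complex"
  assumes "amp a" "\<sigma> * \<sigma> = 1"
  shows "\<exists>C. \<forall>t y. norm (osc \<sigma> (a t) y) \<le> C * wt k y"
  unfolding le_wt_iff using assms(1)
proof (induction k arbitrary: a)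
  case 0
  then show ?case using osc_bounded by simp
next
  case (Suc k)
  obtain C0 where C0: "\<And>t y. norm (osc \<sigma> (a t) y) * (1 + norm y) ^ k \<le> C0"
    using Suc.IH[OF Suc.prems] by blast
  have "\<forall>w\<in>Basis. \<exists>C. \<forall>t y. norm (osc \<sigma> (dd (0, w) (a t)) y) * (1 + norm y) ^ k \<le> C"
    using Suc.IH[OF amp_dd[OF Suc.prems Basis_prodI(2)]] by blast
  then obtain C where C: "\<And>w t y. w \<in> Basis \<Longrightarrow> norm (osc \<sigma> (dd (0, w) (a t)) y) * (1 + norm y) ^ k \<le> C w"
    by metis
  have "norm (osc \<sigma> (a t) y) * (1 + norm y) ^ Suc k \<le> C0 + (\<Sum>w\<in>Basis. C w)" for t y
  proof -
    let ?o = "osc \<sigma> (a t) y"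
    have b: "\<bar>y \<bullet> w\<bar> * norm ?o = norm (osc \<sigma> (dd (0, w) (a t)) y)" if "w \<in> Basis" for w
    proof -
      have "\<bar>\<sigma>\<bar> = 1" using assms(2) by (metis abs_mult_self_eq abs_square_eq_1 power2_eq_square)
      then show ?thesis
        using arg_cong[OF osc_by_parts[OF Suc.prems that assms(2), of y t], of norm] by (simp add: norm_mult)
    qed
    have "norm ?o * (1 + norm y) ^ Suc k = (1 + norm y) ^ k * (norm ?o + norm y * norm ?o)"
      by (simp add: algebra_simps)
    also have "\<dots> \<le> (1 + norm y) ^ k * (norm ?o + (\<Sum>w\<in>Basis. \<bar>y \<bullet> w\<bar>) * norm ?o)"
      by (intro mult_left_mono add_left_mono mult_right_mono norm_le_l1) auto
    also have "\<dots> = norm ?o * (1 + norm y) ^ k + (\<Sum>w\<in>Basis. (\<bar>y \<bullet> w\<bar> * norm ?o) * (1 + norm y) ^ k)"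
      by (simp add: algebra_simps sum_distrib_left sum_distrib_right)
    also have "\<dots> \<le> C0 + (\<Sum>w\<in>Basis. C w)"
      by (intro add_mono C0 sum_mono) (simp only: b C)
    finally show ?thesis .
  qed
  then show ?case by blast
qed

lemma sch_osc:
  assumes "amp a" "\<sigma> * \<sigma> = 1"
  shows "sch (\<lambda>t. osc \<sigma> (a t))"
  unfolding sch_def bsym_pdiff_iff
proof (intro allI conjI impI)
  fix k t and ds :: "'b list"
  show "smooth_on UNIV (osc \<sigma> (a t))"
    unfolding smooth_on_def using osc_pdiff[OF assms(1)] osc_deriv(1) by metis
  assume "set ds \<subseteq> Basis"
  then show "\<exists>C. \<forall>t y. norm (pdiff ds (osc \<sigma> (a t)) y) \<le> C * wt k y"
    using osc_pdiff[OF assms(1)] osc_decay[OF _ assms(2)] by metis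
qed

section \<open>The Fourier transform and inversion at the origin\<close>

definition ft :: "('a::euclidean_space \<Rightarrow> complex) \<Rightarrow> 'a \<Rightarrow> complex" where
  "ft u = osc (-1) (\<lambda>z. u (snd z))"

lemma ft_eq: "ft u \<eta> = (LINT x|lborel. cis (- (\<eta> \<bullet> x)) * u x)"
  by (simp add: ft_def osc_def)

lemma sch_ft: "sch u \<Longrightarrow> sch (\<lambda>t. ft (u t))"
  unfolding ft_def by (rule sch_osc[OF sch_amp]) auto

lemma sch_diff: "sch u \<Longrightarrow> u t differentiable at y"
  by (rule smooth_on_diff[OF sch_smooth]) auto

lemma ft_dd:
  assumes "sch u" "w \<in> Basis"
  shows "of_real (\<eta> \<bullet> w) * ft (u t) \<eta> = ft (\<lambda>y. - \<i> * dd w (u t) y) \<eta>"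
proof -
  have e: "dd (0, w) (\<lambda>z. u t (snd z)) = (\<lambda>z. dd w (u t) (snd z))"
    by (rule ext, rule dd_snd[OF sch_diff[OF assms(1)]])
  have "of_real (\<eta> \<bullet> w) * ft (u t) \<eta> = - \<i> * ft (dd w (u t)) \<eta>"
    using osc_by_parts[OF sch_amp[OF assms(1)] assms(2), of "-1" \<eta> t] unfolding e by (simp add: ft_def)
  also have "\<dots> = ft (\<lambda>y. - \<i> * dd w (u t) y) \<eta>"
    unfolding ft_eq integral_mult_right_zero[symmetric] by (rule arg_cong[of _ _ "integral\<^sup>L lborel"]) (simp add: fun_eq_iff)
  finally show ?thesis .
qed

lemma sch_continuous: "sch u \<Longrightarrow> continuous_on UNIV (u t)"
  by (rule smooth_on_continuous[OF sch_smooth])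

lemma sch_integrable:
  fixes u :: "'t \<Rightarrow> 'a::euclidean_space \<Rightarrow> complex"
  assumes "sch u"
  shows "integrable lborel (u t)"
proof -
  obtain C where C: "\<And>t y. norm (u t y) \<le> C * wt (2 * DIM('a)) y" using sch_bound[OF assms] by blast
  show ?thesis by (rule integrable_wt_bound[OF sch_continuous[OF assms] C]) simp
qed

lemma lborel_integral_scale:
  fixes f :: "'a::euclidean_space \<Rightarrow> complex"
  assumes f: "f \<in> borel_measurable borel" and c: "c > 0"
  shows "(LINT x|lborel. f x) = of_real (c ^ DIM('a)) * (LINT x|lborel. f (c *\<^sub>R x))"
proof -
  have m: "(\<lambda>x::'a. 0 + c *\<^sub>R x) \<in> measurable lborel borel" by simp
  have "(LINT x|lborel. f x) = (LINT x|density (distr lborel borel (\<lambda>x::'a. 0 + c *\<^sub>R x)) (\<lambda>_. ennreal (\<bar>c\<bar> ^ DIM('a))). f x)"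
    using lborel_affine[of c "0::'a"] c by (metis ennreal_power abs_ge_zero less_irrefl)
  also have "\<dots> = (LINT x|distr lborel borel (\<lambda>x::'a. 0 + c *\<^sub>R x). (\<bar>c\<bar> ^ DIM('a)) *\<^sub>R f x)"
    by (rule integral_density) (use f in auto)
  also have "\<dots> = (LINT x|lborel. (\<bar>c\<bar> ^ DIM('a)) *\<^sub>R f (0 + c *\<^sub>R x))"
    by (rule integral_distr[OF m]) (use f in measurable)
  also have "\<dots> = of_real (c ^ DIM('a)) * (LINT x|lborel. f (c *\<^sub>R x))"
    using c by (simp add: scaleR_conv_of_real)
  finally show ?thesis .
qed

text \<open>This is the characteristic function of the standard normal distribution, evaluated at
  \<open>- s\<close> because of the sign in the phase.\<close>

lemma gauss_1d:
  "integrable lborel (\<lambda>r::real. cis (- (s * r)) * complex_of_real (exp (- (r\<^sup>2) / 2)))" (is ?A)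
  "(LINT r|lborel. cis (- (s * r)) * complex_of_real (exp (- (r\<^sup>2) / 2))) = of_real (sqrt (2 * pi) * exp (- (s\<^sup>2) / 2))" (is ?B)
proof -
  have "integrable lborel (\<lambda>r. sqrt (2 * pi) * std_normal_density r)"
    using integrable_normal_moment[of 1 0 0] by simp
  then have i: "integrable lborel (\<lambda>r::real. exp (- (r\<^sup>2) / 2))"
    by (simp add: std_normal_density_def)
  show ?A
    by (rule Bochner_Integration.integrable_bound[OF i]) (auto simp: norm_mult cis_conv_exp)
  have "of_real (exp (- ((-s)\<^sup>2) / 2)) = (CLINT r|density lborel std_normal_density. iexp (- s * r))"
    using fun_cong[OF char_std_normal_distribution, of "-s"] unfolding char_def by simp
  also have "\<dots> = (LINT r|lborel. std_normal_density r *\<^sub>R iexp (- s * r))"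
    by (rule integral_density) auto
  also have "\<dots> = (LINT r|lborel. of_real (1 / sqrt (2 * pi)) * (cis (- (s * r)) * complex_of_real (exp (- (r\<^sup>2) / 2))))"
    by (rule arg_cong[of _ _ "integral\<^sup>L lborel"]) (simp add: fun_eq_iff std_normal_density_def cis_conv_exp scaleR_conv_of_real)
  also have "\<dots> = of_real (1 / sqrt (2 * pi)) * (LINT r|lborel. cis (- (s * r)) * complex_of_real (exp (- (r\<^sup>2) / 2)))"
    by simp
  finally have "of_real (sqrt (2 * pi)) * of_real (exp (- (s\<^sup>2) / 2)) = (LINT r|lborel. cis (- (s * r)) * complex_of_real (exp (- (r\<^sup>2) / 2)))"
    by (simp add: field_simps)
  then show ?B by simp
qed

definition gauss :: "'a::euclidean_space \<Rightarrow> complex" where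
  "gauss x = (\<Prod>b\<in>Basis. of_real (exp (- ((x \<bullet> b)\<^sup>2) / 2)))"

lemma cis_inner: "cis (- (w \<bullet> x)) = (\<Prod>b\<in>Basis. cis (- ((w \<bullet> b) * (x \<bullet> b))))"
  unfolding euclidean_inner[of w x] cis_conv_exp
  by (simp add: exp_sum[symmetric] sum_negf sum_distrib_left)

lemma
  fixes w :: "'a::euclidean_space"
  shows gauss_integrable: "integrable lborel (gauss :: 'a \<Rightarrow> complex)"
    and ft_gauss: "ft gauss w = of_real (sqrt (2 * pi) ^ DIM('a)) * gauss w"
    and integral_gauss: "(LINT x|lborel. gauss (x::'a)) = of_real (sqrt (2 * pi) ^ DIM('a))"
proof -
  let ?g = "\<lambda>w b r. cis (- ((w \<bullet> b) * r)) * complex_of_real (exp (- (r\<^sup>2) / 2))"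
  have e: "cis (- (w \<bullet> x)) * gauss x = (\<Prod>b\<in>Basis. ?g w b (x \<bullet> b))" for w x :: 'a
    unfolding gauss_def cis_inner by (simp add: prod.distrib)
  have i: "integrable lborel (\<lambda>x::'a. cis (- (w \<bullet> x)) * gauss x)" for w :: 'a
    unfolding e by (rule lborel_prod_coordinates(1)[of "?g w", OF gauss_1d(1)])
  have v: "(LINT x|lborel. cis (- (w \<bullet> x)) * gauss x) = of_real (sqrt (2 * pi) ^ DIM('a)) * gauss w" for w :: 'a
    unfolding e unfolding lborel_prod_coordinates(2)[of "?g w", OF gauss_1d(1)] gauss_1d(2) gauss_def
    by (simp only: of_real_mult prod.distrib prod_constant of_real_power)
  show "integrable lborel (gauss :: 'a \<Rightarrow> complex)" using i[of 0] by simp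
  show "ft gauss w = of_real (sqrt (2 * pi) ^ DIM('a)) * gauss w" by (simp add: ft_eq v)
  show "(LINT x|lborel. gauss (x::'a)) = of_real (sqrt (2 * pi) ^ DIM('a))"
    using v[of 0] by (simp add: gauss_def)
qed

lemma gauss_continuous: "continuous_on UNIV (gauss :: 'a::euclidean_space \<Rightarrow> complex)"
  unfolding gauss_def by (intro continuous_intros) auto

lemma gauss_le_1: "norm (gauss x) \<le> 1"
  unfolding gauss_def prod_norm[symmetric] by (rule prod_le_1) auto

lemma ft_multiplication:
  fixes f g :: "'a::euclidean_space \<Rightarrow> complex"
  assumes f: "integrable lborel f" "continuous_on UNIV f" and g: "integrable lborel g" "continuous_on UNIV g"
  shows "(LINT \<eta>|lborel. ft f \<eta> * g \<eta>) = (LINT x|lborel. f x * ft g x)"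
proof -
  let ?F = "\<lambda>(\<eta>, x). cis (- (\<eta> \<bullet> x)) * f x * g \<eta>"
  have c: "continuous_on UNIV ?F"
    unfolding case_prod_unfold cis_conv_exp
    by (intro continuous_intros continuous_on_compose2[OF f(2)] continuous_on_compose2[OF g(2)]) auto
  have m: "?F \<in> borel_measurable (lborel \<Otimes>\<^sub>M lborel)"
    using borel_measurable_continuous_onI[OF c] by (simp add: lborel_prod)
  have inner: "integrable lborel (\<lambda>x. cis (- (\<eta> \<bullet> x)) * f x * g \<eta>)" for \<eta>
  proof -
    have "continuous_on UNIV (\<lambda>x. cis (- (\<eta> \<bullet> x)) * f x)"
      unfolding cis_conv_exp by (intro continuous_intros f)
    then have "(\<lambda>x. cis (- (\<eta> \<bullet> x)) * f x) \<in> borel_measurable borel" by (rule borel_measurable_continuous_onI)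
    then have "integrable lborel (\<lambda>x. cis (- (\<eta> \<bullet> x)) * f x)"
      by (intro Bochner_Integration.integrable_bound[OF f(1)]) (auto simp: norm_mult)
    then show ?thesis by simp
  qed
  have int: "integrable (lborel \<Otimes>\<^sub>M lborel) ?F"
  proof (rule lborel_pair.Fubini_integrable[OF m])
    show "AE \<eta> in lborel. integrable lborel (\<lambda>x. ?F (\<eta>, x))" using inner by simp
    have "integrable lborel (\<lambda>\<eta>. norm (g \<eta>) * (LINT x|lborel. norm (f x)))" using g by simp
    moreover have "(LINT x|lborel. norm (?F (\<eta>, x))) = norm (g \<eta>) * (LINT x|lborel. norm (f x))" for \<eta>
      by (simp add: norm_mult mult.commute)
    ultimately show "integrable lborel (\<lambda>\<eta>. LINT x|lborel. norm (?F (\<eta>, x)))" by simp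
  qed
  have "(LINT \<eta>|lborel. ft f \<eta> * g \<eta>) = (LINT \<eta>|lborel. LINT x|lborel. cis (- (\<eta> \<bullet> x)) * f x * g \<eta>)"
    by (simp add: ft_eq)
  also have "\<dots> = (LINT x|lborel. LINT \<eta>|lborel. cis (- (\<eta> \<bullet> x)) * f x * g \<eta>)"
    using lborel_pair.Fubini_integral[OF int] by simp
  also have "\<dots> = (LINT x|lborel. f x * ft g x)"
  proof (rule arg_cong[of _ _ "integral\<^sup>L lborel"], rule ext)
    fix x
    have "(LINT \<eta>|lborel. cis (- (\<eta> \<bullet> x)) * f x * g \<eta>) = (LINT \<eta>|lborel. f x * (cis (- (x \<bullet> \<eta>)) * g \<eta>))"
      by (simp add: inner_commute mult_ac)
    then show "(LINT \<eta>|lborel. cis (- (\<eta> \<bullet> x)) * f x * g \<eta>) = f x * ft g x" by (simp add: ft_eq)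
  qed
  finally show ?thesis .
qed

text \<open>Gaussian regularisation: the multiplication formula is applied to widening Gaussians,
  and dominated convergence gives the limit of both sides. The constant is the square of the
  integral of the Gaussian.\<close>

lemma ft_inversion_0:
  fixes u :: "'t \<Rightarrow> 'a::euclidean_space \<Rightarrow> complex"
  assumes u: "sch u"
  shows "(LINT \<eta>|lborel. ft (u t) \<eta>) = of_real ((2 * pi) ^ DIM('a)) * u t 0"
proof -
  let ?d = "DIM('a)"
  define \<epsilon> where "\<epsilon> n = inverse (real (Suc n))" for n
  have \<epsilon>: "\<epsilon> n > 0" for n by (simp add: \<epsilon>_def)
  have \<epsilon>0: "\<epsilon> \<longlonglongrightarrow> 0" unfolding \<epsilon>_def by (rule LIMSEQ_inverse_real_of_nat)
  have cu: "continuous_on UNIV (u t)" and iu: "integrable lborel (u t)"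
    using sch_continuous[OF u] sch_integrable[OF u] by auto
  have cf: "continuous_on UNIV (ft (u t))" and if': "integrable lborel (ft (u t))"
    using sch_continuous[OF sch_ft[OF u]] sch_integrable[OF sch_ft[OF u]] by auto
  \<comment> \<open>The dilation is moved from the Gaussian to \<open>u\<close>, so that on either
    side it only occurs in the argument of one fixed function that is continuous at 0.\<close>
  have key: "(LINT \<eta>|lborel. ft (u t) \<eta> * gauss (\<epsilon> n *\<^sub>R \<eta>)) = (LINT x|lborel. u t (\<epsilon> n *\<^sub>R x) * ft gauss x)" for n
  proof -
    let ?e = "\<epsilon> n"
    have cs: "continuous_on UNIV (\<lambda>x. u t (?e *\<^sub>R x))"
      by (intro continuous_on_compose2[OF cu] continuous_intros) auto
    have "integrable lborel (\<lambda>x. u t (?e *\<^sub>R x))"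
    proof -
      obtain C where C: "\<And>y. norm (u t y) \<le> C * wt (2 * ?d) y" using sch_bound[OF u] by blast
      have C0: "C \<ge> 0" using order_trans[OF norm_ge_zero C[of 0]] by (simp add: wt_def)
      have "norm (u t (?e *\<^sub>R x)) \<le> (C / ?e ^ (2 * ?d)) * wt (2 * ?d) x" for x
      proof -
        have "?e \<le> 1" by (simp add: \<epsilon>_def inverse_le_1_iff)
        then have "?e * (1 + norm x) \<le> 1 + norm (?e *\<^sub>R x)" using \<epsilon>[of n] by (simp add: distrib_left)
        then have "(?e * (1 + norm x)) ^ (2 * ?d) \<le> (1 + norm (?e *\<^sub>R x)) ^ (2 * ?d)"
          using \<epsilon>[of n] by (intro power_mono) (auto intro!: mult_nonneg_nonneg)
        moreover have "0 < (?e * (1 + norm x)) ^ (2 * ?d)"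
          using \<epsilon>[of n] by (simp add: add_pos_nonneg)
        ultimately have "wt (2 * ?d) (?e *\<^sub>R x) \<le> 1 / (?e * (1 + norm x)) ^ (2 * ?d)"
          unfolding wt_def by (intro divide_left_mono) (auto intro: mult_pos_pos add_pos_nonneg)
        then have "C * wt (2 * ?d) (?e *\<^sub>R x) \<le> C * (1 / (?e * (1 + norm x)) ^ (2 * ?d))"
          by (rule mult_left_mono[OF _ C0])
        then show ?thesis using C[of "?e *\<^sub>R x"] by (simp add: wt_def power_mult_distrib)
      qed
      then show ?thesis by (rule integrable_wt_bound[OF cs]) simp
    qed
    from ft_multiplication[OF this cs gauss_integrable gauss_continuous]
    have 1: "(LINT \<eta>|lborel. ft (\<lambda>x. u t (?e *\<^sub>R x)) \<eta> * gauss \<eta>) = (LINT x|lborel. u t (?e *\<^sub>R x) * ft gauss x)" .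
    have 2: "ft (u t) \<eta> = of_real (?e ^ ?d) * ft (\<lambda>x. u t (?e *\<^sub>R x)) (?e *\<^sub>R \<eta>)" for \<eta>
    proof -
      have "continuous_on UNIV (\<lambda>x. cis (- (\<eta> \<bullet> x)) * u t x)"
        unfolding cis_conv_exp by (intro continuous_intros cu)
      from lborel_integral_scale[OF borel_measurable_continuous_onI[OF this] \<epsilon>[of n]]
      show ?thesis by (simp add: ft_eq)
    qed
    let ?h = "\<lambda>\<eta>. ft (\<lambda>x. u t (?e *\<^sub>R x)) \<eta> * gauss \<eta>"
    have h: "?h \<eta> = of_real (1 / ?e ^ ?d) * (ft (u t) ((1 / ?e) *\<^sub>R \<eta>) * gauss \<eta>)" for \<eta>
      using 2[of "(1 / ?e) *\<^sub>R \<eta>"] \<epsilon>[of n] by (simp add: field_simps)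
    have "continuous_on UNIV ?h"
      unfolding h by (intro continuous_intros continuous_on_compose2[OF cf] gauss_continuous) auto
    from lborel_integral_scale[OF borel_measurable_continuous_onI[OF this] \<epsilon>[of n]]
    have "(LINT \<eta>|lborel. ?h \<eta>) = (LINT \<eta>|lborel. of_real (?e ^ ?d) * ?h (?e *\<^sub>R \<eta>))" by simp
    also have "\<dots> = (LINT \<eta>|lborel. ft (u t) \<eta> * gauss (?e *\<^sub>R \<eta>))"
      using 2 by (simp add: mult.assoc)
    finally show ?thesis using 1 by simp
  qed
  have L: "(\<lambda>n. LINT \<eta>|lborel. ft (u t) \<eta> * gauss (\<epsilon> n *\<^sub>R \<eta>)) \<longlonglongrightarrow> (LINT \<eta>|lborel. ft (u t) \<eta>)"
  proof (rule integral_dominated_convergence[where w="\<lambda>\<eta>. norm (ft (u t) \<eta>)"])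
    have g: "(\<lambda>n. gauss (\<epsilon> n *\<^sub>R \<eta>)) \<longlonglongrightarrow> 1" for \<eta> :: 'a
    proof -
      have "isCont gauss (0::'a)" using gauss_continuous[where 'a='a] by (simp add: continuous_on_eq_continuous_at)
      moreover have "(\<lambda>n. \<epsilon> n *\<^sub>R \<eta>) \<longlonglongrightarrow> 0" using tendsto_scaleR[OF \<epsilon>0 tendsto_const[of \<eta>]] by simp
      ultimately have "(\<lambda>n. gauss (\<epsilon> n *\<^sub>R \<eta>)) \<longlonglongrightarrow> gauss (0::'a)" by (rule isCont_tendsto_compose)
      then show ?thesis by (simp add: gauss_def)
    qed
    show "AE \<eta> in lborel. (\<lambda>n. ft (u t) \<eta> * gauss (\<epsilon> n *\<^sub>R \<eta>)) \<longlonglongrightarrow> ft (u t) \<eta>"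
      using tendsto_mult[OF tendsto_const g] by (auto intro!: AE_I2)
    show "AE \<eta> in lborel. norm (ft (u t) \<eta> * gauss (\<epsilon> n *\<^sub>R \<eta>)) \<le> norm (ft (u t) \<eta>)" for n
      using gauss_le_1 by (auto intro!: AE_I2 mult_left_le simp: norm_mult)
    show "(\<lambda>\<eta>. ft (u t) \<eta> * gauss (\<epsilon> n *\<^sub>R \<eta>)) \<in> borel_measurable lborel" for n
      unfolding measurable_lborel2
      by (intro borel_measurable_continuous_onI continuous_intros cf continuous_on_compose2[OF gauss_continuous]) auto
  qed (use if' in auto)
  have R: "(\<lambda>n. LINT x|lborel. u t (\<epsilon> n *\<^sub>R x) * ft gauss x) \<longlonglongrightarrow> (LINT x|lborel. u t 0 * ft gauss (x::'a))"
  proof -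
    obtain C where C: "\<And>y. norm (u t y) \<le> C" using sch_bound[OF u, of 0] by auto
    have fg: "ft (gauss :: 'a \<Rightarrow> complex) = (\<lambda>w. of_real (sqrt (2 * pi) ^ DIM('a)) * gauss w)"
      by (rule ext, rule ft_gauss)
    have cg: "continuous_on UNIV (ft (gauss :: 'a \<Rightarrow> complex))"
      unfolding fg by (intro continuous_intros gauss_continuous)
    have ig: "integrable lborel (ft (gauss :: 'a \<Rightarrow> complex))"
      unfolding fg using gauss_integrable[where 'a='a] by simp
    show ?thesis
    proof (rule integral_dominated_convergence[where w="\<lambda>x. C * norm (ft gauss x)"])
      have "isCont (u t) 0" using cu by (simp add: continuous_on_eq_continuous_at)
      moreover have "(\<lambda>n. \<epsilon> n *\<^sub>R x) \<longlonglongrightarrow> 0" for x :: 'a using tendsto_scaleR[OF \<epsilon>0 tendsto_const[of x]] by simp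
      ultimately have "(\<lambda>n. u t (\<epsilon> n *\<^sub>R x)) \<longlonglongrightarrow> u t 0" for x by (rule isCont_tendsto_compose)
      then show "AE x in lborel. (\<lambda>n. u t (\<epsilon> n *\<^sub>R x) * ft gauss x) \<longlonglongrightarrow> u t 0 * ft gauss x"
        by (intro AE_I2 tendsto_mult tendsto_const)
      show "AE x in lborel. norm (u t (\<epsilon> n *\<^sub>R x) * ft gauss x) \<le> C * norm (ft gauss x)" for n
        using C by (auto intro!: AE_I2 mult_right_mono simp: norm_mult)
      show "(\<lambda>x. u t (\<epsilon> n *\<^sub>R x) * ft gauss x) \<in> borel_measurable lborel" for n
        unfolding measurable_lborel2
        by (intro borel_measurable_continuous_onI continuous_intros cg continuous_on_compose2[OF cu]) auto
      show "(\<lambda>x::'a. u t 0 * ft gauss x) \<in> borel_measurable lborel"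
        unfolding measurable_lborel2
        by (intro borel_measurable_continuous_onI continuous_on_mult continuous_on_const cg)
      show "integrable lborel (\<lambda>x::'a. C * norm (ft gauss x))" using ig by simp
    qed
  qed
  have "(LINT \<eta>|lborel. ft (u t) \<eta>) = (LINT x|lborel. u t 0 * ft gauss (x::'a))"
    by (rule LIMSEQ_unique[OF L]) (unfold key, rule R)
  also have "\<dots> = of_real ((2 * pi) ^ ?d) * u t 0"
  proof -
    have "sqrt (2 * pi) ^ ?d * sqrt (2 * pi) ^ ?d = (2 * pi) ^ ?d"
      unfolding power_mult_distrib[symmetric] by simp
    then have "complex_of_real (sqrt (2 * pi) ^ ?d) * of_real (sqrt (2 * pi) ^ ?d) = of_real ((2 * pi) ^ ?d)"
      by (metis of_real_mult)
    moreover have "(LINT x|lborel. u t 0 * ft gauss (x::'a)) =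
        u t 0 * (of_real (sqrt (2 * pi) ^ ?d) * of_real (sqrt (2 * pi) ^ ?d))"
      unfolding ft_gauss integral_mult_right_zero integral_gauss ..
    ultimately show ?thesis by (metis mult.commute)
  qed
  finally show ?thesis .
qed

section \<open>Composition of operators at a point\<close>

definition mu :: "'a::real_normed_vector \<Rightarrow> real" where
  "mu t = 1 / bracket t"

lemma mu_bounds: "0 < mu t" "mu t \<le> 1" "0 \<le> mu t"
  by (auto simp: mu_def bracket_def)

text \<open>A bound in powers of \<open>1 / bracket (t + z)\<close> is split by this into decay in
  the translation \<open>t\<close>, to be kept, and growth in \<open>z\<close>, to be absorbed by a
  rapidly decreasing factor.\<close>

lemma bracket_peetre: "1 / bracket (t + z) \<le> mu t * (1 + norm z)"
proof -
  have "bracket t \<le> bracket (t + z) * (1 + norm z)"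
  proof -
    have "norm t \<le> norm (t + z) + norm z" using norm_triangle_ineq4[of "t + z" z] by simp
    moreover have "norm z \<le> bracket (t + z) * norm z"
      using mult_right_mono[of 1 "bracket (t + z)" "norm z"] by (simp add: bracket_def)
    moreover have "norm (t + z) \<le> bracket (t + z)" "1 \<le> bracket (t + z)" by (auto simp: bracket_def)
    ultimately show ?thesis by (simp add: bracket_def[of t] distrib_left) (smt (verit) mult_nonneg_nonneg norm_ge_zero)
  qed
  moreover have "0 < bracket t" "0 < bracket (t + z)" by (auto simp: bracket_def)
  ultimately show ?thesis by (simp add: mu_def field_simps)
qed

definition neg :: "nat \<Rightarrow> ('t::real_normed_vector \<Rightarrow> complex) \<Rightarrow> bool" where
  "neg N R \<longleftrightarrow> (\<exists>C. \<forall>t. norm (R t) \<le> C * mu t ^ N)"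

lemma negI: "(\<And>t. norm (R t) \<le> C * mu t ^ N) \<Longrightarrow> neg N R"
  unfolding neg_def by blast

lemma neg_zero [simp]: "neg N (\<lambda>t. 0)"
  by (rule negI[of _ 0]) simp

lemma neg_add: "neg N R \<Longrightarrow> neg N S \<Longrightarrow> neg N (\<lambda>t. R t + S t)"
proof -
  assume "neg N R" "neg N S"
  then obtain C D where C: "\<And>t. norm (R t) \<le> C * mu t ^ N" and D: "\<And>t. norm (S t) \<le> D * mu t ^ N"
    unfolding neg_def by blast
  show ?thesis
  proof (rule negI)
    show "norm (R t + S t) \<le> (C + D) * mu t ^ N" for t
      using norm_triangle_ineq[of "R t" "S t"] C[of t] D[of t] unfolding distrib_right by linarith
  qed
qed

lemma neg_mult_bounded:
  assumes "neg N R" "\<And>t. norm (S t) \<le> B"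
  shows "neg N (\<lambda>t. S t * R t)"
proof -
  obtain C where C: "\<And>t. norm (R t) \<le> C * mu t ^ N" using assms(1) unfolding neg_def by blast
  show ?thesis
  proof (rule negI)
    fix t
    have "norm (S t * R t) \<le> B * (C * mu t ^ N)"
      unfolding norm_mult by (intro mult_mono assms C) (auto intro: order_trans[OF norm_ge_zero assms(2)])
    then show "norm (S t * R t) \<le> (B * C) * mu t ^ N" by (simp add: mult.assoc)
  qed
qed

lemma neg_cmult: "neg N R \<Longrightarrow> neg N (\<lambda>t. c * R t)"
  using neg_mult_bounded[of N R "\<lambda>t. c" "norm c"] by simp

lemma neg_diff: "neg N R \<Longrightarrow> neg N S \<Longrightarrow> neg N (\<lambda>t. R t - S t)"
  using neg_add[of N R "\<lambda>t. -1 * S t"] neg_cmult[of N S "-1"] by simp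

lemma neg_sum: "(\<And>i. i \<in> I \<Longrightarrow> neg N (R i)) \<Longrightarrow> neg N (\<lambda>t. \<Sum>i\<in>I. R i t)"
  by (induction I rule: infinite_finite_induct) (auto intro: neg_add)

text \<open>\<open>ordsym k b\<close>: translates \<open>b t = q (t + \<cdot>)\<close> of a symbol \<open>q\<close> of order \<open>-k\<close> satisfy this
  by Peetre's inequality.\<close>
definition ordsym :: "nat \<Rightarrow> ('t::real_normed_vector \<Rightarrow> 'z::euclidean_space \<Rightarrow> complex) \<Rightarrow> bool" where
  "ordsym k b \<longleftrightarrow> (\<forall>t. smooth_on UNIV (b t)) \<and> (\<forall>ds. set ds \<subseteq> Basis \<longrightarrow>
     (\<exists>C\<ge>0. \<forall>t z. norm (pdiff ds (b t) z) \<le> C * (mu t * (1 + norm z)) ^ (k + length ds)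
        \<and> norm (pdiff ds (b t) z) \<le> C))"

lemma ordsym_dd:
  assumes "ordsym k b" "v \<in> Basis"
  shows "ordsym (Suc k) (\<lambda>t. dd v (b t))"
  unfolding ordsym_def
proof (intro conjI allI impI)
  show "smooth_on UNIV (dd v (b t))" for t using assms smooth_on_dd unfolding ordsym_def by blast
  fix ds :: "'b list" assume "set ds \<subseteq> Basis"
  then show "\<exists>C\<ge>0. \<forall>t z. norm (pdiff ds (dd v (b t)) z) \<le> C * (mu t * (1 + norm z)) ^ (Suc k + length ds)
      \<and> norm (pdiff ds (dd v (b t)) z) \<le> C"
    using assms(1)[unfolded ordsym_def, THEN conjunct2, rule_format, of "ds @ [v]"] assms(2)
    by (simp add: pdiff_snoc)
qed

lemma ordsym_bsym: "ordsym k b \<Longrightarrow> bsym (\<lambda>t z. 1) b"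
  unfolding ordsym_def bsym_pdiff_iff by fastforce

lemma ordsym_bound:
  assumes "ordsym k b"
  shows "\<exists>C\<ge>0. \<forall>t z. norm (b t z) \<le> C * (mu t * (1 + norm z)) ^ k \<and> norm (b t z) \<le> C"
  using assms[unfolded ordsym_def, THEN conjunct2, rule_format, of "[]"] by simp

lemma ordsym_smooth: "ordsym k b \<Longrightarrow> smooth_on UNIV (b t)"
  unfolding ordsym_def by blast

text \<open>At \<open>z = 0\<close> this is \<open>m!\<close> times the Taylor term of degree
  \<open>m\<close> in the second variable, as a sum over ordered \<open>m\<close>-tuples of
  directions. The derivatives act on \<open>b\<close> inside the recursion, so that
  \<open>ordsym_dd\<close> counts the gain in order.\<close>

primrec tay :: "nat \<Rightarrow> ('a::euclidean_space \<times> 'a \<Rightarrow> complex) \<Rightarrow> 'a \<Rightarrow> 'a \<times> 'a \<Rightarrow> complex" where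
  "tay 0 b \<eta> z = b z"
| "tay (Suc m) b \<eta> z = (\<Sum>j\<in>Basis. of_real (\<eta> \<bullet> j) * tay m (dd (0, j) b) \<eta> z)"

lemma tay_deriv:
  fixes b :: "'a::euclidean_space \<times> 'a \<Rightarrow> complex"
  assumes "smooth_on UNIV b"
  shows "((\<lambda>s. tay m b \<eta> (0, s *\<^sub>R \<eta>)) has_vector_derivative tay (Suc m) b \<eta> (0, s *\<^sub>R \<eta>)) (at s within S)"
  using assms
proof (induction m arbitrary: b)
  case 0
  have d: "b differentiable at (0, s *\<^sub>R \<eta>)" by (rule smooth_on_diff[OF 0]) simp
  have "((\<lambda>s. (0, s *\<^sub>R \<eta>)) has_derivative (\<lambda>h. (0, h *\<^sub>R \<eta>))) (at s within S)"
    by (auto intro!: derivative_eq_intros)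
  from has_derivative_compose[OF this has_derivative_dd[OF d]]
  have "((\<lambda>s. b (0, s *\<^sub>R \<eta>)) has_derivative (\<lambda>h. dd (0, h *\<^sub>R \<eta>) b (0, s *\<^sub>R \<eta>))) (at s within S)" .
  moreover have "dd (0, h *\<^sub>R \<eta>) b (0, s *\<^sub>R \<eta>) = h *\<^sub>R dd (0, \<eta>) b (0, s *\<^sub>R \<eta>)" for h
    using dd_scale_dir[OF d, of h "(0, \<eta>)"] by simp
  moreover have "dd (0, \<eta>) b (0, s *\<^sub>R \<eta>) = (\<Sum>j\<in>Basis. of_real (\<eta> \<bullet> j) * dd (0, j) b (0, s *\<^sub>R \<eta>))"
    using dd_expand[OF slice_snd(1)[OF d], of \<eta>] by (simp add: slice_snd(2)[OF d] scaleR_conv_of_real)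
  ultimately show ?case by (simp add: has_vector_derivative_def)
next
  case (Suc m)
  have "((\<lambda>s. \<Sum>j\<in>Basis. of_real (\<eta> \<bullet> j) * tay m (dd (0, j) b) \<eta> (0, s *\<^sub>R \<eta>)) has_vector_derivative
     (\<Sum>j\<in>Basis. of_real (\<eta> \<bullet> j) * tay (Suc m) (dd (0, j) b) \<eta> (0, s *\<^sub>R \<eta>))) (at s within S)"
    by (intro has_vector_derivative_sum has_vector_derivative_mult_right Suc.IH smooth_on_dd[OF Suc.prems] Basis_prodI)
  then show ?case by (subst tay.simps(2)[of "Suc m"]) (simp only: tay.simps(2)[of m b])
qed

lemma tay_bound:
  fixes b :: "'t::real_normed_vector \<Rightarrow> 'a::euclidean_space \<times> 'a \<Rightarrow> complex"
  assumes "ordsym k b"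
  shows "\<exists>C\<ge>0. \<forall>t \<eta> z. norm (tay m (b t) \<eta> z) \<le> C * norm \<eta> ^ m * (mu t * (1 + norm z)) ^ (k + m)"
  using assms
proof (induction m arbitrary: b k)
  case 0
  then show ?case using ordsym_bound[OF 0] by auto
next
  case (Suc m)
  have "\<forall>j\<in>Basis. \<exists>C\<ge>0. \<forall>t \<eta> z. norm (tay m (dd (0, j) (b t)) \<eta> z) \<le> C * norm \<eta> ^ m * (mu t * (1 + norm z)) ^ (Suc k + m)"
    using Suc.IH[OF ordsym_dd[OF Suc.prems Basis_prodI(2)]] by blast
  then obtain C where C: "\<And>j. j \<in> Basis \<Longrightarrow> C j \<ge> 0" "\<And>j t \<eta> z. j \<in> Basis \<Longrightarrow>
      norm (tay m (dd (0, j) (b t)) \<eta> z) \<le> C j * norm \<eta> ^ m * (mu t * (1 + norm z)) ^ (Suc k + m)"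
    by metis
  show ?case
  proof (intro exI conjI allI)
    show "0 \<le> (\<Sum>j\<in>Basis. C j)" using C(1) by (simp add: sum_nonneg)
    fix t \<eta> z
    have "norm (tay (Suc m) (b t) \<eta> z) \<le> (\<Sum>j\<in>Basis. norm \<eta> * (C j * norm \<eta> ^ m * (mu t * (1 + norm z)) ^ (Suc k + m)))"
      unfolding tay.simps
      by (rule order_trans[OF norm_sum], rule sum_mono)
         (simp only: norm_mult norm_of_real, intro mult_mono C Basis_le_norm; simp)
    also have "\<dots> = (\<Sum>j\<in>Basis. C j) * norm \<eta> ^ Suc m * (mu t * (1 + norm z)) ^ (k + Suc m)"
      by (simp add: sum_distrib_right sum_distrib_left mult_ac)
    finally show "norm (tay (Suc m) (b t) \<eta> z) \<le> (\<Sum>j\<in>Basis. C j) * norm \<eta> ^ Suc m * (mu t * (1 + norm z)) ^ (k + Suc m)" .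
  qed
qed

text \<open>Of the power \<open>2 * N\<close>, one half is the factor \<open>norm \<eta> ^ N\<close>
  of the Taylor term; the other half is the price of the decay \<open>mu t ^ N\<close>, since every
  derivative gains \<open>mu t * (1 + norm z)\<close>.\<close>

lemma tay_remainder:
  fixes b :: "'t::real_normed_vector \<Rightarrow> 'a::euclidean_space \<times> 'a \<Rightarrow> complex"
  assumes b: "ordsym 0 b" and N: "N > 0"
  shows "\<exists>C\<ge>0. \<forall>t \<eta>. norm (b t (0, \<eta>) - (\<Sum>m<N. of_real (1 / fact m) * tay m (b t) \<eta> 0)) \<le> C * mu t ^ N * (1 + norm \<eta>) ^ (2 * N)"
proof -
  obtain C where C: "C \<ge> 0" "\<And>t \<eta> z. norm (tay N (b t) \<eta> z) \<le> C * norm \<eta> ^ N * (mu t * (1 + norm z)) ^ (0 + N)"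
    using tay_bound[OF b] by metis
  have "norm (b t (0, \<eta>) - (\<Sum>m<N. of_real (1 / fact m) * tay m (b t) \<eta> 0)) \<le> C * mu t ^ N * (1 + norm \<eta>) ^ (2 * N)" for t \<eta>
  proof -
    let ?D = "\<lambda>m s. tay m (b t) \<eta> (0, s *\<^sub>R \<eta>)"
    let ?i = "\<lambda>s. ((1 - s) ^ (N - 1) / fact (N - 1)) *\<^sub>R ?D N s"
    have "(?i has_integral ?D 0 1 - (\<Sum>m<N. ((1 - 0) ^ m / fact m) *\<^sub>R ?D m 0)) {0..1}"
      by (rule Taylor_has_integral[OF N, of ?D "?D 0" 0 1]) (auto intro: tay_deriv[OF ordsym_smooth[OF b]] simp del: tay.simps)
    then have hi: "(?i has_integral (b t (0, \<eta>) - (\<Sum>m<N. of_real (1 / fact m) * tay m (b t) \<eta> 0))) {0..1}"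
      by (simp add: scaleR_conv_of_real zero_prod_def)
    let ?B = "C * mu t ^ N * (1 + norm \<eta>) ^ (2 * N)"
    have "norm (b t (0, \<eta>) - (\<Sum>m<N. of_real (1 / fact m) * tay m (b t) \<eta> 0)) \<le> ?B * measure lborel (cbox 0 (1::real))"
    proof (rule has_integral_bound)
      show "0 \<le> ?B" using C(1) mu_bounds[of t] by simp
      show "(?i has_integral (b t (0, \<eta>) - (\<Sum>m<N. of_real (1 / fact m) * tay m (b t) \<eta> 0))) (cbox 0 1)"
        using hi by simp
      fix s :: real assume "s \<in> cbox 0 1"
      then have s: "0 \<le> s" "s \<le> 1" by auto
      have n: "norm (0::'a, s *\<^sub>R \<eta>) \<le> norm \<eta>" using s by (simp add: norm_Pair mult_left_le_one_le)
      have "norm (?D N s) \<le> C * norm \<eta> ^ N * (mu t * (1 + norm (0::'a, s *\<^sub>R \<eta>))) ^ N"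
        using C(2)[of t \<eta> "(0, s *\<^sub>R \<eta>)"] by simp
      also have "\<dots> \<le> C * (1 + norm \<eta>) ^ N * (mu t * (1 + norm \<eta>)) ^ N"
        using C(1) mu_bounds[of t] n
        by (intro mult_mono power_mono mult_nonneg_nonneg zero_le_power) auto
      also have "\<dots> = ?B"
      proof -
        have "(1 + norm \<eta>) ^ (2 * N) = (1 + norm \<eta>) ^ N * (1 + norm \<eta>) ^ N" by (simp add: mult_2 power_add)
        then show ?thesis by (simp only: power_mult_distrib mult_ac)
      qed
      finally have D: "norm (?D N s) \<le> ?B" .
      have "(1 - s) ^ (N - 1) / fact (N - 1) \<le> 1"
        using s by (simp add: divide_le_eq power_le_one order_trans[OF power_le_one fact_ge_1])
      moreover have "0 \<le> (1 - s) ^ (N - 1) / fact (N - 1)" using s by simp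
      ultimately have "\<bar>(1 - s) ^ (N - 1) / fact (N - 1)\<bar> \<le> 1" by linarith
      then have "norm (?i s) \<le> 1 * norm (?D N s)"
        unfolding norm_scaleR by (rule mult_right_mono) simp
      then show "norm (?i s) \<le> ?B" using D by simp
    qed
    then show ?thesis by simp
  qed
  then show ?thesis using C(1) by blast
qed

text \<open>In multi-index notation this is the sum over \<open>|\<alpha>| = m\<close> of
  \<open>m! / \<alpha>!\<close> times the \<open>\<xi>\<close>-derivative of \<open>b\<close> at 0
  and \<open>(- \<i> \<partial>)^\<alpha> f\<close> at 0. Summing over ordered tuples absorbs the
  multinomial factors, and only \<open>1 / m!\<close> remains to be supplied.\<close>

primrec jetpair :: "nat \<Rightarrow> ('a::euclidean_space \<times> 'a \<Rightarrow> complex) \<Rightarrow> ('a \<Rightarrow> complex) \<Rightarrow> complex" where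
  "jetpair 0 b f = b 0 * f 0"
| "jetpair (Suc m) b f = (\<Sum>j\<in>Basis. jetpair m (dd (0, j) b) (\<lambda>y. - \<i> * dd j f y))"

lemma sch_D: "sch f \<Longrightarrow> j \<in> Basis \<Longrightarrow> sch (\<lambda>t y. - \<i> * dd j (f t) y)"
  by (rule sch_cmult[OF sch_dd])

text \<open>Each factor \<open>\<eta> \<bullet> j\<close> is absorbed by the Fourier transform as a
  derivative of \<open>f\<close>; after \<open>m\<close> of them, inversion at the origin evaluates
  the integral.\<close>

lemma tay_ft_integral:
  fixes f :: "'t \<Rightarrow> 'a::euclidean_space \<Rightarrow> complex"
  assumes "sch f"
  shows "integrable lborel (\<lambda>\<eta>. tay m b \<eta> 0 * ft (f t) \<eta>) \<and>
    (LINT \<eta>|lborel. tay m b \<eta> 0 * ft (f t) \<eta>) = of_real ((2 * pi) ^ DIM('a)) * jetpair m b (f t)"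
  using assms
proof (induction m arbitrary: b f)
  case 0
  have "integrable lborel (ft (f t))" using sch_integrable[OF sch_ft[OF 0]] .
  then show ?case using ft_inversion_0[OF 0, of t] by simp
next
  case (Suc m)
  let ?f = "\<lambda>j t y. - \<i> * dd j (f t) y"
  have e: "tay (Suc m) b \<eta> 0 * ft (f t) \<eta> = (\<Sum>j\<in>Basis. tay m (dd (0, j) b) \<eta> 0 * ft (?f j t) \<eta>)" for \<eta>
  proof -
    have "tay (Suc m) b \<eta> 0 * ft (f t) \<eta> = (\<Sum>j\<in>Basis. tay m (dd (0, j) b) \<eta> 0 * (of_real (\<eta> \<bullet> j) * ft (f t) \<eta>))"
      unfolding tay.simps sum_distrib_right by (rule sum.cong) (auto simp: mult_ac)
    also have "\<dots> = (\<Sum>j\<in>Basis. tay m (dd (0, j) b) \<eta> 0 * ft (?f j t) \<eta>)"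
      by (rule sum.cong[OF refl]) (simp only: ft_dd[OF Suc.prems])
    finally show ?thesis .
  qed
  have ih: "integrable lborel (\<lambda>\<eta>. tay m (dd (0, j) b) \<eta> 0 * ft (?f j t) \<eta>)"
    "(LINT \<eta>|lborel. tay m (dd (0, j) b) \<eta> 0 * ft (?f j t) \<eta>) = of_real ((2 * pi) ^ DIM('a)) * jetpair m (dd (0, j) b) (?f j t)"
    if "j \<in> Basis" for j
    using Suc.IH[OF sch_D[OF Suc.prems that], of "dd (0, j) b"] by blast+
  have "integrable lborel (\<lambda>\<eta>. \<Sum>j\<in>Basis. tay m (dd (0, j) b) \<eta> 0 * ft (?f j t) \<eta>)"
    by (rule Bochner_Integration.integrable_sum[OF ih(1)])
  moreover have "(LINT \<eta>|lborel. (\<Sum>j\<in>Basis. tay m (dd (0, j) b) \<eta> 0 * ft (?f j t) \<eta>)) =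
      of_real ((2 * pi) ^ DIM('a)) * jetpair (Suc m) b (f t)"
    unfolding jetpair.simps sum_distrib_left
    by (rule trans[OF Bochner_Integration.integral_sum[OF ih(1)] sum.cong[OF refl ih(2)]])
  ultimately show ?case unfolding e by (rule conjI)
qed

lemma pairing_expansion:
  fixes f :: "'a::euclidean_space \<times> 'a \<Rightarrow> 'a \<Rightarrow> complex" and b :: "'a \<times> 'a \<Rightarrow> 'a \<times> 'a \<Rightarrow> complex"
  assumes b: "ordsym 0 b" and f: "sch f" and N: "N > 0"
  shows "neg N (\<lambda>t. (LINT \<eta>|lborel. b t (0, \<eta>) * ft (f t) \<eta>) / of_real ((2 * pi) ^ DIM('a))
      - (\<Sum>m<N. of_real (1 / fact m) * jetpair m (b t) (f t)))"
proof -
  \<comment> \<open>The part \<open>2 * N\<close> absorbs the growth of the Taylor remainder, and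
    \<open>2 * DIM\<close> is left over for integrability.\<close>
  let ?k = "2 * N + 2 * DIM('a)"
  let ?c = "complex_of_real ((2 * pi) ^ DIM('a))"
  obtain C where C: "C \<ge> 0" "\<And>t \<eta>. norm (b t (0, \<eta>) - (\<Sum>m<N. of_real (1 / fact m) * tay m (b t) \<eta> 0)) \<le> C * mu t ^ N * (1 + norm \<eta>) ^ (2 * N)"
    using tay_remainder[OF b N] by (elim exE conjE) (rule that, assumption, blast)
  obtain D where D: "\<And>t \<eta>. norm (ft (f t) \<eta>) \<le> D * wt ?k \<eta>" using sch_bound[OF sch_ft[OF f]] by blast
  obtain B where B: "\<And>t z. norm (b t z) \<le> B" using ordsym_bound[OF b] by blast
  have I: "integrable lborel (\<lambda>\<eta>. b t (0, \<eta>) * ft (f t) \<eta>)" for t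
  proof (rule Bochner_Integration.integrable_bound[of _ "\<lambda>\<eta>. B * norm (ft (f t) \<eta>)"])
    show "integrable lborel (\<lambda>\<eta>. B * norm (ft (f t) \<eta>))" using sch_integrable[OF sch_ft[OF f]] by simp
    show "(\<lambda>\<eta>. b t (0, \<eta>) * ft (f t) \<eta>) \<in> borel_measurable lborel"
      unfolding measurable_lborel2
      by (intro borel_measurable_continuous_onI continuous_intros sch_continuous[OF sch_ft[OF f]]
          continuous_on_compose2[OF smooth_on_continuous[OF ordsym_smooth[OF b]]]) auto
    show "AE \<eta> in lborel. norm (b t (0, \<eta>) * ft (f t) \<eta>) \<le> norm (B * norm (ft (f t) \<eta>))"
      using B by (auto intro!: AE_I2 mult_right_mono order_trans[OF B abs_ge_self] simp: norm_mult abs_mult)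
  qed
  have T: "integrable lborel (\<lambda>\<eta>. of_real (1 / fact m) * tay m (b t) \<eta> 0 * ft (f t) \<eta>)"
    "(LINT \<eta>|lborel. of_real (1 / fact m) * tay m (b t) \<eta> 0 * ft (f t) \<eta>) = ?c * (of_real (1 / fact m) * jetpair m (b t) (f t))" for m t
    using tay_ft_integral[OF f, of m "b t" t] by (simp_all add: mult.assoc mult.left_commute)
  show ?thesis
  proof (rule negI)
    fix t
    let ?R = "\<lambda>\<eta>. (b t (0, \<eta>) - (\<Sum>m<N. of_real (1 / fact m) * tay m (b t) \<eta> 0)) * ft (f t) \<eta>"
    have e: "?R \<eta> = b t (0, \<eta>) * ft (f t) \<eta> - (\<Sum>m<N. of_real (1 / fact m) * tay m (b t) \<eta> 0 * ft (f t) \<eta>)" for \<eta>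
      by (simp add: left_diff_distrib sum_distrib_right)
    have iR: "integrable lborel ?R" unfolding e by (intro Bochner_Integration.integrable_diff Bochner_Integration.integrable_sum I T)
    have "(LINT \<eta>|lborel. ?R \<eta>) = (LINT \<eta>|lborel. b t (0, \<eta>) * ft (f t) \<eta>) - ?c * (\<Sum>m<N. of_real (1 / fact m) * jetpair m (b t) (f t))"
      unfolding e using I T(1)
      by (simp only: Bochner_Integration.integral_diff Bochner_Integration.integrable_sum Bochner_Integration.integral_sum T(2) sum_distrib_left)
    moreover have "norm (LINT \<eta>|lborel. ?R \<eta>) \<le> (LINT \<eta>|lborel. (C * mu t ^ N * D) * wt (2 * DIM('a)) (\<eta>::'a))"
    proof (rule order_trans[OF integral_norm_bound], rule integral_mono)
      show "integrable lborel (\<lambda>\<eta>. norm (?R \<eta>))" using iR by (rule integrable_norm)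
      show "integrable lborel (\<lambda>\<eta>::'a. (C * mu t ^ N * D) * wt (2 * DIM('a)) \<eta>)"
        using integrable_wt[where 'a='a, of "2 * DIM('a)"] by simp
      fix \<eta> :: 'a
      have "norm (?R \<eta>) \<le> (C * mu t ^ N * (1 + norm \<eta>) ^ (2 * N)) * (D * wt ?k \<eta>)"
        unfolding norm_mult by (intro mult_mono C D) (use C(1) mu_bounds[of t] in auto)
      also have "(1 + norm \<eta>) ^ (2 * N) * wt ?k \<eta> = wt (2 * DIM('a)) \<eta>"
        by (simp add: wt_def power_add add_nonneg_eq_0_iff)
      then have "(C * mu t ^ N * (1 + norm \<eta>) ^ (2 * N)) * (D * wt ?k \<eta>) = (C * mu t ^ N * D) * wt (2 * DIM('a)) \<eta>"
        by (metis (no_types, lifting) mult.assoc mult.left_commute)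
      finally show "norm (?R \<eta>) \<le> (C * mu t ^ N * D) * wt (2 * DIM('a)) \<eta>" .
    qed
    moreover have "?c \<noteq> 0" by simp
    then have "(X - ?c * Y) / ?c = X / ?c - Y" for X Y by (simp add: diff_divide_distrib)
    ultimately have "norm ((LINT \<eta>|lborel. b t (0, \<eta>) * ft (f t) \<eta>) / ?c - (\<Sum>m<N. of_real (1 / fact m) * jetpair m (b t) (f t)))
       \<le> (LINT \<eta>|lborel. (C * mu t ^ N * D) * wt (2 * DIM('a)) (\<eta>::'a)) / norm ?c"
      by (metis (no_types, lifting) divide_right_mono norm_divide norm_ge_zero)
    also have "\<dots> = (C * D * (LINT \<eta>|lborel. wt (2 * DIM('a)) (\<eta>::'a)) / norm ?c) * mu t ^ N"
      by simp
    finally show "norm ((LINT \<eta>|lborel. b t (0, \<eta>) * ft (f t) \<eta>) / ?c - (\<Sum>m<N. of_real (1 / fact m) * jetpair m (b t) (f t)))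
       \<le> (C * D * (LINT \<eta>|lborel. wt (2 * DIM('a)) (\<eta>::'a)) / norm ?c) * mu t ^ N" .
  qed
qed

lemma pdiff_cmult:
  fixes f :: "'a::euclidean_space \<Rightarrow> complex"
  assumes "smooth_on UNIV f" "set ds \<subseteq> Basis"
  shows "pdiff ds (\<lambda>z. c * f z) = (\<lambda>z. c * pdiff ds f z)"
  using assms(2)
proof (induction ds)
  case (Cons v ds)
  have "dd v (\<lambda>z. c * pdiff ds f z) z = c * dd v (pdiff ds f) z" for z
    by (rule dd_bounded_linear[OF bounded_linear_mult_right smooth_on_diff[OF smooth_on_pdiff[OF assms(1)]]])
      (use Cons in auto)
  then show ?case using Cons by (simp add: pdiff_Cons_dd del: pdiff.simps(2))
qed simp

lemma pdiff_add:
  assumes "smooth_on UNIV f" "smooth_on UNIV g" "set ds \<subseteq> Basis"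
  shows "pdiff ds (\<lambda>z. f z + g z) = (\<lambda>z. pdiff ds f z + pdiff ds g z)"
  using assms(3)
proof (induction ds)
  case (Cons v ds)
  have "dd v (\<lambda>z. pdiff ds f z + pdiff ds g z) z = dd v (pdiff ds f) z + dd v (pdiff ds g) z" for z
    by (rule dd_add; rule smooth_on_diff[OF smooth_on_pdiff]) (use Cons assms in auto)
  then show ?case using Cons by (simp add: pdiff_Cons_dd del: pdiff.simps(2))
qed simp

lemma smooth_on_cmult: "smooth_on UNIV f \<Longrightarrow> smooth_on UNIV (\<lambda>z. (c::complex) * f z)"
  by (rule smooth_on_bounded_linear[OF open_UNIV bounded_linear_mult_right])

text \<open>Where \<open>mu t * (1 + norm z)\<close> is at most 1, a higher power is smaller. Where
  it exceeds 1, the power bound of order \<open>k\<close> is too weak, and the plain bound by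
  \<open>C\<close> in \<open>ordsym\<close> takes over.\<close>

lemma ordsym_0:
  assumes "ordsym k b"
  shows "ordsym 0 b"
  unfolding ordsym_def
proof (intro conjI allI impI)
  show "smooth_on UNIV (b t)" for t by (rule ordsym_smooth[OF assms])
  fix ds :: "'b list" assume "set ds \<subseteq> Basis"
  then obtain C where C: "C \<ge> 0" "\<And>t z. norm (pdiff ds (b t) z) \<le> C * (mu t * (1 + norm z)) ^ (k + length ds)"
     "\<And>t z. norm (pdiff ds (b t) z) \<le> C"
    using assms unfolding ordsym_def by metis
  have "norm (pdiff ds (b t) z) \<le> C * (mu t * (1 + norm z)) ^ (0 + length ds)" for t z
  proof (cases "mu t * (1 + norm z) \<le> 1")
    case True
    have "(mu t * (1 + norm z)) ^ (k + length ds) \<le> (mu t * (1 + norm z)) ^ (0 + length ds)"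
      by (rule power_decreasing) (use True mu_bounds[of t] in auto)
    then show ?thesis using C(2)[of t z] mult_left_mono[OF _ C(1)] order_trans by blast
  next
    case False
    then have "1 \<le> (mu t * (1 + norm z)) ^ (0 + length ds)" by (intro one_le_power) simp
    then show ?thesis using C(3)[of t z] mult_left_mono[OF _ C(1), of 1] by fastforce
  qed
  then show "\<exists>C\<ge>0. \<forall>t z. norm (pdiff ds (b t) z) \<le> C * (mu t * (1 + norm z)) ^ (0 + length ds) \<and> norm (pdiff ds (b t) z) \<le> C"
    using C by blast
qed

lemma ordsym_cmult:
  assumes "ordsym k b"
  shows "ordsym k (\<lambda>t z. c * b t z)"
  unfolding ordsym_def
proof (intro conjI allI impI)
  show "smooth_on UNIV (\<lambda>z. c * b t z)" for t by (rule smooth_on_cmult[OF ordsym_smooth[OF assms]])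
  fix ds :: "'b list" assume ds: "set ds \<subseteq> Basis"
  then obtain C where C: "C \<ge> 0" "\<And>t z. norm (pdiff ds (b t) z) \<le> C * (mu t * (1 + norm z)) ^ (k + length ds)"
     "\<And>t z. norm (pdiff ds (b t) z) \<le> C"
    using assms unfolding ordsym_def by metis
  have "norm (pdiff ds (\<lambda>z. c * b t z) z) \<le> (norm c * C) * (mu t * (1 + norm z)) ^ (k + length ds)
     \<and> norm (pdiff ds (\<lambda>z. c * b t z) z) \<le> norm c * C" for t z
    using mult_left_mono[OF C(2)[of t z], of "norm c"] mult_left_mono[OF C(3)[of t z], of "norm c"]
    by (simp add: pdiff_cmult[OF ordsym_smooth[OF assms] ds] norm_mult mult.assoc)
  then show "\<exists>C\<ge>0. \<forall>t z. norm (pdiff ds (\<lambda>z. c * b t z) z) \<le> C * (mu t * (1 + norm z)) ^ (k + length ds) \<and> norm (pdiff ds (\<lambda>z. c * b t z) z) \<le> C"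
    using C(1) by (intro exI[of _ "norm c * C"]) auto
qed

section \<open>Scalar operators and their jets at the origin\<close>

definition op1 :: "('a::euclidean_space \<times> 'a \<Rightarrow> complex) \<Rightarrow> ('a \<Rightarrow> complex) \<Rightarrow> 'a \<Rightarrow> complex" where
  "op1 a u x = osc 1 (\<lambda>z. a z * ft u (snd z)) x / of_real ((2 * pi) ^ DIM('a))"

lemma amp_symbol_ft:
  fixes b :: "'t \<Rightarrow> 'a::euclidean_space \<times> 'a \<Rightarrow> complex"
  assumes "bsym (\<lambda>t z. 1) b" "sch f"
  shows "amp (\<lambda>t z. b t z * ft (f t) (snd z))"
  by (rule amp_bsym_mult[where m=0]) (use assms sch_amp[OF sch_ft[OF assms(2)]] in auto)

lemma sch_op1:
  assumes "bsym (\<lambda>t z. 1) b" "sch f"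
  shows "sch (\<lambda>t. op1 (b t) (f t))"
proof -
  have "sch (\<lambda>t y. (1 / of_real ((2 * pi) ^ DIM('b))) * osc 1 (\<lambda>z. b t z * ft (f t) (snd z)) y)"
    by (intro sch_cmult sch_osc amp_symbol_ft assms) simp
  then show ?thesis by (simp add: op1_def[abs_def])
qed

lemma ft_cmult: "ft (\<lambda>y. c * u y) \<eta> = c * ft u \<eta>"
proof -
  have "ft (\<lambda>y. c * u y) \<eta> = (LINT x|lborel. c * (cis (- (\<eta> \<bullet> x)) * u x))"
    unfolding ft_eq by (rule arg_cong[of _ _ "integral\<^sup>L lborel"]) (simp add: fun_eq_iff mult_ac)
  also have "\<dots> = c * ft u \<eta>" unfolding ft_eq by (rule integral_mult_right_zero)
  finally show ?thesis .
qed

lemma osc_add: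
  assumes "amp a" "amp b"
  shows "osc \<sigma> (\<lambda>z. a t z + b t z) y = osc \<sigma> (a t) y + osc \<sigma> (b t) y"
  unfolding osc_def distrib_left
  by (rule Bochner_Integration.integral_add) (rule osc_integrable[OF assms(1)], rule osc_integrable[OF assms(2)])

text \<open>Differentiating the phase produces \<open>\<i>\<close> times the covariable, which the
  Fourier transform turns into a derivative of \<open>f\<close>; the other term differentiates the
  symbol in \<open>x\<close>.\<close>

lemma op1_dd:
  assumes b: "bsym (\<lambda>t z. 1) b" and f: "sch f" and v: "v \<in> Basis"
  shows "dd v (op1 (b t) (f t)) y = op1 (dd (v, 0) (b t)) (f t) y + op1 (b t) (dd v (f t)) y"
proof -
  let ?A = "\<lambda>t z. b t z * ft (f t) (snd z)"
  let ?A1 = "\<lambda>t z. dd (v, 0) (b t) z * ft (f t) (snd z)" and ?A2 = "\<lambda>t z. b t z * ft (dd v (f t)) (snd z)"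
  have A: "amp ?A" by (rule amp_symbol_ft[OF b f])
  have A1: "amp ?A1" by (rule amp_symbol_ft[OF bsym_dd[OF b Basis_prodI(1)[OF v]] f])
  have A2: "amp ?A2" by (rule amp_symbol_ft[OF b sch_dd[OF f v]])
  have e: "ampd 1 v (?A t) = (\<lambda>z. ?A1 t z + ?A2 t z)"
  proof
    fix z :: "'b \<times> 'b"
    have d: "ft (f t) differentiable at (snd z)" by (rule sch_diff[OF sch_ft[OF f]])
    have ds: "(\<lambda>z::'b \<times> 'b. ft (f t) (snd z)) differentiable at z"
      by (rule amp_diff[OF sch_amp[OF sch_ft[OF f]]])
    have z0: "dd (v, 0) (\<lambda>z. ft (f t) (snd z)) z = 0"
      using dd_snd[OF d, of v 0] dd_scale_dir[OF d, of 0 0] by simp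
    have "of_real (snd z \<bullet> v) * ft (f t) (snd z) = - \<i> * ft (dd v (f t)) (snd z)"
      unfolding ft_dd[OF f v] by (rule ft_cmult)
    then have "\<i> * (of_real (snd z \<bullet> v) * ft (f t) (snd z)) = \<i> * (- \<i> * ft (dd v (f t)) (snd z))" by simp
    then have F: "\<i> * of_real (snd z \<bullet> v) * ft (f t) (snd z) = ft (dd v (f t)) (snd z)"
      by (simp add: mult.assoc[symmetric])
    have "dd (v, 0) (?A t) z = dd (v, 0) (b t) z * ft (f t) (snd z)"
      using dd_bilinear[OF bounded_bilinear_mult bsym_diff[OF b] ds, of "(v, 0)" t] z0 by simp
    then show "ampd 1 v (?A t) z = ?A1 t z + ?A2 t z"
      unfolding ampd_def using F by (simp add: algebra_simps)
  qed
  have "dd v (\<lambda>y. (1 / of_real ((2 * pi) ^ DIM('b))) * osc 1 (?A t) y) y =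
      (1 / of_real ((2 * pi) ^ DIM('b))) * dd v (osc 1 (?A t)) y"
    by (rule dd_bounded_linear[OF bounded_linear_mult_right osc_deriv(1)[OF A]])
  also have "dd v (osc 1 (?A t)) y = osc 1 (?A1 t) y + osc 1 (?A2 t) y"
    unfolding osc_deriv(2)[OF A v] e by (rule osc_add[OF A1 A2])
  finally show ?thesis by (simp add: op1_def[abs_def] add_divide_distrib)
qed

lemma jetpair_flat:
  assumes "sch (\<lambda>t::unit. f)" "\<And>es. set es \<subseteq> Basis \<Longrightarrow> pdiff es f 0 = 0"
  shows "jetpair m b f = 0"
  using assms
proof (induction m arbitrary: b f)
  case 0
  then show ?case using 0(2)[of "[]"] by simp
next
  case (Suc m)
  have "jetpair m (dd (0, j) b) (\<lambda>y. - \<i> * dd j f y) = 0" if j: "j \<in> Basis" for j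
  proof (rule Suc.IH)
    show "sch (\<lambda>t::unit. \<lambda>y. - \<i> * dd j f y)" by (rule sch_D[OF Suc.prems(1) j])
    fix es :: "'a list" assume es: "set es \<subseteq> Basis"
    have "pdiff es (\<lambda>y. - \<i> * dd j f y) = (\<lambda>y. - \<i> * pdiff es (dd j f) y)"
      by (rule pdiff_cmult[OF smooth_on_dd[OF sch_smooth[OF Suc.prems(1)] j] es])
    then show "pdiff es (\<lambda>y. - \<i> * dd j f y) 0 = 0"
      using Suc.prems(2)[of "es @ [j]"] es j by (simp add: pdiff_snoc)
  qed
  then show ?case by simp
qed

lemma sch_const_family: "sch (\<lambda>t::unit. f) \<Longrightarrow> sch (\<lambda>t. f)"
  unfolding sch_def bsym_pdiff_iff by auto

lemma op1_at_0: "op1 b f 0 = (LINT \<eta>|lborel. b (0, \<eta>) * ft f \<eta>) / of_real ((2 * pi) ^ DIM('a))"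
  for b :: "'a::euclidean_space \<times> 'a \<Rightarrow> complex"
  by (simp add: op1_def osc_def)

text \<open>By \<open>op1_dd\<close> a derivative falls either on the symbol or on \<open>f\<close>.
  In the second case \<open>dd v f\<close> vanishes at 0 together with all its derivatives and
  contributes only a negligible term. For the empty list, the same flatness leaves just the term
  \<open>m = 0\<close> of the pairing expansion.\<close>

lemma op1_flat_jets:
  fixes b :: "'a::euclidean_space \<times> 'a \<Rightarrow> 'a \<times> 'a \<Rightarrow> complex"
  assumes "ordsym 0 b" "sch (\<lambda>t::unit. f)" "\<And>es. set es \<subseteq> Basis \<Longrightarrow> es \<noteq> [] \<Longrightarrow> pdiff es f 0 = 0"
    and "set ds \<subseteq> Basis" and N: "N > 0"
  shows "neg N (\<lambda>t. pdiff ds (op1 (b t) f) 0 - f 0 * pdiff (map (\<lambda>v. (v, 0)) ds) (b t) 0)"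
  using assms(1-4)
proof (induction ds arbitrary: b f rule: rev_induct)
  case Nil
  have "(\<Sum>m<N. of_real (1 / fact m) * jetpair m (b t) f) = f 0 * b t 0" for t
  proof -
    have z: "jetpair m (b t) f = 0" if m0: "m > 0" for m
    proof -
      obtain m' where m: "m = Suc m'" using m0 gr0_implies_Suc by blast
      have "jetpair m' (dd (0, j) (b t)) (\<lambda>y. - \<i> * dd j f y) = 0" if j: "j \<in> Basis" for j
      proof (rule jetpair_flat)
        show "sch (\<lambda>t::unit. \<lambda>y. - \<i> * dd j f y)" by (rule sch_D[OF Nil(2) j])
        fix es :: "'a list" assume es: "set es \<subseteq> Basis"
        have "pdiff es (\<lambda>y. - \<i> * dd j f y) = (\<lambda>y. - \<i> * pdiff es (dd j f) y)"
          by (rule pdiff_cmult[OF smooth_on_dd[OF sch_smooth[OF Nil(2)] j] es])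
        then show "pdiff es (\<lambda>y. - \<i> * dd j f y) 0 = 0"
          using Nil(3)[of "es @ [j]"] es j by (simp add: pdiff_snoc)
      qed
      then show ?thesis by (simp add: m)
    qed
    obtain N' where N': "N = Suc N'" using N by (cases N) auto
    show ?thesis unfolding N' sum.lessThan_Suc_shift using z by (simp del: jetpair.simps(2))
  qed
  then show ?case
    using pairing_expansion[OF Nil(1) sch_const_family[OF Nil(2)] N] by (simp add: op1_at_0)
next
  case (snoc v ds)
  have v: "v \<in> Basis" and ds: "set ds \<subseteq> Basis" using snoc.prems(4) by auto
  note b = ordsym_bsym[OF snoc.prems(1)] and f = sch_const_family[OF snoc.prems(2)]
  have b': "ordsym 0 (\<lambda>t. dd (v, 0) (b t))"
    by (rule ordsym_0[OF ordsym_dd[OF snoc.prems(1) Basis_prodI(1)[OF v]]])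
  have e: "dd v (op1 (b t) f) = (\<lambda>y. op1 (dd (v, 0) (b t)) f y + op1 (b t) (dd v f) y)" for t
    by (rule ext, rule op1_dd[OF b f v])
  have "pdiff (ds @ [v]) (op1 (b t) f) 0 =
      pdiff ds (op1 (dd (v, 0) (b t)) f) 0 + pdiff ds (op1 (b t) (dd v f)) 0" for t
    unfolding pdiff_snoc e
    using pdiff_add[OF sch_smooth[OF sch_op1[OF ordsym_bsym[OF b'] f]] sch_smooth[OF sch_op1[OF b sch_dd[OF f v]]] ds, of t t]
    by simp
  moreover have "neg N (\<lambda>t. pdiff ds (op1 (dd (v, 0) (b t)) f) 0 - f 0 * pdiff (map (\<lambda>v. (v, 0)) ds) (dd (v, 0) (b t)) 0)"
    by (rule snoc.IH[OF b' snoc.prems(2,3) ds])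
  moreover have "neg N (\<lambda>t. pdiff ds (op1 (b t) (dd v f)) 0 - dd v f 0 * pdiff (map (\<lambda>v. (v, 0)) ds) (b t) 0)"
  proof (rule snoc.IH[OF snoc.prems(1) sch_dd[OF snoc.prems(2) v] _ ds])
    fix es :: "'a list" assume "set es \<subseteq> Basis"
    then show "pdiff es (dd v f) 0 = 0" using snoc.prems(3)[of "es @ [v]"] v by (simp add: pdiff_snoc)
  qed
  moreover have "dd v f 0 = 0" using snoc.prems(3)[of "[v]"] v by (simp add: dd_def)
  ultimately have "neg N (\<lambda>t. (pdiff ds (op1 (dd (v, 0) (b t)) f) 0 - f 0 * pdiff (map (\<lambda>v. (v, 0)) ds) (dd (v, 0) (b t)) 0)
      + pdiff ds (op1 (b t) (dd v f)) 0)"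
    by (intro neg_add) simp_all
  then show ?case
    unfolding \<open>\<And>t. pdiff (ds @ [v]) (op1 (b t) f) 0 = _\<close> by (simp add: pdiff_snoc algebra_simps)
qed

text \<open>\<open>m!\<close> times the \<open>m\<close>-th term of the Leibniz product.\<close>
primrec stc :: "nat \<Rightarrow> ('a::euclidean_space \<times> 'a \<Rightarrow> complex) \<Rightarrow> ('a \<times> 'a \<Rightarrow> complex) \<Rightarrow> 'a \<times> 'a \<Rightarrow> complex" where
  "stc 0 a b z = a z * b z"
| "stc (Suc m) a b z = (\<Sum>j\<in>Basis. stc m (dd (0, j) a) (\<lambda>z. - \<i> * dd (j, 0) b z) z)"

text \<open>\<open>jetpair\<close> and \<open>stc\<close> follow the same recursion, and
  \<open>jetpair\<close> sees \<open>g\<close> only through its jet at 0. Replacing that jet by the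
  \<open>x\<close>-jet of \<open>b\<close> makes negligible errors, which are multiplied by bounded
  derivatives of \<open>a\<close>.\<close>

lemma jetpair_stc:
  fixes a b :: "'a::euclidean_space \<times> 'a \<Rightarrow> 'a \<times> 'a \<Rightarrow> complex"
  assumes "ordsym 0 a" "ordsym 0 b" "sch g"
    and "\<And>ds. set ds \<subseteq> Basis \<Longrightarrow> neg N (\<lambda>t. pdiff ds (g t) 0 - pdiff (map (\<lambda>v. (v, 0)) ds) (b t) 0)"
  shows "neg N (\<lambda>t. jetpair m (a t) (g t) - stc m (a t) (b t) 0)"
  using assms
proof (induction m arbitrary: a b g)
  case 0
  obtain C where C: "\<And>t z. norm (a t z) \<le> C" using ordsym_bound[OF 0(1)] by blast
  have "neg N (\<lambda>t. a t 0 * (g t 0 - b t 0))"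
    by (rule neg_mult_bounded[OF _ C]) (use 0(4)[of "[]"] in simp)
  then show ?case by (simp add: algebra_simps)
next
  case (Suc m)
  have "neg N (\<lambda>t. jetpair m (dd (0, j) (a t)) (\<lambda>y. - \<i> * dd j (g t) y) - stc m (dd (0, j) (a t)) (\<lambda>z. - \<i> * dd (j, 0) (b t) z) 0)"
    if j: "j \<in> Basis" for j
  proof (rule Suc.IH)
    show "ordsym 0 (\<lambda>t. dd (0, j) (a t))"
      by (rule ordsym_0[OF ordsym_dd[OF Suc.prems(1) Basis_prodI(2)[OF j]]])
    show "ordsym 0 (\<lambda>t z. - \<i> * dd (j, 0) (b t) z)"
      by (rule ordsym_cmult[OF ordsym_0[OF ordsym_dd[OF Suc.prems(2) Basis_prodI(1)[OF j]]]])
    show "sch (\<lambda>t y. - \<i> * dd j (g t) y)" by (rule sch_D[OF Suc.prems(3) j])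
    fix ds :: "'a list" assume ds: "set ds \<subseteq> Basis"
    then have ds': "set (map (\<lambda>v. (v, 0::'a)) ds) \<subseteq> Basis" using Basis_prodI(1) by auto
    have 1: "pdiff ds (\<lambda>y. - \<i> * dd j (g t) y) 0 = - \<i> * pdiff (ds @ [j]) (g t) 0" for t
      unfolding pdiff_cmult[OF smooth_on_dd[OF sch_smooth[OF Suc.prems(3)] j] ds] pdiff_snoc ..
    have 2: "pdiff (map (\<lambda>v. (v, 0)) ds) (\<lambda>z. - \<i> * dd (j, 0) (b t) z) 0 =
        - \<i> * pdiff (map (\<lambda>v. (v, 0)) (ds @ [j])) (b t) 0" for t
      unfolding pdiff_cmult[OF smooth_on_dd[OF ordsym_smooth[OF Suc.prems(2)] Basis_prodI(1)[OF j]] ds']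
        map_append list.map pdiff_snoc ..
    have "neg N (\<lambda>t. - \<i> * (pdiff (ds @ [j]) (g t) 0 - pdiff (map (\<lambda>v. (v, 0)) (ds @ [j])) (b t) 0))"
      by (rule neg_cmult[OF Suc.prems(4)]) (use ds j in auto)
    then show "neg N (\<lambda>t. pdiff ds (\<lambda>y. - \<i> * dd j (g t) y) 0 - pdiff (map (\<lambda>v. (v, 0)) ds) (\<lambda>z. - \<i> * dd (j, 0) (b t) z) 0)"
      unfolding 1 2 right_diff_distrib .
  qed
  from neg_sum[OF this] show ?case by (simp add: sum_subtractf)
qed

text \<open>The function \<open>op1 b f\<close> is again rapidly decreasing uniformly in
  \<open>t\<close>, so the pairing expansion applies to it; its jet at 0 is that of \<open>b\<close>
  because \<open>f\<close> has the jet of the constant 1. Thus the test function leaves no trace,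
  and the Leibniz expansion of the two symbols at the origin remains.\<close>

lemma op1_composition_expansion:
  fixes a b :: "'a::euclidean_space \<times> 'a \<Rightarrow> 'a \<times> 'a \<Rightarrow> complex"
  assumes a: "ordsym 0 a" and b: "ordsym 0 b" and f: "sch (\<lambda>t::unit. f)"
    and flat: "f 0 = 1" "\<And>es. set es \<subseteq> Basis \<Longrightarrow> es \<noteq> [] \<Longrightarrow> pdiff es f 0 = 0" and N: "N > 0"
  shows "neg N (\<lambda>t. op1 (a t) (op1 (b t) f) 0 - (\<Sum>m<N. of_real (1 / fact m) * stc m (a t) (b t) 0))"
proof -
  have g: "sch (\<lambda>t. op1 (b t) f)" by (rule sch_op1[OF ordsym_bsym[OF b] sch_const_family[OF f]])
  have "neg N (\<lambda>t. jetpair m (a t) (op1 (b t) f) - stc m (a t) (b t) 0)" for m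
    by (rule jetpair_stc[OF a b g]) (use op1_flat_jets[OF b f flat(2) _ N] flat(1) in simp)
  then have "neg N (\<lambda>t. \<Sum>m<N. of_real (1 / fact m) * (jetpair m (a t) (op1 (b t) f) - stc m (a t) (b t) 0))"
    by (intro neg_sum neg_cmult)
  from neg_add[OF pairing_expansion[OF a g N] this]
  show ?thesis by (simp add: op1_at_0 right_diff_distrib sum_subtractf)
qed

section \<open>Cutoff functions\<close>

text \<open>The polynomial parameter makes the family closed under differentiation, so that
  smoothness at 0 follows from first order differentiability of all members.\<close>

definition flat_exp :: "real poly \<Rightarrow> real \<Rightarrow> real" where
  "flat_exp p x = (if x > 0 then poly p (1 / x) * exp (- 1 / x) else 0)"

lemma poly_times_exp_tendsto: "((\<lambda>u. poly p u * exp (- u)) \<longlongrightarrow> (0::real)) at_top"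
proof -
  have "((\<lambda>u. \<Sum>i\<le>degree p. coeff p i * (u ^ i / exp u)) \<longlongrightarrow> (\<Sum>i\<le>degree p. coeff p i * 0)) at_top"
    by (intro tendsto_sum tendsto_mult tendsto_const tendsto_power_div_exp_0)
  then show ?thesis
    by (simp add: poly_altdef exp_minus field_simps sum_divide_distrib)
qed

text \<open>With \<open>u = 1 / x\<close>, differentiating \<open>p(u) exp(-u)\<close> gives
  \<open>(p(u) - p'(u)) u^2 exp(-u)\<close>; the factor \<open>u^2\<close> is the polynomial
  \<open>[:0, 0, 1:]\<close>. At 0 the difference quotient tends to 0 because the exponential beats
  every polynomial.\<close>

lemma flat_exp_deriv:
  "(flat_exp p has_real_derivative flat_exp ((p - pderiv p) * [:0, 0, 1:]) x) (at x)"
proof -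
  consider "x < 0" | "x = 0" | "x > 0" by linarith
  then show ?thesis
  proof cases
    case 1
    have "((\<lambda>x. 0::real) has_real_derivative 0) (at x)" by simp
    moreover have "eventually (\<lambda>y. y < 0) (nhds x)" using 1 by (intro eventually_nhds_in_open[of "{..<0}", simplified]) auto
    then have "eventually (\<lambda>y. flat_exp p y = 0) (nhds x)" by eventually_elim (simp add: flat_exp_def)
    ultimately have "(flat_exp p has_real_derivative 0) (at x)"
      by (subst DERIV_cong_ev[OF refl _ refl]) auto
    then show ?thesis using 1 by (simp add: flat_exp_def)
  next
    case 3
    have "((\<lambda>x. poly p (1 / x) * exp (- 1 / x)) has_real_derivative
        poly (pderiv p) (1 / x) * (- 1 / x\<^sup>2) * exp (- 1 / x) + poly p (1 / x) * (exp (- 1 / x) * (1 / x\<^sup>2))) (at x)"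
      using 3 by (auto intro!: derivative_eq_intros DERIV_chain2[OF poly_DERIV] simp: power2_eq_square field_simps)
    moreover have "eventually (\<lambda>y. y > 0) (nhds x)" using 3 by (intro eventually_nhds_in_open[of "{0<..}", simplified]) auto
    then have "eventually (\<lambda>y. flat_exp p y = poly p (1 / y) * exp (- 1 / y)) (nhds x)"
      by eventually_elim (simp add: flat_exp_def)
    ultimately have "(flat_exp p has_real_derivative
        poly (pderiv p) (1 / x) * (- 1 / x\<^sup>2) * exp (- 1 / x) + poly p (1 / x) * (exp (- 1 / x) * (1 / x\<^sup>2))) (at x)"
      by (subst DERIV_cong_ev[OF refl _ refl]) auto
    moreover have "poly (pderiv p) (1 / x) * (- 1 / x\<^sup>2) * exp (- 1 / x) + poly p (1 / x) * (exp (- 1 / x) * (1 / x\<^sup>2)) =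
        flat_exp ((p - pderiv p) * [:0, 0, 1:]) x"
      using 3 by (simp add: flat_exp_def power2_eq_square field_simps)
    ultimately show ?thesis by simp
  next
    case 2
    have "((\<lambda>h. flat_exp p h / h) \<longlongrightarrow> 0) (at 0)"
    proof (subst filterlim_at_split, intro conjI)
      show "((\<lambda>h. flat_exp p h / h) \<longlongrightarrow> 0) (at_left 0)"
      proof (rule Lim_transform_eventually[OF tendsto_const])
        show "\<forall>\<^sub>F h in at_left 0. 0 = flat_exp p h / h"
          by (auto simp: eventually_at_filter flat_exp_def)
      qed
      have "((\<lambda>h. poly ([:0, 1:] * p) (inverse h) * exp (- (inverse h))) \<longlongrightarrow> 0) (at_right (0::real))"
        by (rule filterlim_compose[OF poly_times_exp_tendsto filterlim_inverse_at_top_right])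
      then show "((\<lambda>h. flat_exp p h / h) \<longlongrightarrow> 0) (at_right 0)"
      proof (rule Lim_transform_eventually)
        show "\<forall>\<^sub>F h in at_right 0. poly ([:0, 1:] * p) (inverse h) * exp (- (inverse h)) = flat_exp p h / h"
          by (auto simp: eventually_at_filter flat_exp_def field_simps)
      qed
    qed
    then have "(flat_exp p has_real_derivative 0) (at 0)" by (simp add: DERIV_def flat_exp_def)
    then show ?thesis using 2 by (simp add: flat_exp_def)
  qed
qed

lemma dd_real: "(f has_real_derivative d) (at x) \<Longrightarrow> dd v f x = d * v"
  unfolding has_field_derivative_def by (drule dd_eqI)

lemma flat_exp_smooth: "smooth_on UNIV (flat_exp p)"
proof -
  have "csm k UNIV (flat_exp p)" for k
  proof (induction k arbitrary: p)
    have d: "flat_exp p differentiable at x" for p x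
      using flat_exp_deriv[of p x] by (meson differentiable_def has_field_derivative_imp_has_derivative)
    { case 0 show ?case using d by simp }
    { case (Suc k)
      have "dd 1 (flat_exp p) = flat_exp ((p - pderiv p) * [:0, 0, 1:])"
        by (rule ext) (simp add: dd_real[OF flat_exp_deriv])
      then show ?case using d Suc[of "(p - pderiv p) * [:0, 0, 1:]"] by simp }
  qed
  then show ?thesis by (simp add: smooth_on_csm)
qed

definition step :: "real \<Rightarrow> real" where
  "step x = flat_exp 1 (x - 1) / (flat_exp 1 (x - 1) + flat_exp 1 (2 - x))"

lemma flat_exp_pos: "x > 0 \<Longrightarrow> flat_exp 1 x > 0" and flat_exp_nonneg: "flat_exp 1 x \<ge> 0"
  and flat_exp_0: "x \<le> 0 \<Longrightarrow> flat_exp p x = 0"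
  by (auto simp: flat_exp_def)

lemma step_denom: "flat_exp 1 (x - 1) + flat_exp 1 (2 - x) > 0"
proof (cases "x > 1")
  case True
  then show ?thesis using flat_exp_pos[of "x - 1"] flat_exp_nonneg[of "2 - x"] by simp
next
  case False
  then show ?thesis using flat_exp_pos[of "2 - x"] flat_exp_nonneg[of "x - 1"] by simp
qed

lemma step_eq_0: "x \<le> 1 \<Longrightarrow> step x = 0"
  by (simp add: step_def flat_exp_0)

lemma step_eq_1: "x \<ge> 2 \<Longrightarrow> step x = 1"
  using step_denom[of x] by (simp add: step_def flat_exp_0)

lemma csm_inverse: "csm k {0<..} (\<lambda>x. c / x ^ n :: real)"
proof (induction k arbitrary: c n)
  have D: "((\<lambda>x. c / x ^ n) has_real_derivative (- real n * c) / x ^ Suc n) (at x)" if "x > 0" for c n and x :: real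
  proof (cases n)
    case (Suc m)
    show ?thesis unfolding Suc using that
      by (auto intro!: derivative_eq_intros simp: field_simps power2_eq_square) (cases m; simp)+
  qed auto
  then have d: "(\<lambda>x. c / x ^ n) differentiable at x" if "x > 0" for c n and x :: real
    using that by (meson differentiable_def has_field_derivative_imp_has_derivative)
  { case 0 show ?case using d by simp }
  { case (Suc k)
    have "csm k {0<..} (dd 1 (\<lambda>x. c / x ^ n))"
    proof (rule csm_cong)
      show "\<forall>y\<in>{0<..}. (- real n * c) / y ^ Suc n = dd 1 (\<lambda>x. c / x ^ n) y"
        using dd_real[OF D] by simp
      show "csm k {0<..} (\<lambda>y. (- real n * c) / y ^ Suc n)" by (rule Suc)
    qed simp
    then show ?case using d by simp }
qed

lemma smooth_affine: "smooth_on UNIV (\<lambda>x::real. c + d * x)"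
  by (rule smooth_on_add) (auto intro: smooth_on_linear bounded_linear_mult_right)

lemma step_smooth: "smooth_on UNIV step"
proof -
  have 1: "smooth_on UNIV (\<lambda>x. flat_exp 1 (x - 1))"
    using smooth_on_compose[OF open_UNIV flat_exp_smooth smooth_affine, of "-1" 1] by simp
  have 2: "smooth_on UNIV (\<lambda>x. flat_exp 1 (2 - x))"
    using smooth_on_compose[OF open_UNIV flat_exp_smooth smooth_affine, of 2 "-1"] by simp
  have "smooth_on {0<..} (\<lambda>x::real. 1 / x)" using csm_inverse[of _ 1 1] by (simp add: smooth_on_csm)
  then have 3: "smooth_on UNIV (\<lambda>x. 1 / (flat_exp 1 (x - 1) + flat_exp 1 (2 - x)))"
    using smooth_on_compose[OF open_UNIV _ smooth_on_add[OF open_UNIV 1 2], of "{0<..}" "\<lambda>x. 1 / x"] step_denom by auto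
  show ?thesis using smooth_on_bilinear[OF open_UNIV bounded_bilinear_mult 1 3] by (simp add: step_def[abs_def])
qed

lemma smooth_norm_sq: "smooth_on UNIV (\<lambda>z::'a::euclidean_space. (norm z)\<^sup>2)"
proof -
  have "smooth_on UNIV (\<lambda>z::'a. z \<bullet> z)"
    by (rule smooth_on_bilinear[OF open_UNIV bounded_bilinear_inner]) (auto intro: smooth_on_linear bounded_linear_ident)
  then show ?thesis by (simp add: power2_norm_eq_inner)
qed

definition cutoff :: "'a::euclidean_space \<Rightarrow> real" where
  "cutoff z = step ((norm z)\<^sup>2)"

lemma cutoff_smooth: "smooth_on UNIV (cutoff :: 'a::euclidean_space \<Rightarrow> real)"
  using smooth_on_compose[OF open_UNIV step_smooth smooth_norm_sq] by (simp add: cutoff_def[abs_def])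

lemma cutoff_0: "norm z \<le> 1 \<Longrightarrow> cutoff z = 0"
  unfolding cutoff_def by (rule step_eq_0) (simp add: power_le_one)

lemma cutoff_1: "norm z \<ge> 2 \<Longrightarrow> cutoff z = 1"
proof -
  assume "norm z \<ge> 2"
  then have "2 * 2 \<le> norm z * norm z" by (intro mult_mono) auto
  then show ?thesis unfolding cutoff_def by (intro step_eq_1) (simp add: power2_eq_square)
qed

lemma excision_cutoff: "excision cutoff"
  unfolding excision_def using cutoff_smooth cutoff_0 cutoff_1 by (metis less_imp_le zero_less_one)

definition bump :: "'a::euclidean_space \<Rightarrow> complex" where
  "bump z = of_real (1 - cutoff z)"

lemma bump_smooth: "smooth_on UNIV (bump :: 'a::euclidean_space \<Rightarrow> complex)"
proof -
  have "smooth_on UNIV (\<lambda>z::'a. 1 + (- 1) * cutoff z)"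
    by (intro smooth_on_add[OF open_UNIV smooth_on_const] smooth_on_bounded_linear[OF open_UNIV bounded_linear_mult_right cutoff_smooth])
  from smooth_on_bounded_linear[OF open_UNIV bounded_linear_of_real this] show ?thesis
    by (simp add: bump_def[abs_def])
qed

text \<open>On the unit ball the function is identically 1, so it has exactly the jet at 0 that
  \<open>op1_composition_expansion\<close> asks of a test function.\<close>

lemma bump_jets:
  assumes "es \<noteq> []"
  shows "pdiff es bump (0::'a::euclidean_space) = 0"
proof -
  obtain ds v where es: "es = ds @ [v]" using assms by (metis rev_exhaust)
  have "pdiff es bump (0::'a) = pdiff es (\<lambda>z. 1) 0"
    by (rule pdiff_cong_open[of "ball 0 1"]) (auto simp: bump_def cutoff_0)
  also have "\<dots> = 0" by (simp add: es pdiff_snoc)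
  finally show ?thesis .
qed

lemma bump_at_0: "bump 0 = 1"
  by (simp add: bump_def cutoff_0)

lemma sch_bump: "sch (\<lambda>t::unit. bump :: 'a::euclidean_space \<Rightarrow> complex)"
  unfolding sch_def bsym_pdiff_iff
proof (intro allI conjI impI)
  show "smooth_on UNIV (bump :: 'a \<Rightarrow> complex)" by (rule bump_smooth)
  fix k and ds :: "'a list" assume ds: "set ds \<subseteq> Basis"
  have "continuous_on (cball 0 2) (\<lambda>y::'a. norm (pdiff ds bump y) * (1 + norm y) ^ k)"
    by (intro continuous_intros continuous_on_subset[OF smooth_on_continuous[OF smooth_on_pdiff[OF bump_smooth ds]]]) auto
  then have "bounded ((\<lambda>y::'a. norm (pdiff ds bump y) * (1 + norm y) ^ k) ` cball 0 2)"
    by (intro compact_imp_bounded compact_continuous_image) auto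
  then obtain C where "\<forall>y\<in>cball 0 2. norm (norm (pdiff ds bump y) * (1 + norm (y::'a)) ^ k) \<le> C"
    unfolding bounded_iff by blast
  then have C: "norm (pdiff ds bump y) * (1 + norm y) ^ k \<le> C" if "norm y \<le> 2" for y :: 'a
    using that by (auto simp: abs_mult)
  have C0: "0 \<le> C" using order_trans[OF _ C[of 0]] by simp
  have "norm (pdiff ds bump y) \<le> C * wt k y" for y :: 'a
  proof (cases "norm y \<le> 2")
    case True
    then show ?thesis unfolding le_wt_iff by (rule C)
  next
    case False
    have "pdiff ds bump y = pdiff ds (\<lambda>z. 0) y"
      by (rule pdiff_cong_open[of "- cball 0 2"]) (use False in \<open>auto simp: bump_def cutoff_1\<close>)
    then show ?thesis using C0 by simp
  qed
  then show "\<exists>C. \<forall>(t::unit) y. norm (pdiff ds (bump :: 'a \<Rightarrow> complex) y) \<le> C * wt k y" by blast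
qed

lemma compact_support_sch:
  fixes h :: "'a::euclidean_space \<Rightarrow> complex"
  assumes h: "smooth_on UNIV h" and supp: "\<And>z. norm z > R \<Longrightarrow> h z = 0"
  shows "sch (\<lambda>t::unit. h)"
  unfolding sch_def bsym_pdiff_iff
proof (intro allI conjI impI)
  show "smooth_on UNIV h" by (rule h)
  fix k and ds :: "'a list" assume ds: "set ds \<subseteq> Basis"
  have "continuous_on (cball 0 R) (\<lambda>y. norm (pdiff ds h y) * (1 + norm y) ^ k)"
    by (intro continuous_intros continuous_on_subset[OF smooth_on_continuous[OF smooth_on_pdiff[OF h ds]]]) auto
  then have "bounded ((\<lambda>y. norm (pdiff ds h y) * (1 + norm y) ^ k) ` cball 0 R)"
    by (intro compact_imp_bounded compact_continuous_image) auto
  then obtain C where "\<forall>y\<in>cball 0 R. norm (norm (pdiff ds h y) * (1 + norm y) ^ k) \<le> C"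
    unfolding bounded_iff by blast
  then have C: "norm (pdiff ds h y) * (1 + norm y) ^ k \<le> C" if "norm y \<le> R" for y
    using that by (auto simp: abs_mult)
  have "norm (pdiff ds h y) \<le> max C 0 * wt k y" for y
  proof (cases "norm y \<le> R")
    case True
    then show ?thesis unfolding le_wt_iff using C by fastforce
  next
    case False
    have "pdiff ds h y = pdiff ds (\<lambda>z. 0) y"
      by (rule pdiff_cong_open[of "- cball 0 R"]) (use False supp in auto)
    then show ?thesis by simp
  qed
  then show "\<exists>C. \<forall>(t::unit) y. norm (pdiff ds h y) \<le> C * wt k y" by blast
qed

lemma compact_support_integral_dd:
  fixes h :: "'a::euclidean_space \<Rightarrow> complex"
  assumes h: "smooth_on UNIV h" and supp: "\<And>z. norm z > R \<Longrightarrow> h z = 0" and v: "v \<in> Basis"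
  shows "(LINT z|lborel. dd v h z) = 0"
proof -
  let ?k = "2 * DIM('a)"
  have s: "sch (\<lambda>t::unit. h)" by (rule compact_support_sch[OF h supp])
  obtain C0 where C0: "\<And>z. norm (h z) \<le> C0 * wt ?k z" using sch_bound[OF s] by blast
  obtain C1 where C1: "\<And>z. norm (dd v h z) \<le> C1 * wt ?k z" using sch_bound[OF sch_dd[OF s v]] by blast
  obtain C2 where C2: "\<And>z. norm (dd v (dd v h) z) \<le> C2 * wt ?k z" using sch_bound[OF sch_dd[OF sch_dd[OF s v] v]] by blast
  have le: "C0 * wt ?k z \<le> (\<bar>C0\<bar> + \<bar>C1\<bar> + \<bar>C2\<bar>) * wt ?k z" "C1 * wt ?k z \<le> (\<bar>C0\<bar> + \<bar>C1\<bar> + \<bar>C2\<bar>) * wt ?k z"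
    "C2 * wt ?k z \<le> (\<bar>C0\<bar> + \<bar>C1\<bar> + \<bar>C2\<bar>) * wt ?k z" for z :: 'a
    by (intro mult_right_mono; simp)+
  have "csm 2 UNIV h" using h by (simp add: smooth_on_csm)
  then show ?thesis
    by (rule integral_dd_eq_0[OF _ v, where k="?k" and C="\<bar>C0\<bar> + \<bar>C1\<bar> + \<bar>C2\<bar>"])
      (use order_trans[OF C0 le(1)] order_trans[OF C1 le(2)] order_trans[OF C2 le(3)] in auto)
qed

lemma smooth_on_Un: "smooth_on S f \<Longrightarrow> smooth_on T f \<Longrightarrow> smooth_on (S \<union> T) f"
  unfolding smooth_on_def by blast

section \<open>Radial weights and the sphere integral\<close>

text \<open>Radial weights supported in the annulus \<open>1 \<le> |z| \<le> 2\<close>; they are functions of \<open>|z|\<^sup>2\<close>.\<close>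
definition radw :: "(real \<Rightarrow> real) \<Rightarrow> bool" where
  "radw \<omega> \<longleftrightarrow> smooth_on UNIV \<omega> \<and> (\<forall>x. x \<le> 1 \<or> x \<ge> 4 \<longrightarrow> \<omega> x = 0)"

lemma norm_sq_small: "norm z < 1 \<Longrightarrow> (norm z)\<^sup>2 \<le> 1"
  by (rule power_le_one) simp_all

lemma norm_sq_large: "norm z > 2 \<Longrightarrow> (norm z)\<^sup>2 \<ge> 4"
  using power_mono[of 2 "norm z" 2] by simp

lemma radw_near_0: "radw \<omega> \<Longrightarrow> norm z < 1 \<Longrightarrow> \<omega> ((norm z)\<^sup>2) = 0"
  using norm_sq_small[of z] by (simp add: radw_def)

lemma weighted_smooth:
  fixes f :: "'a::euclidean_space \<Rightarrow> complex"
  assumes w: "radw \<omega>" and f: "smooth_on (UNIV - {0}) f"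
  shows "smooth_on UNIV (\<lambda>z. of_real (\<omega> ((norm z)\<^sup>2)) * f z)"
proof -
  have o: "open (UNIV - {0::'a})" by (simp add: open_delete)
  have "smooth_on UNIV (\<lambda>z::'a. \<omega> ((norm z)\<^sup>2))"
    using smooth_on_compose[OF open_UNIV _ smooth_norm_sq, of UNIV \<omega>] w by (simp add: radw_def)
  from smooth_on_bounded_linear[OF open_UNIV bounded_linear_of_real this]
  have "smooth_on (UNIV - {0}) (\<lambda>z::'a. complex_of_real (\<omega> ((norm z)\<^sup>2)))"
    by (rule smooth_on_subset) simp
  then have 1: "smooth_on (UNIV - {0}) (\<lambda>z. of_real (\<omega> ((norm z)\<^sup>2)) * f z)"
    by (rule smooth_on_bilinear[OF o bounded_bilinear_mult _ f])
  have 2: "smooth_on (ball 0 1) (\<lambda>z. of_real (\<omega> ((norm z)\<^sup>2)) * f z)"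
    by (rule smooth_on_cong[OF open_ball _ smooth_on_const[of _ 0]])
      (use radw_near_0[OF w, of "_::'a"] in auto)
  have "(UNIV - {0::'a}) \<union> ball 0 1 = UNIV" by auto
  then show ?thesis using smooth_on_Un[OF 1 2] by simp
qed

lemma weighted_support: "radw \<omega> \<Longrightarrow> norm z > 2 \<Longrightarrow> of_real (\<omega> ((norm z)\<^sup>2)) * f z = (0::complex)"
  using norm_sq_large[of z] by (simp add: radw_def)

lemma weighted_sch:
  fixes f :: "'a::euclidean_space \<Rightarrow> complex"
  assumes "radw \<omega>" "smooth_on (UNIV - {0}) f"
  shows "sch (\<lambda>t::unit. \<lambda>z. of_real (\<omega> ((norm z)\<^sup>2)) * f z)"
  by (rule compact_support_sch[OF weighted_smooth[OF assms], of 2]) (rule weighted_support[OF assms(1)])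

lemma weighted_integral_dd:
  fixes f :: "'a::euclidean_space \<Rightarrow> complex"
  assumes "radw \<omega>" "smooth_on (UNIV - {0}) f" "v \<in> Basis"
  shows "(LINT z|lborel. dd v (\<lambda>z. of_real (\<omega> ((norm z)\<^sup>2)) * f z) z) = 0"
  by (rule compact_support_integral_dd[OF weighted_smooth[OF assms(1,2)] _ assms(3), of 2])
    (rule weighted_support[OF assms(1)])

lemma weighted_integrable:
  fixes f :: "'a::euclidean_space \<Rightarrow> complex"
  assumes "radw \<omega>" "smooth_on (UNIV - {0}) f"
  shows "integrable lborel (\<lambda>z. of_real (\<omega> ((norm z)\<^sup>2)) * f z)"
  by (rule sch_integrable[OF weighted_sch[OF assms]])

lemma radw_deriv:
  assumes "radw \<omega>"
  shows "radw (dd 1 \<omega>)" and "(\<omega> has_real_derivative dd 1 \<omega> x) (at x)"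
proof -
  have s: "smooth_on UNIV \<omega>" using assms by (simp add: radw_def)
  have d: "\<omega> differentiable at x" for x by (rule smooth_on_diff[OF s]) simp
  show "(\<omega> has_real_derivative dd 1 \<omega> x) (at x)" for x
  proof -
    have "dd h \<omega> x = dd 1 \<omega> x * h" for h using dd_scale_dir[OF d, of h 1 x] by (simp add: mult.commute)
    then have "(\<lambda>h. dd h \<omega> x) = (*) (dd 1 \<omega> x)" by (intro ext)
    then show ?thesis unfolding has_field_derivative_def using has_derivative_dd[OF d, of x] by metis
  qed
  have s1: "smooth_on UNIV (dd 1 \<omega>)" by (rule smooth_on_dd[OF s]) simp
  \<comment> \<open>Constancy gives a vanishing derivative only strictly outside the interval from 1
    to 4. At the endpoints themselves it follows from continuity, through the closures of the two
    rays.\<close>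
  have clos: "closed {x. dd 1 \<omega> x = 0}"
    by (rule closed_Collect_eq[OF smooth_on_continuous[OF s1] continuous_on_const])
  have z: "dd 1 \<omega> x = 0" if "x < 1 \<or> x > 4" for x
  proof -
    have "dd 1 \<omega> x = dd 1 (\<lambda>x. 0) x"
      by (rule dd_cong_open[of "{..<1} \<union> {4<..}"]) (use that assms in \<open>auto simp: radw_def\<close>)
    then show ?thesis by simp
  qed
  have "closure {..<1} \<subseteq> {x. dd 1 \<omega> x = 0}" "closure {4<..} \<subseteq> {x. dd 1 \<omega> x = 0}"
    by (rule closure_minimal[OF _ clos]; use z in auto)+
  then have "{..1} \<subseteq> {x. dd 1 \<omega> x = 0}" "{4..} \<subseteq> {x. dd 1 \<omega> x = 0}" by simp_all
  then have "\<forall>x. x \<le> 1 \<or> x \<ge> 4 \<longrightarrow> dd 1 \<omega> x = 0" by blast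
  then show "radw (dd 1 \<omega>)" using s1 by (simp add: radw_def)
qed

lemma dd_weight:
  fixes f :: "'a::euclidean_space \<Rightarrow> complex"
  assumes w: "radw \<omega>" and f: "f differentiable at z"
  shows "dd v (\<lambda>z. of_real (\<omega> ((norm z)\<^sup>2)) * f z) z =
    of_real (dd 1 \<omega> ((norm z)\<^sup>2)) * (of_real (2 * (z \<bullet> v)) * f z) + of_real (\<omega> ((norm z)\<^sup>2)) * dd v f z"
proof -
  have D: "((\<lambda>z::'a. of_real (\<omega> (z \<bullet> z)) :: complex) has_derivative (\<lambda>h. of_real (dd 1 \<omega> (z \<bullet> z) * (2 * (z \<bullet> h))))) (at z)"
  proof (rule bounded_linear.has_derivative[OF bounded_linear_of_real])
    have "((\<lambda>z::'a. z \<bullet> z) has_derivative (\<lambda>h. 2 * (z \<bullet> h))) (at z)"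
      by (auto intro!: derivative_eq_intros simp: inner_commute)
    from has_derivative_compose[OF this radw_deriv(2)[OF w, of "z \<bullet> z", unfolded has_field_derivative_def]]
    show "((\<lambda>z. \<omega> (z \<bullet> z)) has_derivative (\<lambda>h. dd 1 \<omega> (z \<bullet> z) * (2 * (z \<bullet> h)))) (at z)" .
  qed
  then have "(\<lambda>z::'a. of_real (\<omega> (z \<bullet> z)) :: complex) differentiable at z" unfolding differentiable_def by blast
  from dd_bilinear[OF bounded_bilinear_mult this f, of v] dd_eqI[OF D, of v]
  show ?thesis by (simp add: power2_norm_eq_inner mult_ac)
qed

lemma euler_homogeneous:
  fixes f :: "'a::euclidean_space \<Rightarrow> 'b::real_normed_vector"
  assumes h: "pos_homogeneous e f" and z: "z \<noteq> 0" and f: "f differentiable at z"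
  shows "dd z f z = of_int e *\<^sub>R f z"
proof -
  have "((\<lambda>s. z + s *\<^sub>R z) has_derivative (\<lambda>s. s *\<^sub>R z)) (at 0)" by (auto intro!: derivative_eq_intros)
  moreover have "(f has_derivative (\<lambda>v. dd v f z)) (at (z + 0 *\<^sub>R z))"
    using has_derivative_dd[OF f] by simp
  ultimately have "((\<lambda>s. f (z + s *\<^sub>R z)) has_derivative (\<lambda>s. dd (s *\<^sub>R z) f z)) (at 0)"
    by (rule has_derivative_compose)
  from dd_eqI[OF this, of 1] have "dd 1 (\<lambda>s::real. f (z + s *\<^sub>R z)) 0 = dd z f z" by simp
  moreover have "dd 1 (\<lambda>s::real. f (z + s *\<^sub>R z)) 0 = dd 1 (\<lambda>s. ((1 + s) powr real_of_int e) *\<^sub>R f z) 0"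
  proof (rule dd_cong_open[of "{-1<..}"])
    show "\<forall>s\<in>{-1<..}. f (z + s *\<^sub>R z) = ((1 + s) powr real_of_int e) *\<^sub>R f z"
    proof
      fix s :: real assume "s \<in> {-1<..}"
      then have s: "1 + s > 0" by simp
      have "z + s *\<^sub>R z = (1 + s) *\<^sub>R z" by (simp add: scaleR_add_left)
      then show "f (z + s *\<^sub>R z) = ((1 + s) powr real_of_int e) *\<^sub>R f z"
        using h[unfolded pos_homogeneous_def, rule_format, OF s z] by simp
    qed
  qed auto
  moreover have "dd 1 (\<lambda>s. ((1 + s) powr real_of_int e) *\<^sub>R f z) 0 = of_int e *\<^sub>R f z"
  proof -
    have "((\<lambda>s::real. (1 + s) powr real_of_int e) has_real_derivative real_of_int e) (at 0)"
      by (auto intro!: derivative_eq_intros)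
    then have "((\<lambda>s::real. (1 + s) powr real_of_int e) has_derivative (\<lambda>h. real_of_int e * h)) (at 0)"
      by (simp add: has_field_derivative_def)
    from dd_eqI[OF has_derivative_scaleR_left[OF this], of 1] show ?thesis by simp
  qed
  ultimately show ?thesis by simp
qed

text \<open>For \<open>G\<close> homogeneous of degree \<open>-d\<close> the vector field \<open>\<omega>(|z|\<^sup>2) G z\<close> has divergence \<open>2 |z|\<^sup>2 \<omega>'(|z|\<^sup>2) G\<close>.\<close>
lemma weighted_radial_integral:
  fixes G :: "'a::euclidean_space \<Rightarrow> complex"
  assumes w: "radw \<omega>" and G: "smooth_on (UNIV - {0}) G" and h: "pos_homogeneous (- int DIM('a)) G"
  shows "(LINT z|lborel. of_real (dd 1 \<omega> ((norm z)\<^sup>2)) * (of_real (2 * (norm z)\<^sup>2) * G z)) = 0"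
proof -
  have o: "open (UNIV - {0::'a})" by (simp add: open_delete)
  have lin: "bounded_linear (\<lambda>z::'a. complex_of_real (z \<bullet> v))" for v
    by (intro bounded_linear_compose[OF bounded_linear_of_real] bounded_linear_inner_left)
  let ?f = "\<lambda>v z. of_real (z \<bullet> v) * G z"
  have f: "smooth_on (UNIV - {0}) (?f v)" for v
    by (rule smooth_on_bilinear[OF o bounded_bilinear_mult smooth_on_linear[OF lin] G])
  let ?h = "\<lambda>v z. of_real (\<omega> ((norm z)\<^sup>2)) * ?f v z"
  have "(\<Sum>v\<in>Basis. dd v (?h v) z) = of_real (dd 1 \<omega> ((norm z)\<^sup>2)) * (of_real (2 * (norm z)\<^sup>2) * G z)" for z
  proof (cases "z = 0")
    case True
    have "dd v (?h v) 0 = dd v (\<lambda>z. 0) 0" for v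
      by (rule dd_cong_open[of "ball 0 1"]) (use radw_near_0[OF w, of "_::'a"] in auto)
    then show ?thesis using True by simp
  next
    case z: False
    have dG: "G differentiable at z" by (rule smooth_on_diff[OF G]) (use z in simp)
    have df: "?f v differentiable at z" for v by (rule smooth_on_diff[OF f]) (use z in simp)
    have ddf: "dd v (?f v) z = G z + of_real (z \<bullet> v) * dd v G z" if "v \<in> Basis" for v
      using dd_bilinear[OF bounded_bilinear_mult bounded_linear_imp_differentiable[OF lin] dG, of v v] that
      by (simp add: dd_linear[OF lin])
    have "(\<Sum>v\<in>Basis. of_real (z \<bullet> v) * dd v G z) = dd z G z"
      unfolding dd_expand[OF dG, of z] by (simp add: scaleR_conv_of_real)
    also have "\<dots> = - of_nat DIM('a) * G z"
      unfolding euler_homogeneous[OF h z dG] by (simp add: scaleR_conv_of_real)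
    finally have E: "(\<Sum>v\<in>Basis. of_real (z \<bullet> v) * dd v G z) = - of_nat DIM('a) * G z" .
    have "(\<Sum>v\<in>Basis. of_real (z \<bullet> v) * of_real (z \<bullet> v)) = complex_of_real ((norm z)\<^sup>2)"
      unfolding power2_norm_eq_inner euclidean_inner[of z z] by simp
    moreover have "(\<Sum>v\<in>Basis. of_real (dd 1 \<omega> ((norm z)\<^sup>2)) * (of_real (2 * (z \<bullet> v)) * ?f v z)) =
        of_real (dd 1 \<omega> ((norm z)\<^sup>2)) * (2 * ((\<Sum>v\<in>Basis. of_real (z \<bullet> v) * of_real (z \<bullet> v)) * G z))"
      by (simp add: sum_distrib_left sum_distrib_right mult_ac)
    \<comment> \<open>The field \<open>G z\<close> is divergence free away from the origin: the
      dimension times \<open>G\<close>, from differentiating \<open>z\<close>, cancels the Euler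
      term of degree \<open>- DIM('a)\<close>.\<close>
    moreover have "(\<Sum>v\<in>Basis. of_real (\<omega> ((norm z)\<^sup>2)) * dd v (?f v) z) = 0"
    proof -
      have "(\<Sum>v\<in>Basis. dd v (?f v) z) = 0"
        using E by (simp add: ddf sum.distrib)
      then show ?thesis by (simp flip: sum_distrib_left)
    qed
    ultimately show ?thesis
      by (simp add: dd_weight[OF w df] sum.distrib)
  qed
  moreover have "integrable lborel (dd v (?h v))" if "v \<in> Basis" for v
    by (rule sch_integrable[OF sch_dd[OF weighted_sch[OF w f] that]])
  then have "(LINT z|lborel. (\<Sum>v\<in>Basis. dd v (?h v) z)) = (\<Sum>v\<in>Basis. LINT z|lborel. dd v (?h v) z)"
    by (rule Bochner_Integration.integral_sum)
  moreover have "(\<Sum>v\<in>Basis. LINT z|lborel. dd v (?h v) z) = 0"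
    by (rule sum.neutral) (use weighted_integral_dd[OF w f] in blast)
  ultimately show ?thesis by simp
qed

lemma smooth_inverse_norm_sq: "smooth_on (UNIV - {0}) (\<lambda>z::'a::euclidean_space. 1 / (norm z)\<^sup>2)"
proof -
  have "smooth_on {0<..} (\<lambda>x::real. 1 / x)" using csm_inverse[of _ 1 1] by (simp add: smooth_on_csm)
  moreover have "smooth_on (UNIV - {0}) (\<lambda>z::'a. (norm z)\<^sup>2)"
    by (rule smooth_on_subset[OF smooth_norm_sq]) simp
  ultimately show ?thesis
    by (intro smooth_on_compose[of "UNIV - {0::'a}" "{0<..}" "\<lambda>x. 1 / x" "\<lambda>z. (norm z)\<^sup>2"])
      (auto simp: open_delete)
qed

text \<open>The integral of \<open>\<partial>\<^sub>v (\<omega> f)\<close> vanishes, so it remains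
  to dispose of the term in which the weight is differentiated. It equals
  \<open>2 |z|\<^sup>2 \<omega>' G\<close> with \<open>G = z\<^sub>v f / |z|\<^sup>2\<close>,
  homogeneous of the degree in which \<open>weighted_radial_integral\<close> applies.\<close>

lemma weighted_divergence:
  fixes f :: "'a::euclidean_space \<Rightarrow> complex"
  assumes w: "radw \<omega>" and f: "smooth_on (UNIV - {0}) f" and h: "pos_homogeneous (1 - int DIM('a)) f" and v: "v \<in> Basis"
  shows "(LINT z|lborel. of_real (\<omega> ((norm z)\<^sup>2)) * dd v f z) = 0"
proof -
  have o: "open (UNIV - {0::'a})" by (simp add: open_delete)
  have lin: "bounded_linear (\<lambda>z::'a. complex_of_real (z \<bullet> v))"
    by (intro bounded_linear_compose[OF bounded_linear_of_real] bounded_linear_inner_left)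
  define G where "G z = of_real (z \<bullet> v) * f z * of_real (1 / (norm z)\<^sup>2)" for z
  have G: "smooth_on (UNIV - {0}) G"
    unfolding G_def[abs_def]
    by (rule smooth_on_bilinear[OF o bounded_bilinear_mult
          smooth_on_bilinear[OF o bounded_bilinear_mult smooth_on_linear[OF lin] f]
          smooth_on_bounded_linear[OF o bounded_linear_of_real smooth_inverse_norm_sq]])
  have hG: "pos_homogeneous (- int DIM('a)) G"
    unfolding pos_homogeneous_def
  proof (intro allI impI)
    fix t :: real and z :: 'a assume t: "t > 0" and z: "z \<noteq> 0"
    have "t powr real_of_int (1 - int DIM('a)) * t * (1 / t\<^sup>2) = t powr (1 - real DIM('a)) * t powr 1 * t powr (- 2)"
      using t by (simp add: powr_minus_divide powr_numeral)
    also have "\<dots> = t powr real_of_int (- int DIM('a))" unfolding powr_add[symmetric] by simp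
    finally have e: "t powr real_of_int (- int DIM('a)) = t powr real_of_int (1 - int DIM('a)) * t * (1 / t\<^sup>2)" ..
    show "G (t *\<^sub>R z) = (t powr real_of_int (- int DIM('a))) *\<^sub>R G z"
      unfolding e G_def h[unfolded pos_homogeneous_def, rule_format, OF t z]
      using t by (simp add: scaleR_conv_of_real power_mult_distrib)
  qed
  have d: "dd v (\<lambda>z. of_real (\<omega> ((norm z)\<^sup>2)) * f z) z =
      of_real (dd 1 \<omega> ((norm z)\<^sup>2)) * (of_real (2 * (norm z)\<^sup>2) * G z) + of_real (\<omega> ((norm z)\<^sup>2)) * dd v f z" for z
  proof (cases "z = 0")
    case True
    have "dd v (\<lambda>z. of_real (\<omega> ((norm z)\<^sup>2)) * f z) 0 = dd v (\<lambda>z. 0) 0"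
      by (rule dd_cong_open[of "ball 0 1"]) (use radw_near_0[OF w, of "_::'a"] in auto)
    then show ?thesis using True w by (simp add: radw_def)
  next
    case z: False
    have "of_real (2 * (norm z)\<^sup>2) * G z = of_real (2 * (z \<bullet> v)) * f z" using z by (simp add: G_def)
    then show ?thesis using dd_weight[OF w smooth_on_diff[OF f], of z v] z by simp
  qed
  have lin2: "smooth_on (UNIV - {0}) (\<lambda>z::'a. complex_of_real (2 * (norm z)\<^sup>2))"
    by (rule smooth_on_bounded_linear[OF o bounded_linear_of_real smooth_on_bounded_linear[OF o bounded_linear_mult_right
          smooth_on_subset[OF smooth_norm_sq]]]) simp
  have "(LINT z|lborel. of_real (dd 1 \<omega> ((norm z)\<^sup>2)) * (of_real (2 * (norm z)\<^sup>2) * G z) + of_real (\<omega> ((norm z)\<^sup>2)) * dd v f z) = 0"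
    using weighted_integral_dd[OF w f v] unfolding d .
  moreover have "integrable lborel (\<lambda>z. of_real (dd 1 \<omega> ((norm z)\<^sup>2)) * (of_real (2 * (norm z)\<^sup>2) * G z))"
    by (rule weighted_integrable[OF radw_deriv(1)[OF w] smooth_on_bilinear[OF o bounded_bilinear_mult lin2 G]])
  moreover have "integrable lborel (\<lambda>z. of_real (\<omega> ((norm z)\<^sup>2)) * dd v f z)"
    by (rule weighted_integrable[OF w smooth_on_dd[OF f v]])
  ultimately show ?thesis using weighted_radial_integral[OF w G hG] by simp
qed

section \<open>From weighted integrals to sphere integrals\<close>

lemma homogeneous_ball_integral:
  fixes B :: "'a::euclidean_space \<Rightarrow> complex"
  assumes B: "B \<in> borel_measurable borel" and h: "\<And>c z. c > 0 \<Longrightarrow> B (c *\<^sub>R z) = B z" and s: "s > 0"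
  shows "(LINT z|lborel. indicator {z. norm z < s} z *\<^sub>R B z) =
    of_real (s ^ DIM('a)) * (LINT z|lborel. indicator {z. norm z < 1} z *\<^sub>R B z)"
proof -
  have m: "(\<lambda>z. indicator {z. norm z < s} z *\<^sub>R B z) \<in> borel_measurable borel"
    by (intro borel_measurable_scaleR borel_measurable_indicator B) simp
  have "indicator {z. norm z < s} (s *\<^sub>R z) *\<^sub>R B (s *\<^sub>R z) = indicator {z. norm z < 1} z *\<^sub>R B z" for z
    using s by (simp add: h indicator_def)
  then show ?thesis using lborel_integral_scale[OF m s] by simp
qed

text \<open>This is the fundamental theorem of calculus for \<open>- \<omega> (s\<^sup>2)\<close>.
  The upper limit 3 lies beyond radius 2, where the weight has vanished.\<close>

lemma layer_cake:
  assumes w: "radw \<omega>" and r: "r \<ge> 0"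
  shows "(LINT s|lborel. indicator {r<..<3} s * (- 2 * s * dd 1 \<omega> (s\<^sup>2))) = \<omega> (r\<^sup>2)"
proof (cases "r < 3")
  case False
  then have "9 \<le> r\<^sup>2" using power_mono[of 3 r 2] by simp
  then show ?thesis using False w by (simp add: radw_def)
next
  case True
  let ?\<phi> = "\<lambda>s. - 2 * s * dd 1 \<omega> (s\<^sup>2)"
  have c: "continuous_on UNIV (dd 1 \<omega>)" using radw_deriv(1)[OF w] smooth_on_continuous by (auto simp: radw_def)
  have "(LINT s|lborel. indicator {r<..<3} s * ?\<phi> s) = (LINT s|lborel. ?\<phi> s * indicator {r..3} s)"
  proof (rule integral_cong_AE)
    have "AE s in lborel. s \<noteq> r \<and> s \<noteq> (3::real)"
      by (intro AE_conjI AE_lborel_singleton)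
    then show "AE s in lborel. indicator {r<..<3} s * ?\<phi> s = ?\<phi> s * indicator {r..3} s"
      by eventually_elim (auto simp: indicator_def)
    have m: "?\<phi> \<in> borel_measurable borel"
      by (intro borel_measurable_continuous_onI continuous_intros continuous_on_compose2[OF c]) auto
    show "(\<lambda>s. indicator {r<..<3} s * ?\<phi> s) \<in> borel_measurable lborel"
      "(\<lambda>s. ?\<phi> s * indicator {r..3} s) \<in> borel_measurable lborel"
      using m by (simp_all)
  qed
  also have "\<dots> = (- \<omega> (3\<^sup>2)) - (- \<omega> (r\<^sup>2))"
  proof (rule integral_FTC_Icc_real)
    show "r \<le> 3" using True by simp
    fix s :: real
    show "((\<lambda>s. - \<omega> (s\<^sup>2)) has_real_derivative ?\<phi> s) (at s)"
      by (auto intro!: derivative_eq_intros DERIV_chain2[OF radw_deriv(2)[OF w]])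
    show "isCont ?\<phi> s"
      using continuous_on_compose2[OF c, of UNIV "\<lambda>s. s\<^sup>2"]
      by (intro continuous_intros) (auto simp: continuous_on_eq_continuous_at intro: continuous_intros)
  qed
  also have "\<dots> = \<omega> (r\<^sup>2)" using w by (simp add: radw_def)
  finally show ?thesis .
qed

text \<open>By \<open>layer_cake\<close> the weight is a superposition of indicator functions of
  balls \<open>norm z < s\<close>. For \<open>B\<close> constant along rays the integral over such a
  ball is \<open>s ^ DIM('a)\<close> times the one over the unit ball, and Fubini separates the
  radial factor, which depends on the weight alone.\<close>

lemma radial_weight_integral:
  fixes B :: "'a::euclidean_space \<Rightarrow> complex"
  assumes w: "radw \<omega>" and B: "B \<in> borel_measurable borel" and M: "\<And>z. norm (B z) \<le> M"
    and h: "\<And>c z. c > 0 \<Longrightarrow> B (c *\<^sub>R z) = B z"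
  shows "(LINT z|lborel. of_real (\<omega> ((norm z)\<^sup>2)) * B z) =
     (LINT s|lborel. indicator {0<..<3} s *\<^sub>R (of_real (- 2 * s * dd 1 \<omega> (s\<^sup>2)) * of_real (s ^ DIM('a)))) *
     (LINT z|lborel. indicator {z. norm z < 1} z *\<^sub>R B z)"
proof -
  let ?\<phi> = "\<lambda>s::real. - 2 * s * dd 1 \<omega> (s\<^sup>2)"
  have c: "continuous_on UNIV (dd 1 \<omega>)" using radw_deriv(1)[OF w] smooth_on_continuous by (auto simp: radw_def)
  have c\<phi>: "continuous_on UNIV ?\<phi>"
    by (intro continuous_intros continuous_on_compose2[OF c]) auto
  have m\<phi>: "?\<phi> \<in> borel_measurable borel" by (rule borel_measurable_continuous_onI[OF c\<phi>])
  have "bounded (?\<phi> ` {0..3})"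
    by (intro compact_imp_bounded compact_continuous_image continuous_on_subset[OF c\<phi>]) auto
  then obtain K where K': "\<forall>x\<in>?\<phi> ` {0..3}. norm x \<le> K" by (rule bounded_iff[THEN iffD1, THEN exE])
  have K: "\<bar>?\<phi> s\<bar> \<le> K" if "s \<in> {0..3}" for s using bspec[OF K' imageI[OF that]] by simp
  have M0: "0 \<le> M" using order_trans[OF norm_ge_zero M] by blast
  have K0: "0 \<le> K" using order_trans[OF abs_ge_zero K[of 0]] by simp
  define S where "S = {(z::'a, s::real). norm z < s \<and> s < 3}"
  have S: "S \<in> sets borel"
  proof -
    have "open S" unfolding S_def case_prod_unfold by (intro open_Collect_conj open_Collect_less continuous_intros)
    then show ?thesis by simp
  qed
  let ?F = "\<lambda>(z, s). indicator S (z, s) *\<^sub>R (of_real (?\<phi> s) * B z)"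
  have mF: "?F \<in> borel_measurable (lborel \<Otimes>\<^sub>M lborel)"
  proof -
    have "continuous_on UNIV (\<lambda>x::'a \<times> real. dd 1 \<omega> ((snd x)\<^sup>2))"
      by (rule continuous_on_compose2[OF c]) (auto intro!: continuous_intros)
    then have "(\<lambda>x. indicator S x *\<^sub>R (of_real (?\<phi> (snd x)) * B (fst x))) \<in> borel_measurable borel"
      by (intro borel_measurable_scaleR borel_measurable_indicator S borel_measurable_times borel_measurable_of_real
          measurable_compose[OF _ B] measurable_compose[OF _ m\<phi>] borel_measurable_continuous_onI continuous_intros)
    then show ?thesis by (simp add: lborel_prod case_prod_unfold)
  qed
  have iF: "integrable (lborel \<Otimes>\<^sub>M lborel) ?F"
  proof (rule Bochner_Integration.integrable_bound[OF _ mF])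
    have "emeasure lborel (cball (0::'a) 3 \<times> {0..3::real}) < \<infinity>"
      by (intro emeasure_bounded_finite bounded_Times) auto
    moreover have "cball (0::'a) 3 \<times> {0..3::real} \<in> sets borel" by (intro borel_closed closed_Times) auto
    ultimately have "integrable lborel (\<lambda>x. indicator (cball (0::'a) 3 \<times> {0..3::real}) x * (K * M))"
      by (intro integrable_mult_left integrable_real_indicator) auto
    then show "integrable (lborel \<Otimes>\<^sub>M lborel) (\<lambda>x. indicator (cball (0::'a) 3 \<times> {0..3::real}) x * (K * M))"
      by (simp add: lborel_prod)
    have "norm (?F (z, s)) \<le> indicator (cball (0::'a) 3 \<times> {0..3::real}) (z, s) * (K * M)" for z s
    proof (cases "(z, s) \<in> S")
      case True
      then have s: "norm z < s" "s < 3" by (auto simp: S_def)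
      then have s': "s \<in> {0..3}" using norm_ge_zero[of z] unfolding atLeastAtMost_iff by linarith
      have "norm (of_real (?\<phi> s) * B z) \<le> K * M"
        unfolding norm_mult norm_of_real by (intro mult_mono K M s' K0) auto
      then show ?thesis using True s s' by simp
    qed (use K0 M0 in simp)
    then have "norm (?F x) \<le> norm (indicator (cball (0::'a) 3 \<times> {0..3::real}) x * (K * M))" for x
      unfolding real_norm_def by (cases x) (rule order_trans[OF _ abs_ge_self], simp only:)
    then show "AE x in lborel \<Otimes>\<^sub>M lborel. norm (?F x) \<le> norm (indicator (cball (0::'a) 3 \<times> {0..3::real}) x * (K * M))"
      by (rule AE_I2)
  qed
  have "of_real (\<omega> ((norm z)\<^sup>2)) * B z = (LINT s|lborel. ?F (z, s))" for z
  proof -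
    have "(LINT s|lborel. ?F (z, s)) = (LINT s|lborel. of_real (indicator {norm z<..<3} s * ?\<phi> s) * B z)"
      by (rule arg_cong[of _ _ "integral\<^sup>L lborel"]) (auto simp: fun_eq_iff S_def indicator_def)
    also have "\<dots> = of_real (LINT s|lborel. indicator {norm z<..<3} s * ?\<phi> s) * B z"
      by (simp only: integral_mult_left_zero integral_complex_of_real)
    finally show ?thesis by (simp only: layer_cake[OF w norm_ge_zero])
  qed
  then have "(LINT z|lborel. of_real (\<omega> ((norm z)\<^sup>2)) * B z) = (LINT z|lborel. LINT s|lborel. ?F (z, s))" by simp
  also have "\<dots> = (LINT s|lborel. LINT z|lborel. ?F (z, s))"
    using lborel_pair.Fubini_integral[OF iF] by simp
  also have "\<dots> = (LINT s|lborel. (indicator {0<..<3} s *\<^sub>R (of_real (?\<phi> s) * of_real (s ^ DIM('a)))) *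
      (LINT z|lborel. indicator {z. norm z < 1} z *\<^sub>R B z))"
  proof (rule arg_cong[of _ _ "integral\<^sup>L lborel"], rule ext)
    fix s :: real
    show "(LINT z|lborel. ?F (z, s)) = (indicator {0<..<3} s *\<^sub>R (of_real (?\<phi> s) * of_real (s ^ DIM('a)))) *
      (LINT z|lborel. indicator {z. norm z < 1} z *\<^sub>R B z)"
    proof (cases "s \<in> {0<..<3}")
      case True
      have "(LINT z|lborel. ?F (z, s)) = (LINT z|lborel. of_real (?\<phi> s) * (indicator {z. norm z < s} z *\<^sub>R B z))"
        by (rule arg_cong[of _ _ "integral\<^sup>L lborel"]) (use True in \<open>auto simp: fun_eq_iff S_def indicator_def\<close>)
      also have "\<dots> = of_real (?\<phi> s) * (LINT z|lborel. indicator {z. norm z < s} z *\<^sub>R B z)"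
        by (rule integral_mult_right_zero)
      finally show ?thesis using True homogeneous_ball_integral[OF B h, of s] by (simp add: mult.assoc)
    next
      case False
      have "(z, s) \<notin> S" for z
      proof
        assume "(z, s) \<in> S"
        then have "norm z < s" "s < 3" by (simp_all add: S_def)
        then show False using False norm_ge_zero[of z] by simp
      qed
      then show ?thesis using False by simp
    qed
  qed
  also have "\<dots> = (LINT s|lborel. indicator {0<..<3} s *\<^sub>R (of_real (?\<phi> s) * of_real (s ^ DIM('a)))) *
     (LINT z|lborel. indicator {z. norm z < 1} z *\<^sub>R B z)"
    by (rule integral_mult_left_zero)
  finally show ?thesis .
qed

definition om :: "real \<Rightarrow> real" where
  "om x = flat_exp 1 (x - 1) * flat_exp 1 (4 - x)"

lemma radw_om_power: "radw (\<lambda>x. om x * x ^ n)"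
proof -
  have 1: "smooth_on UNIV (\<lambda>x. flat_exp 1 (x - 1))"
    using smooth_on_compose[OF open_UNIV flat_exp_smooth smooth_affine, of "-1" 1] by simp
  have 2: "smooth_on UNIV (\<lambda>x. flat_exp 1 (4 - x))"
    using smooth_on_compose[OF open_UNIV flat_exp_smooth smooth_affine, of 4 "-1"] by simp
  have 3: "smooth_on UNIV (\<lambda>x::real. x ^ n)"
  proof (induction n)
    case (Suc n)
    show ?case using smooth_on_bilinear[OF open_UNIV bounded_bilinear_mult smooth_on_linear[OF bounded_linear_ident] Suc] by simp
  qed simp
  show ?thesis unfolding radw_def om_def
    using smooth_on_bilinear[OF open_UNIV bounded_bilinear_mult smooth_on_bilinear[OF open_UNIV bounded_bilinear_mult 1 2] 3]
    by (auto simp: flat_exp_0)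
qed

lemma radw_om: "radw om"
  using radw_om_power[of 0] by simp

lemma om_integral_pos: "(LINT z|lborel. om ((norm (z::'a::euclidean_space))\<^sup>2)) > 0"
proof -
  have s: "sch (\<lambda>t::unit. \<lambda>z::'a. of_real (om ((norm z)\<^sup>2)) * 1 :: complex)"
    by (rule weighted_sch[OF radw_om]) simp
  have cont: "continuous_on UNIV (\<lambda>z::'a. om ((norm z)\<^sup>2))"
    using smooth_on_continuous[OF smooth_on_compose[OF open_UNIV _ smooth_norm_sq, of UNIV om]] radw_om by (simp add: radw_def)
  have int: "integrable lborel (\<lambda>z::'a. om ((norm z)\<^sup>2))"
    using integrable_Re[OF sch_integrable[OF s]] by simp
  have nn: "om x \<ge> 0" for x by (simp add: om_def flat_exp_nonneg)
  obtain b :: 'a where b: "b \<in> Basis" using nonempty_Basis by blast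
  \<comment> \<open>The squared norm \<open>9/4\<close> lies inside the interval from 1 to 4 where
    \<open>om\<close> is positive.\<close>
  let ?z = "(3/2) *\<^sub>R b"
  have "om ((norm ?z)\<^sup>2) > 0" using b by (simp add: om_def power2_eq_square flat_exp_pos)
  show ?thesis
  proof (rule ccontr)
    assume "\<not> ?thesis"
    moreover have "(LINT z|lborel. om ((norm (z::'a))\<^sup>2)) \<ge> 0" by (rule Bochner_Integration.integral_nonneg) (simp add: nn)
    ultimately have "(LINT z|lborel. om ((norm (z::'a))\<^sup>2)) = 0" by simp
    then have ae: "AE z in lborel. om ((norm (z::'a))\<^sup>2) = 0"
      using integral_nonneg_eq_0_iff_AE[OF int] nn by simp
    have "open {z::'a. om ((norm z)\<^sup>2) > 0}" using cont by (intro open_Collect_less continuous_intros) auto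
    moreover have "?z \<in> {z. om ((norm z)\<^sup>2) > 0}" using \<open>om ((norm ?z)\<^sup>2) > 0\<close> by simp
    ultimately obtain e where e: "e > 0" "ball ?z e \<subseteq> {z. om ((norm z)\<^sup>2) > 0}" by (meson openE)
    have "{z::'a. om ((norm z)\<^sup>2) > 0} \<in> null_sets lborel"
    proof -
      have "AE z in lborel. z \<notin> {z::'a. om ((norm z)\<^sup>2) > 0}" using ae by eventually_elim simp
      moreover have "{z::'a. om ((norm z)\<^sup>2) > 0} \<in> sets lborel"
        using \<open>open {z::'a. om ((norm z)\<^sup>2) > 0}\<close> by simp
      ultimately show ?thesis by (simp add: AE_iff_null_sets)
    qed
    then have "ball ?z e \<in> null_sets lborel" using e(2) null_sets_subset[of _ lborel "ball ?z e"] by auto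
    then have "negligible (ball ?z e)" by (simp add: negligible_iff_null_sets null_sets_completionI)
    then show False using e(1) open_not_negligible[OF open_ball, of ?z e] by simp
  qed
qed

text \<open>Multiplying \<open>G\<close> by the matching power of the norm makes it constant along
  rays. The weighted integral is then a scalar \<open>\<kappa>\<close> times the ball integral in
  the definition of \<open>sphere_integral\<close>, so the point is that \<open>\<kappa>\<close> is
  nonzero.\<close>

lemma sphere_integral_eq_0:
  fixes G :: "'a::euclidean_space \<Rightarrow> complex"
  assumes G: "smooth_on (UNIV - {0}) G" and h: "pos_homogeneous (- int DIM('a)) G"
    and zero: "(LINT z|lborel. of_real (om ((norm z)\<^sup>2)) * (of_real (norm z ^ DIM('a)) * G z)) = 0"
  shows "sphere_integral G = 0"
proof -
  define B where "B z = of_real (norm z ^ DIM('a)) * G z" for z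
  have B0: "B 0 = 0" by (simp add: B_def)
  have Bh: "B (c *\<^sub>R z) = B z" if c: "c > 0" for c z
  proof (cases "z = 0")
    case False
    have "(c * norm z) ^ DIM('a) * c powr (- real DIM('a)) = norm z ^ DIM('a)"
      using c by (simp add: power_mult_distrib powr_minus powr_realpow field_simps)
    moreover have "G (c *\<^sub>R z) = (c powr (- real DIM('a))) *\<^sub>R G z"
      using h[unfolded pos_homogeneous_def, rule_format, OF c False] by simp
    ultimately show ?thesis using c unfolding B_def
      by (simp add: scaleR_conv_of_real mult.assoc[symmetric] flip: of_real_mult of_real_power)
  qed (simp add: B0)
  have Bn: "B z = G (z /\<^sub>R norm z)" if "z \<noteq> 0" for z
  proof -
    have "B ((1 / norm z) *\<^sub>R z) = B z" by (rule Bh) (use that in simp)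
    moreover have "B ((1 / norm z) *\<^sub>R z) = G (z /\<^sub>R norm z)" using that by (simp add: B_def inverse_eq_divide)
    ultimately show ?thesis by simp
  qed
  have contG: "continuous_on (UNIV - {0}) G" by (rule smooth_on_continuous[OF G])
  have Bm: "B \<in> borel_measurable borel"
  proof -
    have "(\<lambda>z. indicator (UNIV - {0}) z *\<^sub>R B z) \<in> borel_measurable borel"
      unfolding B_def by (intro borel_measurable_continuous_on_indicator continuous_intros contG) auto
    moreover have "(\<lambda>z. indicator (UNIV - {0}) z *\<^sub>R B z) = B" by (auto simp: fun_eq_iff indicator_def B0)
    ultimately show ?thesis by simp
  qed
  have "bounded (G ` sphere 0 1)"
    by (intro compact_imp_bounded compact_continuous_image continuous_on_subset[OF contG]) auto
  then obtain M0 where M0': "\<forall>x\<in>G ` sphere 0 1. norm x \<le> M0" by (rule bounded_iff[THEN iffD1, THEN exE])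
  have M0: "norm (G z) \<le> M0" if "norm z = 1" for z using M0' that by simp
  have BM: "norm (B z) \<le> max M0 0" for z
  proof (cases "z = 0")
    case False
    then show ?thesis using M0[of "z /\<^sub>R norm z"] Bn[OF False] by simp
  qed (simp add: B0)
  let ?\<kappa> = "LINT s|lborel. indicator {0<..<3} s *\<^sub>R (complex_of_real (- 2 * s * dd 1 om (s\<^sup>2)) * of_real (s ^ DIM('a)))"
  have "?\<kappa> * (LINT z|lborel. indicator {z. norm z < 1} z *\<^sub>R B z) = 0"
    using radial_weight_integral[OF radw_om Bm BM Bh] zero by (simp add: B_def)
  \<comment> \<open>The scalar is the same for all functions constant along rays. For the constant 1
    the left hand side is the integral of the weight, which is positive.\<close>
  moreover have "?\<kappa> \<noteq> 0"
  proof
    assume "?\<kappa> = 0"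
    then have "(LINT z|lborel. of_real (om ((norm (z::'a))\<^sup>2)) * 1) = (0::complex)"
      using radial_weight_integral[OF radw_om, of "\<lambda>z::'a. 1" 1] by simp
    then have "complex_of_real (LINT z|lborel. om ((norm (z::'a))\<^sup>2)) = 0"
      by (simp only: mult_1_right integral_complex_of_real)
    then show False using om_integral_pos[where 'a='a] by simp
  qed
  ultimately have b0: "(LINT z|lborel. indicator {z. norm z < 1} z *\<^sub>R B z) = 0" by simp
  have ball: "{z. norm z < 1} = ball (0::'a) 1" by auto
  have "set_integrable lborel (ball 0 1) B"
    unfolding set_integrable_def
  proof (rule Bochner_Integration.integrable_bound)
    show "integrable lborel (\<lambda>z. indicator (ball (0::'a) 1) z * max M0 0)"
      by (intro integrable_mult_left integrable_real_indicator emeasure_bounded_finite) auto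
    have "(\<lambda>z. indicator (ball 0 1) z *\<^sub>R B z) \<in> borel_measurable borel"
      by (intro borel_measurable_scaleR borel_measurable_indicator Bm) simp
    then show "(\<lambda>z. indicator (ball 0 1) z *\<^sub>R B z) \<in> borel_measurable lborel" by (simp only: measurable_lborel2)
    show "AE z in lborel. norm (indicator (ball 0 1) z *\<^sub>R B z) \<le> norm (indicator (ball (0::'a) 1) z * max M0 0)"
    proof (rule AE_I2)
      fix z show "norm (indicator (ball 0 1) z *\<^sub>R B z) \<le> norm (indicator (ball (0::'a) 1) z * max M0 0)"
        using order_trans[OF BM abs_ge_self, of z] by (cases "z \<in> ball 0 1")
          (simp_all only: indicator_simps scaleR_one scaleR_zero_left mult_1 mult_zero_left norm_zero real_norm_def abs_zero order_refl not_False_eq_True)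
    qed
  qed
  from set_borel_integral_eq_integral(2)[OF this]
  have "integral (ball 0 1) B = 0" using b0 by (simp add: set_lebesgue_integral_def ball)
  moreover have "integral (ball 0 1) (\<lambda>z. G (z /\<^sub>R norm z)) = integral (ball 0 1) B"
    by (rule integral_spike[of "{0}"]) (auto simp: Bn)
  ultimately show ?thesis by (simp add: sphere_integral_def)
qed

section \<open>Alternating sums\<close>

text \<open>The antisymmetrised quantity is a function of words, so that products of different
  shapes, and traces of them, can be alternated by one operator.\<close>

definition alt :: "nat \<Rightarrow> (nat list \<Rightarrow> 'a::ring_1) \<Rightarrow> 'a" where
  "alt n w = (\<Sum>p | p permutes {..<n}. of_int (sign p) * w (map p [0..<n]))"

lemma alt_cong:
  assumes "\<And>l. distinct l \<Longrightarrow> set l = {..<n} \<Longrightarrow> length l = n \<Longrightarrow> v l = w l"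
  shows "alt n v = alt n w"
  unfolding alt_def
proof (rule sum.cong[OF refl])
  fix p assume "p \<in> {p. p permutes {..<n}}"
  then have p: "p permutes {..<n}" by simp
  have "v (map p [0..<n]) = w (map p [0..<n])"
    using permutes_inj_on[OF p, of "{0..<n}"] permutes_image[OF p]
    by (intro assms) (auto simp: distinct_map lessThan_atLeast0)
  then show "of_int (sign p) * v (map p [0..<n]) = of_int (sign p) * w (map p [0..<n])" by simp
qed

lemma alt_add: "alt n (\<lambda>l. v l + w l) = alt n v + alt n w"
  by (simp add: alt_def distrib_left sum.distrib)

lemma alt_sum: "alt n (\<lambda>l. \<Sum>i\<in>I. v i l) = (\<Sum>i\<in>I. alt n (v i))"
  unfolding alt_def sum_distrib_left by (rule sum.swap)

text \<open>Composition on the right permutes the positions of a word; it is used for rearranging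
  factors.\<close>

lemma alt_compose_right:
  assumes q: "q permutes {..<n}" and v: "\<And>p. p permutes {..<n} \<Longrightarrow> v (map p [0..<n]) = w (map (p \<circ> q) [0..<n])"
  shows "alt n v = of_int (sign q) * alt n w"
proof -
  have "alt n w = (\<Sum>p | p permutes {..<n}. of_int (sign (p \<circ> q)) * w (map (p \<circ> q) [0..<n]))"
    unfolding alt_def by (rule sum_permutations_compose_right[OF q])
  also have "\<dots> = (\<Sum>p | p permutes {..<n}. of_int (sign q) * (of_int (sign p) * v (map p [0..<n])))"
  proof (rule sum.cong[OF refl])
    fix p assume "p \<in> {p. p permutes {..<n}}"
    then have p: "p permutes {..<n}" by simp
    have "sign (p \<circ> q) = sign p * sign q"
      by (rule sign_compose) (use p q permutes_imp_permutation in blast)+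
    then show "of_int (sign (p \<circ> q)) * w (map (p \<circ> q) [0..<n]) =
        of_int (sign q) * (of_int (sign p) * v (map p [0..<n]))"
      unfolding v[OF p, symmetric] by (simp add: mult.assoc[symmetric] mult.commute[of "sign p"] flip: of_int_mult)
  qed
  also have "\<dots> = of_int (sign q) * alt n v" by (simp add: alt_def sum_distrib_left)
  finally have e: "alt n w = of_int (sign q) * alt n v" .
  have "of_int (sign q) * alt n w = of_int (sign q * sign q) * alt n v"
    unfolding e by (simp only: of_int_mult mult.assoc)
  then show ?thesis unfolding sign_idempotent by simp
qed

text \<open>Composition on the left renames the letters of a word; it is used when two letters play
  the same role.\<close>

lemma alt_compose_left:
  assumes q: "q permutes {..<n}" and v: "\<And>p. p permutes {..<n} \<Longrightarrow> v (map p [0..<n]) = w (map (q \<circ> p) [0..<n])"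
  shows "alt n v = of_int (sign q) * alt n w"
proof -
  have "alt n w = (\<Sum>p | p permutes {..<n}. of_int (sign (q \<circ> p)) * w (map (q \<circ> p) [0..<n]))"
    unfolding alt_def by (rule setum_permutations_compose_left[OF q])
  also have "\<dots> = (\<Sum>p | p permutes {..<n}. of_int (sign q) * (of_int (sign p) * v (map p [0..<n])))"
  proof (rule sum.cong[OF refl])
    fix p assume "p \<in> {p. p permutes {..<n}}"
    then have p: "p permutes {..<n}" by simp
    have "sign (q \<circ> p) = sign q * sign p"
      by (rule sign_compose) (use p q permutes_imp_permutation in blast)+
    then show "of_int (sign (q \<circ> p)) * w (map (q \<circ> p) [0..<n]) =
        of_int (sign q) * (of_int (sign p) * v (map p [0..<n]))"
      unfolding v[OF p, symmetric] by (simp add: mult.assoc)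
  qed
  also have "\<dots> = of_int (sign q) * alt n v" by (simp add: alt_def sum_distrib_left)
  finally have e: "alt n w = of_int (sign q) * alt n v" .
  have "of_int (sign q) * alt n w = of_int (sign q * sign q) * alt n v"
    unfolding e by (simp only: of_int_mult mult.assoc)
  then show ?thesis unfolding sign_idempotent by simp
qed

text \<open>A transposition of adjacent positions is odd. The list \<open>xs\<close> only fixes the
  position through its length.\<close>

lemma alt_swap:
  assumes n: "length xs + 2 + r = n"
    and v: "\<And>xs' x y zs. length xs' = length xs \<Longrightarrow> length zs = r \<Longrightarrow> v (xs' @ x # y # zs) = w (xs' @ y # x # zs)"
  shows "alt n v = - alt n w"
proof -
  define a where "a = length xs"
  let ?q = "Transposition.transpose a (Suc a)"
  have q: "?q permutes {..<n}" using n by (auto intro: permutes_swap_id simp: a_def)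
  have "alt n v = of_int (sign ?q) * alt n w"
  proof (rule alt_compose_right[OF q])
    fix p :: "nat \<Rightarrow> nat"
    have e: "[0..<n] = [0..<a] @ a # Suc a # [a+2..<n]"
      using n upt_add_eq_append[of 0 a "n - a"] by (simp add: a_def upt_conv_Cons)
    have "map (p \<circ> ?q) [0..<a] = map p [0..<a]" "map (p \<circ> ?q) [a+2..<n] = map p [a+2..<n]"
      by (auto simp: Transposition.transpose_def)
    then have "map (p \<circ> ?q) [0..<n] = map p [0..<a] @ p (Suc a) # p a # map p [a+2..<n]"
      unfolding e by simp
    moreover have "map p [0..<n] = map p [0..<a] @ p a # p (Suc a) # map p [a+2..<n]"
      unfolding e by simp
    ultimately show "v (map p [0..<n]) = w (map (p \<circ> ?q) [0..<n])"
      using v[of "map p [0..<a]" "map p [a+2..<n]" "p a" "p (Suc a)"] n by (simp add: a_def)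
  qed
  then show ?thesis by (simp add: sign_swap_id)
qed

lemma alt_move:
  assumes "a + m + 1 + r = n"
    and "\<And>xs ys z zs. length xs = a \<Longrightarrow> length ys = m \<Longrightarrow> length zs = r \<Longrightarrow> v (xs @ ys @ z # zs) = w (xs @ z # ys @ zs)"
  shows "alt n v = (- 1) ^ m * alt n w"
  using assms
proof (induction m arbitrary: v r)
  case 0
  have "alt n v = alt n w"
  proof (rule alt_cong)
    fix l :: "nat list" assume l: "length l = n"
    have "l = take a l @ [] @ l ! a # drop (Suc a) l" using l 0(1) by (simp add: id_take_nth_drop[symmetric])
    then show "v l = w l" using 0(2)[of "take a l" "[]" "drop (Suc a) l" "l ! a"] l 0(1) by simp
  qed
  then show ?case by simp
next
  case (Suc m)
  \<comment> \<open>\<open>v\<close> with the letters at positions \<open>a + m\<close> and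
    \<open>Suc (a + m)\<close> exchanged. This costs one sign, and the moving letter then has only
    \<open>m\<close> others left to cross.\<close>
  define u where "u l = v (take (a + m) l @ l ! (Suc (a + m)) # l ! (a + m) # drop (a + m + 2) l)" for l
  have u: "u (xs @ x # y # zs) = v (xs @ y # x # zs)" if "length xs = a + m" for xs x y zs
    using that by (simp add: u_def nth_append)
  have "alt n u = - alt n v"
    by (rule alt_swap[of "replicate (a + m) 0" r]) (use Suc.prems(1) u in auto)
  moreover have "alt n u = (- 1) ^ m * alt n w"
  proof (rule Suc.IH)
    show "a + m + 1 + Suc r = n" using Suc.prems(1) by simp
    fix xs ys zs' :: "nat list" and z assume len: "length xs = a" "length ys = m" "length zs' = Suc r"
    then obtain y zs where zs: "zs' = y # zs" "length zs = r" by (cases zs') auto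
    have "u (xs @ ys @ z # zs') = v (xs @ (ys @ [y]) @ z # zs)"
      using u[of "xs @ ys" z y zs] len zs by simp
    also have "\<dots> = w (xs @ z # ys @ zs')"
      using Suc.prems(2)[of xs "ys @ [y]" zs z] len zs by simp
    finally show "u (xs @ ys @ z # zs') = w (xs @ z # ys @ zs')" .
  qed
  ultimately show ?case by (simp add: equation_minus_iff)
qed

text \<open>Antisymmetrised by \<open>alt\<close>, this is the expansion of a Pfaffian up to a
  factor, with entries that may fail to commute.\<close>

fun pairprod :: "(nat \<Rightarrow> nat \<Rightarrow> 'a::monoid_mult) \<Rightarrow> nat \<Rightarrow> nat list \<Rightarrow> 'a" where
  "pairprod g (Suc a) (i # j # l) = g i j * pairprod g a l"
| "pairprod g _ _ = 1"

lemma pairprod_0 [simp]: "pairprod g 0 l = 1"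
  by (cases l rule: remdups_adj.cases) auto

lemma pairprod_append:
  "length xs = 2 * a \<Longrightarrow> pairprod g (a + b) (xs @ ys) = pairprod g a xs * pairprod g b ys"
proof (induction a arbitrary: xs)
  case (Suc a)
  then obtain i j zs where "xs = i # j # zs" "length zs = 2 * a"
    by (metis (no_types, lifting) length_Suc_conv mult_Suc_right numeral_2_eq_2 plus_nat.simps)
  then show ?case using Suc.IH[of zs] by (simp add: mult.assoc)
qed auto

lemma pairprod_snoc:
  "length xs = 2 * a \<Longrightarrow> pairprod g (Suc a) (xs @ i # j # ys) = pairprod g a xs * g i j"
  using pairprod_append[of xs a g 1 "i # j # ys"] by simp

lemma pairprod_prefix: "length xs = 2 * a \<Longrightarrow> pairprod g a (xs @ ys) = pairprod g a xs"
  using pairprod_append[of xs a g 0 ys] by simp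

text \<open>Writing \<open>Z\<^sub>i = P z\<^sub>i P\<close>, the sums \<open>U a b\<close> interpolate between the scalar parts and the
  curvature parts of the commutators \<open>[Z\<^sub>i, Z\<^sub>j]\<close>; cyclicity kills every sum that
  still contains a factor \<open>Z\<^sub>i\<close>, because rotating an even number of positions is an odd permutation.\<close>
lemma alternating_trace_identity:
  fixes Z :: "nat \<Rightarrow> 'a::ring_1" and \<tau> :: "'a \<Rightarrow> complex" and H :: "nat \<Rightarrow> 'a \<Rightarrow> bool"
  assumes comm: "\<And>i j. Z i * Z j - Z j * Z i = c i j * P + F i j"
    and P: "P * P = P" "\<And>i. P * Z i = Z i" "\<And>i. Z i * P = Z i" "\<And>i j. F i j * P = F i j"
    and cen: "\<And>i j x. c i j * x = x * c i j"
    and \<tau>: "\<And>x y. \<tau> (x + y) = \<tau> x + \<tau> y"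
    and tr: "\<And>x y d e. H d x \<Longrightarrow> H e y \<Longrightarrow> d + e = 2 * n \<Longrightarrow> \<tau> (x * y) = \<tau> (y * x)"
    and H: "H 0 1" "\<And>i. H 1 (Z i)" "\<And>i j. H 2 (c i j)" "\<And>x y d e. H d x \<Longrightarrow> H e y \<Longrightarrow> H (d + e) (x * y)"
  shows "alt (2 * n) (\<lambda>l. \<tau> (P * pairprod F n l)) = (- 1) ^ n * alt (2 * n) (\<lambda>l. \<tau> (pairprod c n l * P))"
proof -
  \<comment> \<open>The first \<open>2a\<close> letters enter through scalar commutators, the next
    \<open>2b\<close> through curvatures, and the rest as plain factors \<open>Z\<close>.\<close>
  define W where "W a b l = pairprod c a l * P * pairprod F b (drop (2*a) l) * prod_list (map Z (drop (2*a + 2*b) l))" for a b l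
  define U where "U a b = alt (2 * n) (\<lambda>l. \<tau> (W a b l))" for a b
  have cc: "pairprod c a l * x = x * pairprod c a l" for a l x
  proof (induction a arbitrary: l)
    case (Suc a)
    show ?case
    proof (cases l rule: remdups_adj.cases)
      case (3 i j l')
      have "c i j * pairprod c a l' * x = c i j * x * pairprod c a l'"
        by (simp only: mult.assoc Suc.IH)
      also have "\<dots> = x * (c i j * pairprod c a l')"
        by (simp only: mult.assoc cen[of i j x])
      finally show ?thesis by (simp add: 3)
    qed simp_all
  qed simp
  have Hc: "H (2 * a) (pairprod c a l)" if "length l \<ge> 2 * a" for a l
    using that
  proof (induction a arbitrary: l)
    case (Suc a)
    then obtain i j l' where l: "l = i # j # l'" "length l' \<ge> 2 * a"
      by (cases l rule: remdups_adj.cases) auto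
    show ?case using H(4)[OF H(3) Suc.IH[OF l(2)], of i j] l by simp
  qed (use H(1) in simp)
  have HZ: "H (length l) (prod_list (map Z l))" for l
  proof (induction l)
    case (Cons i l)
    then show ?case using H(4)[OF H(2) Cons, of i] by simp
  qed (use H(1) in simp)
  have "pairprod F b l * P = pairprod F b l \<or> pairprod F b l = 1" for b l
  proof (induction b arbitrary: l)
    case (Suc b)
    show ?case
    proof (cases l rule: remdups_adj.cases)
      case (3 i j l')
      then show ?thesis using Suc.IH[of l'] by (auto simp: mult.assoc P)
    qed simp_all
  qed simp
  \<comment> \<open>An empty product is 1 and does not absorb \<open>P\<close> by itself; with
    \<open>P\<close> in front, both cases agree.\<close>
  then have PF: "P * pairprod F b l * P = P * pairprod F b l" for b l
    by (metis P(1) mult.assoc mult.right_neutral)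
  have zero: "U a 0 = 0" if a: "a < n" for a
  proof -
    let ?w = "\<lambda>l. \<tau> (W a 0 l)"
    have W0: "W a 0 (xs @ z # ys) = pairprod c a xs * (Z z * prod_list (map Z ys))"
      if "length xs = 2 * a" for xs z ys
    proof -
      have "W a 0 (xs @ z # ys) = pairprod c a xs * ((P * Z z) * prod_list (map Z ys))"
        using that by (simp add: W_def pairprod_prefix mult.assoc)
      then show ?thesis by (simp add: P)
    qed
    have W1: "W a 0 (xs @ ys @ [z]) = pairprod c a xs * (prod_list (map Z ys) * Z z)"
      if xs: "length xs = 2 * a" for xs z ys
    proof (cases ys)
      case Nil
      then show ?thesis using W0[OF xs, of z "[]"] by simp
    next
      case (Cons y ys')
      then show ?thesis using W0[OF xs, of y "ys' @ [z]"] by (simp add: mult.assoc)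
    qed
    \<comment> \<open>Of the \<open>2 (n - a)\<close> letters in plain factors the last is moved to
      the front of them, past an odd number of others. The scalar factors are central, so cyclicity
      leaves the trace unchanged while the alternating sum changes sign.\<close>
    have "alt (2 * n) ?w = (- 1) ^ (2 * (n - a) - 1) * alt (2 * n) ?w"
    proof (rule alt_move[of "2 * a" _ 0])
      show "2 * a + (2 * (n - a) - 1) + 1 + 0 = 2 * n" using a by simp
      fix xs ys zs :: "nat list" and z
      assume len: "length xs = 2 * a" "length ys = 2 * (n - a) - 1" "length zs = 0"
      let ?C = "pairprod c a xs" and ?R = "prod_list (map Z ys)"
      have "\<tau> (Z z * (?C * ?R)) = \<tau> ((?C * ?R) * Z z)"
      proof (rule tr)
        show "H 1 (Z z)" by (rule H(2))
        show "H (2 * a + length ys) (?C * ?R)" by (rule H(4)[OF Hc HZ]) (use len in simp)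
        show "1 + (2 * a + length ys) = 2 * n" using len a by simp
      qed
      moreover have "Z z * (?C * ?R) = ?C * (Z z * ?R)" by (metis cc mult.assoc)
      ultimately show "\<tau> (W a 0 (xs @ ys @ z # zs)) = \<tau> (W a 0 (xs @ z # ys @ zs))"
        using len W0[OF len(1), of z ys] W1[OF len(1), of ys z] by (simp add: mult.assoc)
    qed
    moreover have "odd (2 * (n - a) - 1)" using a by simp
    ultimately show ?thesis unfolding U_def by simp
  qed
  \<comment> \<open>Under alternation a product \<open>Z_i Z_j\<close> counts as half its
    commutator, and the commutator splits into a scalar and a curvature part. The hypothesis
    \<open>comm\<close> is applied to the first two plain factors.\<close>
  have rec: "2 * U a b = U (Suc a) b + U a (Suc b)" if ab: "a + b < n" for a b
  proof -
    let ?X = "\<lambda>l. pairprod c a l * P * pairprod F b (drop (2*a) l)"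
    let ?i = "\<lambda>l. l ! (2*a + 2*b)" and ?j = "\<lambda>l. l ! Suc (2*a + 2*b)"
    let ?R = "\<lambda>l. prod_list (map Z (drop (2*a + 2*b + 2) l))"
    define V where "V l = \<tau> (?X l * (Z (?j l) * Z (?i l)) * ?R l)" for l
    define Vc where "Vc l = \<tau> (?X l * (c (?i l) (?j l) * P) * ?R l)" for l
    have lX: "?X (xs @ ys) = ?X xs" if "length xs = 2 * a + 2 * b" for xs ys
    proof -
      have e: "xs @ ys = take (2*a) xs @ (drop (2*a) xs @ ys)" by simp
      have "pairprod c a (xs @ ys) = pairprod c a (take (2*a) xs)"
        unfolding e by (rule pairprod_prefix) (use that in simp)
      moreover have "pairprod c a xs = pairprod c a (take (2*a) xs)"
        using pairprod_prefix[of "take (2*a) xs" a c "drop (2*a) xs"] that by simp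
      moreover have "pairprod F b (drop (2*a) (xs @ ys)) = pairprod F b (drop (2*a) xs)"
        using pairprod_prefix[of "drop (2*a) xs" b F ys] that by simp
      ultimately show ?thesis by simp
    qed
    have "alt (2 * n) V = - U a b"
      unfolding U_def
    proof (rule alt_swap[of "replicate (2*a+2*b) 0" "2*(n-a-b) - 2"])
      show "length (replicate (2*a+2*b) (0::nat)) + 2 + (2*(n-a-b) - 2) = 2 * n" using ab by simp
      fix xs zs :: "nat list" and x y
      assume len: "length xs = length (replicate (2*a+2*b) (0::nat))"
      then show "V (xs @ x # y # zs) = \<tau> (W a b (xs @ y # x # zs))"
        using lX[of xs "x # y # zs"] lX[of xs "y # x # zs"]
        by (simp add: V_def W_def nth_append mult.assoc)
    qed
    moreover have "U a b = (U a (Suc b) + alt (2*n) Vc) + alt (2*n) V"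
    proof -
      have "U a b = alt (2*n) (\<lambda>l. (\<tau> (W a (Suc b) l) + Vc l) + V l)"
        unfolding U_def
      proof (rule alt_cong)
        fix l :: "nat list" assume l: "length l = 2 * n"
        let ?xs = "take (2*a+2*b) l" and ?zs = "drop (2*a+2*b+2) l"
        have dl: "drop (2*a+2*b) l = ?i l # ?j l # ?zs"
          using l ab by (simp add: Cons_nth_drop_Suc)
        have 1: "W a b l = ?X l * (Z (?i l) * Z (?j l)) * ?R l"
          by (simp add: W_def dl mult.assoc)
        have 2: "Z (?i l) * Z (?j l) = c (?i l) (?j l) * P + F (?i l) (?j l) + Z (?j l) * Z (?i l)"
          using comm[of "?i l" "?j l"] by (simp add: algebra_simps)
        have 3: "W a (Suc b) l = ?X l * F (?i l) (?j l) * ?R l"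
        proof -
          have "length (take (2*b) (drop (2*a) l)) = 2 * b" using l ab by simp
          moreover have "drop (2*a) l = take (2*b) (drop (2*a) l) @ ?i l # ?j l # ?zs"
            using dl by (metis append_take_drop_id drop_drop add.commute)
          ultimately have "pairprod F (Suc b) (drop (2*a) l) = pairprod F b (drop (2*a) l) * F (?i l) (?j l)"
            using pairprod_snoc pairprod_prefix by metis
          then show ?thesis by (simp add: W_def mult.assoc add.assoc)
        qed
        have "W a b l = W a (Suc b) l + ?X l * (c (?i l) (?j l) * P) * ?R l + ?X l * (Z (?j l) * Z (?i l)) * ?R l"
          unfolding 1 2 3 by (simp only: distrib_left distrib_right add_ac)
        then show "\<tau> (W a b l) = (\<tau> (W a (Suc b) l) + Vc l) + V l"
          by (simp only: V_def Vc_def \<tau>)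
      qed
      then show ?thesis by (simp add: alt_add U_def)
    qed
    moreover have "alt (2*n) Vc = U (Suc a) b"
    proof -
      \<comment> \<open>The new scalar commutator stands behind \<open>b\<close> curvatures. Its two
        letters are moved in front of them one after the other; each crosses \<open>2b\<close>
        letters, so no sign arises.\<close>
      define V1 where "V1 l = \<tau> (pairprod c a l * P * pairprod F b (drop (Suc (2*a)) l) *
         (c (l ! (2*a)) (?j l) * P) * ?R l)" for l
      have "alt (2*n) Vc = (- 1) ^ (2*b) * alt (2*n) V1"
      proof (rule alt_move[of "2*a" _ "2*n - 2*a - 2*b - 1"])
        show "2*a + 2*b + 1 + (2*n - 2*a - 2*b - 1) = 2*n" using ab by simp
        fix xs ys zs' :: "nat list" and z
        assume len: "length xs = 2*a" "length ys = 2*b" "length zs' = 2*n - 2*a - 2*b - 1"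
        then obtain y zs where "zs' = y # zs" using ab by (cases zs') auto
        then show "Vc (xs @ ys @ z # zs') = V1 (xs @ z # ys @ zs')"
          using len by (simp add: Vc_def V1_def nth_append pairprod_prefix)
      qed
      also have "alt (2*n) V1 = (- 1) ^ (2*b) * alt (2*n) (\<lambda>l. \<tau> (W (Suc a) b l))"
      proof (rule alt_move[of "Suc (2*a)" _ "2*n - 2*a - 2*b - 2"])
        show "Suc (2*a) + 2*b + 1 + (2*n - 2*a - 2*b - 2) = 2*n" using ab by simp
        fix xs ys zs :: "nat list" and z
        assume len: "length xs = Suc (2*a)" "length ys = 2*b"
        then obtain ws x where xs: "xs = ws @ [x]" "length ws = 2*a" by (metis length_Suc_conv_rev)
        have "pairprod c (Suc a) (ws @ x # z # ys @ zs) = pairprod c a ws * c x z"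
          by (rule pairprod_snoc[OF xs(2)])
        then have "W (Suc a) b (xs @ z # ys @ zs) = pairprod c a ws * (c x z * (P * pairprod F b ys)) * prod_list (map Z zs)"
          using len xs by (simp add: W_def pairprod_prefix mult.assoc)
        also have "\<dots> = pairprod c a ws * (P * pairprod F b ys * P * c x z) * prod_list (map Z zs)"
          by (simp only: PF cen[of x z "P * pairprod F b ys"])
        also have "\<dots> = pairprod c a ws * P * pairprod F b ys * (c x z * P) * prod_list (map Z zs)"
          by (simp only: mult.assoc cen[of x z P])
        finally show "V1 (xs @ ys @ z # zs) = \<tau> (W (Suc a) b (xs @ z # ys @ zs))"
          using len xs by (simp add: V1_def nth_append pairprod_prefix mult.assoc)
      qed
      finally show ?thesis by (simp add: U_def)
    qed
    ultimately show ?thesis by simp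
  qed
  \<comment> \<open>By the recursion \<open>U a (Suc b)\<close> is
    \<open>2 * U a b - U (Suc a) b\<close>, so vanishing propagates from \<open>b = 0\<close> as
    long as a plain factor is left.\<close>
  have U0: "U a b = 0" if "a + b < n" for a b
    using that
  proof (induction b arbitrary: a)
    case (Suc b)
    then show ?case using rec[of a b] Suc.IH[of a] Suc.IH[of "Suc a"] by simp
  qed (use zero in simp)
  \<comment> \<open>When \<open>a + b = n - 1\<close> the left side of the recursion is 0, so on the
    diagonal \<open>a + b = n\<close> trading a scalar pair for a curvature pair changes the
    sign.\<close>
  have "U (n - b) b = (- 1) ^ b * U n 0" if "b \<le> n" for b
    using that
  proof (induction b)
    case (Suc b)
    then have "Suc (n - Suc b) = n - b" by simp
    then show ?case using rec[of "n - Suc b" b] U0[of "n - Suc b" b] Suc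
      by (simp add: eq_neg_iff_add_eq_0 add.commute)
  qed simp
  from this[of n] have "U 0 n = (- 1) ^ n * U n 0" by simp
  moreover have "U 0 n = alt (2 * n) (\<lambda>l. \<tau> (P * pairprod F n l))"
    unfolding U_def by (rule alt_cong) (simp add: W_def)
  moreover have "U n 0 = alt (2 * n) (\<lambda>l. \<tau> (pairprod c n l * P))"
    unfolding U_def by (rule alt_cong) (simp add: W_def)
  ultimately show ?thesis by simp
qed

section \<open>Null directions and the symplectic constant\<close>

text \<open>After the substitution the letters \<open>i\<close> and \<open>k\<close> look the same.
  Exchanging them beforehand changes no word but reverses the sign, so the sum is its own
  negative.\<close>

lemma alt_repeated:
  fixes w :: "nat list \<Rightarrow> 'a::real_algebra_1"
  assumes "i < n" "k < n" "i \<noteq> k"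
  shows "alt n (\<lambda>l. w (map (id(k := i)) l)) = 0"
proof -
  let ?q = "Transposition.transpose i k"
  have "alt n (\<lambda>l. w (map (id(k := i)) l)) = of_int (sign ?q) * alt n (\<lambda>l. w (map (id(k := i)) l))"
  proof (rule alt_compose_left)
    show "?q permutes {..<n}" using assms by (auto intro: permutes_swap_id)
    fix p :: "nat \<Rightarrow> nat"
    have "(id(k := i)) (?q x) = (id(k := i)) x" for x using assms by (auto simp: Transposition.transpose_def)
    then show "w (map (id(k := i)) (map p [0..<n])) = w (map (id(k := i)) (map (?q \<circ> p) [0..<n]))"
      by (simp add: comp_def)
  qed
  then have "alt n (\<lambda>l. w (map (id(k := i)) l)) = - alt n (\<lambda>l. w (map (id(k := i)) l))"
    using assms by (simp add: sign_swap_id)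
  then have "(2::real) *\<^sub>R alt n (\<lambda>l. w (map (id(k := i)) l)) = 0"
    by (metis add.right_inverse scaleR_2)
  then show ?thesis by simp
qed

text \<open>The letter \<open>k\<close> occurs exactly once, so the substitution touches a single
  factor \<open>f\<close>. There the sum over \<open>i\<close> is the contraction with the null
  vector \<open>e\<close>, and \<open>e\<close> passes the other factors because it is
  central.\<close>

lemma pairprod_null_direction:
  fixes f :: "nat \<Rightarrow> nat \<Rightarrow> 'a::ring_1"
  assumes cen: "\<And>i x. e i * x = x * e i"
    and l: "\<And>j. (\<Sum>i<m. e i * f i j) = 0" and r: "\<And>i. (\<Sum>j<m. e j * f i j) = 0"
  shows "distinct xs \<Longrightarrow> k \<in> set xs \<Longrightarrow> length xs = 2 * n \<Longrightarrow> (\<Sum>i<m. e i * pairprod f n (map (id(k := i)) xs)) = 0"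
proof (induction n arbitrary: xs)
  case (Suc n)
  then obtain x y ys where xs: "xs = x # y # ys"
    by (metis (no_types, lifting) length_Suc_conv mult_Suc_right numeral_2_eq_2 plus_nat.simps)
  have fresh: "map (\<lambda>a. if a = k then i else a) ys = ys" if "k \<notin> set ys" for i
    using that by (auto intro: map_idI)
  consider "x = k" | "y = k" "x \<noteq> k" | "k \<in> set ys" "x \<noteq> k" "y \<noteq> k"
    using Suc.prems xs by auto
  then show ?case
  proof cases
    case 1
    then have "k \<notin> set ys" "y \<noteq> k" using Suc.prems xs by auto
    then show ?thesis using 1 l[of y] by (simp add: xs fresh mult.assoc[symmetric] flip: sum_distrib_right)
  next
    case 2
    then have "k \<notin> set ys" using Suc.prems xs by auto
    then show ?thesis using 2 r[of x] by (simp add: xs fresh mult.assoc[symmetric] flip: sum_distrib_right)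
  next
    case 3
    have "(\<Sum>i<m. e i * pairprod f n (map (id(k := i)) ys)) = 0"
      by (rule Suc.IH) (use Suc.prems xs 3 in auto)
    moreover have "e i * (f x y * q) = f x y * (e i * q)" for i q
      by (metis cen mult.assoc)
    ultimately show ?thesis using 3 by (simp add: xs fun_upd_def id_def flip: sum_distrib_left)
  qed
qed auto

text \<open>This is the argument that a skew matrix with a null vector has vanishing Pfaffian.
  Contracting the place of the letter \<open>k\<close> with \<open>e\<close> gives 0; by
  \<open>alt_repeated\<close> only the summand \<open>i = k\<close> of that contraction survives,
  and it is \<open>e k\<close> times the alternating sum.\<close>

lemma alt_pairprod_null_direction:
  fixes f :: "nat \<Rightarrow> nat \<Rightarrow> 'a::real_algebra_1"
  assumes cen: "\<And>i x. e i * x = x * e i"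
    and l: "\<And>j. (\<Sum>i<2*n. e i * f i j) = 0" and r: "\<And>i. (\<Sum>j<2*n. e j * f i j) = 0"
    and k: "k < 2 * n"
  shows "e k * alt (2 * n) (pairprod f n) = 0"
proof -
  have "0 = alt (2 * n) (\<lambda>l. \<Sum>i<2*n. e i * pairprod f n (map (id(k := i)) l))"
  proof -
    have "alt (2 * n) (\<lambda>l. \<Sum>i<2*n. e i * pairprod f n (map (id(k := i)) l)) = alt (2 * n) (\<lambda>l. 0)"
      by (rule alt_cong, rule pairprod_null_direction[OF cen l r]) (use k in auto)
    then show ?thesis by (simp add: alt_def)
  qed
  also have "\<dots> = (\<Sum>i<2*n. alt (2 * n) (\<lambda>l. e i * pairprod f n (map (id(k := i)) l)))"
    by (rule alt_sum)
  also have "\<dots> = (\<Sum>i<2*n. e i * alt (2 * n) (\<lambda>l. pairprod f n (map (id(k := i)) l)))"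
  proof (rule sum.cong[OF refl])
    fix i
    have "of_int s * (e i * q) = e i * (of_int s * q)" for s q
      by (metis cen mult.assoc)
    then show "alt (2 * n) (\<lambda>l. e i * pairprod f n (map (id(k := i)) l)) = e i * alt (2 * n) (\<lambda>l. pairprod f n (map (id(k := i)) l))"
      by (simp add: alt_def sum_distrib_left)
  qed
  also have "\<dots> = (\<Sum>i<2*n. if i = k then e i * alt (2 * n) (pairprod f n) else 0)"
  proof (rule sum.cong[OF refl])
    fix i assume "i \<in> {..<2*n}"
    then show "e i * alt (2 * n) (\<lambda>l. pairprod f n (map (id(k := i)) l)) = (if i = k then e i * alt (2 * n) (pairprod f n) else 0)"
      using alt_repeated[of i "2*n" k "pairprod f n"] k by (auto simp: fun_upd_idem)
  qed
  also have "\<dots> = e k * alt (2 * n) (pairprod f n)" using k by simp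
  finally show ?thesis by simp
qed

definition sympl :: "nat \<Rightarrow> nat \<Rightarrow> int" where
  "sympl i j = (if even i \<and> j = Suc i then 1 else if even j \<and> i = Suc j then -1 else 0)"

text \<open>In a nonzero term every pair consists of an even number and its successor, in some
  order. Exchanging whole pairs is an even permutation, so the sign only counts the reversed pairs,
  and so does the product.\<close>

lemma sympl_pairprod_sign:
  "p permutes {..<2*n} \<Longrightarrow> sign p * pairprod sympl n (map p [0..<2*n]) \<ge> 0"
proof (induction n arbitrary: p)
  case (Suc n)
  have "length (map p [0..<2*n]) = 2*n" for p :: "nat \<Rightarrow> nat" by simp
  then have snoc: "pairprod sympl (Suc n) (map p [0..<2 * Suc n]) = pairprod sympl n (map p [0..<2*n]) * sympl (p (2*n)) (p (Suc (2*n)))"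
    for p using pairprod_snoc[of "map p [0..<2*n]" n sympl "p (2*n)" "p (Suc (2*n))" "[]"] by simp
  show ?case
  proof (cases "sympl (p (2*n)) (p (Suc (2*n))) = 0")
    case True
    then show ?thesis by (simp only: snoc)
  next
    case False
    define j where "j = min (p (2*n)) (p (Suc (2*n)))"
    have j: "even j" "{p (2*n), p (Suc (2*n))} = {j, Suc j}"
      using False by (auto simp: sympl_def j_def split: if_splits)
    have "p (2*n) < 2 * Suc n" "p (Suc (2*n)) < 2 * Suc n"
      using permutes_in_image[OF Suc.prems, of "2*n"] permutes_in_image[OF Suc.prems, of "Suc (2*n)"] by auto
    then have jn: "j \<le> 2 * n" using j by (auto simp: j_def)
    let ?t = "Transposition.transpose j (2*n)" and ?u = "Transposition.transpose (Suc j) (Suc (2*n))"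
    \<comment> \<open>Exchanges the pair of \<open>j\<close> and \<open>Suc j\<close> with the last
      pair. It is a product of two transpositions, both trivial when \<open>j = 2 * n\<close>, and
      therefore even.\<close>
    define q where "q = ?t \<circ> ?u"
    have tu: "?t permutes {..<2 * Suc n}" "?u permutes {..<2 * Suc n}"
      using jn by (auto intro!: permutes_swap_id)
    have q: "q permutes {..<2 * Suc n}" unfolding q_def by (rule permutes_compose[OF tu(2,1)])
    have "sign q = sign ?t * sign ?u" unfolding q_def
      by (rule sign_compose) (rule permutation_swap_id)+
    then have sq: "sign q = 1" by (cases "j = 2 * n") (simp_all add: sign_swap_id)
    have qJ: "sympl (q x) (q y) = sympl x y" for x y
    proof (cases "j = 2 * n")
      case True
      then show ?thesis by (simp add: q_def)
    next
      case ne: False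
      have qx: "q x = (if x = j then 2*n else if x = Suc j then Suc (2*n) else if x = 2*n then j else if x = Suc (2*n) then Suc j else x)" for x
        using ne j(1) by (auto simp: q_def Transposition.transpose_def)
      from j(1) obtain m where m: "j = 2 * m" by (rule evenE)
      have e: "even (q x) = even x" for x by (simp add: qx m)
      have s: "q (Suc x) = Suc (q x)" if "even x" for x
      proof -
        from that obtain k where "x = 2 * k" by (rule evenE)
        then show ?thesis by (simp add: qx m)
      qed
      have "even x \<and> q y = Suc (q x) \<longleftrightarrow> even x \<and> y = Suc x" for x y
        using s[of x] permutes_inj[OF q, THEN inj_eq, of y "Suc x"] by auto
      from this[of x y] this[of y x] show ?thesis unfolding sympl_def e by auto
    qed
    have qj: "q j = 2*n" "q (Suc j) = Suc (2*n)"
      using j(1) by (auto simp: q_def Transposition.transpose_def)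
    define p1 where "p1 = q \<circ> p"
    have p1: "p1 permutes {..<2 * Suc n}" unfolding p1_def by (rule permutes_compose[OF Suc.prems q])
    have sp1: "sign p1 = sign p"
      unfolding p1_def using sign_compose[of q p] sq q Suc.prems permutes_imp_permutation[of "{..<2 * Suc n}"] by simp
    have pp: "pairprod sympl m (map q l) = pairprod sympl m l" for m l
      by (induction sympl m l rule: pairprod.induct) (simp_all add: qJ)
    have pp1: "pairprod sympl (Suc n) (map p1 [0..<2 * Suc n]) = pairprod sympl (Suc n) (map p [0..<2 * Suc n])"
      using pp[of "Suc n" "map p [0..<2 * Suc n]"] by (simp add: p1_def)
    have res: "r permutes {..<2*n}" if "r permutes {..<2 * Suc n}" "r (2*n) = 2*n" "r (Suc (2*n)) = Suc (2*n)" for r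
      by (rule permutes_superset[OF that(1)]) (use that in \<open>auto simp: less_Suc_eq\<close>)
    have "p1 (2*n) = 2*n \<and> p1 (Suc (2*n)) = Suc (2*n) \<or> p1 (2*n) = Suc (2*n) \<and> p1 (Suc (2*n)) = 2*n"
      using j(2) qj by (auto simp: p1_def doubleton_eq_iff)
    then have "sign p1 * pairprod sympl (Suc n) (map p1 [0..<2 * Suc n]) \<ge> 0"
    proof
      assume *: "p1 (2*n) = 2*n \<and> p1 (Suc (2*n)) = Suc (2*n)"
      then have "sign p1 * pairprod sympl n (map p1 [0..<2*n]) \<ge> 0"
        by (intro Suc.IH res p1) auto
      then show ?thesis using * unfolding snoc by (simp add: sympl_def)
    next
      \<comment> \<open>The last pair is reversed. Composing with the transposition of the last two
        positions flips the sign of the permutation, which matches the factor -1 of that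
        pair.\<close>
      assume *: "p1 (2*n) = Suc (2*n) \<and> p1 (Suc (2*n)) = 2*n"
      let ?v = "Transposition.transpose (2*n) (Suc (2*n))"
      have v: "?v permutes {..<2 * Suc n}" by (auto intro!: permutes_swap_id)
      have "sign (p1 \<circ> ?v) * pairprod sympl n (map (p1 \<circ> ?v) [0..<2*n]) \<ge> 0"
        by (intro Suc.IH res permutes_compose[OF v p1]) (use * in auto)
      moreover have "map (p1 \<circ> ?v) [0..<2*n] = map p1 [0..<2*n]" by (auto simp: Transposition.transpose_def)
      moreover have "sign (p1 \<circ> ?v) = - sign p1"
        using sign_compose[of p1 ?v] p1 permutes_imp_permutation[of "{..<2 * Suc n}"]
        by (simp add: sign_swap_id permutation_swap_id)
      ultimately show ?thesis using * unfolding snoc by (simp add: sympl_def)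
    qed
    then show ?thesis by (simp only: pp1 sp1)
  qed
qed simp

lemma alt_sympl_pos: "alt (2*n) (pairprod sympl n) > (0::int)"
proof -
  let ?f = "\<lambda>p. sign p * pairprod sympl n (map p [0..<2*n])"
  have "pairprod sympl n [0..<2*n] = 1"
  proof (induction n)
    case (Suc n)
    moreover have "sympl (2*n) (Suc (2*n)) = 1" by (simp add: sympl_def)
    ultimately show ?case using pairprod_snoc[of "[0..<2*n]" n sympl "2*n" "Suc (2*n)" "[]"] by simp
  qed simp
  then have "1 = ?f id" by simp
  also have "\<dots> \<le> (\<Sum>p | p permutes {..<2*n}. ?f p)"
    by (rule member_le_sum) (use sympl_pairprod_sign finite_permutations permutes_id in \<open>auto simp: id_def\<close>)
  also have "\<dots> = alt (2*n) (pairprod sympl n)" by (simp add: alt_def)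
  finally show ?thesis by simp
qed

section \<open>The formal Leibniz product\<close>

text \<open>Extensional representation: the junk value at the origin is fixed to \<open>0\<close>.\<close>
typedef ('n::finite, 'q::finite) sym =
  "{f :: ('n, 'q) symbol. smooth_on (UNIV - {0}) f \<and> f 0 = 0}"
  morphisms val Sym
  by (rule exI[of _ "\<lambda>z. 0"]) simp

setup_lifting type_definition_sym

lemma open_punct: "open (UNIV - {0::'a::real_normed_vector})"
  by (simp add: open_delete)

lemma bounded_bilinear_matrix_mult: "bounded_bilinear ((**) :: complex^'q^'q \<Rightarrow> complex^'q^'q \<Rightarrow> complex^'q^'q)"
proof (rule bilinear_conv_bounded_bilinear[THEN iffD1])
  show "bilinear ((**) :: complex^'q^'q \<Rightarrow> complex^'q^'q \<Rightarrow> complex^'q^'q)"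
    unfolding bilinear_def
    by (auto intro!: linearI simp: matrix_matrix_mult_def vec_eq_iff sum.distrib distrib_left distrib_right scaleR_sum_right)
qed

definition mscale :: "complex \<Rightarrow> complex^'q^'q \<Rightarrow> complex^'q^'q" where
  "mscale c A = (\<chi> i j. c * A $ i $ j)"

lemma bounded_linear_mscale: "bounded_linear (mscale c)"
proof (rule linear_conv_bounded_linear[THEN iffD1])
  show "linear (mscale c)"
    by (auto intro!: linearI simp: mscale_def vec_eq_iff distrib_left)
qed

instantiation sym :: (finite, finite) real_algebra_1
begin

lift_definition zero_sym :: "('a, 'b) sym" is "\<lambda>z. 0" by simp
lift_definition one_sym :: "('a, 'b) sym" is "\<lambda>z. if z = 0 then 0 else mat 1"
  by (simp add: smooth_on_cong[OF open_punct, where f="\<lambda>z. mat 1"])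
lift_definition plus_sym :: "('a, 'b) sym \<Rightarrow> ('a, 'b) sym \<Rightarrow> ('a, 'b) sym" is "\<lambda>f g z. f z + g z"
  by (simp add: smooth_on_add[OF open_punct])
lift_definition uminus_sym :: "('a, 'b) sym \<Rightarrow> ('a, 'b) sym" is "\<lambda>f z. - f z"
  by (simp add: smooth_on_bounded_linear[OF open_punct bounded_linear_minus[OF bounded_linear_ident]])
lift_definition scaleR_sym :: "real \<Rightarrow> ('a, 'b) sym \<Rightarrow> ('a, 'b) sym" is "\<lambda>r f z. r *\<^sub>R f z"
  by (simp add: smooth_on_bounded_linear[OF open_punct bounded_linear_scaleR_right])
lift_definition times_sym :: "('a, 'b) sym \<Rightarrow> ('a, 'b) sym \<Rightarrow> ('a, 'b) sym" is "\<lambda>f g z. f z ** g z"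
proof
  fix f g :: "('a, 'b) symbol"
  assume "smooth_on (UNIV - {0}) f \<and> f 0 = 0" "smooth_on (UNIV - {0}) g \<and> g 0 = 0"
  then show "smooth_on (UNIV - {0}) (\<lambda>z. f z ** g z)" "f 0 ** g 0 = 0"
    by (simp_all add: smooth_on_bilinear[OF open_punct bounded_bilinear_matrix_mult])
qed
definition minus_sym :: "('a, 'b) sym \<Rightarrow> ('a, 'b) sym \<Rightarrow> ('a, 'b) sym" where "minus_sym a b = a + - b"

instance
proof
  note mm = matrix_add_ldistrib matrix_mul_assoc
  fix a b c :: "('a, 'b) sym" and r s :: real
  show "a + b + c = a + (b + c)" by transfer (simp add: add.assoc)
  show "a + b = b + a" by transfer (simp add: add.commute)
  show "0 + a = a" by transfer simp
  show "- a + a = 0" by transfer simp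
  show "a - b = a + - b" by (rule minus_sym_def)
  show "r *\<^sub>R (a + b) = r *\<^sub>R a + r *\<^sub>R b" by transfer (simp add: scaleR_add_right)
  show "(r + s) *\<^sub>R a = r *\<^sub>R a + s *\<^sub>R a" by transfer (simp add: scaleR_add_left)
  show "r *\<^sub>R s *\<^sub>R a = (r * s) *\<^sub>R a" by transfer simp
  show "1 *\<^sub>R a = a" by transfer simp
  show "a * b * c = a * (b * c)" by transfer (simp add: matrix_mul_assoc)
  show "(a + b) * c = a * c + b * c"
    by transfer (auto simp: fun_eq_iff bounded_bilinear.add_left[OF bounded_bilinear_matrix_mult])
  show "a * (b + c) = a * b + a * c"
    by transfer (auto simp: fun_eq_iff bounded_bilinear.add_right[OF bounded_bilinear_matrix_mult])
  show "r *\<^sub>R a * b = r *\<^sub>R (a * b)"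
    by transfer (auto simp: fun_eq_iff bounded_bilinear.scaleR_left[OF bounded_bilinear_matrix_mult])
  show "a * r *\<^sub>R b = r *\<^sub>R (a * b)"
    by transfer (auto simp: fun_eq_iff bounded_bilinear.scaleR_right[OF bounded_bilinear_matrix_mult])
  show "1 * a = a" by transfer (auto simp: fun_eq_iff)
  show "a * 1 = a" by transfer (auto simp: fun_eq_iff)
  show "(0::('a, 'b) sym) \<noteq> 1"
  proof transfer
    have "(axis undefined 1 :: real^'a, 0::real^'a) \<noteq> 0" by (simp add: prod_eq_iff axis_eq_0_iff)
    moreover have "(mat 1 :: complex^'b^'b) \<noteq> 0" by (auto simp: mat_def vec_eq_iff)
    ultimately show "(\<lambda>z::(real^'a) \<times> (real^'a). 0 :: complex^'b^'b) \<noteq> (\<lambda>z. if z = 0 then 0 else mat 1)"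
      by metis
  qed
qed

end

lemma val_add: "val (a + b) z = val a z + val b z" by transfer simp
lemma val_mult: "val (a * b) z = val a z ** val b z" by transfer simp
lemma val_0: "val 0 z = 0" by transfer simp
lemma val_at_0: "val a 0 = 0" by transfer simp
lemma val_scaleR: "val (r *\<^sub>R a) z = r *\<^sub>R val a z" by transfer simp
lemma val_uminus: "val (- a) z = - val a z" by transfer simp
lemma val_sum: "val (\<Sum>i\<in>I. a i) z = (\<Sum>i\<in>I. val (a i) z)"
  by (induction I rule: infinite_finite_induct) (auto simp: val_add val_0)
lemma val_smooth: "smooth_on (UNIV - {0}) (val a)" by transfer simp
lemma val_diff: "z \<noteq> 0 \<Longrightarrow> val a differentiable at z" by (rule smooth_on_diff[OF val_smooth]) simp
lemma sym_eqI: "(\<And>z. z \<noteq> 0 \<Longrightarrow> val a z = val b z) \<Longrightarrow> a = b"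
proof -
  assume *: "\<And>z. z \<noteq> 0 \<Longrightarrow> val a z = val b z"
  have "val a = val b"
  proof
    fix z show "val a z = val b z" by (cases "z = 0") (simp_all add: val_at_0 *)
  qed
  then show "a = b" by (simp add: val_inject)
qed

text \<open>\<open>sym\<close> is an algebra over the reals; complex scalars, in particular the
  factors \<open>\<i>\<close> of the Leibniz product, act through this map.\<close>

lift_definition csc :: "complex \<Rightarrow> ('n::finite, 'q::finite) sym \<Rightarrow> ('n, 'q) sym" is "\<lambda>c f z. mscale c (f z)"
  by (simp add: smooth_on_bounded_linear[OF open_punct bounded_linear_mscale]) (simp add: mscale_def vec_eq_iff)

lemma val_csc: "val (csc c a) z = mscale c (val a z)" by transfer simp

lemma csc_add: "csc c (a + b) = csc c a + csc c b"
  by (rule sym_eqI) (simp add: val_csc val_add mscale_def vec_eq_iff distrib_left)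
lemma csc_mult_left: "csc c a * b = csc c (a * b)"
  by (rule sym_eqI) (simp add: val_csc val_mult mscale_def vec_eq_iff matrix_matrix_mult_def sum_distrib_left mult.assoc)
lemma csc_mult_right: "a * csc c b = csc c (a * b)"
  by (rule sym_eqI) (simp add: val_csc val_mult mscale_def vec_eq_iff matrix_matrix_mult_def sum_distrib_left mult.left_commute)
lemma csc_csc: "csc c (csc d a) = csc (c * d) a"
  by (rule sym_eqI) (simp add: val_csc mscale_def vec_eq_iff mult.assoc)

text \<open>\<open>smooth_on\<close> speaks of basis directions, so these are the ones for which the
  derivative stays in the type. Setting the others to 0 makes the derivation and commutation rules
  hold for every \<open>v\<close>.\<close>

lift_definition pd :: "(real^'n::finite) \<times> (real^'n) \<Rightarrow> ('n, 'q::finite) sym \<Rightarrow> ('n, 'q) sym" is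
  "\<lambda>v f z. if v \<in> Basis \<and> z \<noteq> 0 then dd v f z else 0"
proof
  fix v :: "(real^'n) \<times> (real^'n)" and f :: "('n, 'q) symbol" assume "smooth_on (UNIV - {0}) f \<and> f 0 = 0"
  then have f: "smooth_on (UNIV - {0}) f" by simp
  show "smooth_on (UNIV - {0}) (\<lambda>z. if v \<in> Basis \<and> z \<noteq> 0 then dd v f z else 0)"
  proof (cases "v \<in> Basis")
    case True
    show ?thesis by (rule smooth_on_cong[OF open_punct _ smooth_on_dd[OF f True]]) (simp add: True)
  qed simp
qed simp

lemma val_pd: "v \<in> Basis \<Longrightarrow> z \<noteq> 0 \<Longrightarrow> val (pd v a) z = dd v (val a) z"
  by transfer simp

lemma val_pd': "val (pd v a) z = (if v \<in> Basis \<and> z \<noteq> 0 then dd v (val a) z else 0)"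
  by transfer simp

lemma pd_add: "pd v (a + b) = pd v a + pd v b"
proof (rule sym_eqI)
  fix z :: "(real^'a) \<times> (real^'a)" assume z: "z \<noteq> 0"
  have "val (a + b) = (\<lambda>z. val a z + val b z)" by (rule ext) (rule val_add)
  then show "val (pd v (a + b)) z = val (pd v a + pd v b) z"
    using dd_add[OF val_diff[OF z] val_diff[OF z], of v a b] by (simp add: val_pd' val_add)
qed

lemma pd_mult: "pd v (a * b) = pd v a * b + a * pd v b"
proof (rule sym_eqI)
  fix z :: "(real^'a) \<times> (real^'a)" assume z: "z \<noteq> 0"
  have "val (a * b) = (\<lambda>z. val a z ** val b z)" by (rule ext) (rule val_mult)
  moreover have "(0::complex^'b^'b) ** A = 0" "A ** (0::complex^'b^'b) = 0" for A
    by (simp_all add: matrix_matrix_mult_def vec_eq_iff)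
  ultimately show "val (pd v (a * b)) z = val (pd v a * b + a * pd v b) z"
    using dd_bilinear[OF bounded_bilinear_matrix_mult val_diff[OF z] val_diff[OF z], of v a b]
    by (simp add: val_pd' val_add val_mult)
qed

lemma pd_csc: "pd v (csc c a) = csc c (pd v a)"
proof (rule sym_eqI)
  fix z :: "(real^'a) \<times> (real^'a)" assume z: "z \<noteq> 0"
  have "val (csc c a) = (\<lambda>z. mscale c (val a z))" by (rule ext) (rule val_csc)
  moreover have "mscale c (0::complex^'b^'b) = 0" by (simp add: mscale_def vec_eq_iff)
  ultimately show "val (pd v (csc c a)) z = val (csc c (pd v a)) z"
    using dd_bounded_linear[OF bounded_linear_mscale val_diff[OF z], of v c a] by (simp add: val_pd' val_csc)
qed

lemma pd_commute: "pd v (pd w a) = pd w (pd v a)"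
proof (rule sym_eqI)
  fix z :: "(real^'a) \<times> (real^'a)" assume z: "z \<noteq> 0"
  show "val (pd v (pd w a)) z = val (pd w (pd v a)) z"
  proof (cases "v \<in> Basis \<and> w \<in> Basis")
    case True
    have e: "dd u (val (pd x a)) z = dd u (dd x (val a)) z" if "x \<in> Basis" for u x
      by (rule dd_cong_open[OF open_punct]) (use z that in \<open>auto simp: val_pd\<close>)
    have "dd v (dd w (val a)) z = dd w (dd v (val a)) z"
      by (rule dd_commute[OF open_punct, of z]; (rule val_diff | rule smooth_on_diff[OF smooth_on_dd[OF val_smooth]])?)
        (use z True in auto)
    then show ?thesis using True z by (simp add: val_pd e)
  next
    case False
    have "dd u (val (0::('a,'b) sym)) z = 0" for u
    proof -
      have "val (0::('a,'b) sym) = (\<lambda>z. 0)" by (rule ext) (rule val_0)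
      then show ?thesis by simp
    qed
    moreover have "pd x a = 0" if "x \<notin> Basis" for x using that by (intro sym_eqI) (simp add: val_pd' val_0)
    ultimately show ?thesis using False by (auto simp: val_pd' val_0)
  qed
qed

lemma pd_0 [simp]: "pd v 0 = 0" and csc_0 [simp]: "csc c 0 = 0"
  using pd_add[of v 0 0] csc_add[of c 0 0] by simp_all

lemma pd_sum: "pd v (\<Sum>i\<in>I. a i) = (\<Sum>i\<in>I. pd v (a i))"
  by (induction I rule: infinite_finite_induct) (auto simp: pd_add)

lemma csc_sum: "csc c (\<Sum>i\<in>I. a i) = (\<Sum>i\<in>I. csc c (a i))"
  by (induction I rule: infinite_finite_induct) (auto simp: csc_add)

lemma csc_scaleR: "csc c (r *\<^sub>R a) = r *\<^sub>R csc c a"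
  by (rule sym_eqI) (simp add: val_csc val_scaleR mscale_def vec_eq_iff)

lemma csc_of_real: "csc (of_real r) a = r *\<^sub>R a"
  by (rule sym_eqI) (simp add: val_csc val_scaleR mscale_def vec_eq_iff scaleR_conv_of_real[where 'a=complex])

lemma pd_scaleR: "pd v (r *\<^sub>R a) = r *\<^sub>R pd v a"
  by (metis csc_of_real pd_csc)

abbreviation DX :: "real^'n::finite \<Rightarrow> ('n, 'q::finite) sym \<Rightarrow> ('n, 'q) sym" where
  "DX j a \<equiv> csc (- \<i>) (pd (j, 0) a)"

primrec stC :: "nat \<Rightarrow> ('n::finite, 'q::finite) sym \<Rightarrow> ('n, 'q) sym \<Rightarrow> ('n, 'q) sym" where
  "stC 0 a b = a * b"
| "stC (Suc m) a b = (\<Sum>j\<in>Basis. stC m (pd (0, j) a) (DX j b))"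

lemma stC_add_left: "stC m (a + a') b = stC m a b + stC m a' b"
  by (induction m arbitrary: a a' b) (auto simp: distrib_right pd_add sum.distrib)

lemma stC_add_right: "stC m a (b + b') = stC m a b + stC m a b'"
  by (induction m arbitrary: a b b') (auto simp: distrib_left pd_add csc_add sum.distrib)

lemma stC_csc_left: "stC m (csc c a) b = csc c (stC m a b)"
  by (induction m arbitrary: a b) (auto simp: csc_mult_left pd_csc csc_sum)

lemma stC_csc_right: "stC m a (csc c b) = csc c (stC m a b)"
proof (induction m arbitrary: a b)
  case (Suc m)
  have "DX j (csc c b) = csc c (DX j b)" for j by (simp add: pd_csc csc_csc mult.commute)
  then show ?case using Suc by (simp add: csc_sum)
qed (simp add: csc_mult_right)

lemma stC_pd: "pd v (stC m a b) = stC m (pd v a) b + stC m a (pd v b)"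
proof (induction m arbitrary: a b)
  case (Suc m)
  have "pd v (pd (0, j) a) = pd (0, j) (pd v a)" "pd v (DX j b) = DX j (pd v b)" for j
    by (simp_all add: pd_commute[of v] pd_csc)
  then show ?case by (simp add: pd_sum Suc sum.distrib)
qed (simp add: pd_mult)

lemma stC_0 [simp]: "stC m 0 b = 0" "stC m a 0 = 0"
  using stC_add_left[of m 0 0 b] stC_add_right[of m a 0 0] by simp_all

lemma stC_sum_left: "stC m (\<Sum>i\<in>I. a i) b = (\<Sum>i\<in>I. stC m (a i) b)"
  by (induction I rule: infinite_finite_induct) (auto simp: stC_add_left)

lemma stC_sum_right: "stC m a (\<Sum>i\<in>I. b i) = (\<Sum>i\<in>I. stC m a (b i))"
  by (induction I rule: infinite_finite_induct) (auto simp: stC_add_right)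

definition stN :: "nat \<Rightarrow> ('n::finite, 'q::finite) sym \<Rightarrow> ('n, 'q) sym \<Rightarrow> ('n, 'q) sym" where
  "stN m a b = (1 / fact m) *\<^sub>R stC m a b"

lemma stN_add_left: "stN m (a + a') b = stN m a b + stN m a' b"
  and stN_add_right: "stN m a (b + b') = stN m a b + stN m a b'"
  and stN_0: "stN m 0 b = 0" "stN m a 0 = 0"
  by (simp_all add: stN_def stC_add_left stC_add_right scaleR_add_right)

lemma stN_sum_left: "stN m (\<Sum>i\<in>I. a i) b = (\<Sum>i\<in>I. stN m (a i) b)"
  and stN_sum_right: "stN m c (\<Sum>i\<in>I. a i) = (\<Sum>i\<in>I. stN m c (a i))"
  by (simp_all add: stN_def stC_sum_left stC_sum_right scaleR_sum_right)

lemma stN_scaleR: "stN m (r *\<^sub>R a) b = r *\<^sub>R stN m a b" "stN m a (r *\<^sub>R b) = r *\<^sub>R stN m a b"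
  using stC_csc_left[of m "of_real r" a b] stC_csc_right[of m a "of_real r" b]
  by (simp_all add: stN_def csc_of_real)

lemma stN_pd: "pd v (stN m a b) = stN m (pd v a) b + stN m a (pd v b)"
  by (simp add: stN_def pd_scaleR stC_pd scaleR_add_right)

lemma stN_DX: "DX j (stN m a b) = stN m (DX j a) b + stN m a (DX j b)"
  by (simp add: stN_pd csc_add) (simp add: stN_def csc_scaleR stC_csc_left stC_csc_right)

lemma stN_Suc: "real (Suc m) *\<^sub>R stN (Suc m) a b = (\<Sum>j\<in>Basis. stN m (pd (0, j) a) (DX j b))"
proof -
  have "real (Suc m) * (1 / fact (Suc m)) = (1 / fact m :: real)" by (simp del: of_nat_Suc)
  then show ?thesis by (simp add: stN_def scaleR_sum_right del: of_nat_Suc fact_Suc)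
qed

lemma stN_zero: "stN 0 a b = a * b"
  by (simp add: stN_def)

text \<open>Both sides satisfy the same first order recursion in \<open>r\<close>, obtained from
  \<open>(m + 1) N\<^sub>m\<^sub>+\<^sub>1 a b = \<Sum>\<^sub>j N\<^sub>m (\<partial>\<^sub>\<xi>\<^sub>j a) (D\<^sub>j b)\<close>.\<close>
lemma stN_assoc:
  "(\<Sum>k\<le>r. stN k (stN (r - k) a b) c) = (\<Sum>k\<le>r. stN k a (stN (r - k) b c))"
proof (induction r arbitrary: a b c)
  case 0
  show ?case by (simp add: stN_zero mult.assoc)
next
  case (Suc r)
  let ?X = "\<lambda>j. pd (0, j)"
  \<comment> \<open>On the summand with index \<open>k\<close> the factor \<open>r + 1\<close> is
    written as \<open>k + (r + 1 - k)\<close>: the first part lowers the outer product through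
    \<open>stN_Suc\<close>, the second the inner one.\<close>
  have split: "real (Suc r) *\<^sub>R (\<Sum>k\<le>Suc r. f k) =
     (\<Sum>k\<le>r. real (Suc k) *\<^sub>R f (Suc k)) + (\<Sum>k\<le>r. real (Suc (r - k)) *\<^sub>R f k)" for f :: "nat \<Rightarrow> ('a, 'b) sym"
  proof -
    have "real (Suc r) *\<^sub>R (\<Sum>k\<le>Suc r. f k) = (\<Sum>k\<le>Suc r. real k *\<^sub>R f k) + (\<Sum>k\<le>Suc r. real (Suc r - k) *\<^sub>R f k)"
      unfolding scaleR_sum_right sum.distrib[symmetric] scaleR_add_left[symmetric]
      by (rule sum.cong) (auto simp flip: of_nat_add)
    moreover have "(\<Sum>k\<le>Suc r. real k *\<^sub>R f k) = (\<Sum>k\<le>r. real (Suc k) *\<^sub>R f (Suc k))"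
      by (simp only: sum.atMost_Suc_shift) simp
    moreover have "(\<Sum>k\<le>Suc r. real (Suc r - k) *\<^sub>R f k) = (\<Sum>k\<le>r. real (Suc (r - k)) *\<^sub>R f k)"
      by (simp add: Suc_diff_le add_diff_eq)
    ultimately show ?thesis by simp
  qed
  let ?L = "\<lambda>a b c. \<Sum>k\<le>r. stN k (stN (r - k) a b) c"
  let ?R = "\<lambda>a b c. \<Sum>k\<le>r. stN k a (stN (r - k) b c)"
  have "real (Suc r) *\<^sub>R (\<Sum>k\<le>Suc r. stN k (stN (Suc r - k) a b) c) =
     (\<Sum>k\<le>r. \<Sum>j\<in>Basis. stN k (?X j (stN (r - k) a b)) (DX j c)) + (\<Sum>k\<le>r. stN k (real (Suc (r - k)) *\<^sub>R stN (Suc (r - k)) a b) c)"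
    unfolding split by (rule arg_cong2[of _ _ _ _ "(+)"], (rule sum.cong[OF refl], simp only: stN_Suc diff_Suc_Suc),
        (rule sum.cong[OF refl], simp only: stN_scaleR Suc_diff_le atMost_iff))
  \<comment> \<open>The \<open>\<xi>\<close>-derivative and the \<open>x\<close>-derivative that are
    split off meet the pairs \<open>(a, c)\<close>, \<open>(b, c)\<close> and \<open>(a, b)\<close>.
    The other bracketing produces the same three pairs, so the induction hypothesis applies to
    each.\<close>
  also have "\<dots> = (\<Sum>j\<in>Basis. ?L (?X j a) b (DX j c) + ?L a (?X j b) (DX j c) + ?L (?X j a) (DX j b) c)"
    unfolding stN_Suc stN_sum_left sum.swap[of _ Basis] stN_pd stN_add_left sum.distrib by simp
  also have "\<dots> = (\<Sum>j\<in>Basis. ?R (?X j a) b (DX j c) + ?R a (?X j b) (DX j c) + ?R (?X j a) (DX j b) c)"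
    unfolding Suc.IH ..
  also have "\<dots> = (\<Sum>k\<le>r. \<Sum>j\<in>Basis. stN k (?X j a) (DX j (stN (r - k) b c))) + (\<Sum>k\<le>r. stN k a (real (Suc (r - k)) *\<^sub>R stN (Suc (r - k)) b c))"
    unfolding stN_Suc stN_sum_right sum.swap[of _ Basis] stN_DX stN_add_right sum.distrib by (simp add: add_ac)
  also have "\<dots> = real (Suc r) *\<^sub>R (\<Sum>k\<le>Suc r. stN k a (stN (Suc r - k) b c))"
    unfolding split by (rule arg_cong2[of _ _ _ _ "(+)"], (rule sum.cong[OF refl], simp only: stN_Suc diff_Suc_Suc),
        (rule sum.cong[OF refl], simp only: stN_scaleR Suc_diff_le atMost_iff))
  finally show ?case by (simp del: of_nat_Suc)
qed

section \<open>The ring of formal symbols\<close>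

typedef ('n::finite, 'q::finite) fsym = "UNIV :: (nat \<Rightarrow> ('n, 'q) sym) set"
  morphisms cf Fs by simp

lemma cf_Fs [simp]: "cf (Fs f) = f"
  by (simp add: Fs_inverse)

lemma fsym_eqI: "(\<And>k. cf a k = cf b k) \<Longrightarrow> a = b"
  by (metis cf_inject ext)

text \<open>Index \<open>k\<close> stands for \<open>k\<close> orders below the top order. The
  \<open>m\<close>-th Leibniz term differentiates \<open>m\<close> times in \<open>\<xi>\<close> and
  \<open>m\<close> times in \<open>x\<close>, and each derivative costs one order, hence
  \<open>2 * m\<close>.\<close>

definition idx2 :: "nat \<Rightarrow> (nat \<times> nat \<times> nat) set" where
  "idx2 k = {(m, i, j). i + j + 2 * m = k}"

lemma finite_idx2 [simp]: "finite (idx2 k)"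
  by (rule finite_subset[of _ "{..k} \<times> {..k} \<times> {..k}"]) (auto simp: idx2_def)

definition star :: "(nat \<Rightarrow> ('n::finite, 'q::finite) sym) \<Rightarrow> (nat \<Rightarrow> ('n, 'q) sym) \<Rightarrow> nat \<Rightarrow> ('n, 'q) sym" where
  "star a b k = (\<Sum>(m, i, j)\<in>idx2 k. stN m (a i) (b j))"

text \<open>Both triple products are grouped by the total number \<open>r\<close> of derivative
  pairs; for fixed factors and fixed \<open>r\<close> the identity is
  \<open>stN_assoc\<close>.\<close>

lemma star_assoc: "star (star a b) c k = star a (star b c) k"
proof -
  let ?Q = "{(m, m', i, j, l). i + j + l + 2 * m + 2 * m' = k}"
  let ?Q' = "{(r, i, j, l). i + j + l + 2 * r = k}"
  have finQ': "finite ?Q'"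
    by (rule finite_subset[of _ "{..k} \<times> {..k} \<times> {..k} \<times> {..k}"]) auto
  have "star (star a b) c k = (\<Sum>((m, p, l), (m', i, j))\<in>Sigma (idx2 k) (\<lambda>(m, p, l). idx2 p). stN m (stN m' (a i) (b j)) (c l))"
    unfolding star_def by (simp add: stN_sum_left case_prod_unfold sum.Sigma)
  also have "\<dots> = (\<Sum>((r, i, j, l), m)\<in>Sigma ?Q' (\<lambda>(r, i, j, l). {..r}). stN m (stN (r - m) (a i) (b j)) (c l))"
    by (rule sum.reindex_bij_witness[where i="\<lambda>((r, i, j, l), m). ((m, i + j + 2 * (r - m), l), (r - m, i, j))"
          and j="\<lambda>((m, p, l), (m', i, j)). ((m + m', i, j, l), m)"]) (auto simp: idx2_def)
  also have "\<dots> = (\<Sum>(r, i, j, l)\<in>?Q'. \<Sum>m\<le>r. stN m (stN (r - m) (a i) (b j)) (c l))"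
    using finQ' by (simp add: case_prod_unfold sum.Sigma)
  also have "\<dots> = (\<Sum>(r, i, j, l)\<in>?Q'. \<Sum>m\<le>r. stN m (a i) (stN (r - m) (b j) (c l)))"
    unfolding stN_assoc ..
  also have "\<dots> = (\<Sum>((r, i, j, l), m)\<in>Sigma ?Q' (\<lambda>(r, i, j, l). {..r}). stN m (a i) (stN (r - m) (b j) (c l)))"
    using finQ' by (simp add: case_prod_unfold sum.Sigma)
  also have "\<dots> = (\<Sum>((m, i, p), (m', j, l))\<in>Sigma (idx2 k) (\<lambda>(m, i, p). idx2 p). stN m (a i) (stN m' (b j) (c l)))"
    by (rule sum.reindex_bij_witness[where j="\<lambda>((r, i, j, l), m). ((m, i, j + l + 2 * (r - m)), (r - m, j, l))"
          and i="\<lambda>((m, i, p), (m', j, l)). ((m + m', i, j, l), m)"]) (auto simp: idx2_def)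
  also have "\<dots> = star a (star b c) k"
    unfolding star_def by (simp add: stN_sum_right case_prod_unfold sum.Sigma)
  finally show ?thesis .
qed

lemma pd_one: "pd v (1 :: ('n::finite, 'q::finite) sym) = 0"
  using pd_mult[of v 1 "1::('n,'q) sym"] by simp

lemma stN_one: "stN m 1 b = (if m = 0 then b else 0)" "stN m a 1 = (if m = 0 then a else 0)"
  by (cases m; simp add: stN_def pd_one)+

lemma stN_delta:
  "stN m (if i = 0 then 1 else 0) b = (if m = 0 \<and> i = (0::nat) then b else 0)"
  "stN m a (if i = 0 then 1 else 0) = (if m = 0 \<and> i = (0::nat) then a else 0)"
  by (simp_all add: stN_one stN_0)

lemma idx2_0: "idx2 k \<inter> {(m, i, j). m = 0 \<and> i = 0} = {(0, 0, k)}" "idx2 k \<inter> {(m, i, j). m = 0 \<and> j = 0} = {(0, k, 0)}"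
  by (auto simp: idx2_def)

instantiation fsym :: (finite, finite) ring_1
begin
definition "0 = Fs (\<lambda>k. 0 :: ('a, 'b) sym)"
definition "1 = Fs (\<lambda>k. if k = 0 then 1 else 0 :: ('a, 'b) sym)"
definition "a + b = Fs (\<lambda>k. cf a k + cf b k :: ('a, 'b) sym)"
definition "- a = Fs (\<lambda>k. - cf a k :: ('a, 'b) sym)"
definition "a - b = Fs (\<lambda>k. cf a k - cf b k :: ('a, 'b) sym)"
definition "a * b = Fs (star (cf a) (cf b) :: nat \<Rightarrow> ('a, 'b) sym)"

instance
proof
  fix a b c :: "('a, 'b) fsym"
  note defs = zero_fsym_def one_fsym_def plus_fsym_def uminus_fsym_def minus_fsym_def times_fsym_def
  show "a + b + c = a + (b + c)" "a + b = b + a" "0 + a = a" "- a + a = 0" "a - b = a + - b"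
    by (simp_all add: defs add_ac cf_inverse)
  show "a * b * c = a * (b * c)" by (rule fsym_eqI) (simp add: defs star_assoc)
  show "(a + b) * c = a * c + b * c" "a * (b + c) = a * b + a * c"
    by (rule fsym_eqI, simp add: defs star_def stN_add_left stN_add_right case_prod_unfold sum.distrib)+
  show "1 * a = a"
  proof (rule fsym_eqI)
    fix k
    have "cf (1 * a) k = (\<Sum>x\<in>idx2 k. if x \<in> {(m, i, j). m = 0 \<and> i = 0} then cf a (snd (snd x)) else 0)"
      unfolding defs star_def cf_Fs by (rule sum.cong) (auto simp: stN_delta split: if_splits)
    also have "\<dots> = cf a k" by (simp only: sum.inter_restrict[symmetric] finite_idx2 idx2_0) simp
    finally show "cf (1 * a) k = cf a k" .
  qed
  show "a * 1 = a"
  proof (rule fsym_eqI)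
    fix k
    have "cf (a * 1) k = (\<Sum>x\<in>idx2 k. if x \<in> {(m, i, j). m = 0 \<and> j = 0} then cf a (fst (snd x)) else 0)"
      unfolding defs star_def cf_Fs by (rule sum.cong) (auto simp: stN_delta split: if_splits)
    also have "\<dots> = cf a k" by (simp only: sum.inter_restrict[symmetric] finite_idx2 idx2_0) simp
    finally show "cf (a * 1) k = cf a k" .
  qed
  have "cf (0::('a,'b) fsym) 0 \<noteq> cf 1 0" by (simp add: defs)
  then show "(0::('a, 'b) fsym) \<noteq> 1" by metis
qed
end

lemma cf_0 [simp]: "cf 0 k = 0" and cf_1: "cf 1 k = (if k = 0 then 1 else 0)"
  and cf_add: "cf (a + b) k = cf a k + cf b k" and cf_minus: "cf (a - b) k = cf a k - cf b k"
  and cf_uminus: "cf (- a) k = - cf a k"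
  and cf_mult: "cf (a * b) k = (\<Sum>(m, i, j)\<in>idx2 k. stN m (cf a i) (cf b j))"
  by (simp_all add: zero_fsym_def one_fsym_def plus_fsym_def minus_fsym_def uminus_fsym_def times_fsym_def star_def)

lemma cf_mult_leading:
  assumes "\<And>i. i < A \<Longrightarrow> cf a i = 0" "\<And>j. j < B \<Longrightarrow> cf b j = 0"
  shows "k < A + B \<Longrightarrow> cf (a * b) k = 0" and "cf (a * b) (A + B) = cf a A * cf b B"
proof -
  have *: "stN m (cf a i) (cf b j) = 0" if "i < A \<or> j < B" for m i j
    using that assms by (auto simp: stN_0)
  show "cf (a * b) k = 0" if "k < A + B"
    unfolding cf_mult
  proof (rule sum.neutral, rule ballI)
    fix x assume "x \<in> idx2 k"
    then obtain m i j where x: "x = (m, i, j)" "i + j + 2 * m = k" by (auto simp: idx2_def)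
    then have "i < A \<or> j < B" using that by auto
    then show "(case x of (m, i, j) \<Rightarrow> stN m (cf a i) (cf b j)) = 0" using x * by simp
  qed
  have "cf (a * b) (A + B) = (\<Sum>x\<in>idx2 (A + B). if x = (0, A, B) then cf a A * cf b B else 0)"
    unfolding cf_mult
  proof (rule sum.cong[OF refl])
    fix x assume "x \<in> idx2 (A + B)"
    then obtain m i j where x: "x = (m, i, j)" "i + j + 2 * m = A + B" by (auto simp: idx2_def)
    then have "i < A \<or> j < B \<or> x = (0, A, B)" by auto
    then show "(case x of (m, i, j) \<Rightarrow> stN m (cf a i) (cf b j)) = (if x = (0, A, B) then cf a A * cf b B else 0)"
      using x * by (auto simp: stN_zero)
  qed
  also have "(0, A, B) \<in> idx2 (A + B)" by (simp add: idx2_def)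
  then have "(\<Sum>x\<in>idx2 (A + B). if x = (0, A, B) then cf a A * cf b B else 0) = cf a A * cf b B"
    by (simp add: sum.delta)
  finally show "cf (a * b) (A + B) = cf a A * cf b B" .
qed

section \<open>Degrees and the trace property\<close>

definition dg :: "int \<Rightarrow> ('n::finite, 'q::finite) sym \<Rightarrow> bool" where
  "dg d a \<longleftrightarrow> pos_homogeneous d (val a)"

lemma dg_0 [simp]: "dg d 0"
  by (simp add: dg_def pos_homogeneous_def val_0)

lemma dg_add: "dg d a \<Longrightarrow> dg d b \<Longrightarrow> dg d (a + b)"
  by (simp add: dg_def pos_homogeneous_def val_add scaleR_add_right)

lemma dg_sum: "(\<And>i. i \<in> I \<Longrightarrow> dg d (a i)) \<Longrightarrow> dg d (\<Sum>i\<in>I. a i)"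
  by (induction I rule: infinite_finite_induct) (auto intro: dg_add)

lemma mscale_scaleR: "mscale c (r *\<^sub>R A) = r *\<^sub>R mscale c A"
  by (simp add: mscale_def vec_eq_iff)

lemma dg_csc: "dg d a \<Longrightarrow> dg d (csc c a)"
  by (simp add: dg_def pos_homogeneous_def val_csc mscale_scaleR)

lemma dg_scaleR: "dg d a \<Longrightarrow> dg d (r *\<^sub>R a)"
  using dg_csc[of d a "of_real r"] by (simp add: csc_of_real)

lemma dg_mult: "dg d a \<Longrightarrow> dg e b \<Longrightarrow> dg (d + e) (a * b)"
  by (simp add: dg_def pos_homogeneous_def val_mult powr_add
      bounded_bilinear.scaleR_left[OF bounded_bilinear_matrix_mult]
      bounded_bilinear.scaleR_right[OF bounded_bilinear_matrix_mult] mult.commute)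

lemma dg_1: "dg 0 1"
  unfolding dg_def pos_homogeneous_def by transfer auto

lemma pos_homogeneous_dd:
  fixes f :: "'a::euclidean_space \<Rightarrow> 'b::real_normed_vector"
  assumes h: "pos_homogeneous d f" and f: "\<And>z. z \<noteq> 0 \<Longrightarrow> f differentiable at z"
  shows "pos_homogeneous (d - 1) (dd v f)"
  unfolding pos_homogeneous_def
proof (intro allI impI)
  fix t :: real and z :: 'a assume t: "t > 0" and z: "z \<noteq> 0"
  have tz: "t *\<^sub>R z \<noteq> 0" using t z by simp
  have "dd v (\<lambda>z. f (t *\<^sub>R z)) z = dd (t *\<^sub>R v) f (t *\<^sub>R z)"
  proof (rule dd_eqI[of _ "\<lambda>v. dd (t *\<^sub>R v) f (t *\<^sub>R z)"])
    have "((\<lambda>z. t *\<^sub>R z) has_derivative (\<lambda>h. t *\<^sub>R h)) (at z)" by (auto intro!: derivative_eq_intros)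
    from has_derivative_compose[OF this has_derivative_dd[OF f[OF tz]]]
    show "((\<lambda>z. f (t *\<^sub>R z)) has_derivative (\<lambda>v. dd (t *\<^sub>R v) f (t *\<^sub>R z))) (at z)" .
  qed
  then have 1: "dd v (\<lambda>z. f (t *\<^sub>R z)) z = t *\<^sub>R dd v f (t *\<^sub>R z)"
    by (simp add: dd_scale_dir[OF f[OF tz]])
  have "dd v (\<lambda>z. f (t *\<^sub>R z)) z = dd v (\<lambda>z. (t powr real_of_int d) *\<^sub>R f z) z"
    by (rule dd_cong_open[of "UNIV - {0}"]) (use h t z in \<open>auto simp: pos_homogeneous_def open_delete\<close>)
  also have "\<dots> = (t powr real_of_int d) *\<^sub>R dd v f z"
    by (rule dd_bounded_linear[OF bounded_linear_scaleR_right f[OF z]])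
  finally have "t *\<^sub>R dd v f (t *\<^sub>R z) = (t powr real_of_int d) *\<^sub>R dd v f z" using 1 by simp
  then have "(1 / t) *\<^sub>R (t *\<^sub>R dd v f (t *\<^sub>R z)) = (1 / t) *\<^sub>R ((t powr real_of_int d) *\<^sub>R dd v f z)" by simp
  then show "dd v f (t *\<^sub>R z) = (t powr real_of_int (d - 1)) *\<^sub>R dd v f z"
    using t by (simp add: powr_diff)
qed

lemma dg_pd: "dg d a \<Longrightarrow> dg (d - 1) (pd v a)"
proof (cases "v \<in> Basis")
  case True
  assume "dg d a"
  from pos_homogeneous_dd[OF this[unfolded dg_def] val_diff] show ?thesis
    unfolding dg_def pos_homogeneous_def by (simp add: val_pd True)
next
  case False
  then have "pd v a = 0" by (intro sym_eqI) (simp add: val_pd' val_0)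
  then show ?thesis by simp
qed

lemma dg_stC: "dg d a \<Longrightarrow> dg e b \<Longrightarrow> dg (d + e - 2 * int m) (stC m a b)"
proof (induction m arbitrary: a b d e)
  case (Suc m)
  have eq: "d + e - 2 * int (Suc m) = (d - 1) + (e - 1) - 2 * int m" by simp
  show ?case unfolding stC.simps eq
    by (intro dg_sum Suc.IH dg_pd dg_csc Suc.prems)
qed (simp add: dg_mult)

definition hom :: "int \<Rightarrow> ('n::finite, 'q::finite) fsym \<Rightarrow> bool" where
  "hom d a \<longleftrightarrow> (\<forall>k. dg (d - int k) (cf a k))"

lemma hom_mult:
  assumes "hom d a" "hom e b"
  shows "hom (d + e) (a * b)"
  unfolding hom_def cf_mult
proof (intro allI dg_sum)
  fix k x assume "x \<in> idx2 k"
  then obtain m i j where x: "x = (m, i, j)" "i + j + 2 * m = k" by (auto simp: idx2_def)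
  have "dg ((d - int i) + (e - int j) - 2 * int m) (stN m (cf a i) (cf b j))"
    unfolding stN_def using assms by (intro dg_scaleR dg_stC) (auto simp: hom_def)
  moreover have "(d - int i) + (e - int j) - 2 * int m = d + e - int k" using x by auto
  ultimately show "dg (d + e - int k) (case x of (m, i, j) \<Rightarrow> stN m (cf a i) (cf b j))" using x by simp
qed

lemma hom_1: "hom 0 1"
  by (simp add: hom_def cf_1 dg_1)

text \<open>In total degree \<open>-N\<close> a derivative may be moved to the other factor with a
  minus sign, because \<open>T\<close> kills derivatives of terms of degree \<open>1 - N\<close>.
  Moving \<open>\<partial>\<xi>\<close> off \<open>a\<close> on the left and
  \<open>\<partial>x\<close> off \<open>a\<close> on the right leaves the same two factors on both
  sides, in opposite order, with equal signs. The two derivatives then sit on \<open>b\<close> and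
  compensate in the degree for lowering \<open>m\<close> by one.\<close>

lemma stC_trace:
  fixes T :: "('n::finite, 'q::finite) sym \<Rightarrow> complex"
  assumes add: "\<And>a b. T (a + b) = T a + T b" and cyc: "\<And>a b. T (a * b) = T (b * a)"
    and div: "\<And>v a. dg (1 - N) a \<Longrightarrow> T (pd v a) = 0"
    and csc: "\<And>c a. T (csc c a) = c * T a"
  shows "dg d a \<Longrightarrow> dg e b \<Longrightarrow> d + e - 2 * int m = - N \<Longrightarrow> T (stC m a b) = T (stC m b a)"
proof (induction m arbitrary: a b d e)
  case (Suc m)
  have T0: "T 0 = 0" using add[of 0 0] by simp
  have Tsum: "T (\<Sum>i\<in>I. f i) = (\<Sum>i\<in>I. T (f i))" for I :: "(real^'n) set" and f
    by (induction I rule: infinite_finite_induct) (auto simp: T0 add)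
  have "T (stC m (pd (0, j) a) (DX j b)) = T (stC m (pd (0, j) b) (DX j a))" for j
  proof -
    let ?b = "pd (0, j) (DX j b)"
    have N1: "d + (e - 1) - 2 * int m = 1 - N" and N2: "(e - 1) + d - 2 * int m = 1 - N"
      using Suc.prems(3) by simp_all
    have "dg (1 - N) (stC m a (DX j b))"
      unfolding N1[symmetric] by (rule dg_stC[OF Suc.prems(1) dg_csc[OF dg_pd[OF Suc.prems(2)]]])
    from div[OF this, of "(0, j)"] have 1: "T (stC m (pd (0, j) a) (DX j b)) = - T (stC m a ?b)"
      by (simp add: stC_pd add eq_neg_iff_add_eq_0)
    have "dg (1 - N) (stC m (pd (0, j) b) a)"
      unfolding N2[symmetric] by (rule dg_stC[OF dg_pd[OF Suc.prems(2)] Suc.prems(1)])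
    from div[OF this, of "(j, 0)"] have "T (stC m (pd (0, j) b) (pd (j, 0) a)) = - T (stC m (pd (j, 0) (pd (0, j) b)) a)"
      by (simp add: stC_pd add eq_neg_iff_add_eq_0 add.commute)
    then have "T (csc (- \<i>) (stC m (pd (0, j) b) (pd (j, 0) a))) = - T (csc (- \<i>) (stC m (pd (j, 0) (pd (0, j) b)) a))"
      by (simp add: csc)
    then have 2: "T (stC m (pd (0, j) b) (DX j a)) = - T (stC m ?b a)"
      by (simp add: stC_csc_left stC_csc_right pd_csc pd_commute[of "(0, j)"])
    have "T (stC m a ?b) = T (stC m ?b a)"
      by (rule Suc.IH[OF Suc.prems(1) dg_pd[OF dg_csc[OF dg_pd[OF Suc.prems(2)]]]])
        (use Suc.prems(3) in simp)
    then show ?thesis using 1 2 by simp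
  qed
  then show ?case by (simp add: Tsum)
qed (simp add: cyc)

section \<open>Coordinates and their commutators\<close>

lift_definition coord :: "(real^'n::finite) \<times> (real^'n) \<Rightarrow> ('n, 'q::finite) sym" is
  "\<lambda>v z. (z \<bullet> v) *\<^sub>R mat 1"
  by (auto intro!: smooth_on_linear bounded_linear_compose[OF bounded_linear_scaleR_left bounded_linear_inner_left])

lemma val_coord: "val (coord v) z = (z \<bullet> v) *\<^sub>R mat 1"
  by transfer simp

lemma val_one: "val 1 z = (if z = 0 then 0 else mat 1)"
  by transfer simp

lemma coord_mult: "val (coord v * a) z = (z \<bullet> v) *\<^sub>R val a z" "val (a * coord v) z = (z \<bullet> v) *\<^sub>R val a z"
  by (simp_all add: val_mult val_coord bounded_bilinear.scaleR_left[OF bounded_bilinear_matrix_mult]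
      bounded_bilinear.scaleR_right[OF bounded_bilinear_matrix_mult])

lemma coord_central: "coord v * a = a * coord v"
  by (rule sym_eqI) (simp add: coord_mult)

lemma pd_coord: "w \<in> Basis \<Longrightarrow> pd w (coord v) = (w \<bullet> v) *\<^sub>R 1"
proof (rule sym_eqI)
  fix z :: "(real^'a) \<times> (real^'a)" assume w: "w \<in> Basis" and z: "z \<noteq> 0"
  have "val (coord v :: ('a,'b) sym) = (\<lambda>z. (z \<bullet> v) *\<^sub>R mat 1)" by (rule ext) (rule val_coord)
  moreover have "dd w (\<lambda>z. (z \<bullet> v) *\<^sub>R (mat 1 :: complex^'b^'b)) z = (w \<bullet> v) *\<^sub>R mat 1"
    by (simp add: dd_linear bounded_linear_compose[OF bounded_linear_scaleR_left bounded_linear_inner_left])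
  ultimately show "val (pd w (coord v :: ('a,'b) sym)) z = val ((w \<bullet> v) *\<^sub>R 1) z"
    using w z by (simp add: val_pd val_scaleR val_one)
qed

lemma dg_coord: "dg 1 (coord v)"
  by (simp add: dg_def pos_homogeneous_def val_coord)

definition zc :: "(real^'n::finite) \<times> (real^'n) \<Rightarrow> ('n, 'q::finite) fsym" where
  "zc v = Fs (\<lambda>k. if k = 0 then coord v else 0)"

lemma hom_zc: "hom 1 (zc v)"
  by (simp add: hom_def zc_def dg_coord)

text \<open>A coordinate has constant first and vanishing second derivatives, so a Leibniz product
  with it stops after the first order term.\<close>

lemma stN_coord:
  "stN (Suc (Suc m)) (coord v) b = 0" "stN (Suc (Suc m)) b (coord v) = 0"
  "stN 1 (coord v) b = (\<Sum>j\<in>Basis. ((0, j) \<bullet> v) *\<^sub>R DX j b)"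
  "stN 1 b (coord v) = (\<Sum>j\<in>Basis. ((j, 0) \<bullet> v) *\<^sub>R csc (- \<i>) (pd (0, j) b))"
  by (simp_all add: stN_def pd_coord Basis_prod_def pd_scaleR pd_one csc_scaleR csc_mult_right pd_csc)

lemma sum_idx2_support:
  fixes f :: "nat \<times> nat \<times> nat \<Rightarrow> 'b::comm_monoid_add"
  assumes "\<And>m i j. (m, i, j) \<in> idx2 k \<Longrightarrow> (m, i, j) \<noteq> p \<Longrightarrow> (m, i, j) \<noteq> q \<Longrightarrow> f (m, i, j) = 0" "p \<in> idx2 k" "p \<noteq> q"
  shows "(\<Sum>x\<in>idx2 k. f x) = f p + (if q \<in> idx2 k then f q else 0)"
proof -
  have "(\<Sum>x\<in>idx2 k. f x) = (\<Sum>x\<in>idx2 k \<inter> {p, q}. f x)"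
    by (rule sum.mono_neutral_right) (use assms in auto)
  also have "idx2 k \<inter> {p, q} = (if q \<in> idx2 k then {p, q} else {p})" using assms by auto
  finally show ?thesis using assms by simp
qed

lemma cf_zc_mult:
  "cf (zc v * a) k = coord v * cf a k + (if k \<ge> 2 then stN 1 (coord v) (cf a (k - 2)) else 0)"
  "cf (a * zc v) k = cf a k * coord v + (if k \<ge> 2 then stN 1 (cf a (k - 2)) (coord v) else 0)"
proof -
  have m: "m = 0 \<or> m = 1 \<or> (\<exists>m'. m = Suc (Suc m'))" for m :: nat
    by (metis One_nat_def not0_implies_Suc)
  have "cf (zc v * a) k = (case (0, 0, k) of (m, i, j) \<Rightarrow> stN m (cf (zc v) i) (cf a j)) +
      (if (1, 0, k - 2) \<in> idx2 k then (case (1, 0, k - 2) of (m, i, j) \<Rightarrow> stN m (cf (zc v) i) (cf a j)) else 0)"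
    unfolding cf_mult
  proof (rule sum_idx2_support)
    fix m i j assume "(m, i, j) \<in> idx2 k" "(m, i, j) \<noteq> (0, 0, k)" "(m, i, j) \<noteq> (1, 0, k - 2)"
    then show "(case (m, i, j) of (m, i, j) \<Rightarrow> stN m (cf (zc v) i) (cf a j)) = 0"
      using m[of m] by (auto simp: idx2_def zc_def stN_0 stN_coord simp del: One_nat_def)
  qed (auto simp: idx2_def)
  then show "cf (zc v * a) k = coord v * cf a k + (if k \<ge> 2 then stN 1 (coord v) (cf a (k - 2)) else 0)"
    by (auto simp: idx2_def zc_def stN_zero simp del: One_nat_def)
  have "cf (a * zc v) k = (case (0, k, 0) of (m, i, j) \<Rightarrow> stN m (cf a i) (cf (zc v) j)) +
      (if (1, k - 2, 0) \<in> idx2 k then (case (1, k - 2, 0) of (m, i, j) \<Rightarrow> stN m (cf a i) (cf (zc v) j)) else 0)"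
    unfolding cf_mult
  proof (rule sum_idx2_support)
    fix m i j assume "(m, i, j) \<in> idx2 k" "(m, i, j) \<noteq> (0, k, 0)" "(m, i, j) \<noteq> (1, k - 2, 0)"
    then show "(case (m, i, j) of (m, i, j) \<Rightarrow> stN m (cf a i) (cf (zc v) j)) = 0"
      using m[of m] by (auto simp: idx2_def zc_def stN_0 stN_coord simp del: One_nat_def)
  qed (auto simp: idx2_def)
  then show "cf (a * zc v) k = cf a k * coord v + (if k \<ge> 2 then stN 1 (cf a (k - 2)) (coord v) else 0)"
    by (auto simp: idx2_def zc_def stN_zero simp del: One_nat_def)
qed

text \<open>The commutator with a coordinate in the Leibniz product: the pointwise products cancel,
  and what is left is the first order part, a derivative of \<open>b\<close> in the conjugate
  variable times \<open>\<i>\<close> or \<open>- \<i>\<close>.\<close>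

definition dlt :: "(real^'n::finite) \<times> (real^'n) \<Rightarrow> ('n, 'q::finite) sym \<Rightarrow> ('n, 'q) sym" where
  "dlt v b = stN 1 (coord v) b - stN 1 b (coord v)"

lemma cf_zc_commutator: "cf (zc v * a - a * zc v) k = (if k \<ge> 2 then dlt v (cf a (k - 2)) else 0)"
  by (simp add: cf_minus cf_zc_mult dlt_def coord_central[of v] del: One_nat_def)

lemma sum_Basis_delta:
  fixes f :: "'a::euclidean_space \<Rightarrow> 'b::real_vector"
  assumes "w \<in> Basis"
  shows "(\<Sum>j\<in>Basis. (j \<bullet> w) *\<^sub>R f j) = f w"
proof -
  have "(\<Sum>j\<in>Basis. (j \<bullet> w) *\<^sub>R f j) = (\<Sum>j\<in>Basis. if j = w then f j else 0)"
    by (rule sum.cong) (auto simp: inner_Basis assms)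
  then show ?thesis using assms by simp
qed

lemma dlt_x: "w \<in> Basis \<Longrightarrow> dlt (w, 0) b = csc \<i> (pd (0, w) b)"
  and dlt_xi: "w \<in> Basis \<Longrightarrow> dlt (0, w) b = DX w b"
proof -
  have "csc (- \<i>) u = - csc \<i> u" for u :: "('a, 'b) sym"
    by (rule sym_eqI) (simp add: val_csc val_uminus mscale_def vec_eq_iff)
  then show "w \<in> Basis \<Longrightarrow> dlt (w, 0) b = csc \<i> (pd (0, w) b)" "w \<in> Basis \<Longrightarrow> dlt (0, w) b = DX w b"
    unfolding dlt_def stN_coord using sum_Basis_delta[of w "\<lambda>j. csc (- \<i>) (pd (0, j) b)"] sum_Basis_delta[of w "\<lambda>j. DX j b"]
    by simp_all
qed

text \<open>The scalar \<open>\<i>\<close> placed at index 2, so that it counts as a symbol of order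
  2. A commutator of two coordinates then has the same nominal order as their product, and all terms
  of the commutator relation are homogeneous together.\<close>

definition hb :: "('n::finite, 'q::finite) fsym" where
  "hb = Fs (\<lambda>k. if k = 2 then csc \<i> 1 else 0)"

lemma hom_hb: "hom 2 hb"
  by (simp add: hom_def hb_def dg_csc dg_1)

lemma stN_csc_one:
  "stN m (csc c 1) b = (if m = 0 then csc c b else 0)" "stN m a (csc c 1) = (if m = 0 then csc c a else 0)"
proof -
  have "stN m (csc c 1) b = csc c (stN m 1 b)" "stN m a (csc c 1) = csc c (stN m a 1)"
    by (simp_all add: stN_def stC_csc_left stC_csc_right csc_scaleR)
  then show "stN m (csc c 1) b = (if m = 0 then csc c b else 0)" "stN m a (csc c 1) = (if m = 0 then csc c a else 0)"
    by (simp_all add: stN_one)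
qed

lemma stN_csc_delta:
  "stN m (if i = 2 then csc c 1 else 0) b = (if m = 0 \<and> i = (2::nat) then csc c b else 0)"
  "stN m a (if i = 2 then csc c 1 else 0) = (if m = 0 \<and> i = (2::nat) then csc c a else 0)"
  by (simp_all add: stN_csc_one stN_0)

lemma cf_hb_mult: "cf (hb * a) k = (if k \<ge> 2 then csc \<i> (cf a (k - 2)) else 0)"
  and cf_mult_hb: "cf (a * hb) k = (if k \<ge> 2 then csc \<i> (cf a (k - 2)) else 0)"
proof -
  have "cf (hb * a) k = (\<Sum>x\<in>idx2 k. if x = (0, 2, k - 2) then csc \<i> (cf a (k - 2)) else 0)"
    unfolding cf_mult by (rule sum.cong) (auto simp: idx2_def hb_def stN_csc_delta split: if_splits)
  moreover have "(0, 2, k - 2) \<in> idx2 k \<longleftrightarrow> k \<ge> 2" "(0, k - 2, 2) \<in> idx2 k \<longleftrightarrow> k \<ge> 2"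
    by (auto simp: idx2_def)
  note mem = this
  ultimately show "cf (hb * a) k = (if k \<ge> 2 then csc \<i> (cf a (k - 2)) else 0)" by (simp add: sum.delta)
  have "cf (a * hb) k = (\<Sum>x\<in>idx2 k. if x = (0, k - 2, 2) then csc \<i> (cf a (k - 2)) else 0)"
    unfolding cf_mult by (rule sum.cong) (auto simp: idx2_def hb_def stN_csc_delta split: if_splits)
  then show "cf (a * hb) k = (if k \<ge> 2 then csc \<i> (cf a (k - 2)) else 0)" by (simp add: sum.delta mem)
qed

lemma hb_central: "hb * a = a * hb"
  by (rule fsym_eqI) (simp add: cf_hb_mult cf_mult_hb)

lemma cf_hb_power_mult: "cf (hb ^ n * a) (2 * n + k) = csc (\<i> ^ n) (cf a k)"
proof (induction n)
  case 0
  have "csc 1 (cf a k) = cf a k" using csc_of_real[of 1] by simp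
  then show ?case by simp
next
  case (Suc n)
  then show ?case by (simp add: mult.assoc cf_hb_mult csc_csc)
qed

lemma euler:
  assumes "dg 0 h"
  shows "(\<Sum>v\<in>Basis. coord v * pd v h) = 0"
proof (rule sym_eqI)
  fix z :: "(real^'a) \<times> (real^'a)" assume z: "z \<noteq> 0"
  have "val (\<Sum>v\<in>Basis. coord v * pd v h) z = (\<Sum>v\<in>Basis. (z \<bullet> v) *\<^sub>R dd v (val h) z)"
    unfolding val_sum by (rule sum.cong) (simp_all add: coord_mult val_pd z)
  also have "\<dots> = dd z (val h) z" by (rule dd_expand[OF val_diff[OF z], symmetric])
  also have "\<dots> = 0"
  proof -
    have "((\<lambda>s. z + s *\<^sub>R z) has_derivative (\<lambda>s. s *\<^sub>R z)) (at 0)" by (auto intro!: derivative_eq_intros)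
    moreover have "(val h has_derivative (\<lambda>v. dd v (val h) z)) (at (z + 0 *\<^sub>R z))"
      using has_derivative_dd[OF val_diff[OF z]] by simp
    ultimately have "((\<lambda>s. val h (z + s *\<^sub>R z)) has_derivative (\<lambda>s. dd (s *\<^sub>R z) (val h) z)) (at 0)"
      by (rule has_derivative_compose)
    then have "dd 1 (\<lambda>s::real. val h (z + s *\<^sub>R z)) 0 = dd z (val h) z" using dd_eqI by fastforce
    moreover have "dd 1 (\<lambda>s::real. val h (z + s *\<^sub>R z)) 0 = dd 1 (\<lambda>s. val h z) (0::real)"
    proof (rule dd_cong_open[of "{-1<..}"])
      show "\<forall>s\<in>{-1<..}. val h (z + s *\<^sub>R z) = val h z"
      proof
        fix s :: real assume "s \<in> {-1<..}"
        then have "1 + s > 0" by simp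
        moreover have "z + s *\<^sub>R z = (1 + s) *\<^sub>R z" by (simp add: scaleR_add_left)
        ultimately show "val h (z + s *\<^sub>R z) = val h z"
          using assms[unfolded dg_def pos_homogeneous_def, rule_format, OF \<open>1 + s > 0\<close> z]
          by (simp del: split_paired_All)
      qed
    qed auto
    ultimately show ?thesis by simp
  qed
  finally show "val (\<Sum>v\<in>Basis. coord v * pd v h) z = val 0 z" by (simp add: val_0)
qed

lemma pairprod_leading:
  assumes "\<And>i j k. i < N \<Longrightarrow> j < N \<Longrightarrow> k < 4 \<Longrightarrow> cf (F i j) k = 0" "\<And>i j. i < N \<Longrightarrow> j < N \<Longrightarrow> cf (F i j) 4 = E i j"
  shows "length l = 2 * n \<Longrightarrow> set l \<subseteq> {..<N} \<Longrightarrow>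
    (\<forall>k<4 * n. cf (pairprod F n l) k = 0) \<and> cf (pairprod F n l) (4 * n) = pairprod E n l"
proof (induction n arbitrary: l)
  case (Suc n)
  then obtain x y ys where l: "l = x # y # ys"
    by (metis (no_types, lifting) length_Suc_conv mult_Suc_right numeral_2_eq_2 plus_nat.simps)
  have IH: "\<forall>k<4 * n. cf (pairprod F n ys) k = 0" "cf (pairprod F n ys) (4 * n) = pairprod E n ys"
    using Suc.IH[of ys] Suc.prems l by auto
  have xy: "x < N" "y < N" using Suc.prems l by auto
  show ?case
    using cf_mult_leading[of 4 "F x y" "4 * n" "pairprod F n ys"] IH assms xy by (simp add: l)
qed (simp add: cf_1)

lemma pairprod_scaled:
  fixes J :: "nat \<Rightarrow> nat \<Rightarrow> int" and h :: "'a::ring_1"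
  assumes "\<And>i j. i < N \<Longrightarrow> j < N \<Longrightarrow> c i j = of_int (J i j) * h"
  shows "set l \<subseteq> {..<N} \<Longrightarrow> length l = 2 * n \<Longrightarrow> pairprod c n l = of_int (pairprod J n l) * h ^ n"
proof (induction n arbitrary: l)
  case (Suc n)
  then obtain x y ys where l: "l = x # y # ys"
    by (metis (no_types, lifting) length_Suc_conv mult_Suc_right numeral_2_eq_2 plus_nat.simps)
  have comm: "h * (of_int p * X) = of_int p * (h * X)" for p X
    unfolding mult.assoc[symmetric] mult_of_int_commute[of p h] ..
  have IH: "pairprod c n ys = of_int (pairprod J n ys) * h ^ n" and xy: "c x y = of_int (J x y) * h"
    using Suc.IH[of ys] Suc.prems assms l by simp_all
  show ?case unfolding l pairprod.simps IH xy of_int_mult power_Suc mult.assoc comm ..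
qed simp

text \<open>The compressions \<open>Z\<^sub>i = P z\<^sub>i P\<close> of the coordinates satisfy \<open>[Z\<^sub>i, Z\<^sub>j] = [z\<^sub>i, z\<^sub>j] P + F\<^sub>i\<^sub>j\<close>
  with \<open>F\<^sub>i\<^sub>j = P [z\<^sub>i, P] [z\<^sub>j, P] P - (i \<leftrightarrow> j)\<close>. The alternating sum over products of the \<open>F\<^sub>i\<^sub>j\<close> only
  sees the principal symbol, which is constant along rays, so the radial direction is a null direction.\<close>
theorem formal_idempotent_trace:
  fixes P :: "('n::finite, 'q::finite) fsym" and T :: "('n, 'q) sym \<Rightarrow> complex"
  assumes PP: "P * P = P" and hP: "hom 0 P"
    and add: "\<And>a b. T (a + b) = T a + T b" and cyc: "\<And>a b. T (a * b) = T (b * a)"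
    and div: "\<And>v a. dg (1 - 2 * int CARD('n)) a \<Longrightarrow> T (pd v a) = 0"
    and csc: "\<And>c a. T (csc c a) = c * T a"
  shows "T (cf P (2 * CARD('n))) = 0"
proof -
  let ?n = "CARD('n)"
  obtain \<beta> :: "nat \<Rightarrow> 'n" where \<beta>: "bij_betw \<beta> {..<?n} UNIV"
    using ex_bij_betw_nat_finite[of "UNIV :: 'n set"] by (auto simp: lessThan_atLeast0)
  \<comment> \<open>The coordinates are listed as \<open>x_1, \<xi>_1, x_2, \<xi>_2, ...\<close>,
    the order in which their commutators form the matrix \<open>sympl\<close>.\<close>
  define ax where "ax i = (axis (\<beta> (i div 2)) 1 :: real^'n)" for i
  have axB: "ax i \<in> Basis" for i by (auto simp: ax_def Basis_vec_def)
  have ax_eq: "ax i = ax j \<longleftrightarrow> i div 2 = j div 2" if "i < 2 * ?n" "j < 2 * ?n" for i j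
    using bij_betw_imp_inj_on[OF \<beta>, THEN inj_on_eq_iff, of "i div 2" "j div 2"] that
    by (auto simp: ax_def axis_eq_axis)
  \<comment> \<open>\<open>v i\<close> is the direction of the coordinate with index
    \<open>i\<close> and \<open>w i\<close> the conjugate one: commuting with the coordinate is
    \<open>\<gamma> i\<close> times the derivative in direction \<open>w i\<close>.\<close>
  define v where "v i = (if even i then (ax i, 0) else (0, ax i))" for i
  define w where "w i = (if even i then (0, ax i) else (ax i, 0))" for i
  define \<gamma> where "\<gamma> i = (if even i then \<i> else - \<i>)" for i :: nat
  have wB: "w i \<in> Basis" for i using axB by (auto simp: w_def Basis_prod_def)
  have dlt_v: "dlt (v i) b = csc (\<gamma> i) (pd (w i) b)" for i and b :: "('n, 'q) sym"
    by (simp add: v_def w_def \<gamma>_def dlt_x dlt_xi axB)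
  \<comment> \<open>The identity for alternating sums speaks of all natural indices. From
    \<open>2n\<close> on there are no coordinates, and zero keeps the commutator relation true
    there.\<close>
  define z where "z i = (if i < 2 * ?n then zc (v i) else (0 :: ('n, 'q) fsym))" for i
  define c where "c i j = (if i < 2 * ?n \<and> j < 2 * ?n then of_int (sympl i j) * hb else (0 :: ('n, 'q) fsym))" for i j
  have zz: "z i * z j - z j * z i = c i j" for i j
  proof (cases "i < 2 * ?n \<and> j < 2 * ?n")
    case True
    have sc: "\<gamma> i * of_real (w i \<bullet> v j) = of_int (sympl i j) * \<i>"
    proof -
      have div2: "(i div 2 = j div 2) = (if even i then j = i \<or> j = Suc i else j = i \<or> i = Suc j)" if "even i \<noteq> even j"
        using that by (auto elim!: evenE oddE)
      have ip: "ax i \<bullet> ax j = (if i div 2 = j div 2 then 1 else 0)"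
        using ax_eq[of i j] True inner_Basis[OF axB axB, of i j] by auto
      show ?thesis
        using div2 ip unfolding w_def v_def \<gamma>_def by (auto simp: sympl_def split: if_splits)
    qed
    have "cf (z i * z j - z j * z i) k = cf (of_int (sympl i j) * hb) k" for k
    proof -
      have oi: "cf (of_int m * (hb :: ('n,'q) fsym)) k = (if k = 2 then csc (of_int m * \<i>) 1 else 0)" for m
      proof -
        have "cf (of_int m * (hb :: ('n,'q) fsym)) k = of_int m * cf (hb :: ('n,'q) fsym) k"
          by (induction m rule: int_induct[where k=0]) (simp_all add: algebra_simps cf_add cf_minus)
        moreover have "of_int m * csc \<i> (1 :: ('n,'q) sym) = csc (of_int m * \<i>) 1"
        proof -
          have "of_int m * csc \<i> (1 :: ('n,'q) sym) = csc (of_real (of_int m)) (csc \<i> 1)"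
            unfolding csc_of_real by (simp add: scaleR_conv_of_real)
          then show ?thesis by (simp add: csc_csc)
        qed
        moreover have "cf (hb :: ('n,'q) fsym) k = (if k = 2 then csc \<i> 1 else 0)" by (simp add: hb_def)
        ultimately show ?thesis by (cases "k = 2") simp_all
      qed
      have "cf (z i * z j - z j * z i) k = (if k \<ge> 2 then dlt (v i) (cf (zc (v j) :: ('n, 'q) fsym) (k - 2)) else 0)"
        using True by (simp add: z_def cf_zc_commutator)
      also have "\<dots> = (if k = 2 then csc (of_int (sympl i j) * \<i>) 1 else 0)"
        using sc by (auto simp: zc_def dlt_v pd_coord[OF wB] csc_of_real[symmetric] csc_csc)
      finally show ?thesis by (simp add: oi)
    qed
    then show ?thesis using True by (intro fsym_eqI) (simp add: c_def)
  qed (auto simp: z_def c_def)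
  define Z where "Z i = P * z i * P" for i
  define D where "D i = z i * P - P * z i" for i
  define F where "F i j = P * D i * D j * P - P * D j * D i * P" for i j
  have PPx: "P * (P * x) = P * x" for x by (metis PP mult.assoc)
  have cen: "c i j * x = x * c i j" for i j x
  proof -
    have "of_int m * hb * x = x * (of_int m * hb)" for m
      by (metis hb_central mult.assoc mult_of_int_commute)
    then show ?thesis by (simp add: c_def)
  qed
  \<comment> \<open>Expanding the two commutators gives four products, and \<open>P * P = P\<close>
    cancels two of them.\<close>
  have PDD: "P * D i * D j * P = Z i * Z j - P * z i * z j * P" for i j
    by (simp add: D_def Z_def algebra_simps PP PPx)
  have comm: "Z i * Z j - Z j * Z i = c i j * P + F i j" for i j
  proof -
    have "F i j = Z i * Z j - Z j * Z i - P * (z i * z j - z j * z i) * P"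
      unfolding F_def PDD by (simp add: algebra_simps)
    also have "P * (z i * z j - z j * z i) * P = c i j * P"
      unfolding zz cen[of i j P, symmetric] by (simp add: mult.assoc PP)
    finally show ?thesis by simp
  qed
  define H where "H d x \<longleftrightarrow> hom (int d) x" for d and x :: "('n, 'q) fsym"
  \<comment> \<open>A product of \<open>2n\<close> factors of order 1 has order \<open>2n\<close>,
    so its coefficient at index \<open>4n\<close> has degree \<open>-2n\<close>, the degree in which
    \<open>T\<close> is cyclic.\<close>
  define \<tau> where "\<tau> x = T (cf x (4 * ?n))" for x
  have T0: "T 0 = 0" using add[of 0 0] by simp
  have Tsum: "T (\<Sum>i\<in>I. f i) = (\<Sum>i\<in>I. T (f i))" for I :: "(nat \<times> nat \<times> nat) set" and f
    by (induction I rule: infinite_finite_induct) (auto simp: T0 add)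
  have tr: "\<tau> (x * y) = \<tau> (y * x)" if x: "H d x" and y: "H e y" and de: "d + e = 2 * ?n" for x y d e
  proof -
    have "\<tau> (x * y) = (\<Sum>(m, i, j)\<in>idx2 (4 * ?n). T (stN m (cf x i) (cf y j)))"
      by (simp add: \<tau>_def cf_mult Tsum case_prod_unfold)
    also have "\<dots> = (\<Sum>(m, i, j)\<in>idx2 (4 * ?n). T (stN m (cf y j) (cf x i)))"
    proof (rule sum.cong[OF refl], clarify)
      fix m i j assume "(m, i, j) \<in> idx2 (4 * ?n)"
      then have ij: "i + j + 2 * m = 4 * ?n" by (simp add: idx2_def)
      have "T (stC m (cf x i) (cf y j)) = T (stC m (cf y j) (cf x i))"
      proof (rule stC_trace[OF add cyc div csc])
        show "dg (int d - int i) (cf x i)" "dg (int e - int j) (cf y j)"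
          using x y unfolding H_def hom_def by auto
        show "int d - int i + (int e - int j) - 2 * int m = - (2 * int ?n)" using ij de by linarith
      qed auto
      then show "T (stN m (cf x i) (cf y j)) = T (stN m (cf y j) (cf x i))"
        unfolding stN_def csc_of_real[symmetric] csc by simp
    qed
    also have "\<dots> = (\<Sum>(m, i, j)\<in>idx2 (4 * ?n). T (stN m (cf y i) (cf x j)))"
      by (rule sum.reindex_bij_witness[where i="\<lambda>(m, i, j). (m, j, i)" and j="\<lambda>(m, i, j). (m, j, i)"])
        (auto simp: idx2_def)
    also have "\<dots> = \<tau> (y * x)" by (simp add: \<tau>_def cf_mult Tsum case_prod_unfold)
    finally show ?thesis .
  qed
  have homc: "hom 2 (of_int m * hb :: ('n, 'q) fsym)" for m
  proof -
    have "hom 0 (of_int m :: ('n, 'q) fsym)"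
    proof -
      have "cf (of_int m :: ('n, 'q) fsym) k = (if k = 0 then csc (of_int m) 1 else 0)" for k
      proof -
        have "cf (of_int m :: ('n, 'q) fsym) k = of_int m * cf 1 k"
          by (induction m rule: int_induct[where k=0]) (simp_all add: algebra_simps cf_add cf_minus)
        moreover have "csc (of_int m) (1::('n,'q) sym) = of_int m"
          using csc_of_real[of "of_int m" "1::('n,'q) sym"] by (simp add: scaleR_conv_of_real)
        ultimately show ?thesis by (simp add: cf_1)
      qed
      then show ?thesis by (simp add: hom_def dg_csc dg_1)
    qed
    from hom_mult[OF this hom_hb] show ?thesis by simp
  qed
  have h0: "hom d (0 :: ('n, 'q) fsym)" for d by (simp add: hom_def)
  have HZ: "H 1 (Z i)" for i
  proof -
    have "hom 1 (z i)" by (simp add: z_def hom_zc h0)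
    from hom_mult[OF hom_mult[OF hP this] hP] show ?thesis by (simp add: H_def Z_def)
  qed
  have key: "alt (2 * ?n) (\<lambda>l. \<tau> (P * pairprod F ?n l)) = (- 1) ^ ?n * alt (2 * ?n) (\<lambda>l. \<tau> (pairprod c ?n l * P))"
  proof (rule alternating_trace_identity[where H=H, OF comm PP _ _ _ cen])
    show "P * Z i = Z i" "Z i * P = Z i" for i by (simp_all add: Z_def mult.assoc PP PPx)
    show "F i j * P = F i j" for i j by (simp add: F_def algebra_simps PP)
    show "\<tau> (x + y) = \<tau> x + \<tau> y" for x y by (simp add: \<tau>_def cf_add add)
    show "\<tau> (x * y) = \<tau> (y * x)" if "H d x" "H e y" "d + e = 2 * ?n" for x y d e by (rule tr[OF that])
    show "H 0 1" by (simp add: H_def hom_1)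
    show "H 1 (Z i)" for i by (rule HZ)
    show "H 2 (c i j)" for i j by (simp add: H_def c_def homc h0)
    show "H (d + e) (x * y)" if "H d x" "H e y" for x y d e
      using hom_mult[of "int d" x "int e" y] that by (simp add: H_def)
  qed
  define h where "h = cf P 0"
  define E where "E i j = h * dlt (v i) h * dlt (v j) h * h - h * dlt (v j) h * dlt (v i) h * h" for i j
  have FE: "k < 4 \<Longrightarrow> cf (F i j) k = 0" "cf (F i j) 4 = E i j" if ij: "i < 2 * ?n" "j < 2 * ?n" for i j k
  proof -
    have two_two: "2 + 2 = (4::nat)" by simp
    \<comment> \<open>A commutator with a coordinate starts at index 2, so \<open>F\<close> starts
      at index 4. A product of \<open>n\<close> of them at index \<open>4n\<close> is therefore the
      product of their leading terms.\<close>
    have Dk: "cf (D i) k = 0" if "i < 2 * ?n" "k < 2" for i k using that by (simp add: D_def z_def cf_zc_commutator)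
    have D2: "cf (D i) 2 = dlt (v i) h" if "i < 2 * ?n" for i using that by (simp add: D_def z_def cf_zc_commutator h_def)
    have PD: "k < 2 \<Longrightarrow> cf (P * D i) k = 0" "cf (P * D i) 2 = h * dlt (v i) h" if "i < 2 * ?n" for i k
      using cf_mult_leading[of 0 P 2 "D i", unfolded add_0] Dk[OF that] D2[OF that] by (auto simp: h_def)
    have PDD: "k < 4 \<Longrightarrow> cf (P * D i * D j) k = 0" "cf (P * D i * D j) 4 = h * dlt (v i) h * dlt (v j) h"
      if "i < 2 * ?n" "j < 2 * ?n" for i j k
      using cf_mult_leading[of 2 "P * D i" 2 "D j", unfolded two_two] Dk[OF that(2)] D2[OF that(2)] PD[OF that(1)] by auto
    have PDDP: "k < 4 \<Longrightarrow> cf (P * D i * D j * P) k = 0" "cf (P * D i * D j * P) 4 = h * dlt (v i) h * dlt (v j) h * h"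
      if "i < 2 * ?n" "j < 2 * ?n" for i j k
      using cf_mult_leading[of 4 "P * D i * D j" 0 P, unfolded add_0_right] PDD[OF that] by (auto simp: h_def)
    show "k < 4 \<Longrightarrow> cf (F i j) k = 0" "cf (F i j) 4 = E i j"
      using PDDP[OF ij] PDDP[OF ij(2,1)] by (simp_all add: F_def E_def cf_minus)
  qed
  \<comment> \<open>The radial null vector. Since \<open>- (\<gamma> i * \<gamma> i) = 1\<close>,
    the product of \<open>e i\<close> with the commutator of coordinate \<open>i\<close> and
    \<open>h\<close> is the coordinate along \<open>w i\<close> times the derivative in that
    direction; the sum over \<open>i\<close> is Euler's operator, which kills
    \<open>h\<close>.\<close>
  define e where "e k = csc (- \<gamma> k) (coord (w k) :: ('n, 'q) sym)" for k
  have ecen: "e i * x = x * e i" for i x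
    by (simp add: e_def csc_mult_left csc_mult_right coord_central)
  have edlt: "e i * dlt (v i) h = coord (w i) * pd (w i) h" for i
  proof -
    have "- (\<gamma> i * \<gamma> i) = 1" by (simp add: \<gamma>_def)
    then have "csc (- \<gamma> i * \<gamma> i) (coord (w i) * pd (w i) h) = coord (w i) * pd (w i) h"
      using csc_of_real[of 1] by simp
    then show ?thesis by (simp add: e_def dlt_v csc_mult_left csc_mult_right csc_csc)
  qed
  have wbij: "bij_betw w {..<2 * ?n} Basis"
    unfolding bij_betw_def
  proof
    show "inj_on w {..<2 * ?n}"
    proof (rule inj_onI)
      fix i j assume ij: "i \<in> {..<2 * ?n}" "j \<in> {..<2 * ?n}" "w i = w j"
      have "ax i \<noteq> 0" for i using axB[of i] nonzero_Basis by blast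
      then have "even i = even j" "ax i = ax j" using ij(3) by (auto simp: w_def split: if_splits)
      then show "i = j" using ax_eq[of i j] ij by (auto elim!: evenE oddE)
    qed
    then have "card (w ` {..<2 * ?n}) = 2 * ?n" by (simp add: card_image)
    moreover have "card (Basis :: ((real^'n) \<times> (real^'n)) set) = 2 * ?n" by simp
    ultimately show "w ` {..<2 * ?n} = Basis" using wB by (intro card_subset_eq) auto
  qed
  have dgh: "dg 0 h" using hP unfolding hom_def h_def by (metis diff_zero of_nat_0)
  have rad: "(\<Sum>i<2 * ?n. e i * dlt (v i) h) = 0"
    unfolding edlt using sum.reindex_bij_betw[OF wbij, of "\<lambda>u. coord u * pd u h"] euler[OF dgh] by simp
  have el: "e i * (a * dlt (v i) h * b) = a * (e i * dlt (v i) h) * b" for i a b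
    by (metis ecen mult.assoc)
  have sl: "(\<Sum>i<2 * ?n. e i * E i j) = 0" for j
  proof -
    have "e i * E i j = h * (e i * dlt (v i) h) * (dlt (v j) h * h) - (h * dlt (v j) h) * (e i * dlt (v i) h) * h" for i
      unfolding E_def right_diff_distrib el[symmetric] by (simp add: mult.assoc)
    then show ?thesis by (simp add: sum_subtractf rad flip: sum_distrib_left sum_distrib_right)
  qed
  have sr: "(\<Sum>j<2 * ?n. e j * E i j) = 0" for i
  proof -
    have "E i j = - E j i" for j by (simp add: E_def)
    then show ?thesis using sl[of i] by (simp add: sum_negf)
  qed
  \<comment> \<open>The null vector only shows that each coordinate times the alternating sum
    vanishes. At a point other than the origin some coordinate is nonzero and can be divided
    out.\<close>
  have alt0: "alt (2 * ?n) (pairprod E ?n) = 0"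
  proof (rule sym_eqI)
    fix x :: "(real^'n) \<times> (real^'n)" assume x: "x \<noteq> 0"
    then obtain u where u: "u \<in> Basis" "x \<bullet> u \<noteq> 0" by (metis euclidean_all_zero_iff)
    then have "u \<in> w ` {..<2 * ?n}" using wbij by (simp add: bij_betw_def)
    then obtain k where k: "k < 2 * ?n" "w k = u" by auto
    have "e k * alt (2 * ?n) (pairprod E ?n) = 0"
      by (rule alt_pairprod_null_direction[OF ecen sl sr k(1)])
    then have "csc (\<gamma> k) (e k * alt (2 * ?n) (pairprod E ?n)) = 0" by simp
    moreover have "csc (\<gamma> k) (e k * y) = coord u * y" for y
    proof -
      have "\<gamma> k * - \<gamma> k = 1" by (simp add: \<gamma>_def)
      then show ?thesis using csc_of_real[of 1 "coord u * y"] by (simp add: e_def csc_mult_left csc_csc k(2))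
    qed
    ultimately have "val (coord u * alt (2 * ?n) (pairprod E ?n)) x = 0" by (simp add: val_0)
    then show "val (alt (2 * ?n) (pairprod E ?n)) x = val 0 x" using u by (simp add: coord_mult val_0)
  qed
  have Tint: "T (of_int m * a) = of_int m * T a" for m a
  proof -
    have "of_int m * a = csc (of_real (of_int m)) a"
      unfolding csc_of_real by (simp add: scaleR_conv_of_real)
    then show ?thesis by (simp add: csc)
  qed
  have "alt (2 * ?n) (\<lambda>l. \<tau> (P * pairprod F ?n l)) = T (h * alt (2 * ?n) (pairprod E ?n))"
  proof -
    have "\<tau> (P * pairprod F ?n l) = T (h * pairprod E ?n l)" if "set l \<subseteq> {..<2 * ?n}" "length l = 2 * ?n" for l
      using cf_mult_leading(2)[of 0 P "4 * ?n" "pairprod F ?n l"] pairprod_leading[where F=F and E=E and N="2 * ?n" and l=l and n="?n", OF FE] that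
      by (simp add: \<tau>_def h_def)
    then have "alt (2 * ?n) (\<lambda>l. \<tau> (P * pairprod F ?n l)) = alt (2 * ?n) (\<lambda>l. T (h * pairprod E ?n l))"
      by (intro alt_cong) auto
    also have "\<dots> = T (h * alt (2 * ?n) (pairprod E ?n))"
    proof -
      have Ts: "T (\<Sum>i\<in>I. f i) = (\<Sum>i\<in>I. T (f i))" for I :: "(nat \<Rightarrow> nat) set" and f
        by (induction I rule: infinite_finite_induct) (auto simp: T0 add)
      have "h * (of_int s * y) = of_int s * (h * y)" for s y by (metis mult.assoc mult_of_int_commute)
      then show ?thesis by (simp add: alt_def sum_distrib_left Ts Tint)
    qed
    finally show ?thesis .
  qed
  then have zero: "alt (2 * ?n) (\<lambda>l. \<tau> (pairprod c ?n l * P)) = 0" using key alt0 T0 by simp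
  \<comment> \<open>Every scalar commutator carries one factor \<open>hb\<close>, so
    \<open>n\<close> of them shift the index by \<open>2n\<close>, and index \<open>4n\<close> of
    the product reads index \<open>2n\<close> of \<open>P\<close>.\<close>
  have "\<tau> (pairprod c ?n l * P) = of_int (pairprod sympl ?n l) * (\<i> ^ ?n * T (cf P (2 * ?n)))"
    if "set l = {..<2 * ?n}" "length l = 2 * ?n" for l
  proof -
    have "pairprod c ?n l = of_int (pairprod sympl ?n l) * hb ^ ?n"
      by (rule pairprod_scaled[of "2 * ?n"]) (use that in \<open>auto simp: c_def\<close>)
    moreover have "cf (of_int m * x) k = of_int m * cf x k" for m k and x :: "('n,'q) fsym"
      by (induction m rule: int_induct[where k=0]) (simp_all add: algebra_simps cf_add cf_minus)
    moreover have "4 * ?n = 2 * ?n + 2 * ?n" by simp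
    ultimately show ?thesis unfolding \<tau>_def by (simp only: mult.assoc cf_hb_power_mult Tint csc)
  qed
  then have "alt (2 * ?n) (\<lambda>l. \<tau> (pairprod c ?n l * P)) =
      alt (2 * ?n) (\<lambda>l. of_int (pairprod sympl ?n l) * (\<i> ^ ?n * T (cf P (2 * ?n))))"
    by (intro alt_cong)
  also have "\<dots> = of_int (alt (2 * ?n) (pairprod sympl ?n)) * (\<i> ^ ?n * T (cf P (2 * ?n)))"
    by (simp add: alt_def sum_distrib_right mult.assoc)
  finally have "of_int (alt (2 * ?n) (pairprod sympl ?n)) * (\<i> ^ ?n * T (cf P (2 * ?n))) = (0::complex)"
    using zero by simp
  moreover have "alt (2 * ?n) (pairprod sympl ?n) \<noteq> (0::int)" using alt_sympl_pos[of ?n] by simp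
  ultimately show ?thesis by simp
qed

section \<open>Matrix-valued symbols\<close>

lemma pdiff_bounded_linear:
  assumes S: "open S" and L: "bounded_linear L" and f: "smooth_on S f" and ds: "set ds \<subseteq> Basis" and z: "z \<in> S"
  shows "pdiff ds (\<lambda>z. L (f z)) z = L (pdiff ds f z)"
  using ds z
proof (induction ds arbitrary: z)
  case (Cons v ds)
  have "dd v (pdiff ds (\<lambda>z. L (f z))) z = dd v (\<lambda>z. L (pdiff ds f z)) z"
    by (rule dd_cong_open[OF S Cons.prems(2)]) (use Cons in simp)
  also have "\<dots> = L (dd v (pdiff ds f) z)"
    by (rule dd_bounded_linear[OF L smooth_on_diff[OF smooth_on_pdiff[OF f] Cons.prems(2)]]) (use Cons.prems in simp)
  finally show ?case by (simp only: pdiff_Cons_dd)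
qed simp

lemma pdiff_diff_on:
  assumes S: "open S" and f: "smooth_on S f" and g: "smooth_on S g" and ds: "set ds \<subseteq> Basis" and z: "z \<in> S"
  shows "pdiff ds (\<lambda>z. f z - g z) z = pdiff ds f z - pdiff ds g z"
  using ds z
proof (induction ds arbitrary: z)
  case (Cons v ds)
  have d: "pdiff ds f differentiable at z" "pdiff ds g differentiable at z"
    using Cons.prems by (auto intro!: smooth_on_diff[OF smooth_on_pdiff[OF f]] smooth_on_diff[OF smooth_on_pdiff[OF g]])
  have "dd v (pdiff ds (\<lambda>z. f z - g z)) z = dd v (\<lambda>z. pdiff ds f z - pdiff ds g z) z"
    by (rule dd_cong_open[OF S Cons.prems(2)]) (use Cons in simp)
  also have "\<dots> = dd v (pdiff ds f) z - dd v (pdiff ds g) z"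
    by (rule dd_eqI[OF has_derivative_diff[OF has_derivative_dd has_derivative_dd]]) (rule d)+
  finally show ?case by (simp only: pdiff_Cons_dd)
qed simp

lemma pdiff_sum_on:
  assumes S: "open S" and f: "\<And>i. i \<in> I \<Longrightarrow> smooth_on S (f i)" and ds: "set ds \<subseteq> Basis" and z: "z \<in> S"
  shows "pdiff ds (\<lambda>z. \<Sum>i\<in>I. f i z) z = (\<Sum>i\<in>I. pdiff ds (f i) z)"
  using ds z
proof (induction ds arbitrary: z)
  case (Cons v ds)
  have "dd v (pdiff ds (\<lambda>z. \<Sum>i\<in>I. f i z)) z = dd v (\<lambda>z. \<Sum>i\<in>I. pdiff ds (f i) z) z"
    by (rule dd_cong_open[OF S Cons.prems(2)]) (use Cons in simp)
  also have "\<dots> = (\<Sum>i\<in>I. dd v (pdiff ds (f i)) z)"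
    by (rule dd_sum) (rule smooth_on_diff[OF smooth_on_pdiff[OF f]], use Cons.prems in auto)
  finally show ?case by (simp only: pdiff_Cons_dd)
qed simp

lemma bsym_reindex: "bsym W a \<Longrightarrow> bsym (\<lambda>s. W (f s)) (\<lambda>s. a (f s))"
  unfolding bsym_pdiff_iff by meson

section \<open>Vector-valued integrals\<close>

lemma bounded_linear_axis: "bounded_linear (axis i :: complex \<Rightarrow> complex^'q::finite)"
  by (rule linear_conv_bounded_linear[THEN iffD1]) (auto intro!: linearI simp: axis_def vec_eq_iff)

lemma vec_sum_axis: "(\<chi> i. x i) = (\<Sum>i\<in>UNIV. axis i (x i :: complex))"
  by (simp add: vec_eq_iff axis_def)

text \<open>\<open>fourier\<close> and \<open>op\<close> are gauge integrals of vector-valued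
  functions, whereas the estimates are made for Lebesgue integrals of the components.\<close>

lemma integral_vec:
  fixes F :: "'q::finite \<Rightarrow> 'a::euclidean_space \<Rightarrow> complex"
  assumes F: "\<And>i. integrable lborel (F i)"
  shows "integral UNIV (\<lambda>x. \<chi> i. F i x) = (\<chi> i. LINT x|lborel. F i x)"
proof -
  have i: "integrable lborel (\<lambda>x. \<Sum>i\<in>UNIV. axis i (F i x))"
    by (rule Bochner_Integration.integrable_sum) (rule integrable_bounded_linear[OF bounded_linear_axis F])
  have "integral UNIV (\<lambda>x. \<chi> i. F i x) = (LINT x|lborel. (\<Sum>i\<in>UNIV. axis i (F i x)))"
    unfolding vec_sum_axis by (rule integral_unique[OF has_integral_integral_lborel[OF i]])
  also have "\<dots> = (\<Sum>i\<in>UNIV. LINT x|lborel. axis i (F i x))"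
    by (rule Bochner_Integration.integral_sum) (rule integrable_bounded_linear[OF bounded_linear_axis F])
  also have "\<dots> = (\<Sum>i\<in>UNIV. axis i (LINT x|lborel. F i x))"
    by (intro sum.cong refl integral_bounded_linear[OF bounded_linear_axis F])
  finally show ?thesis by (simp only: vec_sum_axis)
qed

abbreviation entry :: "('b \<Rightarrow> complex^'q^'r) \<Rightarrow> 'r \<Rightarrow> 'q \<Rightarrow> 'b \<Rightarrow> complex" where
  "entry p i k \<equiv> \<lambda>z. p z $ i $ k"

lemma bounded_linear_entry: "bounded_linear (\<lambda>M::complex^'q::finite^'r::finite. M $ i $ k)"
  using bounded_linear_compose[OF bounded_linear_vec_nth[of k] bounded_linear_vec_nth[of i]] .

lemma norm_entry: "norm (M $ i $ k) \<le> norm (M :: complex^'q::finite^'r::finite)"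
  by (rule order_trans[OF Finite_Cartesian_Product.norm_nth_le Finite_Cartesian_Product.norm_nth_le])

text \<open>The symbol estimate at \<open>t + z\<close> becomes a power bound in \<open>t\<close>
  and \<open>z\<close> by Peetre's inequality, and a plain bound because the bracket is at least
  1.\<close>

lemma Gamma_0_ordsym:
  fixes p :: "('n::finite, 'q::finite) symbol"
  assumes p: "Gamma 0 p"
  shows "ordsym 0 (\<lambda>t z. entry p i k (t + z))"
proof -
  have s: "smooth_on UNIV p" using p by (simp add: Gamma_def)
  have st: "smooth_on UNIV (\<lambda>z. p (t + z))" for t by (rule smooth_on_translate[OF s])
  have "\<exists>C\<ge>0. \<forall>t z. norm (pdiff ds (\<lambda>z. entry p i k (t + z)) z) \<le> C * (mu t * (1 + norm z)) ^ (0 + length ds)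
      \<and> norm (pdiff ds (\<lambda>z. entry p i k (t + z)) z) \<le> C" if ds: "set ds \<subseteq> Basis" for ds
  proof -
    obtain C where C: "\<And>z. norm (pdiff ds p z) \<le> C * bracket z powr (real_of_int 0 - real (length ds))"
      using p ds unfolding Gamma_def by meson
    have b: "bracket z powr (real_of_int 0 - real (length ds)) = (1 / bracket z) ^ length ds" for z :: "(real^'n) \<times> (real^'n)"
      by (simp add: bracket_def powr_minus powr_realpow divide_inverse power_inverse)
    have b1: "0 \<le> 1 / bracket z" "1 / bracket z \<le> 1" for z :: "(real^'n) \<times> (real^'n)"
      by (auto simp: bracket_def)
    have e: "norm (pdiff ds (\<lambda>z. entry p i k (t + z)) z) \<le> \<bar>C\<bar> * (1 / bracket (t + z)) ^ length ds" for t z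
    proof -
      have "pdiff ds (\<lambda>z. entry p i k (t + z)) z = pdiff ds p (t + z) $ i $ k"
        using pdiff_bounded_linear[OF open_UNIV bounded_linear_entry[of i k] st ds] by (simp add: pdiff_translate[OF s ds])
      then have "norm (pdiff ds (\<lambda>z. entry p i k (t + z)) z) \<le> norm (pdiff ds p (t + z))"
        using norm_entry by metis
      also have "\<dots> \<le> C * (1 / bracket (t + z)) ^ length ds" using C[of "t + z"] unfolding b .
      also have "\<dots> \<le> \<bar>C\<bar> * (1 / bracket (t + z)) ^ length ds" by (intro mult_right_mono zero_le_power b1) simp
      finally show ?thesis .
    qed
    have "norm (pdiff ds (\<lambda>z. entry p i k (t + z)) z) \<le> \<bar>C\<bar> * (mu t * (1 + norm z)) ^ length ds" for t z
      by (rule order_trans[OF e]) (intro mult_left_mono power_mono bracket_peetre b1 abs_ge_zero)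
    moreover have "norm (pdiff ds (\<lambda>z. entry p i k (t + z)) z) \<le> \<bar>C\<bar>" for t z
      by (rule order_trans[OF e mult_left_le]) (intro power_le_one b1 abs_ge_zero)+
    ultimately show ?thesis by (intro exI[of _ "\<bar>C\<bar>"]) simp
  qed
  then show ?thesis unfolding ordsym_def
    by (intro conjI allI impI smooth_on_bounded_linear[OF open_UNIV bounded_linear_entry st])
qed

lemma Gamma_0_bsym:
  fixes p :: "('n::finite, 'q::finite) symbol"
  assumes p: "Gamma 0 p"
  shows "bsym (\<lambda>(t::'t) z. 1) (\<lambda>t. entry p i k)"
  using bsym_reindex[OF ordsym_bsym[OF Gamma_0_ordsym[OF p]], where f = "\<lambda>t::'t. 0"] by simp

section \<open>Matrix operators entry by entry\<close>

lemma fourier_eq_ft: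
  fixes u :: "real^'n::finite \<Rightarrow> complex^'q::finite"
  assumes u: "\<And>k. sch (\<lambda>t::unit. \<lambda>x. u x $ k)"
  shows "fourier u \<xi> $ k = ft (\<lambda>x. u x $ k) \<xi>"
proof -
  have i: "integrable lborel (\<lambda>x. cis (- (x \<bullet> \<xi>)) * u x $ k)" for k
    using osc_integrable[OF sch_amp[OF u[of k]], where \<sigma> = "-1" and y = \<xi>] by (simp add: inner_commute)
  show ?thesis unfolding fourier_def integral_vec[OF i] by (simp add: ft_eq inner_commute)
qed

lemma powr_DIM: "(2 * pi) powr (- real CARD('n::finite)) = 1 / (2 * pi) ^ DIM(real^'n)"
  by (simp add: powr_minus powr_realpow divide_inverse)

lemma op_eq_op1:
  fixes u :: "real^'n::finite \<Rightarrow> complex^'q::finite"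
  assumes p: "Gamma 0 p" and u: "\<And>k. sch (\<lambda>t::unit. \<lambda>x. u x $ k)"
  shows "op p u x $ i = (\<Sum>k\<in>UNIV. op1 (entry p i k) (\<lambda>x. u x $ k) x)"
proof -
  let ?v = "\<lambda>k. ft (\<lambda>x. u x $ k)"
  have i: "integrable lborel (\<lambda>\<xi>. cis (1 * (x \<bullet> \<xi>)) * (p (x, \<xi>) $ i $ k * ?v k \<xi>))" for i k
    using osc_integrable[OF amp_symbol_ft[OF Gamma_0_bsym[OF p, of i k] u[of k]], where \<sigma> = 1 and y = x] by simp
  have e: "cis (x \<bullet> \<xi>) * (p (x, \<xi>) *v fourier u \<xi>) $ i = (\<Sum>k\<in>UNIV. cis (1 * (x \<bullet> \<xi>)) * (p (x, \<xi>) $ i $ k * ?v k \<xi>))" for i \<xi>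
    by (simp add: matrix_vector_mult_def fourier_eq_ft[OF u] sum_distrib_left)
  have "op p u x = (1 / (2 * pi) ^ DIM(real^'n)) *\<^sub>R
      (\<chi> i. LINT \<xi>|lborel. (\<Sum>k\<in>UNIV. cis (1 * (x \<bullet> \<xi>)) * (p (x, \<xi>) $ i $ k * ?v k \<xi>)))"
    unfolding op_def powr_DIM e by (subst integral_vec) (intro Bochner_Integration.integrable_sum i, simp)
  also have "\<dots> $ i = (1 / (2 * pi) ^ DIM(real^'n)) *\<^sub>R (\<Sum>k\<in>UNIV. osc 1 (\<lambda>z. entry p i k z * ?v k (snd z)) x)"
    unfolding vector_scaleR_component vec_lambda_beta osc_def snd_conv
    by (subst Bochner_Integration.integral_sum[OF i]) simp
  finally show ?thesis by (simp add: op1_def sum_divide_distrib scaleR_conv_of_real[where 'a=complex] divide_inverse sum_distrib_left mult.commute)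
qed

text \<open>Phase space translations; conjugating an operator by \<open>tr a b\<close> translates its symbol by \<open>(a, b)\<close>.\<close>
definition tr :: "'a::euclidean_space \<Rightarrow> 'a \<Rightarrow> ('a \<Rightarrow> complex) \<Rightarrow> 'a \<Rightarrow> complex" where
  "tr a b u x = cis (b \<bullet> x) * u (x - a)"

lemma pdiff_cis: "\<exists>c. pdiff ds (\<lambda>x. cis (b \<bullet> x)) = (\<lambda>x::'a::euclidean_space. c * cis (b \<bullet> x))"
proof (induction ds)
  case (Cons v ds)
  then obtain c where c: "pdiff ds (\<lambda>x. cis (b \<bullet> x)) = (\<lambda>x. c * cis (b \<bullet> x))" ..
  have "dd v (\<lambda>x. c * cis (b \<bullet> x)) x = (c * \<i> * of_real (b \<bullet> v)) * cis (b \<bullet> x)" for x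
    by (rule dd_eqI[where f' = "\<lambda>h. (c * \<i> * of_real (b \<bullet> h)) * cis (b \<bullet> x)"])
      (auto intro!: derivative_eq_intros simp: scaleR_conv_of_real algebra_simps)
  then show ?case unfolding pdiff_Cons_dd c by blast
qed (auto intro: exI[of _ 1])

lemma bsym_cis: "bsym (\<lambda>(t::'t) (z::'a::euclidean_space). 1) (\<lambda>t x. cis (b \<bullet> x))"
  unfolding bsym_pdiff_iff
proof (intro conjI allI impI)
  show "smooth_on UNIV (\<lambda>x. cis (b \<bullet> x))" by (rule smooth_cis_linear[OF bounded_linear_inner_right])
  fix ds :: "'a list"
  obtain c where "pdiff ds (\<lambda>x. cis (b \<bullet> x)) = (\<lambda>x. c * cis (b \<bullet> x))" using pdiff_cis by blast
  then show "\<exists>C. \<forall>(t::'t) z. norm (pdiff ds (\<lambda>x. cis (b \<bullet> x)) z) \<le> C * 1"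
    by (intro exI[of _ "norm c"]) (simp add: norm_mult)
qed

lemma sch_translate:
  assumes u: "sch (\<lambda>t::'t. u)"
  shows "sch (\<lambda>t::'t. \<lambda>x. u (x - a))"
  unfolding sch_def bsym_pdiff_iff
proof (intro conjI allI impI)
  have s: "smooth_on UNIV u" by (rule sch_smooth[OF u])
  show "smooth_on UNIV (\<lambda>x. u (x - a))" using smooth_on_translate[OF s, of "- a"] by simp
  fix k and ds :: "'a list" assume ds: "set ds \<subseteq> Basis"
  obtain C where C: "\<And>y. norm (pdiff ds u y) \<le> C * wt k y"
    using sch_bound[OF sch_pdiff[OF u ds]] by blast
  have C0: "0 \<le> C" using order_trans[OF norm_ge_zero C[of 0]] by (simp add: wt_def)
  have "norm (pdiff ds (\<lambda>x. u (x - a)) z) \<le> (C * (1 + norm a) ^ k) * wt k z" for z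
  proof -
    have p: "pdiff ds (\<lambda>x. u (x - a)) z = pdiff ds u (z - a)" using pdiff_translate[OF s ds, of "- a"] by simp
    have "norm z \<le> norm (z - a) + norm a" using norm_triangle_ineq[of "z - a" a] by simp
    then have "1 + norm z \<le> (1 + norm a) * (1 + norm (z - a))"
      using mult_nonneg_nonneg[OF norm_ge_zero[of a] norm_ge_zero[of "z - a"]] unfolding distrib_left distrib_right by linarith
    then have "(1 + norm z) ^ k \<le> ((1 + norm a) * (1 + norm (z - a))) ^ k" by (intro power_mono) auto
    then have "wt k (z - a) \<le> (1 + norm a) ^ k * wt k z"
      by (simp add: wt_def power_mult_distrib divide_simps add_pos_nonneg zero_less_power mult.commute)
    then show ?thesis unfolding p using order_trans[OF C mult_left_mono[OF _ C0]] by (simp add: mult.assoc)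
  qed
  then show "\<exists>C. \<forall>(t::'t) z. norm (pdiff ds (\<lambda>x. u (x - a)) z) \<le> C * wt k z" by blast
qed

lemma sch_tr:
  assumes u: "sch (\<lambda>t::'t. u)"
  shows "sch (\<lambda>t::'t. tr a b u)"
  unfolding sch_def
proof
  fix k
  have "bsym (\<lambda>t y. wt k y) (\<lambda>t::'t. \<lambda>x. u (x - a))" using sch_translate[OF u] by (simp add: sch_def)
  from bsym_mult[OF bsym_cis this, of b] show "bsym (\<lambda>t y. wt k y) (\<lambda>t::'t. tr a b u)"
    by (simp add: tr_def[abs_def])
qed

lemma sch_measurable: "sch (\<lambda>t::unit. u) \<Longrightarrow> u \<in> borel_measurable borel"
  by (rule borel_measurable_continuous_onI[OF smooth_on_continuous[OF sch_smooth]])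

lemma ft_tr:
  assumes u: "sch (\<lambda>t::unit. u)"
  shows "ft (tr a b u) \<xi> = cis (- (a \<bullet> (\<xi> - b))) * ft u (\<xi> - b)"
proof -
  let ?f = "\<lambda>x. cis (- (\<xi> \<bullet> x)) * tr a b u x"
  have "continuous_on UNIV (\<lambda>x. cis (- (\<xi> \<bullet> x)))" by (intro continuous_intros)
  then have m: "?f \<in> borel_measurable borel"
    by (intro borel_measurable_times borel_measurable_continuous_onI sch_measurable[OF sch_tr[OF u]])
  have "?f (a + x) = cis (- (a \<bullet> (\<xi> - b))) * (cis (- ((\<xi> - b) \<bullet> x)) * u x)" for x
  proof -
    have "cis (- (\<xi> \<bullet> (a + x))) * cis (b \<bullet> (a + x)) = cis (- (a \<bullet> (\<xi> - b))) * cis (- ((\<xi> - b) \<bullet> x))"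
      unfolding cis_mult inner_add_right inner_diff_left inner_diff_right inner_commute[of a]
      by (rule arg_cong[of _ _ cis]) linarith
    then show ?thesis unfolding tr_def mult.assoc[symmetric] by simp
  qed
  then have "(LINT x|lborel. ?f (a + x)) = cis (- (a \<bullet> (\<xi> - b))) * ft u (\<xi> - b)"
    by (simp add: ft_eq)
  then show ?thesis by (simp add: ft_eq lborel_integral_translate[OF m])
qed

text \<open>Substituting \<open>b + \<eta>\<close> for the covariable undoes the shift in the
  Fourier transform of the test function and puts it into the symbol; the remaining phases are those
  of \<open>tr a b\<close>.\<close>

lemma op1_tr:
  assumes u: "sch (\<lambda>t::unit. u)" and A: "smooth_on UNIV A"
  shows "op1 A (tr a b u) = tr a b (op1 (\<lambda>z. A ((a, b) + z)) u)"
proof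
  fix x
  let ?g = "\<lambda>\<eta>. cis (x \<bullet> \<eta>) * (A (x, \<eta>) * ft (tr a b u) \<eta>)"
  have c: "continuous_on UNIV (\<lambda>\<eta>. cis (x \<bullet> \<eta>))" by (intro continuous_intros)
  have c': "continuous_on UNIV (\<lambda>\<eta>. A (x, \<eta>))"
    by (rule continuous_on_compose2[OF smooth_on_continuous[OF A]]) (auto intro!: continuous_intros)
  have m: "?g \<in> borel_measurable borel"
    by (intro borel_measurable_times borel_measurable_continuous_onI c c' sch_measurable sch_ft sch_tr u)
  have g: "?g (b + \<eta>) = cis (b \<bullet> x) * (cis ((x - a) \<bullet> \<eta>) * (A ((a, b) + (x - a, \<eta>)) * ft u \<eta>))" for \<eta>
  proof -
    have *: "cis (x \<bullet> (b + \<eta>)) * cis (- (a \<bullet> \<eta>)) = cis (b \<bullet> x) * cis ((x - a) \<bullet> \<eta>)"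
      unfolding cis_mult inner_add_right inner_diff_left inner_commute[of x b]
      by (rule arg_cong[of _ _ cis]) linarith
    have "?g (b + \<eta>) = (cis (x \<bullet> (b + \<eta>)) * cis (- (a \<bullet> \<eta>))) * (A (x, b + \<eta>) * ft u \<eta>)"
      unfolding ft_tr[OF u] add_diff_cancel_left' by (simp only: mult_ac)
    then show ?thesis unfolding * by (simp add: mult.assoc)
  qed
  have "(LINT \<eta>|lborel. ?g (b + \<eta>)) = cis (b \<bullet> x) * osc 1 (\<lambda>z. A ((a, b) + z) * ft u (snd z)) (x - a)"
    unfolding g osc_def snd_conv mult_1 by (rule integral_mult_right_zero)
  then show "op1 A (tr a b u) x = tr a b (op1 (\<lambda>z. A ((a, b) + z)) u) x"
    using lborel_integral_translate[OF m, of b] by (simp add: op1_def tr_def osc_def)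
qed

lemma axis_schwartz:
  fixes w :: "real^'n::finite \<Rightarrow> complex"
  assumes w: "sch (\<lambda>t::unit. w)"
  shows "schwartz (\<lambda>x. axis l (w x) :: complex^'q::finite)"
  unfolding schwartz_def
proof (intro conjI allI impI)
  have s: "smooth_on UNIV w" by (rule sch_smooth[OF w])
  show "smooth_on UNIV (\<lambda>x. axis l (w x) :: complex^'q)"
    by (rule smooth_on_bounded_linear[OF open_UNIV bounded_linear_axis s])
  fix ds :: "(real^'n) list" and k assume ds: "set ds \<subseteq> Basis"
  obtain K where K: "\<And>x. norm (axis l x :: complex^'q) \<le> norm x * K" "K > 0"
    using bounded_linear.pos_bounded[OF bounded_linear_axis] by blast
  obtain C where C: "\<And>y. norm (pdiff ds w y) \<le> C * wt k y"
    using sch_bound[OF sch_pdiff[OF w ds]] by blast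
  have "norm x ^ k * norm (pdiff ds (\<lambda>x. axis l (w x) :: complex^'q) x) \<le> C * K" for x
  proof -
    have "pdiff ds (\<lambda>x. axis l (w x) :: complex^'q) x = axis l (pdiff ds w x)"
      by (rule pdiff_bounded_linear[OF open_UNIV bounded_linear_axis s ds]) simp
    then have "norm (pdiff ds (\<lambda>x. axis l (w x) :: complex^'q) x) \<le> norm (pdiff ds w x) * K" using K(1) by metis
    then have "norm x ^ k * norm (pdiff ds (\<lambda>x. axis l (w x) :: complex^'q) x) \<le> (1 + norm x) ^ k * (norm (pdiff ds w x) * K)"
      by (intro mult_mono power_mono) auto
    also have "\<dots> = (norm (pdiff ds w x) * (1 + norm x) ^ k) * K" by simp
    also have "\<dots> \<le> C * K" using C[of x] K(2) unfolding le_wt_iff by (intro mult_right_mono) auto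
    finally show ?thesis .
  qed
  then show "\<exists>C. \<forall>x. norm x ^ k * norm (pdiff ds (\<lambda>x. axis l (w x) :: complex^'q) x) \<le> C" by blast
qed

lemma ft_zero: "ft (\<lambda>x. 0) = (\<lambda>\<xi>. 0)"
  by (simp add: fun_eq_iff ft_eq)

lemma op1_zero: "op1 A (\<lambda>x. 0) = (\<lambda>x. 0)"
  by (simp add: fun_eq_iff op1_def osc_def ft_zero)

section \<open>From the operator identity to an expansion of the symbol\<close>

text \<open>A test function whose only nonzero component is the \<open>l\<close>-th isolates column
  \<open>l\<close> of the operator, and the matrix identity becomes a finite sum of scalar
  ones.\<close>

lemma idempotent_entries:
  fixes p :: "('n::finite, 'q::finite) symbol"
  assumes p: "Gamma 0 p" and idem: "\<And>u. schwartz u \<Longrightarrow> op p (op p u) = op p u"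
    and w: "sch (\<lambda>t::unit. w)"
  shows "(\<Sum>k\<in>UNIV. op1 (entry p i k) (op1 (entry p k l) w) x) = op1 (entry p i l) w x"
proof -
  define U where "U = (\<lambda>x. axis l (w x) :: complex^'q)"
  have Uk: "(\<lambda>x. U x $ k) = (if k = l then w else (\<lambda>x. 0))" for k
    by (auto simp: U_def axis_def fun_eq_iff)
  have sU: "sch (\<lambda>t::unit. \<lambda>x. U x $ k)" for k
    unfolding Uk using w by (simp add: sch_def bsym_pdiff_iff) (metis mult_zero_left order_refl)
  have e: "op p U x $ i = op1 (entry p i l) w x" for x i
  proof -
    have "op1 (entry p i k) (if k = l then w else (\<lambda>x. 0)) x = (if k = l then op1 (entry p i k) w x else 0)" for k
      by (simp add: op1_zero)
    then show ?thesis unfolding op_eq_op1[OF p sU] Uk by simp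
  qed
  have s2: "sch (\<lambda>t::unit. \<lambda>x. op p U x $ k)" for k
    unfolding e by (rule sch_op1[OF Gamma_0_bsym[OF p] w])
  have "op p (op p U) x $ i = op p U x $ i" using idem[OF axis_schwartz[OF w]] by (simp add: U_def)
  then show ?thesis unfolding op_eq_op1[OF p s2] e .
qed

text \<open>The identity is tested on the translate of \<open>w\<close> by \<open>t = (a, b)\<close>
  and evaluated at \<open>a\<close>. By \<open>op1_tr\<close> the translation moves into the
  symbols, and the common phase \<open>cis (b \<bullet> a)\<close> cancels.\<close>

lemma idempotent_entries_translate:
  fixes p :: "('n::finite, 'q::finite) symbol"
  assumes p: "Gamma 0 p" and idem: "\<And>u. schwartz u \<Longrightarrow> op p (op p u) = op p u"
    and w: "sch (\<lambda>t::unit. w)"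
  shows "(\<Sum>k\<in>UNIV. op1 (\<lambda>z. entry p i k (t + z)) (op1 (\<lambda>z. entry p k l (t + z)) w) 0)
    = op1 (\<lambda>z. entry p i l (t + z)) w 0"
proof -
  obtain a b where t: "t = (a, b)" by (cases t)
  have s: "smooth_on UNIV (entry p i k)" for i k
    using Gamma_0_bsym[OF p, where 't = unit] by (rule bsym_smooth)
  have s': "sch (\<lambda>t::unit. op1 (\<lambda>z. entry p k l ((a, b) + z)) w)" for k
    using sch_op1[OF bsym_reindex[OF ordsym_bsym[OF Gamma_0_ordsym[OF p, of k l]], where f = "\<lambda>t::unit. (a, b)"] w] by simp
  have "(\<Sum>k\<in>UNIV. op1 (entry p i k) (op1 (entry p k l) (tr a b w)) a) = op1 (entry p i l) (tr a b w) a"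
    by (rule idempotent_entries[OF p idem sch_tr[OF w]])
  then have "(\<Sum>k\<in>UNIV. cis (b \<bullet> a) * op1 (\<lambda>z. entry p i k (t + z)) (op1 (\<lambda>z. entry p k l (t + z)) w) 0)
    = cis (b \<bullet> a) * op1 (\<lambda>z. entry p i l (t + z)) w 0"
    unfolding op1_tr[OF w s] op1_tr[OF s' s] by (simp add: tr_def t)
  then show ?thesis by (simp add: sum_distrib_left[symmetric])
qed

lemma dd_translate: "smooth_on UNIV f \<Longrightarrow> v \<in> Basis \<Longrightarrow> dd v (\<lambda>z. f (t + z)) = (\<lambda>z. dd v f (t + z))"
  using pdiff_translate[of f "[v]" t] by (simp add: dd_def)

lemma stc_translate:
  fixes a b :: "'a::euclidean_space \<times> 'a \<Rightarrow> complex"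
  assumes "smooth_on UNIV a" "smooth_on UNIV b"
  shows "stc m (\<lambda>z. a (t + z)) (\<lambda>z. b (t + z)) z = stc m a b (t + z)"
  using assms
proof (induction m arbitrary: a b z)
  case (Suc m)
  show ?case unfolding stc.simps
  proof (rule sum.cong[OF refl])
    fix j :: 'a assume j: "j \<in> Basis"
    then have j': "(0, j) \<in> Basis" "(j, 0) \<in> Basis" by (auto simp: Basis_prod_def)
    show "stc m (dd (0, j) (\<lambda>z. a (t + z))) (\<lambda>z. - \<i> * dd (j, 0) (\<lambda>z. b (t + z)) z) z =
        stc m (dd (0, j) a) (\<lambda>z. - \<i> * dd (j, 0) b z) (t + z)"
      unfolding dd_translate[OF Suc.prems(1) j'(1)] dd_translate[OF Suc.prems(2) j'(2)]
      by (rule Suc.IH[OF smooth_on_dd[OF Suc.prems(1) j'(1)] smooth_on_cmult[OF smooth_on_dd[OF Suc.prems(2) j'(2)]]])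
  qed
qed simp

theorem idempotent_symbol_expansion:
  fixes p :: "('n::finite, 'q::finite) symbol"
  assumes p: "Gamma 0 p" and idem: "\<And>u. schwartz u \<Longrightarrow> op p (op p u) = op p u" and N: "N > 0"
  shows "neg N (\<lambda>t. entry p i l t -
    (\<Sum>m<N. of_real (1 / fact m) * (\<Sum>k\<in>UNIV. stc m (entry p i k) (entry p k l) t)))"
proof -
  let ?b = "bump :: real^'n \<Rightarrow> complex"
  let ?e = "\<lambda>i k t z. entry p i k (t + z)"
  have s: "smooth_on UNIV (entry p i k)" for i k
    using Gamma_0_bsym[OF p, where 't = unit] by (rule bsym_smooth)
  have 1: "neg N (\<lambda>t. \<Sum>k\<in>UNIV. op1 (?e i k t) (op1 (?e k l t) ?b) 0 - (\<Sum>m<N. of_real (1 / fact m) * stc m (?e i k t) (?e k l t) 0))"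
    by (intro neg_sum op1_composition_expansion Gamma_0_ordsym p sch_bump bump_at_0 bump_jets N)
  \<comment> \<open>The side with a single operator is expanded on the same test function: its jet
    is that of the constant 1, so the value at 0 is the symbol itself up to order
    \<open>-N\<close>.\<close>
  have 2: "neg N (\<lambda>t. op1 (?e i l t) ?b 0 - entry p i l t)"
  proof -
    have "neg N (\<lambda>t. pdiff [] (op1 (?e i l t) ?b) 0 - ?b 0 * pdiff (map (\<lambda>v. (v, 0)) []) (?e i l t) 0)"
      by (rule op1_flat_jets[OF Gamma_0_ordsym[OF p] sch_bump _ _ N]) (use bump_jets in auto)
    then show ?thesis by (simp add: bump_at_0)
  qed
  have e: "(\<Sum>k\<in>UNIV. op1 (?e i k t) (op1 (?e k l t) ?b) 0) = op1 (?e i l t) ?b 0" for t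
    by (rule idempotent_entries_translate[OF p idem sch_bump])
  have 3: "(\<Sum>k\<in>UNIV. op1 (?e i k t) (op1 (?e k l t) ?b) 0 - (\<Sum>m<N. of_real (1 / fact m) * stc m (?e i k t) (?e k l t) 0))
     - (op1 (?e i l t) ?b 0 - entry p i l t) =
     entry p i l t - (\<Sum>m<N. of_real (1 / fact m) * (\<Sum>k\<in>UNIV. stc m (entry p i k) (entry p k l) t))" for t
    unfolding sum_subtractf e stc_translate[OF s s] sum_distrib_left
    by (subst sum.swap) simp
  show ?thesis using neg_diff[OF 1 2] unfolding 3 .
qed

section \<open>Asymptotic expansions at infinity\<close>

text \<open>This says \<open>F r = (\<Sum>j<N. c j / r ^ j) + O(r ^ (-N))\<close>. Removing the
  constant term and multiplying by \<open>r\<close> gives an expansion that is one term shorter,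
  which makes products and uniqueness inductions on \<open>N\<close>.\<close>

primrec asx :: "nat \<Rightarrow> (real \<Rightarrow> complex) \<Rightarrow> (nat \<Rightarrow> complex) \<Rightarrow> bool" where
  "asx 0 F c = (\<exists>C. \<forall>\<^sub>F r in at_top. norm (F r) \<le> C)"
| "asx (Suc N) F c = asx N (\<lambda>r. of_real r * (F r - c 0)) (\<lambda>j. c (Suc j))"

lemma asx_cong: "\<forall>\<^sub>F r in at_top. F r = G r \<Longrightarrow> asx N F c \<Longrightarrow> asx N G c"
proof (induction N arbitrary: F G c)
  case 0
  from 0(2) obtain C where "\<forall>\<^sub>F r in at_top. norm (F r) \<le> C" by auto
  then have "\<forall>\<^sub>F r in at_top. norm (G r) \<le> C" using 0(1) by eventually_elim simp
  then show ?case by auto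
next
  case (Suc N)
  have "\<forall>\<^sub>F r in at_top. of_real r * (F r - c 0) = of_real r * (G r - c 0)"
    using Suc.prems(1) by eventually_elim simp
  from Suc.IH[OF this] Suc.prems(2) show ?case by simp
qed

lemma asx_coeff_cong: "(\<And>j. j < N \<Longrightarrow> c j = d j) \<Longrightarrow> asx N F c \<Longrightarrow> asx N F d"
proof (induction N arbitrary: F c d)
  case (Suc N)
  have "asx N (\<lambda>r. of_real r * (F r - c 0)) (\<lambda>j. d (Suc j))"
    by (rule Suc.IH[of "\<lambda>j. c (Suc j)"]) (use Suc.prems in auto)
  then show ?case using Suc.prems(1)[of 0] by simp
qed simp

lemma asx_zero: "asx N (\<lambda>r. 0) (\<lambda>j. 0)"
  by (induction N) (auto intro: exI[of _ 0])

lemma asx_add: "asx N F c \<Longrightarrow> asx N G d \<Longrightarrow> asx N (\<lambda>r. F r + G r) (\<lambda>j. c j + d j)"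
proof (induction N arbitrary: F G c d)
  case 0
  then obtain C D where "\<forall>\<^sub>F r in at_top. norm (F r) \<le> C" "\<forall>\<^sub>F r in at_top. norm (G r) \<le> D" by auto
  then have "\<forall>\<^sub>F r in at_top. norm (F r + G r) \<le> C + D" by eventually_elim (rule norm_triangle_mono)
  then show ?case by auto
next
  case (Suc N)
  have "(\<lambda>r. of_real r * (F r + G r - (c 0 + d 0))) = (\<lambda>r. of_real r * (F r - c 0) + of_real r * (G r - d 0))"
    by (simp add: fun_eq_iff algebra_simps)
  then show ?case using Suc.IH[OF Suc.prems[unfolded asx.simps]] by simp
qed

lemma asx_cmult: "asx N F c \<Longrightarrow> asx N (\<lambda>r. a * F r) (\<lambda>j. a * c j)"
proof (induction N arbitrary: F c)
  case 0
  then obtain C where "\<forall>\<^sub>F r in at_top. norm (F r) \<le> C" by auto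
  then have "\<forall>\<^sub>F r in at_top. norm (a * F r) \<le> norm a * C"
    by eventually_elim (simp add: norm_mult mult_left_mono)
  then show ?case by auto
next
  case (Suc N)
  have "(\<lambda>r. of_real r * (a * F r - a * c 0)) = (\<lambda>r. a * (of_real r * (F r - c 0)))"
    by (simp add: fun_eq_iff algebra_simps)
  then show ?case using Suc.IH[OF Suc.prems[unfolded asx.simps]] by simp
qed

lemma asx_sum: "(\<And>i. i \<in> I \<Longrightarrow> asx N (F i) (c i)) \<Longrightarrow> asx N (\<lambda>r. \<Sum>i\<in>I. F i r) (\<lambda>j. \<Sum>i\<in>I. c i j)"
  by (induction I rule: infinite_finite_induct) (auto simp: asx_zero intro!: asx_add)

lemma asx_shift: "asx N F c \<Longrightarrow> asx (Suc N) (\<lambda>r. F r / of_real r) (\<lambda>j. if j = 0 then 0 else c (j - 1))"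
proof -
  assume F: "asx N F c"
  have "\<forall>\<^sub>F r in at_top. F r = of_real r * (F r / of_real r - 0)"
    using eventually_gt_at_top[of "0::real"] by eventually_elim simp
  from asx_cong[OF this F] show ?thesis by simp
qed

lemma asx_bounded_shift:
  fixes F :: "real \<Rightarrow> complex"
  shows "\<exists>C. \<forall>\<^sub>F r in at_top. norm (of_real r * (F r - c)) \<le> C \<Longrightarrow> (F \<longlongrightarrow> c) at_top"
proof -
  assume "\<exists>C. \<forall>\<^sub>F r in at_top. norm (of_real r * (F r - c)) \<le> C"
  then obtain C where C: "\<forall>\<^sub>F r in at_top. norm (of_real r * (F r - c)) \<le> C" by blast
  have "\<forall>\<^sub>F r in at_top. norm (F r - c) \<le> C / r"
    using C eventually_gt_at_top[of "0::real"] by eventually_elim (simp add: norm_mult pos_le_divide_eq mult.commute)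
  moreover have "((\<lambda>r::real. C / r) \<longlongrightarrow> 0) at_top"
    by (rule tendsto_divide_0[OF tendsto_const filterlim_at_top_imp_at_infinity[OF filterlim_ident]])
  ultimately have "((\<lambda>r. F r - c) \<longlongrightarrow> 0) at_top" by (rule Lim_null_comparison)
  then show ?thesis by (simp add: LIM_zero_iff)
qed

lemma asx_Suc_bounded: "asx (Suc N) F c \<Longrightarrow> asx N F c"
proof (induction N arbitrary: F c)
  case 0
  then have "(F \<longlongrightarrow> c 0) at_top" by (intro asx_bounded_shift) simp
  then have "((\<lambda>r. norm (F r)) \<longlongrightarrow> norm (c 0)) at_top" by (rule tendsto_norm)
  then have "\<forall>\<^sub>F r in at_top. norm (F r) < norm (c 0) + 1" by (rule order_tendstoD) simp
  then have "\<forall>\<^sub>F r in at_top. norm (F r) \<le> norm (c 0) + 1" by eventually_elim simp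
  then show ?case by auto
next
  case (Suc N)
  from Suc.IH[OF Suc.prems[unfolded asx.simps(2)[of "Suc N"]]] show ?case by simp
qed

lemma asx_le: "asx N F c \<Longrightarrow> M \<le> N \<Longrightarrow> asx M F c"
proof (induction N)
  case (Suc N)
  then show ?case using asx_Suc_bounded[of N F c] by (cases "M = Suc N") (simp_all del: asx.simps)
qed simp

lemma asx_bounded: "asx N F c \<Longrightarrow> \<exists>C. \<forall>\<^sub>F r in at_top. norm (F r) \<le> C"
  using asx_le[of N F c 0] by simp

lemma asx_mult:
  "asx N F c \<Longrightarrow> asx N G d \<Longrightarrow> asx N (\<lambda>r. F r * G r) (\<lambda>k. \<Sum>i\<le>k. c i * d (k - i))"
proof (induction N arbitrary: F G c d)
  case 0
  then obtain C D where "\<forall>\<^sub>F r in at_top. norm (F r) \<le> C" "\<forall>\<^sub>F r in at_top. norm (G r) \<le> D" by auto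
  then have "\<forall>\<^sub>F r in at_top. norm (F r * G r) \<le> C * D"
  proof eventually_elim
    case (elim r)
    then show ?case unfolding norm_mult by (intro mult_mono) (auto intro: order_trans[OF norm_ge_zero])
  qed
  then show ?case by auto
next
  case (Suc N)
  have F1: "asx N (\<lambda>r. of_real r * (F r - c 0)) (\<lambda>j. c (Suc j))" and G1: "asx N (\<lambda>r. of_real r * (G r - d 0)) (\<lambda>j. d (Suc j))"
    using Suc.prems by simp_all
  have "asx N (\<lambda>r. (of_real r * (F r - c 0)) * G r + c 0 * (of_real r * (G r - d 0)))
     (\<lambda>k. (\<Sum>i\<le>k. c (Suc i) * d (k - i)) + c 0 * d (Suc k))"
    by (intro asx_add asx_cmult Suc.IH[OF F1 asx_Suc_bounded[OF Suc.prems(2)]] G1)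
  moreover have "(\<lambda>r. (of_real r * (F r - c 0)) * G r + c 0 * (of_real r * (G r - d 0))) = (\<lambda>r. of_real r * (F r * G r - c 0 * d 0))"
    by (simp add: fun_eq_iff algebra_simps)
  moreover have "(\<Sum>i\<le>k. c (Suc i) * d (k - i)) + c 0 * d (Suc k) = (\<Sum>i\<le>Suc k. c i * d (Suc k - i))" for k
    by (subst sum.atMost_Suc_shift) simp
  ultimately show ?case by simp
qed

lemma asx_unique: "asx N F c \<Longrightarrow> asx N F d \<Longrightarrow> j < N \<Longrightarrow> c j = d j"
proof (induction N arbitrary: F c d j)
  case (Suc N)
  have "(F \<longlongrightarrow> c 0) at_top" "(F \<longlongrightarrow> d 0) at_top"
    using asx_bounded Suc.prems(1,2) unfolding asx.simps(2) by (blast intro: asx_bounded_shift)+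
  then have 0: "c 0 = d 0" by (intro tendsto_unique[OF trivial_limit_at_top_linorder])
  show ?case
  proof (cases j)
    case (Suc i)
    then show ?thesis using Suc.IH[of "\<lambda>r. of_real r * (F r - c 0)" "\<lambda>j. c (Suc j)" "\<lambda>j. d (Suc j)" i] Suc.prems 0 by simp
  qed (simp add: 0)
qed simp

lemma asxI:
  assumes "\<forall>\<^sub>F r in at_top. norm (F r - (\<Sum>j<N. c j / of_real r ^ j)) \<le> C / r ^ N"
  shows "asx N F c"
  using assms
proof (induction N arbitrary: F c)
  case (Suc N)
  have "\<forall>\<^sub>F r in at_top. norm (of_real r * (F r - c 0) - (\<Sum>j<N. c (Suc j) / of_real r ^ j)) \<le> C / r ^ N"
    using Suc.prems eventually_gt_at_top[of "0::real"]
  proof eventually_elim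
    case (elim r)
    have "of_real r * (F r - c 0) - (\<Sum>j<N. c (Suc j) / of_real r ^ j) = of_real r * (F r - (\<Sum>j<Suc N. c j / of_real r ^ j))"
      using elim(2) unfolding sum.lessThan_Suc_shift by (simp add: algebra_simps sum_distrib_left)
    then have "norm (of_real r * (F r - c 0) - (\<Sum>j<N. c (Suc j) / of_real r ^ j)) \<le> r * (C / r ^ Suc N)"
      using mult_left_mono[OF elim(1), of r] elim(2) by (simp add: norm_mult del: power_Suc sum.lessThan_Suc)
    then show ?case using elim(2) by simp
  qed
  from Suc.IH[OF this] show ?case by simp
qed (use assms in auto)

section \<open>Expansions of symbols along rays\<close>

text \<open>The factor \<open>r ^ (k + length ds)\<close> undoes the decay of a derivative of a
  symbol of order \<open>-k\<close>, so that all derivatives have expansions starting with a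
  constant. The coefficients are derivatives of the homogeneous terms at the fixed point
  \<open>z\<close>. Derivatives are part of the notion because the Leibniz product takes
  them.\<close>

definition ray_exp :: "nat \<Rightarrow> 'z::euclidean_space \<Rightarrow> nat \<Rightarrow> ('z \<Rightarrow> complex) \<Rightarrow> (nat \<Rightarrow> 'z \<Rightarrow> complex) \<Rightarrow> bool" where
  "ray_exp N z k a h \<longleftrightarrow> (\<forall>ds. set ds \<subseteq> Basis \<longrightarrow>
     asx N (\<lambda>r. of_real (r ^ (k + length ds)) * pdiff ds a (r *\<^sub>R z)) (\<lambda>j. pdiff ds (h j) z))"

lemma ray_exp_dd: "ray_exp N z k a h \<Longrightarrow> v \<in> Basis \<Longrightarrow> ray_exp N z (Suc k) (dd v a) (\<lambda>j. dd v (h j))"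
  unfolding ray_exp_def
proof (intro allI impI)
  fix ds :: "'a list" assume *: "\<forall>ds. set ds \<subseteq> Basis \<longrightarrow> asx N (\<lambda>r. of_real (r ^ (k + length ds)) * pdiff ds a (r *\<^sub>R z)) (\<lambda>j. pdiff ds (h j) z)"
    "v \<in> Basis" "set ds \<subseteq> Basis"
  have "asx N (\<lambda>r. of_real (r ^ (k + length (ds @ [v]))) * pdiff (ds @ [v]) a (r *\<^sub>R z)) (\<lambda>j. pdiff (ds @ [v]) (h j) z)"
    by (rule *(1)[rule_format]) (use * in simp)
  then show "asx N (\<lambda>r. of_real (r ^ (Suc k + length ds)) * pdiff ds (dd v a) (r *\<^sub>R z)) (\<lambda>j. pdiff ds (dd v (h j)) z)"
    unfolding pdiff_snoc by simp
qed

lemma ray_exp_cmult: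
  assumes "ray_exp N z k a h" and a: "smooth_on UNIV a" and h: "\<And>j. smooth_on (UNIV - {0}) (h j)" and z: "z \<noteq> 0"
  shows "ray_exp N z k (\<lambda>z. c * a z) (\<lambda>j z. c * h j z)"
  unfolding ray_exp_def
proof (intro allI impI)
  fix ds :: "'a list" assume ds: "set ds \<subseteq> Basis"
  have 1: "pdiff ds (\<lambda>z. c * a z) z' = c * pdiff ds a z'" for z'
    by (rule pdiff_bounded_linear[OF open_UNIV bounded_linear_mult_right a ds UNIV_I])
  have 2: "pdiff ds (\<lambda>z. c * h j z) z = c * pdiff ds (h j) z" for j
    by (rule pdiff_bounded_linear[OF _ bounded_linear_mult_right h ds]) (use z in auto)
  have "asx N (\<lambda>r. of_real (r ^ (k + length ds)) * pdiff ds a (r *\<^sub>R z)) (\<lambda>j. pdiff ds (h j) z)"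
    using assms(1) ds by (simp add: ray_exp_def)
  from asx_cmult[OF this, of c]
  show "asx N (\<lambda>r. of_real (r ^ (k + length ds)) * pdiff ds (\<lambda>z. c * a z) (r *\<^sub>R z)) (\<lambda>j. pdiff ds (\<lambda>z. c * h j z) z)"
    unfolding 1 2 by (simp only: mult.left_commute)
qed

lemma smooth_on_cmult_punct: "smooth_on (UNIV - {0}) f \<Longrightarrow> smooth_on (UNIV - {0}) (\<lambda>z. (c::complex) * f z)"
  by (rule smooth_on_bounded_linear[OF _ bounded_linear_mult_right]) auto

text \<open>Coefficients of a product of expansions are convolved, and each of the \<open>m\<close>
  derivative pairs contributes the factor \<open>r ^ 2\<close>.\<close>

lemma asx_stc:
  fixes a b :: "'a::euclidean_space \<times> 'a \<Rightarrow> complex"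
  assumes "ray_exp N z k a f" "ray_exp N z l b g" "smooth_on UNIV b" "\<And>j. smooth_on (UNIV - {0}) (g j)" and z: "z \<noteq> 0"
  shows "asx N (\<lambda>r. of_real (r ^ (k + l + 2 * m)) * stc m a b (r *\<^sub>R z)) (\<lambda>p. \<Sum>i\<le>p. stc m (f i) (g (p - i)) z)"
  using assms(1-4)
proof (induction m arbitrary: a b f g k l)
  case 0
  have "asx N (\<lambda>r. of_real (r ^ k) * a (r *\<^sub>R z)) (\<lambda>j. f j z)" "asx N (\<lambda>r. of_real (r ^ l) * b (r *\<^sub>R z)) (\<lambda>j. g j z)"
    using 0(1,2)[unfolded ray_exp_def, rule_format, of "[]"] by simp_all
  from asx_mult[OF this] show ?case by (simp add: power_add mult_ac)
next
  case (Suc m)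
  have "asx N (\<lambda>r. of_real (r ^ (Suc k + Suc l + 2 * m)) * stc m (dd (0, j) a) (\<lambda>z. - \<i> * dd (j, 0) b z) (r *\<^sub>R z))
      (\<lambda>p. \<Sum>i\<le>p. stc m (dd (0, j) (f i)) (\<lambda>z. - \<i> * dd (j, 0) (g (p - i)) z) z)" if j: "j \<in> Basis" for j
  proof -
    have j': "(0, j) \<in> Basis" "(j, 0) \<in> Basis" using j by (auto simp: Basis_prod_def)
    note b = smooth_on_dd[OF Suc.prems(3) j'(2)]
    note g = smooth_on_dd[OF Suc.prems(4) j'(2)]
    show ?thesis
      by (rule Suc.IH[OF ray_exp_dd[OF Suc.prems(1) j'(1)] ray_exp_cmult[OF ray_exp_dd[OF Suc.prems(2) j'(2)] b g z]
          smooth_on_cmult[OF b] smooth_on_cmult_punct[OF g]])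
  qed
  from asx_sum[OF this]
  have "asx N (\<lambda>r. \<Sum>j\<in>Basis. of_real (r ^ (Suc k + Suc l + 2 * m)) * stc m (dd (0, j) a) (\<lambda>z. - \<i> * dd (j, 0) b z) (r *\<^sub>R z))
     (\<lambda>p. \<Sum>j\<in>Basis. \<Sum>i\<le>p. stc m (dd (0, j) (f i)) (\<lambda>z. - \<i> * dd (j, 0) (g (p - i)) z) z)" .
  moreover have "(\<lambda>p. \<Sum>j\<in>Basis. \<Sum>i\<le>p. stc m (dd (0, j) (f i)) (\<lambda>z. - \<i> * dd (j, 0) (g (p - i)) z) z) =
     (\<lambda>p. \<Sum>i\<le>p. stc (Suc m) (f i) (g (p - i)) z)"
    unfolding stc.simps by (rule ext) (rule sum.swap)
  ultimately show ?case unfolding stc.simps sum_distrib_left by (simp add: add_ac)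
qed

section \<open>The homogeneous terms form a formal idempotent\<close>

lemma pos_homogeneous_pdiff:
  assumes "pos_homogeneous d f" and f: "smooth_on (UNIV - {0}) f" and "set ds \<subseteq> Basis"
  shows "pos_homogeneous (d - int (length ds)) (pdiff ds f)"
  using assms(3)
proof (induction ds)
  case (Cons v ds)
  have "pdiff ds f differentiable at z" if "z \<noteq> 0" for z
    by (rule smooth_on_diff[OF smooth_on_pdiff[OF f]]) (use that Cons.prems in auto)
  then have "pos_homogeneous (d - int (length ds) - 1) (dd v (pdiff ds f))"
    using Cons by (intro pos_homogeneous_dd) auto
  moreover have "d - int (length ds) - 1 = d - int (length (v # ds))" by simp
  ultimately show ?case unfolding pdiff_Cons_dd by (simp only:)
qed (use assms in simp)

lemma asx_shift_power: "asx N F c \<Longrightarrow> asx N (\<lambda>r. F r / of_real r ^ n) (\<lambda>j. if j < n then 0 else c (j - n))"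
proof (induction n)
  case (Suc n)
  have "asx N (\<lambda>r. F r / of_real r ^ n / of_real r) (\<lambda>j. if j = 0 then 0 else (if j - 1 < n then 0 else c (j - 1 - n)))"
    by (rule asx_Suc_bounded[OF asx_shift[OF Suc.IH[OF Suc.prems]]])
  then have "asx N (\<lambda>r. F r / of_real r ^ n / of_real r) (\<lambda>j. if j < Suc n then 0 else c (j - Suc n))"
    by (rule asx_coeff_cong[rotated]) auto
  then show ?case by (simp add: mult.commute)
qed simp

text \<open>By definition the remainder after \<open>N\<close> terms is a symbol of order
  \<open>-N\<close> for any excision function, in particular for \<open>cutoff\<close>, which is 1
  beyond radius 2. There homogeneity turns the value of a term at \<open>r *\<^sub>R z\<close> into
  a power of \<open>r\<close> times its value at \<open>z\<close>.\<close>

lemma ray_exp_classical: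
  fixes p :: "('n::finite, 'q::finite) symbol"
  assumes p: "Gamma 0 p" and h: "classical_terms 0 p h" and z: "z \<noteq> 0"
  shows "ray_exp N z 0 (entry p i k) (\<lambda>j. entry (h j) i k)"
  unfolding ray_exp_def
proof (intro allI impI)
  fix ds :: "((real^'n) \<times> (real^'n)) list" assume ds: "set ds \<subseteq> Basis"
  define L where "L = length ds"
  have ps: "smooth_on UNIV p" using p by (simp add: Gamma_def)
  have hs: "smooth_on (UNIV - {0}) (h j)" and hh: "pos_homogeneous (0 - int j) (h j)" for j
    using h by (simp_all add: classical_terms_def)
  define q where "q z = p z - (\<Sum>j<N. cutoff z *\<^sub>R h j z)" for z
  have "Gamma (0 - int N) q" using h excision_cutoff unfolding classical_terms_def q_def by blast
  then obtain C where C: "\<And>z. norm (pdiff ds q z) \<le> C * bracket z powr (real_of_int (0 - int N) - real L)"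
    using ds unfolding Gamma_def L_def by meson
  define S where "S = {z::(real^'n) \<times> (real^'n). norm z > 2}"
  have S: "open S" unfolding S_def by (intro open_Collect_less continuous_intros)
  have S0: "S \<subseteq> UNIV - {0}" by (auto simp: S_def)
  have hsS: "smooth_on S (h j)" for j by (rule smooth_on_subset[OF hs S0])
  have sumS: "smooth_on S (\<lambda>z. \<Sum>j<N. h j z)" by (rule smooth_on_sum[OF S]) (rule hsS)
  have pS: "smooth_on S p" by (rule smooth_on_subset[OF ps]) simp
  have dq: "pdiff ds q w = pdiff ds p w - (\<Sum>j<N. pdiff ds (h j) w)" if w: "w \<in> S" for w
  proof -
    have "pdiff ds q w = pdiff ds (\<lambda>z. p z - (\<Sum>j<N. h j z)) w"
      by (rule pdiff_cong_open[OF S _ w]) (auto simp: q_def S_def cutoff_1)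
    also have "\<dots> = pdiff ds p w - pdiff ds (\<lambda>z. \<Sum>j<N. h j z) w"
      by (rule pdiff_diff_on[OF S pS sumS ds w])
    also have "pdiff ds (\<lambda>z. \<Sum>j<N. h j z) w = (\<Sum>j<N. pdiff ds (h j) w)"
      by (rule pdiff_sum_on[OF S hsS ds w])
    finally show ?thesis .
  qed
  have pe: "pdiff ds (entry p i k) w = pdiff ds p w $ i $ k" for w
    by (rule pdiff_bounded_linear[OF open_UNIV bounded_linear_entry ps ds UNIV_I])
  have he: "pdiff ds (entry (h j) i k) z = pdiff ds (h j) z $ i $ k" for j
    by (rule pdiff_bounded_linear[OF open_punct bounded_linear_entry hs ds]) (use z in simp)
  have nz: "norm z > 0" using z by simp
  have "\<forall>\<^sub>F r in at_top. norm (of_real (r ^ (0 + length ds)) * pdiff ds (entry p i k) (r *\<^sub>R z) -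
      (\<Sum>j<N. pdiff ds (entry (h j) i k) z / of_real r ^ j)) \<le> (C / norm z ^ (N + L)) / r ^ N"
    using eventually_gt_at_top[of "3 / norm z"]
  proof eventually_elim
    case (elim r)
    have r: "r > 0" using elim nz by (meson divide_pos_pos less_trans zero_less_numeral)
    have nr: "norm (r *\<^sub>R z) = r * norm z" using r by simp
    \<comment> \<open>The threshold puts \<open>r *\<^sub>R z\<close> beyond radius 2, where the
      cutoff is 1, and beyond radius 1, where the bracket is the norm.\<close>
    have r3: "r * norm z > 3" using elim nz by (simp add: pos_divide_less_eq)
    then have w: "r *\<^sub>R z \<in> S" unfolding S_def mem_Collect_eq nr by linarith
    have br: "bracket (r *\<^sub>R z) = r * norm z" unfolding bracket_def nr using r3 by simp
    have hr: "pdiff ds (h j) (r *\<^sub>R z) = (1 / (r ^ j * r ^ L)) *\<^sub>R pdiff ds (h j) z" for j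
    proof -
      have "pdiff ds (h j) (r *\<^sub>R z) = (r powr real_of_int (0 - int j - int L)) *\<^sub>R pdiff ds (h j) z"
        using pos_homogeneous_pdiff[OF hh hs ds, of j] r z unfolding pos_homogeneous_def L_def by blast
      moreover have "r powr real_of_int (0 - int j - int L) = r powr - real (j + L)"
        by (rule arg_cong[of _ _ "(powr) r"]) simp
      moreover have "\<dots> = 1 / (r ^ j * r ^ L)"
        using r by (simp only: powr_minus powr_realpow power_add divide_inverse mult_1)
      ultimately show ?thesis by simp
    qed
    have "of_real (r ^ (0 + length ds)) * pdiff ds (entry p i k) (r *\<^sub>R z) - (\<Sum>j<N. pdiff ds (entry (h j) i k) z / of_real r ^ j)
      = of_real (r ^ L) * (pdiff ds q (r *\<^sub>R z) $ i $ k)"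
    proof -
      have "of_real (r ^ L) * (pdiff ds (h j) (r *\<^sub>R z) $ i $ k) = pdiff ds (h j) z $ i $ k / of_real r ^ j" for j
        unfolding hr using r by (simp add: scaleR_conv_of_real[where 'a=complex])
      then show ?thesis unfolding dq[OF w] pe he L_def[symmetric]
        by (simp add: right_diff_distrib sum_distrib_left)
    qed
    moreover have "norm (of_real (r ^ L) * (pdiff ds q (r *\<^sub>R z) $ i $ k)) \<le> r ^ L * (C * (1 / (r * norm z) ^ (N + L)))"
    proof -
      have "norm (pdiff ds q (r *\<^sub>R z) $ i $ k) \<le> C * bracket (r *\<^sub>R z) powr (real_of_int (0 - int N) - real L)"
        by (rule order_trans[OF norm_entry C])
      then have "norm (pdiff ds q (r *\<^sub>R z) $ i $ k) \<le> C * (r * norm z) powr (real_of_int (0 - int N) - real L)"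
        unfolding br .
      moreover have "(r * norm z) powr (real_of_int (0 - int N) - real L) = (r * norm z) powr - real (N + L)"
        by (rule arg_cong[of _ _ "(powr) (r * norm z)"]) simp
      moreover have "\<dots> = 1 / (r * norm z) ^ (N + L)"
        using mult_pos_pos[OF r nz] by (simp only: powr_minus powr_realpow divide_inverse mult_1)
      ultimately have "norm (pdiff ds q (r *\<^sub>R z) $ i $ k) \<le> C * (1 / (r * norm z) ^ (N + L))" by (simp only:)
      moreover have "0 \<le> r ^ L" using r by simp
      ultimately show ?thesis unfolding norm_mult norm_of_real by (simp only: abs_of_nonneg mult_left_mono)
    qed
    moreover have "r ^ L * (C * (1 / (r * norm z) ^ (N + L))) = (C / norm z ^ (N + L)) / r ^ N"
      using r nz by (simp add: power_mult_distrib power_add)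
    ultimately show ?case by simp
  qed
  then show "asx N (\<lambda>r. of_real (r ^ (0 + length ds)) * pdiff ds (entry p i k) (r *\<^sub>R z)) (\<lambda>j. pdiff ds (entry (h j) i k) z)"
    by (rule asxI)
qed

lemma asx_neg:
  fixes R :: "'a::euclidean_space \<Rightarrow> complex"
  assumes "neg N R" and z: "z \<noteq> 0"
  shows "asx N (\<lambda>r. R (r *\<^sub>R z)) (\<lambda>j. 0)"
proof -
  obtain C where C: "\<And>t. norm (R t) \<le> C * mu t ^ N" using assms(1) unfolding neg_def by blast
  have nz: "norm z > 0" using z by simp
  have "\<forall>\<^sub>F r in at_top. norm (R (r *\<^sub>R z) - (\<Sum>j<N. 0 / of_real r ^ j)) \<le> (C / norm z ^ N) / r ^ N"
    using eventually_gt_at_top[of "1 / norm z"]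
  proof eventually_elim
    case (elim r)
    have r: "r > 0" using elim nz by (meson divide_pos_pos less_trans zero_less_one)
    have "r * norm z > 1" using elim nz by (simp add: pos_divide_less_eq)
    then have "mu (r *\<^sub>R z) = 1 / (r * norm z)" using r by (simp add: mu_def bracket_def)
    then have "norm (R (r *\<^sub>R z)) \<le> C * (1 / (r * norm z)) ^ N" using C by metis
    also have "\<dots> = (C / norm z ^ N) / r ^ N" by (simp add: power_divide power_mult_distrib)
    finally show ?case by simp
  qed
  then show ?thesis by (rule asxI)
qed

lemma sum_idx2: "(\<Sum>(m, i, j)\<in>idx2 k. g m i j) = (\<Sum>m<Suc k. if k < 2 * m then 0 else (\<Sum>i\<le>k - 2 * m. g m i (k - 2 * m - i)))"
proof -
  have "(\<Sum>m<Suc k. if k < 2 * m then 0 else (\<Sum>i\<le>k - 2 * m. g m i (k - 2 * m - i))) =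
     (\<Sum>m | m < Suc k \<and> 2 * m \<le> k. \<Sum>i\<le>k - 2 * m. g m i (k - 2 * m - i))"
    by (rule sum.mono_neutral_cong_right) auto
  also have "\<dots> = (\<Sum>(m, i)\<in>Sigma {m. m < Suc k \<and> 2 * m \<le> k} (\<lambda>m. {..k - 2 * m}). g m i (k - 2 * m - i))"
    by (rule sum.Sigma) auto
  also have "\<dots> = (\<Sum>(m, i, j)\<in>idx2 k. g m i j)"
    by (rule sum.reindex_bij_witness[where i = "\<lambda>(m, i, j). (m, i)" and j = "\<lambda>(m, i). (m, i, k - 2 * m - i)"])
      (auto simp: idx2_def)
  finally show ?thesis by simp
qed

lemma idempotent_homogeneous_terms:
  fixes p :: "('n::finite, 'q::finite) symbol"
  assumes p: "Gamma 0 p" and h: "classical_terms 0 p h" and idem: "\<And>u. schwartz u \<Longrightarrow> op p (op p u) = op p u" and z: "z \<noteq> 0"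
  shows "h k z $ i $ l = (\<Sum>(m, s, t)\<in>idx2 k. of_real (1 / fact m) * (\<Sum>q\<in>UNIV. stc m (entry (h s) i q) (entry (h t) q l) z))"
proof -
  \<comment> \<open>The coefficient with index \<open>k\<close> is determined by an expansion with
    \<open>k + 1\<close> terms. The Leibniz terms with \<open>2 * m > k\<close> contribute nothing
    to it.\<close>
  define N where "N = Suc k"
  have pe: "smooth_on UNIV (entry p i k)" for i k
    using p by (intro smooth_on_bounded_linear[OF open_UNIV bounded_linear_entry]) (simp add: Gamma_def)
  have he: "smooth_on (UNIV - {0}) (entry (h j) i k)" for i j k
    using h by (intro smooth_on_bounded_linear[OF open_punct bounded_linear_entry]) (simp add: classical_terms_def)
  note ray = ray_exp_classical[OF p h z, of N]
  let ?c = "\<lambda>m q n. \<Sum>s\<le>n. stc m (entry (h s) i q) (entry (h (n - s)) q l) z"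
  have 1: "asx N (\<lambda>r. stc m (entry p i q) (entry p q l) (r *\<^sub>R z)) (\<lambda>j. if j < 2 * m then 0 else ?c m q (j - 2 * m))" for m q
  proof (rule asx_cong[OF _ asx_shift_power])
    show "asx N (\<lambda>r. of_real (r ^ (0 + 0 + 2 * m)) * stc m (entry p i q) (entry p q l) (r *\<^sub>R z)) (?c m q)"
      by (rule asx_stc[OF ray ray pe he z])
    show "\<forall>\<^sub>F r in at_top. of_real (r ^ (0 + 0 + 2 * m)) * stc m (entry p i q) (entry p q l) (r *\<^sub>R z) / of_real r ^ (2 * m)
      = stc m (entry p i q) (entry p q l) (r *\<^sub>R z)"
      using eventually_gt_at_top[of "0::real"] by eventually_elim simp
  qed
  let ?R = "\<lambda>t. entry p i l t - (\<Sum>m<N. of_real (1 / fact m) * (\<Sum>q\<in>UNIV. stc m (entry p i q) (entry p q l) t))"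
  have "neg N ?R" by (rule idempotent_symbol_expansion[OF p idem]) (simp_all add: N_def)
  then have 2: "asx N (\<lambda>r. ?R (r *\<^sub>R z)) (\<lambda>j. 0)" by (rule asx_neg[OF _ z])
  have 3: "asx N (\<lambda>r. \<Sum>m<N. of_real (1 / fact m) * (\<Sum>q\<in>UNIV. stc m (entry p i q) (entry p q l) (r *\<^sub>R z)))
     (\<lambda>j. \<Sum>m<N. of_real (1 / fact m) * (\<Sum>q\<in>UNIV. if j < 2 * m then 0 else ?c m q (j - 2 * m)))"
    by (intro asx_sum asx_cmult 1)
  have 4: "asx N (\<lambda>r. entry p i l (r *\<^sub>R z)) (\<lambda>j. \<Sum>m<N. of_real (1 / fact m) * (\<Sum>q\<in>UNIV. if j < 2 * m then 0 else ?c m q (j - 2 * m)))"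
    using asx_add[OF 2 3] by simp
  have 5: "asx N (\<lambda>r. entry p i l (r *\<^sub>R z)) (\<lambda>j. entry (h j) i l z)"
    using ray[of i l, unfolded ray_exp_def, rule_format, of "[]"] by simp
  have "h k z $ i $ l = (\<Sum>m<N. of_real (1 / fact m) * (\<Sum>q\<in>UNIV. if k < 2 * m then 0 else ?c m q (k - 2 * m)))"
    using asx_unique[OF 5 4, of k] by (simp add: N_def del: sum.lessThan_Suc)
  also have "\<dots> = (\<Sum>m<N. if k < 2 * m then 0 else (\<Sum>s\<le>k - 2 * m. of_real (1 / fact m) *
     (\<Sum>q\<in>UNIV. stc m (entry (h s) i q) (entry (h (k - 2 * m - s)) q l) z)))"
  proof (rule sum.cong[OF refl])
    fix m
    show "of_real (1 / fact m) * (\<Sum>q\<in>UNIV. if k < 2 * m then 0 else ?c m q (k - 2 * m)) = (if k < 2 * m then 0 else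
      (\<Sum>s\<le>k - 2 * m. of_real (1 / fact m) * (\<Sum>q\<in>UNIV. stc m (entry (h s) i q) (entry (h (k - 2 * m - s)) q l) z)))"
      unfolding sum_distrib_left[symmetric] by (cases "k < 2 * m") (simp_all add: sum.swap[of _ UNIV])
  qed
  finally show ?thesis unfolding N_def sum_idx2 .
qed

lemma stc_cong_open:
  assumes S: "open S" and "\<forall>z\<in>S. a z = a' z" "\<forall>z\<in>S. b z = b' z" and z: "z \<in> S"
  shows "stc m a b z = stc m a' b' z"
  using assms(2,3)
proof (induction m arbitrary: a b a' b')
  case (Suc m)
  have "stc m (dd (0, j) a) (\<lambda>z. - \<i> * dd (j, 0) b z) z = stc m (dd (0, j) a') (\<lambda>z. - \<i> * dd (j, 0) b' z) z" for j
    by (rule Suc.IH) (use dd_cong_open[OF S _ Suc.prems(1)] dd_cong_open[OF S _ Suc.prems(2)] in auto)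
  then show ?case by simp
qed (use z in simp)

text \<open>Derivatives act entrywise and matrix multiplication only sums over the middle index, so
  the product in the ring \<open>sym\<close> reduces to the scalar \<open>stc\<close> for which
  expansions along rays are available.\<close>

lemma val_stC_entry:
  fixes a b :: "('a::finite, 'q::finite) sym"
  assumes z: "z \<noteq> 0"
  shows "val (stC m a b) z $ i $ l = (\<Sum>q\<in>UNIV. stc m (entry (val a) i q) (entry (val b) q l) z)"
proof (induction m arbitrary: a b)
  case 0
  show ?case by (simp add: val_mult matrix_matrix_mult_def)
next
  case (Suc m)
  have e: "entry (val (pd v a)) i k z = dd v (entry (val a) i k) z" if "v \<in> Basis" "z \<noteq> 0" for v a i k z
    unfolding val_pd[OF that] by (rule dd_bounded_linear[OF bounded_linear_entry val_diff[OF that(2)], symmetric])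
  have *: "stc m (entry (val (pd (0, j) a)) i q) (entry (val (csc (- \<i>) (pd (j, 0) b))) q l) z =
    stc m (dd (0, j) (entry (val a) i q)) (\<lambda>z. - \<i> * dd (j, 0) (entry (val b) q l) z) z" if j: "j \<in> Basis" for j q
  proof (rule stc_cong_open[OF open_punct])
    have j': "(0, j) \<in> Basis" "(j, 0) \<in> Basis" using j by (auto simp: Basis_prod_def)
    show "\<forall>z\<in>UNIV - {0}. entry (val (pd (0, j) a)) i q z = dd (0, j) (entry (val a) i q) z"
      by (intro ballI) (rule e[OF j'(1)], simp)
    show "\<forall>z\<in>UNIV - {0}. entry (val (csc (- \<i>) (pd (j, 0) b))) q l z = - \<i> * dd (j, 0) (entry (val b) q l) z"
    proof
      fix z assume "z \<in> UNIV - {0 :: (real^'a) \<times> (real^'a)}"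
      then have "z \<noteq> 0" by simp
      from e[OF j'(2) this, of b q l] show "entry (val (csc (- \<i>) (pd (j, 0) b))) q l z = - \<i> * dd (j, 0) (entry (val b) q l) z"
        by (simp add: val_csc mscale_def)
    qed
    show "z \<in> UNIV - {0}" using z by simp
  qed
  have "val (stC (Suc m) a b) z $ i $ l = (\<Sum>j\<in>Basis. \<Sum>q\<in>UNIV. stc m (entry (val (pd (0, j) a)) i q) (entry (val (csc (- \<i>) (pd (j, 0) b))) q l) z)"
    by (simp add: val_sum Suc.IH)
  also have "\<dots> = (\<Sum>j\<in>Basis. \<Sum>q\<in>UNIV. stc m (dd (0, j) (entry (val a) i q)) (\<lambda>z. - \<i> * dd (j, 0) (entry (val b) q l) z) z)"
    by (intro sum.cong refl *)
  also have "\<dots> = (\<Sum>q\<in>UNIV. stc (Suc m) (entry (val a) i q) (entry (val b) q l) z)"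
    unfolding stc.simps by (rule sum.swap)
  finally show ?case .
qed

section \<open>The residue as a trace\<close>

lemma bounded_linear_trace: "bounded_linear (trace :: complex^'q::finite^'q \<Rightarrow> complex)"
  unfolding trace_def[abs_def] by (intro bounded_linear_sum bounded_linear_entry)

text \<open>For terms of degree \<open>-2n\<close> the factor \<open>(norm z) ^ (2n)\<close> makes
  the trace constant along rays, and the integral is a nonzero multiple of the sphere integral in
  \<open>Res\<close>. As an integral over the whole space it allows integration by parts without
  surface measure.\<close>

definition wres :: "('n::finite, 'q::finite) sym \<Rightarrow> complex" where
  "wres a = (LINT z|lborel. of_real (om ((norm z)\<^sup>2) * ((norm z)\<^sup>2) ^ CARD('n)) * trace (val a z))"

lemma trace_val_smooth: "smooth_on (UNIV - {0}) (\<lambda>z. trace (val a z))"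
  by (rule smooth_on_bounded_linear[OF open_punct bounded_linear_trace val_smooth])

lemma wres_add: "wres (a + b) = wres a + wres b"
proof -
  have i: "integrable lborel (\<lambda>z. of_real (om ((norm z)\<^sup>2) * ((norm z)\<^sup>2) ^ CARD('n)) * trace (val a z))"
    for a :: "('n::finite, 'q::finite) sym"
    by (rule weighted_integrable[OF radw_om_power trace_val_smooth])
  show ?thesis unfolding wres_def val_add trace_add distrib_left by (rule Bochner_Integration.integral_add[OF i i])
qed

lemma wres_csc: "wres (csc c a) = c * wres a"
proof -
  have "trace (val (csc c a) z) = c * trace (val a z)" for z
    by (simp add: val_csc mscale_def trace_def sum_distrib_left)
  then show ?thesis unfolding wres_def by (simp only: mult.left_commute[of _ c] integral_mult_right_zero)
qed

lemma wres_commute: "wres (a * b) = wres (b * a)"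
proof -
  have "trace (val a z ** val b z) = trace (val b z ** val a z)" for z by (rule trace_mul_sym)
  then show ?thesis unfolding wres_def val_mult by simp
qed

lemma DIM_phase_space: "DIM((real^'n::finite) \<times> (real^'n)) = 2 * CARD('n)"
  by simp

lemma wres_pd:
  fixes a :: "('n::finite, 'q::finite) sym"
  assumes "dg (1 - 2 * int CARD('n)) a"
  shows "wres (pd v a) = 0"
proof (cases "v \<in> Basis")
  case True
  have h: "pos_homogeneous (1 - int DIM((real^'n) \<times> (real^'n))) (\<lambda>z. trace (val a z))"
    using assms unfolding dg_def pos_homogeneous_def DIM_phase_space of_nat_mult of_nat_numeral
    by (simp add: linear_scale[OF bounded_linear.linear[OF bounded_linear_trace]])
  have e: "of_real (om ((norm z)\<^sup>2) * ((norm z)\<^sup>2) ^ CARD('n)) * trace (val (pd v a) z) =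
     of_real (om ((norm z)\<^sup>2) * ((norm z)\<^sup>2) ^ CARD('n)) * dd v (\<lambda>z. trace (val a z)) z" for z
  proof (cases "z = 0")
    case False
    have "trace (val (pd v a) z) = dd v (\<lambda>z. trace (val a z)) z"
      unfolding val_pd[OF \<open>v \<in> Basis\<close> False]
      by (rule dd_bounded_linear[OF bounded_linear_trace val_diff[OF False], symmetric])
    then show ?thesis by simp
  qed simp
  show ?thesis unfolding wres_def e by (rule weighted_divergence[OF radw_om_power trace_val_smooth h True])
next
  case False
  have "trace (0 :: complex^'q^'q) = 0" by (simp add: trace_def)
  then show ?thesis using False by (simp add: wres_def val_pd')
qed

theorem mainTheorem16:
  fixes p :: "('n::finite, 'q::finite) symbol"
  assumes "Gamma_cl 0 p"
    and "\<forall>u. schwartz u \<longrightarrow> op p (op p u) = op p u"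
  shows "Res 0 p = 0"
proof -
  have p: "Gamma 0 p" using assms(1) by (simp add: Gamma_cl_def)
  have idem: "op p (op p u) = op p u" if "schwartz u" for u using assms(2) that by blast
  \<comment> \<open>\<open>Res\<close> reads its term from this same choice, so the definition can
    be substituted directly at the end.\<close>
  define h where "h = (SOME h. classical_terms 0 p h)"
  have h: "classical_terms 0 p h" unfolding h_def by (rule someI_ex[of "classical_terms 0 p"]) (use assms(1) in \<open>simp add: Gamma_cl_def\<close>)
  have hs: "smooth_on (UNIV - {0}) (h j)" and hh: "pos_homogeneous (0 - int j) (h j)" for j
    using h by (simp_all add: classical_terms_def)
  \<comment> \<open>Homogeneous terms are unconstrained at the origin; the type \<open>sym\<close>
    asks for the value 0 there.\<close>
  define P :: "('n, 'q) fsym" where "P = Fs (\<lambda>k. Sym (\<lambda>z. if z = 0 then 0 else h k z))"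
  have vP: "val (cf P k) = (\<lambda>z. if z = 0 then 0 else h k z)" for k
  proof -
    have "smooth_on (UNIV - {0}) (\<lambda>z. if z = 0 then 0 else h k z)"
      by (rule smooth_on_cong[OF open_punct _ hs[of k]]) simp
    then show ?thesis unfolding P_def cf_Fs by (subst Sym_inverse) simp_all
  qed
  have PP: "P * P = P"
  proof (rule fsym_eqI, rule sym_eqI)
    fix k and z :: "(real^'n) \<times> (real^'n)" assume z: "z \<noteq> 0"
    have "val (cf (P * P) k) z $ i $ l = h k z $ i $ l" for i l
    proof -
      have "val (cf (P * P) k) z $ i $ l = (\<Sum>(m, s, t)\<in>idx2 k. of_real (1 / fact m) *
          (\<Sum>q\<in>UNIV. stc m (entry (val (cf P s)) i q) (entry (val (cf P t)) q l) z))"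
        unfolding cf_mult val_sum sum_component
        by (intro sum.cong refl) (auto simp: stN_def val_scaleR val_stC_entry[OF z] scaleR_conv_of_real[where 'a=complex])
      also have "\<dots> = (\<Sum>(m, s, t)\<in>idx2 k. of_real (1 / fact m) * (\<Sum>q\<in>UNIV. stc m (entry (h s) i q) (entry (h t) q l) z))"
      proof -
        have "stc m (entry (val (cf P s)) i q) (entry (val (cf P t)) q l) z = stc m (entry (h s) i q) (entry (h t) q l) z" for m s t q
          by (rule stc_cong_open[OF open_punct]) (use z in \<open>auto simp: vP\<close>)
        then show ?thesis by simp
      qed
      also have "\<dots> = h k z $ i $ l" by (rule idempotent_homogeneous_terms[OF p h idem z, symmetric])
      finally show ?thesis .
    qed
    then show "val (cf (P * P) k) z = val (cf P k) z" using z by (simp add: vec_eq_iff vP)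
  qed
  have hP: "hom 0 P"
    using hh unfolding hom_def dg_def pos_homogeneous_def vP by simp
  have "wres (cf P (2 * CARD('n))) = 0"
    by (rule formal_idempotent_trace[OF PP hP wres_add wres_commute wres_pd wres_csc])
  then have zero: "(LINT z|lborel. of_real (om ((norm z)\<^sup>2)) * (of_real (norm z ^ DIM((real^'n) \<times> (real^'n))) * trace (h (2 * CARD('n)) z))) = 0"
  proof -
    have e: "of_real (om ((norm z)\<^sup>2) * ((norm z)\<^sup>2) ^ CARD('n)) * trace (val (cf P (2 * CARD('n))) z) =
      of_real (om ((norm z)\<^sup>2)) * (of_real (norm z ^ DIM((real^'n) \<times> (real^'n))) * trace (h (2 * CARD('n)) z))"
      for z :: "(real^'n) \<times> (real^'n)"
      unfolding DIM_phase_space power_mult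
      by (cases "z = 0") (simp_all add: vP)
    show ?thesis using \<open>wres (cf P (2 * CARD('n))) = 0\<close> unfolding wres_def e .
  qed
  have sm: "smooth_on (UNIV - {0}) (\<lambda>z. trace (h (2 * CARD('n)) z))"
    by (rule smooth_on_bounded_linear[OF open_punct bounded_linear_trace hs])
  have hom: "pos_homogeneous (- int DIM((real^'n) \<times> (real^'n))) (\<lambda>z. trace (h (2 * CARD('n)) z))"
    using hh[of "2 * CARD('n)"] unfolding pos_homogeneous_def DIM_phase_space diff_0
    by (simp add: linear_scale[OF bounded_linear.linear[OF bounded_linear_trace]])
  have "sphere_integral (\<lambda>z. trace (h (2 * CARD('n)) z)) = 0"
    by (rule sphere_integral_eq_0[OF sm hom zero])
  \<comment> \<open>For order 0 the index in \<open>Res\<close> is \<open>2 * CARD('n)\<close>,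
    which is positive, so the second branch of its definition applies.\<close>
  then show ?thesis unfolding Res_def Let_def h_def[symmetric] by (simp add: nat_mult_distrib)
qed

end
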